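(* Let $n,m\ge 2$. For every $h\in\mathbb{R}_{>0}$, let $x_h\in(0,\pi)$ be defined by $\cot(x_h)=\frac{h}{m-1}$. Then there is $b\in(x_h,\pi]$ and a one-parameter family, parametrized by $A\in(0,b)$, of $O(n)\times O(m)$-invariant embedded hypersurfaces of constant mean curvature $h$ in $\mathbb{R}^n\times\mathbf{S}^m$ diffeomorphic to $\mathbb{R}^n\times\mathbf{S}^{m-1}$, where the hypersurface with parameter $A$ is the one whose generating curve starts at the point $(0,A)$ orthogonally to the $y$-axis $\{x=0\}$. Moreover, if $b\ne\pi$, then there is an embedding of $\mathbf{S}^{n+m-1}$ into $\mathbb{R}^n\times\mathbf{S}^m$ with constant mean curvature $h$ which is invariant under the action of $O(n)\times O(m)$.
   Context: $\mathbf{S}^m$ is the unit round sphere and $\mathbb{R}^n\times\mathbf{S}^m$ carries the product metric. $O(n)$ acts on $\mathbb{R}^n$ in the standard way (fixing the origin) and $O(m)$ acts on $\mathbf{S}^m$ by isometries fixing the south pole $S$. The orbit space of the $O(n)\times O(m)$-action is identified with $[0,\infty)\times[0,\pi]$ via $(v,q)\mapsto(x,y)=(|v|,\operatorname{dist}(S,q))$. An invariant hypersurface is the preimage of a curve $\varphi$ in $[0,\infty)\times[0,\pi]$, its generating curve. Parametrize $\varphi(s)=(x(s),y(s))$ by arc length with $x'=\cos\sigma$, $y'=\sin\sigma$. The mean curvature (sum of the principal curvatures) with respect to the normal $(\sin\sigma,-\cos\sigma)$ equals $h$ if and only if $$\sigma'(s)=(m-1)\frac{\cos y(s)}{\sin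 y(s)}\cos\sigma(s)-(n-1)\frac{\sin\sigma(s)}{x(s)}-h .$$ Where the generating curve is a graph $y=p(x)$ (oriented so that $x'>0$) this reads $$p''=(1+p'^2)\left((m-1)\frac{\cos p}{\sin p}-(n-1)\frac{p'}{x}-h\sqrt{1+p'^2}\right);$$ a curve starting at $(0,A)$ orthogonally to $\{x=0\}$ corresponds to the initial conditions $p(0)=A$, $p'(0)=0$. *)

theory Defs
  imports "HOL-Analysis.Analysis"
begin

text \<open>
  Manifolds are subsets of Euclidean spaces, carrying the induced Riemannian metric.  A map
  between subsets is smooth if it locally extends to a smooth map on an open set; a
  diffeomorphism is a smooth bijection with smooth inverse.  A set that is diffeomorphic in
  this sense to a smooth manifold is automatically an embedded smooth submanifold of the
  surrounding Euclidean space.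
\<close>

primrec Ck_on :: "nat \<Rightarrow> 'a::real_normed_vector set \<Rightarrow> ('a \<Rightarrow> 'b::real_normed_vector) \<Rightarrow> bool"
  where
    "Ck_on 0 U f \<longleftrightarrow> continuous_on U f"
  | "Ck_on (Suc k) U f \<longleftrightarrow>
       (\<forall>x\<in>U. f differentiable (at x)) \<and>
       (\<forall>v. Ck_on k U (\<lambda>x. frechet_derivative f (at x) v))"

definition smooth_map :: "'a::real_normed_vector set \<Rightarrow> ('a \<Rightarrow> 'b::real_normed_vector) \<Rightarrow> bool"
  where "smooth_map S f \<longleftrightarrow>
    (\<forall>x\<in>S. \<exists>U g. open U \<and> x \<in> U \<and> (\<forall>k. Ck_on k U g) \<and> (\<forall>y\<in>S \<inter> U. g y = f y))"

definition diffeomorphism ::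
    "'a::real_normed_vector set \<Rightarrow> 'b::real_normed_vector set \<Rightarrow> ('a \<Rightarrow> 'b) \<Rightarrow> ('b \<Rightarrow> 'a) \<Rightarrow> bool"
  where "diffeomorphism S T f g \<longleftrightarrow>
    homeomorphism S T f g \<and> smooth_map S f \<and> smooth_map T g"

definition diffeomorphic ::
    "'a::real_normed_vector set \<Rightarrow> 'b::real_normed_vector set \<Rightarrow> bool"
  where "diffeomorphic S T \<longleftrightarrow> (\<exists>f g. diffeomorphism S T f g)"

definition smooth_embedding ::
    "'a::real_normed_vector set \<Rightarrow> 'b::real_normed_vector set \<Rightarrow> ('a \<Rightarrow> 'b) \<Rightarrow> bool"
  where "smooth_embedding S N f \<longleftrightarrow> f ` S \<subseteq> N \<and> (\<exists>g. diffeomorphism S (f ` S) f g)"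

text \<open>Velocities at \<open>p\<close> of curves in \<open>M\<close>.\<close>

definition tangent_space :: "'a::real_normed_vector set \<Rightarrow> 'a \<Rightarrow> 'a set"
  where "tangent_space M p =
    {v. \<exists>\<gamma>::real \<Rightarrow> 'a. \<gamma> 0 = p \<and> (\<forall>t. \<gamma> t \<in> M) \<and> (\<gamma> has_vector_derivative v) (at 0)}"

definition unit_normal_field ::
    "'a::euclidean_space set \<Rightarrow> 'a set \<Rightarrow> ('a \<Rightarrow> 'a) \<Rightarrow> bool"
  where "unit_normal_field N M \<nu> \<longleftrightarrow>
    smooth_map M \<nu> \<and>
    (\<forall>p\<in>M. norm (\<nu> p) = 1 \<and> \<nu> p \<in> tangent_space N p \<and> (\<forall>v\<in>tangent_space M p. \<nu> p \<bullet> v = 0))"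

text \<open>
  The mean curvature is the sum of the principal curvatures, i.e. of the eigenvalues of the shape
  operator \<open>v \<mapsto> - \<nabla>\<^sub>v \<nu>\<close>.  The Levi-Civita derivative \<open>\<nabla>\<^sub>v \<nu>\<close> in \<open>N\<close> is the component
  tangent to \<open>N\<close> of the directional derivative of \<open>\<nu>\<close> along \<open>v\<close>.  The set \<open>B\<close> is an
  orthonormal basis of principal directions and \<open>\<kappa> v\<close> the principal curvature in direction \<open>v\<close>.
  A derivative within \<open>M\<close> need not be unique as a linear map, but it is on the tangent
  space of \<open>M\<close>, where alone it is evaluated.
\<close>

definition has_mean_curvature_at ::
    "'a::euclidean_space set \<Rightarrow> 'a set \<Rightarrow> ('a \<Rightarrow> 'a) \<Rightarrow> 'a \<Rightarrow> real \<Rightarrow> bool"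
  where "has_mean_curvature_at N M \<nu> p H \<longleftrightarrow>
    (\<exists>D B \<kappa>.
       (\<nu> has_derivative D) (at p within M) \<and>
       pairwise orthogonal B \<and> (\<forall>v\<in>B. norm v = 1) \<and> span B = tangent_space M p \<and>
       (\<forall>v\<in>B. \<forall>w\<in>tangent_space N p. (D v + \<kappa> v *\<^sub>R v) \<bullet> w = 0) \<and>
       H = (\<Sum>v\<in>B. \<kappa> v))"

definition constant_mean_curvature ::
    "'a::euclidean_space set \<Rightarrow> 'a set \<Rightarrow> ('a \<Rightarrow> 'a) \<Rightarrow> real \<Rightarrow> bool"
  where "constant_mean_curvature N M \<nu> h \<longleftrightarrow>
    unit_normal_field N M \<nu> \<and> (\<forall>p\<in>M. has_mean_curvature_at N M \<nu> p h)"

text \<open>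
  With \<open>n = CARD('n)\<close> and \<open>m = CARD('m)\<close>, the product of Euclidean \<open>n\<close>-space and the unit
  \<open>m\<close>-sphere, the latter in \<open>real \<times> real^'m\<close>, whose norm is the Euclidean one.  The first
  coordinate is the axis through the poles.
\<close>

type_synonym ('n, 'm) ambient = "(real^'n) \<times> (real \<times> (real^'m))"

definition RnSm :: "('n::finite, 'm::finite) ambient set"
  where "RnSm = UNIV \<times> sphere 0 1"

definition south_pole :: "real \<times> (real^'m::finite)"
  where "south_pole = (- 1, 0)"

definition OnOm_invariant :: "('n::finite, 'm::finite) ambient set \<Rightarrow> bool"
  where "OnOm_invariant M \<longleftrightarrow>
    (\<forall>P Q. orthogonal_transformation P \<and> orthogonal_transformation Q \<longrightarrow>
       (\<lambda>(v, t, w). (P v, t, Q w)) ` M = M)"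

text \<open>The second component is the geodesic (great circle) distance from the south pole.\<close>

definition orbit_coords :: "('n::finite, 'm::finite) ambient \<Rightarrow> real \<times> real"
  where "orbit_coords p = (norm (fst p), arccos (south_pole \<bullet> snd p))"

text \<open>
  A simple curve of infinite length in the orbit space, parametrized by arc length, with angle
  function \<open>\<sigma>\<close>.  Infinite length makes the hypersurface complete; without this, a short
  arc starting orthogonally at \<open>(0, A)\<close> would already generate a (non-complete) copy of the
  product of Euclidean \<open>n\<close>-space and an \<open>(m-1)\<close>-sphere.
\<close>

definition generating_curve :: "(real \<Rightarrow> real \<times> real) \<Rightarrow> (real \<Rightarrow> real) \<Rightarrow> bool"
  where "generating_curve \<phi> \<sigma> \<longleftrightarrow>
    inj_on \<phi> {0..} \<and> continuous_on {0..} \<sigma> \<and>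
    (\<forall>s\<ge>0. \<phi> s \<in> {0..} \<times> {0..pi} \<and>
       (\<phi> has_vector_derivative (cos (\<sigma> s), sin (\<sigma> s))) (at s within {0..}))"

definition generated_hypersurface :: "(real \<Rightarrow> real \<times> real) \<Rightarrow> ('n::finite, 'm::finite) ambient set"
  where "generated_hypersurface \<phi> = {p \<in> RnSm. orbit_coords p \<in> \<phi> ` {0..}}"

text \<open>
  \<open>\<nu>\<close> is the horizontal lift of the normal \<open>(sin \<sigma>, - cos \<sigma>)\<close> of the curve.  The points over
  \<open>(x, y)\<close> are \<open>(x \<omega>, (- cos y, sin y \<theta>))\<close> with unit vectors \<open>\<omega>\<close>, \<open>\<theta>\<close>; there the coordinate fields
  of \<open>x\<close> and \<open>y\<close> lift to \<open>(\<omega>, 0)\<close> and \<open>(0, (sin y, cos y \<theta>))\<close>.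
\<close>

definition lifts_curve_normal ::
    "(real \<Rightarrow> real \<times> real) \<Rightarrow> (real \<Rightarrow> real) \<Rightarrow>
     (('n::finite, 'm::finite) ambient \<Rightarrow> ('n, 'm) ambient) \<Rightarrow> bool"
  where "lifts_curve_normal \<phi> \<sigma> \<nu> \<longleftrightarrow>
    (\<forall>s\<ge>0. \<forall>\<omega> \<theta>. norm \<omega> = 1 \<and> norm \<theta> = 1 \<longrightarrow>
       (let x = fst (\<phi> s); y = snd (\<phi> s) in
         \<nu> (x *\<^sub>R \<omega>, (- cos y, sin y *\<^sub>R \<theta>)) =
           (sin (\<sigma> s) *\<^sub>R \<omega>, (- cos (\<sigma> s)) *\<^sub>R (sin y, cos y *\<^sub>R \<theta>))))"

end

theory Submission
  imports Defs
begin

text \<open>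
  Written as a graph \<open>y(x)\<close> with \<open>S = sin \<sigma>\<close>, the profile equation is a system that is singular only at
  \<open>x = 0\<close>, and Picard iteration of a Volterra integral equation solves it.  The energy
  \<open>E = sin\<^sup>m\<^sup>-\<^sup>1 y cos \<sigma> - h \<integral>\<^sub>0\<^sup>y sin\<^sup>m\<^sup>-\<^sup>1\<close> is nondecreasing along profiles.  If \<open>E > 0\<close> at some point, then
  \<open>cos \<sigma>\<close> and \<open>sin y\<close> stay away from \<open>0\<close> and the profile is an entire graph; this is an open condition on
  the initial height \<open>A\<close>, and it holds for \<open>A \<le> x_h\<close> already at \<open>x = 0\<close>.  Let \<open>b\<close> be the supremum of the
  heights below which it always holds.

  If \<open>b < \<pi>\<close>, then \<open>E \<le> 0\<close> along the profile from height \<open>b\<close>.  This forces \<open>S\<close> below a negative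
  multiple of \<open>x\<close>, so the profile stops being a graph at some \<open>x = R\<close>, where it is vertical.  Comparison
  with the entire graphs just below it shows that it reaches \<open>y = 0\<close> there.  Near this point \<open>sin y\<close> is a
  good parameter, in which the profile is smooth and even, so that it closes up to a smooth sphere.
\<close>

section \<open>Calculus of \<open>C\<^sup>k\<close> maps\<close>

text \<open>The slope \<open>p'\<close> of a profile may blow up, whereas
  \<open>S = p' / sqrt (1 + p'\<^sup>2)\<close> stays bounded and a vertical end is the finite value
  \<open>- 1\<close>. The division by \<open>x\<close> is removed by the operator
  \<open>avg k\<close>: \<open>x * avg k f x\<close> is the solution of
  \<open>u' + k u / x = f\<close> that is regular at \<open>0\<close>, and \<open>avg k\<close>
  preserves differentiability classes and parity. Solutions therefore live on intervals symmetric
  about \<open>0\<close>, where \<open>y\<close> is even and \<open>S\<close> is odd; evenness is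
  what makes functions of \<open>norm v\<close> smooth at \<open>v = 0\<close>. At the pole the same
  operator with weight \<open>l\<close> does the same service. The delicate point is that the
  critical profile might end as a vertical line at positive height. Its end \<open>R\<close>
  satisfies \<open>k / R < h\<close>, since otherwise it would be kept away from the vertical
  direction. But then a vertical profile keeps turning and ceases to be a graph, which the entire
  graphs close to it cannot do, unless the height has already dropped to \<open>0\<close>.\<close>

lemma Ck_on_cong:
  assumes "open U" "\<And>x. x \<in> U \<Longrightarrow> f x = g x"
  shows "Ck_on k U f \<longleftrightarrow> Ck_on k U g"
  using assms(2)
proof (induction k arbitrary: f g)
  case 0
  then show ?case by (simp cong: continuous_on_cong)
next
  case (Suc k)
  have d: "(f has_derivative D) (at x) \<longleftrightarrow> (g has_derivative D) (at x)" if "x \<in> U" for x D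
    using has_derivative_transform_within_open[OF _ \<open>open U\<close> that] Suc.prems
    by metis
  have eq: "frechet_derivative f (at x) = frechet_derivative g (at x)" if "x \<in> U" for x
    unfolding frechet_derivative_def using d[OF that] by presburger
  have "Ck_on k U (\<lambda>x. frechet_derivative f (at x) v) = Ck_on k U (\<lambda>x. frechet_derivative g (at x) v)" for v
    by (rule Suc.IH) (simp only: eq)
  moreover have "f differentiable (at x) \<longleftrightarrow> g differentiable (at x)" if "x \<in> U" for x
    unfolding differentiable_def using d[OF that] by blast
  ultimately show ?case by simp
qed

lemma Ck_on_subset: "Ck_on k U f \<Longrightarrow> V \<subseteq> U \<Longrightarrow> Ck_on k V f"
  by (induction k arbitrary: f) (auto intro: continuous_on_subset)

text \<open>\<open>Ck_on\<close> speaks of the chosen \<open>frechet_derivative\<close>. This rule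
  and \<open>Ck_on_SucD\<close> trade it for an explicit derivative, after which each closure
  property is an induction on the order that differentiates once.\<close>

lemma Ck_on_SucI:
  assumes "open U" "\<And>x. x \<in> U \<Longrightarrow> (f has_derivative f' x) (at x)"
    and "\<And>v. Ck_on k U (\<lambda>x. f' x v)"
  shows "Ck_on (Suc k) U f"
proof -
  have eq: "f' x = frechet_derivative f (at x)" if "x \<in> U" for x
    using assms(2) that frechet_derivative_at by blast
  have "Ck_on k U (\<lambda>x. frechet_derivative f (at x) v)" for v
    by (rule Ck_on_cong[THEN iffD1, OF \<open>open U\<close> _ assms(3)]) (simp add: eq)
  then show ?thesis using assms(2) by (auto simp: differentiable_def)
qed

lemma Ck_on_SucD:
  assumes "Ck_on (Suc k) U f"
  obtains f' where "\<And>x. x \<in> U \<Longrightarrow> (f has_derivative f' x) (at x)"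
    and "\<And>v. Ck_on k U (\<lambda>x. f' x v)"
  using assms by (auto simp: frechet_derivative_works intro!: that)

lemma Ck_on_0I: "Ck_on k U f \<Longrightarrow> continuous_on U f"
  by (cases k) (auto simp: continuous_at_imp_continuous_on differentiable_imp_continuous_within)

lemma Ck_on_Suc_imp: "Ck_on (Suc k) U f \<Longrightarrow> Ck_on k U f"
proof (induction k arbitrary: f)
  case 0
  then show ?case using Ck_on_0I[OF 0] by simp
qed simp

lemma Ck_on_const [simp]: "Ck_on k U (\<lambda>x. c)"
  by (induction k arbitrary: c) auto

lemma Ck_on_bounded_linear:
  assumes "bounded_linear L" "open U" shows "Ck_on k U L"
proof (cases k)
  case 0
  then show ?thesis using assms by (simp add: linear_continuous_on)
next
  case (Suc j)
  then show ?thesis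
    using Ck_on_SucI[OF \<open>open U\<close>, of L "\<lambda>_. L" j] bounded_linear_imp_has_derivative[OF assms(1)]
    by auto
qed

lemma Ck_on_ident: "open U \<Longrightarrow> Ck_on k U (\<lambda>x. x)"
  by (rule Ck_on_bounded_linear) auto

lemma Ck_on_linear_comp:
  assumes "bounded_linear L" "open U" "Ck_on k U f" shows "Ck_on k U (\<lambda>x. L (f x))"
  using assms(3)
proof (induction k arbitrary: f)
  case 0
  then show ?case
    using bounded_linear.continuous_on[OF assms(1)] by auto
next
  case (Suc k)
  obtain f' where f': "\<And>x. x \<in> U \<Longrightarrow> (f has_derivative f' x) (at x)" "\<And>v. Ck_on k U (\<lambda>x. f' x v)"
    using Suc.prems by (metis Ck_on_SucD)
  show ?case
    by (rule Ck_on_SucI[OF \<open>open U\<close>, where f'="\<lambda>x v. L (f' x v)"])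
       (use bounded_linear.has_derivative[OF assms(1)] f' Suc.IH in auto)
qed

lemma Ck_on_add:
  assumes "open U" "Ck_on k U f" "Ck_on k U g" shows "Ck_on k U (\<lambda>x. f x + g x)"
  using assms(2,3)
proof (induction k arbitrary: f g)
  case 0
  then show ?case by (auto intro: continuous_on_add)
next
  case (Suc k)
  obtain f' where f': "\<And>x. x \<in> U \<Longrightarrow> (f has_derivative f' x) (at x)" "\<And>v. Ck_on k U (\<lambda>x. f' x v)"
    using Suc.prems(1) by (metis Ck_on_SucD)
  obtain g' where g': "\<And>x. x \<in> U \<Longrightarrow> (g has_derivative g' x) (at x)" "\<And>v. Ck_on k U (\<lambda>x. g' x v)"
    using Suc.prems(2) by (metis Ck_on_SucD)
  show ?case
    by (rule Ck_on_SucI[OF \<open>open U\<close>, where f'="\<lambda>x v. f' x v + g' x v"])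
       (use f' g' Suc.IH in \<open>auto intro: has_derivative_add\<close>)
qed

lemma Ck_on_bilinear:
  assumes "bounded_bilinear B" "open U" "Ck_on k U f" "Ck_on k U g"
  shows "Ck_on k U (\<lambda>x. B (f x) (g x))"
  using assms(3,4)
proof (induction k arbitrary: f g)
  case 0
  then show ?case using bounded_bilinear.continuous_on[OF assms(1)] by auto
next
  case (Suc k)
  obtain f' where f': "\<And>x. x \<in> U \<Longrightarrow> (f has_derivative f' x) (at x)" "\<And>v. Ck_on k U (\<lambda>x. f' x v)"
    using Suc.prems(1) by (metis Ck_on_SucD)
  obtain g' where g': "\<And>x. x \<in> U \<Longrightarrow> (g has_derivative g' x) (at x)" "\<And>v. Ck_on k U (\<lambda>x. g' x v)"
    using Suc.prems(2) by (metis Ck_on_SucD)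
  show ?case
  proof (rule Ck_on_SucI[OF \<open>open U\<close>, where f'="\<lambda>x v. B (f x) (g' x v) + B (f' x v) (g x)"])
    show "((\<lambda>x. B (f x) (g x)) has_derivative (\<lambda>v. B (f x) (g' x v) + B (f' x v) (g x))) (at x)"
      if "x \<in> U" for x
      using bounded_bilinear.FDERIV[OF assms(1) f'(1)[OF that] g'(1)[OF that]] .
    show "Ck_on k U (\<lambda>x. B (f x) (g' x v) + B (f' x v) (g x))" for v
      by (intro Ck_on_add Suc.IH \<open>open U\<close> f' g') (use Suc.prems Ck_on_Suc_imp in blast)+
  qed
qed

lemma Ck_on_minus: "open U \<Longrightarrow> Ck_on k U f \<Longrightarrow> Ck_on k U (\<lambda>x. - f x)"
  using Ck_on_linear_comp[OF bounded_linear_minus[OF bounded_linear_ident]] .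

lemma Ck_on_diff: "open U \<Longrightarrow> Ck_on k U f \<Longrightarrow> Ck_on k U g \<Longrightarrow> Ck_on k U (\<lambda>x. f x - g x)"
  using Ck_on_add[of U k f "\<lambda>x. - g x"] Ck_on_minus by auto

lemmas Ck_on_mult = Ck_on_bilinear[OF bounded_bilinear_mult]
  and Ck_on_scaleR = Ck_on_bilinear[OF bounded_bilinear_scaleR]
  and Ck_on_inner = Ck_on_bilinear[OF bounded_bilinear_inner]
  and Ck_on_fst = Ck_on_linear_comp[OF bounded_linear_fst]
  and Ck_on_snd = Ck_on_linear_comp[OF bounded_linear_snd]

lemma Ck_on_Pair:
  assumes "open U" "Ck_on k U f" "Ck_on k U g" shows "Ck_on k U (\<lambda>x. (f x, g x))"
proof -
  have l1: "bounded_linear (\<lambda>a. (a, 0))" and l2: "bounded_linear (\<lambda>a. (0, a))"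
    by (auto intro!: bounded_linear_Pair bounded_linear_ident bounded_linear_zero)
  show ?thesis
    using Ck_on_add[OF assms(1) Ck_on_linear_comp[OF l1 assms(1,2)] Ck_on_linear_comp[OF l2 assms(1,3)]]
    by simp
qed

lemma Ck_on_sum:
  assumes "open U" "\<And>i. i \<in> I \<Longrightarrow> Ck_on k U (f i)" shows "Ck_on k U (\<lambda>x. \<Sum>i\<in>I. f i x)"
  using assms(2) by (induction I rule: infinite_finite_induct) (auto intro: Ck_on_add[OF assms(1)])

lemma Ck_on_power: "open U \<Longrightarrow> Ck_on k U f \<Longrightarrow> Ck_on k U (\<lambda>x. (f x :: real) ^ j)"
  by (induction j) (auto intro: Ck_on_mult)

text \<open>The chain rule evaluates \<open>g'\<close> in the moving direction
  \<open>f' x v\<close>, while the induction hypothesis covers only fixed directions. Expanding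
  \<open>f' x v\<close> in the finite basis of the middle space reduces it to a sum of products with
  the maps \<open>g' (f x) i\<close>.\<close>

lemma Ck_on_compose:
  fixes f :: "'a::real_normed_vector \<Rightarrow> 'b::euclidean_space" and g :: "'b \<Rightarrow> 'c::real_normed_vector"
  assumes "open U" "open V" "f ` U \<subseteq> V" "Ck_on k U f" "Ck_on k V g"
  shows "Ck_on k U (\<lambda>x. g (f x))"
  using assms(4,5)
proof (induction k arbitrary: g)
  case 0
  then show ?case using assms(3) by (auto intro: continuous_on_compose2)
next
  case (Suc k)
  obtain f' where f': "\<And>x. x \<in> U \<Longrightarrow> (f has_derivative f' x) (at x)" "\<And>v. Ck_on k U (\<lambda>x. f' x v)"
    using Suc.prems(1) by (metis Ck_on_SucD)
  obtain g' where g': "\<And>x. x \<in> V \<Longrightarrow> (g has_derivative g' x) (at x)" "\<And>v. Ck_on k V (\<lambda>x. g' x v)"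
    using Suc.prems(2) by (metis Ck_on_SucD)
  show ?case
  proof (rule Ck_on_SucI[OF \<open>open U\<close>, where f'="\<lambda>x v. \<Sum>i\<in>Basis. (f' x v \<bullet> i) *\<^sub>R g' (f x) i"])
    fix x assume x: "x \<in> U"
    then have "f x \<in> V" using assms(3) by auto
    have d: "((\<lambda>x. g (f x)) has_derivative (\<lambda>v. g' (f x) (f' x v))) (at x)"
      using has_derivative_compose[OF f'(1)[OF x] g'(1)[OF \<open>f x \<in> V\<close>]] .
    have "g' (f x) w = (\<Sum>i\<in>Basis. (w \<bullet> i) *\<^sub>R g' (f x) i)" for w
    proof -
      interpret linear "g' (f x)" using g'(1)[OF \<open>f x \<in> V\<close>] has_derivative_linear by blast
      have "g' (f x) w = g' (f x) (\<Sum>i\<in>Basis. (w \<bullet> i) *\<^sub>R i)" by (simp add: euclidean_representation)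
      then show ?thesis by (simp add: sum scaleR)
    qed
    then have "(\<lambda>v. g' (f x) (f' x v)) = (\<lambda>v. \<Sum>i\<in>Basis. (f' x v \<bullet> i) *\<^sub>R g' (f x) i)"
      by (intro ext)
    then show "((\<lambda>x. g (f x)) has_derivative (\<lambda>v. \<Sum>i\<in>Basis. (f' x v \<bullet> i) *\<^sub>R g' (f x) i)) (at x)"
      using d by (simp only:)
  next
    fix v
    show "Ck_on k U (\<lambda>x. \<Sum>i\<in>Basis. (f' x v \<bullet> i) *\<^sub>R g' (f x) i)"
    proof (intro Ck_on_sum Ck_on_scaleR \<open>open U\<close> Ck_on_inner f'(2) Ck_on_const)
      fix i :: 'b
      show "Ck_on k U (\<lambda>x. g' (f x) i)"
        using Suc.IH[OF _ g'(2)] Suc.prems(1) Ck_on_Suc_imp by blast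
    qed
  qed
qed

lemma Ck_on_real_SucI:
  fixes f :: "real \<Rightarrow> real"
  assumes "open U" "\<And>x. x \<in> U \<Longrightarrow> (f has_real_derivative f' x) (at x)" "Ck_on k U f'"
  shows "Ck_on (Suc k) U f"
  by (rule Ck_on_SucI[OF \<open>open U\<close>, where f'="\<lambda>x v. f' x * v"])
     (use assms in \<open>auto simp: has_field_derivative_def intro: Ck_on_mult\<close>)

lemma Ck_on_real_SucD:
  fixes f :: "real \<Rightarrow> real"
  assumes "open U" "Ck_on (Suc k) U f"
  obtains f' where "\<And>x. x \<in> U \<Longrightarrow> (f has_real_derivative f' x) (at x)" "Ck_on k U f'"
proof -
  obtain f' where f': "\<And>x. x \<in> U \<Longrightarrow> (f has_derivative f' x) (at x)" "\<And>v. Ck_on k U (\<lambda>x. f' x v)"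
    using assms(2) by (metis Ck_on_SucD)
  have "(f has_real_derivative f' x 1) (at x)" if "x \<in> U" for x
  proof -
    interpret linear "f' x" using f'(1)[OF that] has_derivative_linear by blast
    have "f' x v = f' x 1 * v" for v using scaleR[of v 1] by simp
    then have "f' x = (\<lambda>v. f' x 1 * v)" by blast
    then show ?thesis unfolding has_field_derivative_def using f'(1)[OF that] by simp
  qed
  then show ?thesis using f'(2)[of 1] by (rule that)
qed

lemma Ck_on_deriv:
  fixes f f' :: "real \<Rightarrow> real"
  assumes "open U" "\<And>x. x \<in> U \<Longrightarrow> (f has_real_derivative f' x) (at x)" "Ck_on (Suc k) U f"
  shows "Ck_on k U f'"
proof -
  obtain g where g: "\<And>x. x \<in> U \<Longrightarrow> (f has_real_derivative g x) (at x)" "Ck_on k U g"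
    using Ck_on_real_SucD[OF assms(1,3)] by blast
  have "f' x = g x" if "x \<in> U" for x using assms(2) g(1) that DERIV_unique by blast
  then show ?thesis using Ck_on_cong[OF assms(1)] g(2) by blast
qed

lemma Ck_on_sin_cos: "Ck_on k UNIV (sin :: real \<Rightarrow> real)" "Ck_on k UNIV (cos :: real \<Rightarrow> real)"
proof (induction k)
  case (Suc k)
  { case 1 show ?case by (rule Ck_on_real_SucI[where f'=cos]) (use Suc in auto) }
  { case 2
    show ?case by (rule Ck_on_real_SucI[where f'="\<lambda>x. - sin x"])
      (use Suc in \<open>auto intro!: Ck_on_minus derivative_eq_intros\<close>) }
qed (auto intro: continuous_intros)

lemma Ck_on_sin: "open U \<Longrightarrow> Ck_on k U f \<Longrightarrow> Ck_on k U (\<lambda>x. sin (f x :: real))"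
  and Ck_on_cos: "open U \<Longrightarrow> Ck_on k U f \<Longrightarrow> Ck_on k U (\<lambda>x. cos (f x :: real))"
  using Ck_on_compose[of U UNIV f k] Ck_on_sin_cos by auto

text \<open>The derivative is a polynomial in the function itself, so the induction feeds on its own
  hypothesis.\<close>

lemma Ck_on_inverse_real: "Ck_on k (- {0}) (inverse :: real \<Rightarrow> real)"
proof (induction k)
  case (Suc k)
  show ?case
    by (rule Ck_on_real_SucI[where f'="\<lambda>x. - (inverse x * inverse x)"])
       (use Suc in \<open>auto intro!: Ck_on_minus Ck_on_mult derivative_eq_intros simp: open_Compl\<close>)
qed (auto intro!: continuous_intros)

lemma Ck_on_inverse:
  fixes f :: "'a::real_normed_vector \<Rightarrow> real"
  assumes "open U" "Ck_on k U f" "\<And>x. x \<in> U \<Longrightarrow> f x \<noteq> 0" shows "Ck_on k U (\<lambda>x. inverse (f x))"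
  by (rule Ck_on_compose[OF \<open>open U\<close> _ _ assms(2) Ck_on_inverse_real]) (use assms(3) in auto)

lemma Ck_on_divide:
  fixes f g :: "'a::real_normed_vector \<Rightarrow> real"
  assumes "open U" "Ck_on k U f" "Ck_on k U g" "\<And>x. x \<in> U \<Longrightarrow> g x \<noteq> 0"
  shows "Ck_on k U (\<lambda>x. f x / g x)"
  using Ck_on_mult[OF assms(1,2) Ck_on_inverse[OF assms(1,3,4)]] by (simp add: divide_inverse)

lemma Ck_on_sqrt_real: "Ck_on k {0<..} sqrt"
proof (induction k)
  case (Suc k)
  show ?case
  proof (rule Ck_on_real_SucI[where f'="\<lambda>x. inverse (sqrt x) / 2"])
    show "Ck_on k {0<..} (\<lambda>x. inverse (sqrt x) / 2)"
      using Suc by (intro Ck_on_divide Ck_on_inverse) auto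
  qed (auto intro: DERIV_real_sqrt)
qed (auto intro!: continuous_intros)

lemma Ck_on_sqrt:
  fixes f :: "'a::real_normed_vector \<Rightarrow> real"
  assumes "open U" "Ck_on k U f" "\<And>x. x \<in> U \<Longrightarrow> f x > 0" shows "Ck_on k U (\<lambda>x. sqrt (f x))"
  by (rule Ck_on_compose[OF \<open>open U\<close> _ _ assms(2) Ck_on_sqrt_real]) (use assms(3) in auto)

lemma Ck_on_norm:
  fixes f :: "'a::real_normed_vector \<Rightarrow> 'b::real_inner"
  assumes "open U" "Ck_on k U f" "\<And>x. x \<in> U \<Longrightarrow> f x \<noteq> 0" shows "Ck_on k U (\<lambda>x. norm (f x))"
  unfolding norm_eq_sqrt_inner using assms by (intro Ck_on_sqrt Ck_on_inner) auto

section \<open>Weighted averages and radial functions\<close>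

abbreviation smooth_on :: "'a::real_normed_vector set \<Rightarrow> ('a \<Rightarrow> 'b::real_normed_vector) \<Rightarrow> bool"
  where "smooth_on U f \<equiv> \<forall>k. Ck_on k U f"

text \<open>Substituting \<open>s = t * x\<close> shows that \<open>x ^ (k + 1) * avg k f x\<close>
  is the integral of \<open>s ^ k * f s\<close> from \<open>0\<close> to \<open>x\<close>. So
  \<open>x * avg k f x\<close> is the variation of constants formula for
  \<open>u' + k u / x = f\<close>, with the homogeneous solution \<open>x ^ (- k)\<close> left out.
  The scaled form has no quotient at \<open>x = 0\<close> and covers both signs of
  \<open>x\<close>.\<close>

definition avg :: "nat \<Rightarrow> (real \<Rightarrow> real) \<Rightarrow> real \<Rightarrow> real"
  where "avg k f x = integral {0..1} (\<lambda>t. t ^ k * f (t * x))"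

lemma mult_mem_convex:
  fixes U :: "real set"
  assumes "convex U" "0 \<in> U" "x \<in> U" "0 \<le> t" "t \<le> 1" shows "t * x \<in> U"
  using convexD[OF assms(1,3,2), of t "1 - t"] assms(4,5) by simp

lemma continuous_on_avg_integrand:
  fixes f :: "real \<Rightarrow> real"
  assumes "convex U" "0 \<in> U" "continuous_on U f"
  shows "continuous_on (U \<times> {0..1}) (\<lambda>(x, t). t ^ k * f (t * x))"
proof -
  have "continuous_on (U \<times> {0..1}) (\<lambda>p. f (snd p * fst p))"
    by (rule continuous_on_compose2[OF assms(3)])
       (use mult_mem_convex[OF assms(1,2)] in \<open>auto intro!: continuous_intros\<close>)
  then show ?thesis
    unfolding case_prod_unfold by (intro continuous_intros)
qed

lemma continuous_on_avg:
  fixes f :: "real \<Rightarrow> real"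
  assumes "convex U" "0 \<in> U" "continuous_on U f" shows "continuous_on U (avg k f)"
  using integral_continuous_on_param[of U 0 "1::real" "\<lambda>x t. t ^ k * f (t * x)"]
    continuous_on_avg_integrand[OF assms] unfolding avg_def[abs_def] by simp

lemma avg_integrable:
  fixes f :: "real \<Rightarrow> real"
  assumes "convex U" "0 \<in> U" "continuous_on U f" "x \<in> U"
  shows "(\<lambda>t. t ^ k * f (t * x)) integrable_on {0..1}"
proof -
  have "continuous_on {0..1} (\<lambda>t. f (t * x))"
    by (rule continuous_on_compose2[OF assms(3)])
       (use mult_mem_convex[OF assms(1,2,4)] in \<open>auto intro!: continuous_intros\<close>)
  then show ?thesis by (intro integrable_continuous_real continuous_intros)
qed

lemma avg_cong:
  assumes "\<And>t. 0 \<le> t \<Longrightarrow> t \<le> 1 \<Longrightarrow> f (t * x) = g (t * x)" shows "avg k f x = avg k g x"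
  unfolding avg_def by (rule integral_cong) (use assms in auto)

lemma avg_uminus: "avg k f (- x) = avg k (\<lambda>x. f (- x)) x"
  by (simp add: avg_def)

lemma avg_zero: "avg k f 0 = f 0 / (real k + 1)"
proof -
  have "((\<lambda>t. t ^ k) has_integral 1 ^ Suc k / (real k + 1) - 0 ^ Suc k / (real k + 1)) {0..1::real}"
  proof (rule fundamental_theorem_of_calculus)
    fix t :: real
    have "((\<lambda>t. t ^ Suc k / (real k + 1)) has_real_derivative t ^ k) (at t within {0..1})"
      using DERIV_cdivide[OF DERIV_power_Suc[OF DERIV_ident, of k t], of "real k + 1"]
      by (simp add: add.commute[of 1])
    then show "((\<lambda>t. t ^ Suc k / (real k + 1)) has_vector_derivative t ^ k) (at t within {0..1})"
      by (simp add: has_real_derivative_iff_has_vector_derivative)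
  qed simp
  then have "((\<lambda>t. t ^ k * f 0) has_integral (1 / (real k + 1)) * f 0) {0..1::real}"
    by (intro has_integral_mult_left) simp
  then show ?thesis using integral_unique[of "\<lambda>t. t ^ k * f 0"] unfolding avg_def by simp
qed

text \<open>Differentiating under the integral pulls out one factor \<open>t\<close>, so the result
  is again an average, with the weight raised by one. This is why the smoothness induction in
  \<open>Ck_on_avg\<close> runs over all weights at once.\<close>

lemma DERIV_avg:
  assumes "convex U" "0 \<in> U" "open U" "\<And>x. x \<in> U \<Longrightarrow> (f has_real_derivative f' x) (at x)"
    "continuous_on U f'" "x \<in> U"
  shows "(avg k f has_real_derivative avg (Suc k) f' x) (at x)"
proof -
  have cf: "continuous_on U f"
    using assms(4) by (meson DERIV_isCont continuous_at_imp_continuous_on)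
  have "((\<lambda>x. integral (cbox 0 1) (\<lambda>t. t ^ k * f (t * x))) has_field_derivative
      integral (cbox 0 1) (\<lambda>t. t ^ Suc k * f' (t * x))) (at x within U)"
  proof (rule leibniz_rule_field_derivative)
    fix x t :: real assume "x \<in> U" "t \<in> cbox 0 1"
    then have "t * x \<in> U" using mult_mem_convex[OF assms(1,2)] by auto
    then have "((\<lambda>x. t ^ k * f (t * x)) has_real_derivative t ^ k * (f' (t * x) * t)) (at x within U)"
      by (intro DERIV_cmult DERIV_chain2[OF assms(4)]) (auto intro!: derivative_eq_intros)
    then show "((\<lambda>x. t ^ k * f (t * x)) has_real_derivative t ^ Suc k * f' (t * x)) (at x within U)"
      by (simp add: mult_ac)
  next
    show "(\<lambda>t. t ^ k * f (t * x)) integrable_on cbox 0 1" if "x \<in> U" for x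
      using avg_integrable[OF assms(1,2) cf that] by simp
    show "continuous_on (U \<times> cbox 0 1) (\<lambda>(x, t). t ^ Suc k * f' (t * x))"
      using continuous_on_avg_integrand[OF assms(1,2,5), of "Suc k"] by (simp del: power_Suc)
  qed (use assms in auto)
  then show ?thesis
    using at_within_open[OF assms(6,3)] unfolding avg_def[abs_def] by simp
qed

lemma Ck_on_avg:
  assumes "convex U" "0 \<in> U" "open U" "Ck_on j U f" shows "Ck_on j U (avg k f)"
  using assms(4)
proof (induction j arbitrary: f k)
  case 0
  then show ?case using continuous_on_avg[OF assms(1,2)] by simp
next
  case (Suc j)
  obtain f' where f': "\<And>x. x \<in> U \<Longrightarrow> (f has_real_derivative f' x) (at x)" "Ck_on j U f'"
    using Ck_on_real_SucD[OF assms(3) Suc.prems] by blast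
  show ?case
    by (rule Ck_on_real_SucI[OF assms(3) DERIV_avg[OF assms(1-3) f'(1) Ck_on_0I[OF f'(2)]] Suc.IH[OF f'(2)]])
qed

lemma avg_antiderivative:
  assumes "\<And>t. 0 \<le> t \<Longrightarrow> t \<le> 1 \<Longrightarrow> (F has_real_derivative (t * x) ^ k * f (t * x)) (at (t * x))"
  shows "x ^ Suc k * avg k f x = F x - F 0"
proof -
  have "((\<lambda>t. x * ((t * x) ^ k * f (t * x))) has_integral F (1 * x) - F (0 * x)) {0..1}"
  proof (rule fundamental_theorem_of_calculus)
    fix t :: real assume "t \<in> {0..1}"
    then have "((\<lambda>t. F (t * x)) has_real_derivative (t * x) ^ k * f (t * x) * x) (at t)"
      by (intro DERIV_chain2[of F _ "\<lambda>t. t * x", OF assms]) (auto intro!: derivative_eq_intros)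
    then show "((\<lambda>t. F (t * x)) has_vector_derivative x * ((t * x) ^ k * f (t * x))) (at t within {0..1})"
      by (simp add: has_real_derivative_iff_has_vector_derivative mult_ac has_vector_derivative_at_within)
  qed simp
  moreover have "(\<lambda>t. x * ((t * x) ^ k * f (t * x))) = (\<lambda>t. x ^ Suc k * (t ^ k * f (t * x)))"
    by (auto simp: power_mult_distrib)
  ultimately have "((\<lambda>t. x ^ Suc k * (t ^ k * f (t * x))) has_integral F x - F 0) {0..1}" by simp
  then have "integral {0..1} (\<lambda>t. x ^ Suc k * (t ^ k * f (t * x))) = F x - F 0"
    by (rule integral_unique)
  then show ?thesis by (simp only: avg_def integral_mult_right)
qed

text \<open>\<open>DERIV_mult_avg\<close> needs two-sided derivatives of an antiderivative along the
  whole segment from \<open>0\<close> to \<open>y\<close>, for all \<open>y\<close> near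
  \<open>x\<close>. The antiderivative is therefore taken on an interval that reaches beyond both
  \<open>0\<close> and \<open>x\<close> by \<open>e\<close>.\<close>

lemma antiderivative_open:
  fixes g :: "real \<Rightarrow> real"
  assumes "convex U" "0 \<in> U" "open U" "continuous_on U g" "x \<in> U"
  obtains F e where "e > 0" "ball x e \<subseteq> U"
    "\<And>y t. y \<in> ball x e \<Longrightarrow> 0 \<le> t \<Longrightarrow> t \<le> 1 \<Longrightarrow> (F has_real_derivative g (t * y)) (at (t * y))"
proof -
  obtain e where e: "e > 0" "cball x e \<subseteq> U" "cball 0 e \<subseteq> U"
  proof -
    obtain e1 where "e1 > 0" "cball x e1 \<subseteq> U" using assms(3,5) open_contains_cball by blast
    moreover obtain e2 where "e2 > 0" "cball 0 e2 \<subseteq> U" using assms(2,3) open_contains_cball by blast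
    ultimately show ?thesis
      by (intro that[of "min e1 e2"]) (auto simp: subset_eq)
  qed
  define a where "a = min (- e) (x - e)"
  define b where "b = max e (x + e)"
  have "is_interval U" using assms(1) is_interval_convex_1 by blast
  moreover have "a \<in> U" "b \<in> U" using e by (auto simp: a_def b_def min_def max_def dist_real_def)
  ultimately have ab: "{a..b} \<subseteq> U"
    by (meson atLeastAtMost_iff mem_is_interval_1_I subsetI)
  obtain F where F: "\<And>x. x \<in> {a..b} \<Longrightarrow> (F has_vector_derivative g x) (at x within {a..b})"
    using antiderivative_continuous[OF continuous_on_subset[OF assms(4) ab]] by blast
  have "(F has_real_derivative g z) (at z)" if "a < z" "z < b" for z
  proof -
    have "at z within {a..b} = at z"
      by (rule at_within_interior) (use that in simp)
    then show ?thesis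
      using F[of z] that by (simp add: has_real_derivative_iff_has_vector_derivative)
  qed
  moreover have "a < t * y \<and> t * y < b" if "y \<in> ball x e" "0 \<le> t" "t \<le> 1" for t y
  proof -
    have y: "a < y" "y < b" "a < 0" "0 < b" using that(1) e(1) by (auto simp: a_def b_def dist_real_def)
    then show ?thesis using mult_mem_convex[of "{a<..<b}" y t] that by auto
  qed
  ultimately show ?thesis
    using that[of e F] e by (auto simp: subset_eq)
qed

text \<open>For \<open>x \<noteq> 0\<close> this differentiates \<open>(F x - F 0) / x ^ k\<close>
  with \<open>F\<close> an antiderivative of \<open>x ^ k * f x\<close>. At \<open>x = 0\<close> the
  difference quotient is \<open>avg k f\<close> itself, and its value \<open>f 0 / (k + 1)\<close>
  equals \<open>f 0 - k * avg k f 0\<close>: the equation holds through the singular point.\<close>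

lemma DERIV_mult_avg:
  assumes "convex U" "0 \<in> U" "open U" "continuous_on U f" "x \<in> U"
  shows "((\<lambda>x. x * avg k f x) has_real_derivative f x - real k * avg k f x) (at x)"
proof -
  have c: "continuous_on U (\<lambda>x. x ^ k * f x)" using assms(4) by (intro continuous_intros)
  obtain e F where F: "e > 0" "ball x e \<subseteq> U"
    "\<And>y t. y \<in> ball x e \<Longrightarrow> 0 \<le> t \<Longrightarrow> t \<le> 1 \<Longrightarrow> (F has_real_derivative (t * y) ^ k * f (t * y)) (at (t * y))"
    by (rule antiderivative_open[OF assms(1-3) c assms(5)]) (rule that)
  have eq: "y ^ Suc k * avg k f y = F y - F 0" if "y \<in> ball x e" for y
    by (rule avg_antiderivative) (use F(3)[OF that] in auto)
  show ?thesis
  proof (cases "x = 0")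
    case False
    have "((\<lambda>y. (F y - F 0) / y ^ k) has_real_derivative
       (x ^ k * f x * x ^ k - (F x - F 0) * (real k * x ^ (k - 1))) / (x ^ k * x ^ k)) (at x)"
      using F(3)[of x 1] F(1) False
      by (auto intro!: derivative_eq_intros)
    moreover have "(x ^ k * f x * x ^ k - (F x - F 0) * (real k * x ^ (k - 1))) / (x ^ k * x ^ k)
       = f x - real k * avg k f x"
    proof (cases k)
      case (Suc j)
      have "F x - F 0 = x ^ Suc k * avg k f x" using eq[of x] F(1) by simp
      then show ?thesis using False Suc by (simp only:) (simp add: field_simps)
    qed simp
    ultimately have d: "((\<lambda>y. (F y - F 0) / y ^ k) has_real_derivative f x - real k * avg k f x) (at x)"
      by simp
    show ?thesis
    proof (rule DERIV_cong_ev[THEN iffD1, OF refl _ refl d])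
      have "\<forall>\<^sub>F y in nhds x. y \<in> ball x e \<inter> - {0}"
        by (rule eventually_nhds_in_open) (use F False in auto)
      then show "\<forall>\<^sub>F y in nhds x. (F y - F 0) / y ^ k = y * avg k f y"
      proof (rule eventually_mono)
        fix y assume "y \<in> ball x e \<inter> - {0}"
        then show "(F y - F 0) / y ^ k = y * avg k f y" using eq[of y] by (auto simp: field_simps)
      qed
    qed
  next
    case True
    have "continuous_on U (avg k f)" by (rule continuous_on_avg[OF assms(1,2,4)])
    then have "isCont (avg k f) 0" using assms(2,3) continuous_on_eq_continuous_at by blast
    then have "((\<lambda>h. ((0 + h) * avg k f (0 + h) - 0 * avg k f 0) / h) \<longlongrightarrow> avg k f 0) (at 0)"
      unfolding isCont_def by (rule Lim_transform_eventually) (auto simp: eventually_at intro!: exI[of _ 1])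
    moreover have "avg k f 0 = f 0 - real k * avg k f 0"
      unfolding avg_zero by (simp add: field_simps)
    ultimately show ?thesis using True by (simp add: DERIV_def)
  qed
qed

text \<open>Hadamard's lemma in one variable: with weight \<open>0\<close> the singular term of
  \<open>DERIV_mult_avg\<close> disappears, so both sides have the same derivative.\<close>

lemma mult_avg_deriv:
  assumes "convex U" "0 \<in> U" "open U" "\<And>x. x \<in> U \<Longrightarrow> (f has_real_derivative f' x) (at x)"
    "continuous_on U f'" "x \<in> U"
  shows "f x = f 0 + x * avg 0 f' x"
proof -
  have "((\<lambda>x. f x - x * avg 0 f' x) has_real_derivative 0) (at y within U)" if "y \<in> U" for y
    using DERIV_diff[OF assms(4)[OF that] DERIV_mult_avg[OF assms(1-3,5) that, of 0]]
    by (simp add: has_field_derivative_at_within)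
  then obtain c where "\<forall>x\<in>U. f x - x * avg 0 f' x = c"
    using has_field_derivative_zero_constant[OF assms(1), of "\<lambda>x. f x - x * avg 0 f' x"] by blast
  then have "f x - x * avg 0 f' x = c" "f 0 - 0 * avg 0 f' 0 = c" using assms(2,6) by blast+
  then show ?thesis by simp
qed

lemma smooth_on_real_deriv:
  fixes f :: "real \<Rightarrow> real"
  assumes "open U" "smooth_on U f"
  shows "\<And>x. x \<in> U \<Longrightarrow> (f has_real_derivative deriv f x) (at x)" "smooth_on U (deriv f)"
proof -
  obtain f' where f': "\<And>x. x \<in> U \<Longrightarrow> (f has_real_derivative f' x) (at x)"
    using Ck_on_real_SucD[OF assms(1) assms(2)[rule_format, of "Suc 0"]] by blast
  show d: "(f has_real_derivative deriv f x) (at x)" if "x \<in> U" for x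
    using f'[OF that] DERIV_imp_deriv[OF f'[OF that]] by simp
  show "smooth_on U (deriv f)"
  proof
    show "Ck_on k U (deriv f)" for k
      using Ck_on_deriv[OF assms(1) d] assms(2) by simp
  qed
qed

lemma smooth_on_divide_ident:
  fixes f :: "real \<Rightarrow> real"
  assumes "convex U" "0 \<in> U" "open U" "smooth_on U f" "f 0 = 0"
  obtains g where "smooth_on U g" "\<And>x. x \<in> U \<Longrightarrow> f x = x * g x" "g 0 = deriv f 0"
proof (rule that)
  have c: "continuous_on U (deriv f)"
    using smooth_on_real_deriv(2)[OF assms(3,4)] Ck_on_0I by blast
  show "smooth_on U (avg 0 (deriv f))"
    using Ck_on_avg[OF assms(1-3)] smooth_on_real_deriv(2)[OF assms(3,4)] by blast
  show "f x = x * avg 0 (deriv f) x" if "x \<in> U" for x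
    using mult_avg_deriv[OF assms(1-3) smooth_on_real_deriv(1)[OF assms(3,4)] c that] assms(5) by simp
  show "avg 0 (deriv f) 0 = deriv f 0" unfolding avg_zero by simp
qed

section \<open>Even functions and smooth functions of the norm\<close>

lemma DERIV_even:
  fixes q :: "real \<Rightarrow> real"
  assumes "\<And>y. \<bar>y\<bar> < r \<Longrightarrow> q (- y) = q y" "(q has_real_derivative D) (at x)" "\<bar>x\<bar> < r"
  shows "(q has_real_derivative - D) (at (- x))"
proof -
  have "((\<lambda>y. q (- y)) has_real_derivative D * - 1) (at (- x))"
    by (rule DERIV_chain2[where f=q]) (use assms(2) in \<open>auto intro!: derivative_eq_intros\<close>)
  then show ?thesis
  proof (rule DERIV_cong_ev[THEN iffD1, OF refl _ _, rotated 2])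
    have "\<forall>\<^sub>F y in nhds (- x). y \<in> {- r<..<r}"
      by (rule eventually_nhds_in_open) (use assms(3) in auto)
    then show "\<forall>\<^sub>F y in nhds (- x). q (- y) = q y"
      by (rule eventually_mono) (use assms(1) in auto)
  qed simp
qed

lemma DERIV_even_zero:
  fixes q :: "real \<Rightarrow> real"
  assumes "r > 0" "\<And>y. \<bar>y\<bar> < r \<Longrightarrow> q (- y) = q y" "(q has_real_derivative D) (at 0)"
  shows "D = 0"
proof -
  have "(q has_real_derivative - D) (at (- 0))"
    by (rule DERIV_even[OF assms(2,3)]) (use assms(1) in auto)
  then have "D = - D" using DERIV_unique[OF assms(3), of "- D"] by simp
  then show ?thesis by simp
qed

text \<open>The derivative of an even function is odd, so it vanishes at \<open>0\<close> and can be
  divided by the variable. The quotient is smooth and even again, which lets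
  \<open>Ck_on_radial\<close> iterate.\<close>

lemma even_deriv_quotient:
  fixes q :: "real \<Rightarrow> real"
  assumes "r > 0" "\<And>x. \<bar>x\<bar> < r \<Longrightarrow> q (- x) = q x" "smooth_on {-r<..<r} q"
  obtains q1 where "\<And>x. \<bar>x\<bar> < r \<Longrightarrow> (q has_real_derivative x * q1 x) (at x)"
    "\<And>x. \<bar>x\<bar> < r \<Longrightarrow> q1 (- x) = q1 x" "smooth_on {-r<..<r} q1"
proof -
  have U: "convex {-r<..<r}" "0 \<in> {-r<..<r}" "open {-r<..<r}"
    using assms(1) by (auto simp: convex_real_interval)
  note d = smooth_on_real_deriv[OF U(3) assms(3)]
  have d0: "deriv q 0 = 0" using DERIV_even_zero[OF assms(1,2) d(1)] U(2) by auto
  obtain q1 where q1: "smooth_on {-r<..<r} q1" "\<And>x. x \<in> {-r<..<r} \<Longrightarrow> deriv q x = x * q1 x"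
    using smooth_on_divide_ident[OF U d(2) d0] by metis
  show ?thesis
  proof (rule that[OF _ _ q1(1)])
    show "(q has_real_derivative x * q1 x) (at x)" if "\<bar>x\<bar> < r" for x
      using d(1)[of x] q1(2)[of x] that by (auto simp: abs_less_iff)
    show "q1 (- x) = q1 x" if "\<bar>x\<bar> < r" for x
    proof (cases "x = 0")
      case False
      have "(q has_real_derivative - deriv q x) (at (- x))"
        by (rule DERIV_even[OF assms(2) d(1)]) (use that in auto)
      then have "deriv q (- x) = - deriv q x" using DERIV_imp_deriv by blast
      moreover have "deriv q x = x * q1 x" "deriv q (- x) = - x * q1 (- x)"
        using q1(2)[of x] q1(2)[of "- x"] that by (auto simp: abs_less_iff)
      ultimately have "x * q1 (- x) = x * q1 x" by linarith
      then show ?thesis using False by simp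
    qed simp
  qed
qed

text \<open>Off the origin this is the chain rule. At the origin \<open>norm\<close> is not
  differentiable, but a vanishing derivative of \<open>q\<close> absorbs this. There
  \<open>\<omega>\<close> is an arbitrary unit vector, so that one formula serves on and off the
  axis.\<close>

lemma has_derivative_radial:
  fixes q :: "real \<Rightarrow> real" and v :: "'a::euclidean_space"
  assumes "(q has_real_derivative D) (at x)" "v = x *\<^sub>R \<omega>" "norm \<omega> = 1" "x \<ge> 0" "x = 0 \<Longrightarrow> D = 0"
  shows "((\<lambda>v. q (norm v)) has_derivative (\<lambda>a. D * (\<omega> \<bullet> a))) (at v)"
proof (cases "x = 0")
  case False
  then have v: "norm v = x" "v \<noteq> 0" "sgn v = \<omega>"
    using assms by (auto simp: sgn_div_norm)
  have "(norm has_derivative (\<lambda>a. a \<bullet> \<omega>)) (at v)"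
    using has_derivative_norm[OF v(2)] v(3) by simp
  then show ?thesis
    using has_derivative_compose[of norm "\<lambda>a. a \<bullet> \<omega>" v UNIV q "(*) D"] assms(1) v(1)
    by (simp add: has_field_derivative_def inner_commute)
next
  case True
  then have v: "v = 0" and D: "D = 0" using assms by auto
  have q: "(q has_derivative (\<lambda>_. 0)) (at 0)"
    using assms(1) True D by (simp add: has_field_derivative_def lambda_zero)
  have "((\<lambda>v::'a. q (norm v)) has_derivative (\<lambda>a. 0)) (at 0)"
    unfolding has_derivative_at_within
  proof (intro conjI)
    have "((\<lambda>y. (q y - q 0) /\<^sub>R \<bar>y\<bar>) \<longlongrightarrow> 0) (at 0)"
      using q unfolding has_derivative_at_within by simp
    moreover have "filterlim (norm :: 'a \<Rightarrow> real) (at 0) (at 0)"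
      by (auto simp: filterlim_at eventually_at intro!: tendsto_eq_intros exI[of _ 1])
    ultimately have "((\<lambda>y::'a. (q (norm y) - q 0) /\<^sub>R \<bar>norm y\<bar>) \<longlongrightarrow> 0) (at 0)"
      by (rule filterlim_compose)
    then show "((\<lambda>y::'a. (q (norm y) - q (norm 0) - 0) /\<^sub>R norm (y - 0)) \<longlongrightarrow> 0) (at 0)"
      by simp
  qed simp
  then show ?thesis using v D by simp
qed

text \<open>With \<open>q' x = x * q1 x\<close> the derivative of \<open>q (norm v)\<close> in
  direction \<open>a\<close> is \<open>q1 (norm v) * (v \<bullet> a)\<close>, without division by
  \<open>norm v\<close>. As \<open>q1\<close> satisfies the same hypotheses as \<open>q\<close>, the
  induction on the order closes.\<close>

lemma Ck_on_radial:
  fixes q :: "real \<Rightarrow> real"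
  assumes "r > 0" "\<And>x. \<bar>x\<bar> < r \<Longrightarrow> q (- x) = q x" "smooth_on {-r<..<r} q"
  shows "Ck_on k (ball (0::'a::euclidean_space) r) (\<lambda>v. q (norm v))"
  using assms(2,3)
proof (induction k arbitrary: q)
  case 0
  have "continuous_on {-r<..<r} q" using 0(2) Ck_on_0I by blast
  then show ?case
  proof -
    have "- r < norm v" for v :: 'a using assms(1) norm_ge_zero[of v] by linarith
    then show ?thesis
      using \<open>continuous_on {-r<..<r} q\<close>
      by (auto intro!: continuous_on_compose2[of "{-r<..<r}" q] continuous_intros)
  qed
next
  case (Suc k)
  obtain q1 where q1: "\<And>x. \<bar>x\<bar> < r \<Longrightarrow> (q has_real_derivative x * q1 x) (at x)"
    "\<And>x. \<bar>x\<bar> < r \<Longrightarrow> q1 (- x) = q1 x" "smooth_on {-r<..<r} q1"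
    by (rule even_deriv_quotient[OF assms(1) Suc.prems], assumption, rule that)
  show ?case
  proof (rule Ck_on_SucI[where f'="\<lambda>v a. q1 (norm v) * (v \<bullet> a)"])
    fix v :: 'a assume v: "v \<in> ball 0 r"
    obtain \<omega> :: 'a where w: "v = norm v *\<^sub>R \<omega>" "norm \<omega> = 1"
    proof (cases "v = 0")
      case True
      then show ?thesis using that[of "SOME i. i \<in> Basis"] by (simp add: some_in_eq)
    next
      case False
      then show ?thesis using that[of "sgn v"] by (simp add: sgn_div_norm)
    qed
    have "((\<lambda>v. q (norm v)) has_derivative (\<lambda>a. norm v * q1 (norm v) * (\<omega> \<bullet> a))) (at v)"
      by (rule has_derivative_radial[OF q1(1) w(1)]) (use v w in auto)
    moreover have "norm v * q1 (norm v) * (\<omega> \<bullet> a) = q1 (norm v) * (v \<bullet> a)" for a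
      by (subst (4) w(1)) simp
    ultimately show "((\<lambda>v. q (norm v)) has_derivative (\<lambda>a. q1 (norm v) * (v \<bullet> a))) (at v)"
      by simp
  next
    show "Ck_on k (ball 0 r) (\<lambda>v::'a. q1 (norm v) * (v \<bullet> a))" for a
      using Suc.IH[OF q1(2,3)] by (intro Ck_on_mult Ck_on_inner Ck_on_ident Ck_on_const) auto
  qed simp
qed

text \<open>The inverse function theorem on a whole interval, keeping track of oddness. It supplies
  the change of radial coordinate at the end where the sphere closes up.\<close>

lemma smooth_odd_inverse:
  fixes K K' :: "real \<Rightarrow> real"
  assumes "r > 0" "smooth_on {-r<..<r} K" "\<And>x. \<bar>x\<bar> < r \<Longrightarrow> K (- x) = - K x"
    and K': "\<And>x. \<bar>x\<bar> < r \<Longrightarrow> (K has_real_derivative K' x) (at x)" "\<And>x. \<bar>x\<bar> < r \<Longrightarrow> K' x > 0"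
  obtains d c \<xi> where "0 < c" "c < r" "0 < d" "smooth_on {-d<..<d} \<xi>"
    "\<And>s. \<bar>s\<bar> < d \<Longrightarrow> \<bar>\<xi> s\<bar> < c" "\<And>s. \<bar>s\<bar> < d \<Longrightarrow> K (\<xi> s) = s" "\<And>s. \<bar>s\<bar> < d \<Longrightarrow> \<xi> (- s) = - \<xi> s"
    "\<And>x. \<bar>x\<bar> < c \<Longrightarrow> \<bar>K x\<bar> < d" "\<And>x. \<bar>x\<bar> < c \<Longrightarrow> \<xi> (K x) = x"
proof -
  \<comment> \<open>Half of \<open>r\<close> leaves room: \<open>K\<close> is continuous and
    injective on the compact interval \<open>{-c..c}\<close>, hence has a continuous inverse
    there.\<close>
  define c where "c = r / 2"
  have c: "0 < c" "c < r" using assms(1) by (auto simp: c_def)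
  have mono: "K x < K y" if "- r < x" "x < y" "y < r" for x y
    by (rule DERIV_pos_imp_increasing[OF that(2)]) (use K' that in force)
  have inj: "inj_on K {-c..c}"
    by (rule linorder_inj_onI') (use mono c in force)
  have K0: "K 0 = 0" using assms(3)[of 0] assms(1) by simp
  define d where "d = K c"
  have d: "d > 0" using mono[of 0 c] c K0 by (simp add: d_def)
  have Kmc: "K (- c) = - d" using assms(3)[of c] c by (simp add: d_def)
  have cont: "continuous_on {-c..c} K"
    by (rule continuous_at_imp_continuous_on) (use K'(1) c in \<open>force intro: DERIV_isCont\<close>)
  have img: "{-d..d} \<subseteq> K ` {-c..c}"
  proof
    fix s assume "s \<in> {-d..d}"
    then obtain x where "-c \<le> x" "x \<le> c" "K x = s"
      using IVT'[of K "-c" s c] Kmc d_def cont c by auto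
    then show "s \<in> K ` {-c..c}" by auto
  qed
  define \<xi> where "\<xi> = inv_into {-c..c} K"
  have K\<xi>: "K (\<xi> s) = s" and \<xi>r: "\<xi> s \<in> {-c..c}" if "\<bar>s\<bar> \<le> d" for s
  proof -
    have "s \<in> K ` {-c..c}" using img that by force
    then show "K (\<xi> s) = s" "\<xi> s \<in> {-c..c}" unfolding \<xi>_def
      using f_inv_into_f[of s K] inv_into_into[of s K] by blast+
  qed
  have \<xi>K: "\<xi> (K x) = x" if "\<bar>x\<bar> \<le> c" for x
    unfolding \<xi>_def by (rule inv_into_f_f[OF inj]) (use that in auto)
  have \<xi>c: "\<bar>\<xi> s\<bar> < c" if "\<bar>s\<bar> < d" for s
  proof -
    have "\<xi> s \<noteq> c" "\<xi> s \<noteq> - c" using K\<xi>[of s] that Kmc d_def d by auto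
    then show ?thesis using \<xi>r[of s] that by (auto simp: abs_if)
  qed
  have "continuous_on (K ` {-c..c}) \<xi>"
    unfolding \<xi>_def using continuous_on_inv[OF cont compact_Icc, of \<xi>] inv_into_f_f[OF inj] \<xi>_def by auto
  then have c\<xi>: "continuous_on {-d<..<d} \<xi>"
    by (rule continuous_on_subset) (use img in force)
  have d\<xi>: "(\<xi> has_real_derivative inverse (K' (\<xi> s))) (at s)" if "s \<in> {-d<..<d}" for s
  proof (rule DERIV_inverse_function[where f=K and a="-d" and b=d])
    have b: "\<bar>\<xi> s\<bar> < r" using \<xi>c[of s] that c by (auto simp: abs_less_iff)
    show "(K has_real_derivative K' (\<xi> s)) (at (\<xi> s))" "K' (\<xi> s) \<noteq> 0"
      using K'[OF b] by auto
    show "isCont \<xi> s" using c\<xi> that continuous_on_eq_continuous_at open_greaterThanLessThan by blast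
  qed (use that K\<xi> in auto)
  have K's: "Ck_on j {-r<..<r} K'" for j
    by (rule Ck_on_deriv[of "{-r<..<r}" K]) (use K'(1) assms(2) in auto)
  have "Ck_on j {-d<..<d} \<xi>" for j
  proof (induction j)
    case (Suc j)
    show ?case
    proof (rule Ck_on_real_SucI[OF _ d\<xi>])
      have "Ck_on j {-d<..<d} (\<lambda>s. K' (\<xi> s))"
        by (rule Ck_on_compose[OF _ _ _ Suc K's]) (use \<xi>c c in \<open>force simp: abs_less_iff\<close>)+
      then show "Ck_on j {-d<..<d} (\<lambda>s. inverse (K' (\<xi> s)))"
      proof (rule Ck_on_inverse[rotated])
        show "K' (\<xi> s) \<noteq> 0" if "s \<in> {-d<..<d}" for s
          using K'(2)[of "\<xi> s"] \<xi>c[of s] that c by (auto simp: abs_less_iff)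
      qed simp
    qed auto
  qed (use c\<xi> in simp)
  moreover have "\<xi> (- s) = - \<xi> s" if "\<bar>s\<bar> < d" for s
  proof -
    have "\<bar>\<xi> s\<bar> < c" using \<xi>c that by blast
    then have "K (- \<xi> s) = - s" using assms(3)[of "\<xi> s"] c K\<xi>[of s] that by simp
    then show ?thesis using \<xi>K[of "- \<xi> s"] \<open>\<bar>\<xi> s\<bar> < c\<close> by simp
  qed
  moreover have "\<bar>K x\<bar> < d" if "\<bar>x\<bar> < c" for x
    using mono[of x c] mono[of "-c" x] that c Kmc by (auto simp: d_def abs_less_iff)
  ultimately show ?thesis
    using that[of c d \<xi>] c d \<xi>c K\<xi> \<xi>K by auto
qed

section \<open>Singular Volterra systems\<close>

lemma avg_diff:
  fixes f g :: "real \<Rightarrow> real"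
  assumes "convex U" "0 \<in> U" "continuous_on U f" "continuous_on U g" "x \<in> U"
  shows "avg k f x - avg k g x = avg k (\<lambda>x. f x - g x) x"
  unfolding avg_def
  by (subst integral_diff[symmetric])
     (use avg_integrable[OF assms(1,2) _ assms(5)] assms(3,4) in \<open>auto simp: algebra_simps\<close>)

text \<open>Integrating an exponential of rate \<open>K\<close> gains the factor
  \<open>1 / K\<close>; this makes the Picard map a contraction in an exponentially weighted norm.
  The weight \<open>t ^ k\<close> is at most \<open>1\<close>, so the singular term costs
  nothing.\<close>

lemma mult_avg_bound:
  fixes g :: "real \<Rightarrow> real"
  assumes "convex U" "0 \<in> U" "continuous_on U g" "x \<in> U" "K > 0"
    and "\<And>t. 0 \<le> t \<Longrightarrow> t \<le> 1 \<Longrightarrow> \<bar>g (t * x)\<bar> \<le> c * exp (K * \<bar>x\<bar> * t)"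
  shows "\<bar>x * avg k g x\<bar> \<le> c / K * exp (K * \<bar>x\<bar>)"
proof -
  have "\<bar>g 0\<bar> \<le> c" using assms(6)[of 0] by simp
  then have "c \<ge> 0" using abs_ge_zero[of "g 0"] by linarith
  have "((\<lambda>t. \<bar>x\<bar> * (c * exp (K * \<bar>x\<bar> * t))) has_integral
      c / K * exp (K * \<bar>x\<bar> * 1) - c / K * exp (K * \<bar>x\<bar> * 0)) {0..1}"
    by (rule fundamental_theorem_of_calculus)
       (use assms(5) in \<open>auto intro!: derivative_eq_intros
          simp: has_real_derivative_iff_has_vector_derivative[symmetric]\<close>)
  then have i: "((\<lambda>t. \<bar>x\<bar> * (c * exp (K * \<bar>x\<bar> * t))) has_integral c / K * (exp (K * \<bar>x\<bar>) - 1)) {0..1}"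
    by (simp add: right_diff_distrib)
  have "norm (integral {0..1} (\<lambda>t. x * (t ^ k * g (t * x)))) \<le>
      integral {0..1} (\<lambda>t. \<bar>x\<bar> * (c * exp (K * \<bar>x\<bar> * t)))"
  proof (rule integral_norm_bound_integral)
    show "(\<lambda>t. x * (t ^ k * g (t * x))) integrable_on {0..1}"
      using avg_integrable[OF assms(1-4)] by (rule integrable_on_mult_right)
    show "(\<lambda>t. \<bar>x\<bar> * (c * exp (K * \<bar>x\<bar> * t))) integrable_on {0..1}" using i by blast
    fix t :: real assume t: "t \<in> {0..1}"
    have "\<bar>t ^ k\<bar> * \<bar>g (t * x)\<bar> \<le> 1 * (c * exp (K * \<bar>x\<bar> * t))"
      using t assms(6)[of t] by (intro mult_mono) (auto simp: power_le_one)
    then show "norm (x * (t ^ k * g (t * x))) \<le> \<bar>x\<bar> * (c * exp (K * \<bar>x\<bar> * t))"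
      by (simp add: abs_mult mult_left_mono)
  qed
  also have "\<dots> = c / K * (exp (K * \<bar>x\<bar>) - 1)" using i by (rule integral_unique)
  also have "\<dots> \<le> c / K * exp (K * \<bar>x\<bar>)"
    using \<open>c \<ge> 0\<close> assms(5) by (intro mult_left_mono) auto
  finally show ?thesis by (simp add: avg_def)
qed

text \<open>Global Lipschitz bounds let the iteration run on the whole line; the profile equation
  meets them only after truncation.\<close>

locale lipschitz_pair =
  fixes f1 f2 :: "real \<times> real \<Rightarrow> real" and L :: real
  assumes L: "L > 0"
    and lip1: "\<And>u v. \<bar>f1 u - f1 v\<bar> \<le> L * norm (u - v)"
    and lip2: "\<And>u v. \<bar>f2 u - f2 v\<bar> \<le> L * norm (u - v)"
begin

lemma continuous_f: "continuous_on S f1" "continuous_on S f2"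
proof -
  have "L-lipschitz_on S f1" "L-lipschitz_on S f2"
    using L lip1 lip2 by (auto intro!: lipschitz_onI simp: dist_norm)
  then show "continuous_on S f1" "continuous_on S f2"
    by (auto intro: lipschitz_on_continuous_on)
qed

lemma continuous_fu:
  assumes "continuous_on U u"
  shows "continuous_on U (\<lambda>x. f1 (u x))" "continuous_on U (\<lambda>x. f2 (u x))"
  using continuous_on_compose2[OF continuous_f(1)[of UNIV] assms]
    continuous_on_compose2[OF continuous_f(2)[of UNIV] assms] by auto

text \<open>The second component carries no free initial value: regularity forces it to vanish at
  \<open>0\<close>, which says that the curve leaves the axis orthogonally.\<close>

definition step :: "nat \<Rightarrow> real \<Rightarrow> (real \<Rightarrow> real \<times> real) \<Rightarrow> real \<Rightarrow> real \<times> real"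
  where "step k A u x = (A + x * avg 0 (\<lambda>x. f1 (u x)) x, x * avg k (\<lambda>x. f2 (u x)) x)"

text \<open>The rate \<open>4 * L\<close> in the weight turns each Lipschitz estimate into a factor
  \<open>L / (4 * L)\<close>; the two components together give \<open>1 / 2\<close>.\<close>

lemma step_diff:
  assumes U: "convex U" "0 \<in> U" "continuous_on U u" "continuous_on U v" "x \<in> U"
    and d: "\<And>t. 0 \<le> t \<Longrightarrow> t \<le> 1 \<Longrightarrow> norm (u (t * x) - v (t * x)) \<le> d * exp (4 * L * \<bar>x\<bar> * t)"
  shows "norm (step k A u x - step k B v x) \<le> \<bar>A - B\<bar> + d / 2 * exp (4 * L * \<bar>x\<bar>)"
proof -
  have a: "\<bar>x * avg 0 (\<lambda>x. f1 (u x)) x - x * avg 0 (\<lambda>x. f1 (v x)) x\<bar> \<le> L * d / (4 * L) * exp (4 * L * \<bar>x\<bar>)"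
    and b: "\<bar>x * avg k (\<lambda>x. f2 (u x)) x - x * avg k (\<lambda>x. f2 (v x)) x\<bar> \<le> L * d / (4 * L) * exp (4 * L * \<bar>x\<bar>)"
  proof -
    have bound: "L * norm (u (t * x) - v (t * x)) \<le> L * d * exp (4 * L * \<bar>x\<bar> * t)"
      if "0 \<le> t" "t \<le> 1" for t
      using mult_left_mono[OF d[OF that], of L] L by (simp add: mult.assoc)
    show "\<bar>x * avg 0 (\<lambda>x. f1 (u x)) x - x * avg 0 (\<lambda>x. f1 (v x)) x\<bar> \<le> L * d / (4 * L) * exp (4 * L * \<bar>x\<bar>)"
      unfolding right_diff_distrib[symmetric] avg_diff[OF U(1,2) continuous_fu(1)[OF U(3)] continuous_fu(1)[OF U(4)] U(5)]
      by (rule mult_avg_bound[OF U(1,2) _ U(5)])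
         (use L order_trans[OF lip1 bound] continuous_fu U in \<open>auto intro!: continuous_intros\<close>)
    show "\<bar>x * avg k (\<lambda>x. f2 (u x)) x - x * avg k (\<lambda>x. f2 (v x)) x\<bar> \<le> L * d / (4 * L) * exp (4 * L * \<bar>x\<bar>)"
      unfolding right_diff_distrib[symmetric] avg_diff[OF U(1,2) continuous_fu(2)[OF U(3)] continuous_fu(2)[OF U(4)] U(5)]
      by (rule mult_avg_bound[OF U(1,2) _ U(5)])
         (use L order_trans[OF lip2 bound] continuous_fu U in \<open>auto intro!: continuous_intros\<close>)
  qed
  have "norm (step k A u x - step k B v x) \<le>
      \<bar>A + x * avg 0 (\<lambda>x. f1 (u x)) x - (B + x * avg 0 (\<lambda>x. f1 (v x)) x)\<bar> +
      \<bar>x * avg k (\<lambda>x. f2 (u x)) x - x * avg k (\<lambda>x. f2 (v x)) x\<bar>"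
    using norm_Pair_le[of "A + x * avg 0 (\<lambda>x. f1 (u x)) x - (B + x * avg 0 (\<lambda>x. f1 (v x)) x)"
      "x * avg k (\<lambda>x. f2 (u x)) x - x * avg k (\<lambda>x. f2 (v x)) x"]
    by (simp only: step_def diff_Pair real_norm_def)
  also have "\<dots> \<le> \<bar>A - B\<bar> + 2 * (L * d / (4 * L) * exp (4 * L * \<bar>x\<bar>))"
    using a b by linarith
  finally show ?thesis using L by simp
qed

text \<open>Evaluate the fixed point equations where the exponentially weighted distance is maximal:
  half of the maximum is absorbed. With \<open>A = B\<close> this is uniqueness, otherwise
  continuous dependence on the height.\<close>

lemma stability:
  assumes X: "X \<ge> 0" and u: "continuous_on {-X..X} u" "\<And>x. \<bar>x\<bar> \<le> X \<Longrightarrow> u x = step k A u x"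
    and v: "continuous_on {-X..X} v" "\<And>x. \<bar>x\<bar> \<le> X \<Longrightarrow> v x = step k B v x" and x: "\<bar>x\<bar> \<le> X"
  shows "norm (u x - v x) \<le> 2 * \<bar>A - B\<bar> * exp (4 * L * \<bar>x\<bar>)"
proof -
  define m where "m x = norm (u x - v x) * exp (- (4 * L * \<bar>x\<bar>))" for x
  have "continuous_on {-X..X} m" unfolding m_def using u(1) v(1) by (intro continuous_intros)
  then obtain z where z: "z \<in> {-X..X}" "\<And>x. x \<in> {-X..X} \<Longrightarrow> m x \<le> m z"
    using continuous_attains_sup[of "{-X..X}" m] X by auto
  have mb: "norm (u x - v x) \<le> m z * exp (4 * L * \<bar>x\<bar>)" if "x \<in> {-X..X}" for x
    using z(2)[OF that] by (simp add: m_def exp_minus field_simps)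
  have "norm (u z - v z) = norm (step k A u z - step k B v z)"
    using u(2)[of z] v(2)[of z] z(1) by (simp add: abs_le_iff)
  also have "\<dots> \<le> \<bar>A - B\<bar> + m z / 2 * exp (4 * L * \<bar>z\<bar>)"
  proof (rule step_diff[of "{-X..X}"])
    fix t :: real assume t: "0 \<le> t" "t \<le> 1"
    then have "t * z \<in> {-X..X}" using mult_mem_convex[of "{-X..X}" z t] z(1) X by auto
    then show "norm (u (t * z) - v (t * z)) \<le> m z * exp (4 * L * \<bar>z\<bar> * t)"
      using mb[of "t * z"] t by (simp add: abs_mult mult_ac)
  qed (use u v z X in auto)
  moreover have "norm (u z - v z) = m z * exp (4 * L * \<bar>z\<bar>)"
    by (simp add: m_def exp_minus field_simps)
  ultimately have "m z * exp (4 * L * \<bar>z\<bar>) \<le> \<bar>A - B\<bar> + m z / 2 * exp (4 * L * \<bar>z\<bar>)"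
    by linarith
  then have "m z * exp (4 * L * \<bar>z\<bar>) \<le> 2 * \<bar>A - B\<bar>" by simp
  moreover have "m z * 1 \<le> m z * exp (4 * L * \<bar>z\<bar>)"
    by (rule mult_left_mono) (use L in \<open>auto simp: m_def\<close>)
  ultimately have "m z \<le> 2 * \<bar>A - B\<bar>" by simp
  then show ?thesis
    using mb[of x] x by (intro order_trans[OF mb[of x]] mult_right_mono) auto
qed

text \<open>Banach's fixed point theorem, applied not to \<open>u\<close> but to
  \<open>u / E\<close>: bounded right-hand sides let \<open>step\<close> grow at most linearly,
  which \<open>E\<close> dominates, and in this weighted norm the Picard map has contraction factor
  \<open>1 / 2\<close>.\<close>

lemma existence:
  assumes B: "\<And>u. \<bar>f1 u\<bar> \<le> B" "\<And>u. \<bar>f2 u\<bar> \<le> B"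
  obtains u where "continuous_on UNIV u" "\<And>x. u x = step k A u x"
proof -
  have "B \<ge> 0" using B(1)[of 0] by simp
  define E where "E x = exp (4 * L * \<bar>x\<bar>)" for x :: real
  have cE: "continuous_on UNIV E" "continuous_on UNIV (\<lambda>x. inverse (E x))" and E0: "E x > 0" for x
    unfolding E_def by (auto intro!: continuous_intros)
  define W where "W v = (\<lambda>x. E x *\<^sub>R apply_bcontfun v x)" for v :: "real \<Rightarrow>\<^sub>C (real \<times> real)"
  have cW: "continuous_on UNIV (W v)" for v
    unfolding W_def by (intro continuous_intros cE) auto
  define T where "T v = Bcontfun (\<lambda>x. inverse (E x) *\<^sub>R step k A (W v) x)" for v
  have avgB: "\<bar>avg j f x\<bar> \<le> B" if "continuous_on UNIV f" "\<And>x. \<bar>f x\<bar> \<le> B" for j f x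
  proof -
    have "norm (integral {0..1} (\<lambda>t. t ^ j * f (t * x))) \<le> integral {0..1} (\<lambda>t::real. B)"
    proof (rule integral_norm_bound_integral)
      show "(\<lambda>t. t ^ j * f (t * x)) integrable_on {0..1}"
        by (rule avg_integrable[of UNIV]) (use that in auto)
      fix t :: real assume "t \<in> {0..1}"
      then have "\<bar>t ^ j\<bar> * \<bar>f (t * x)\<bar> \<le> 1 * B"
        using that(2) by (intro mult_mono) (auto simp: power_le_one)
      then show "norm (t ^ j * f (t * x)) \<le> B" by (simp add: abs_mult)
    qed (rule integrable_const_ivl)
    then show ?thesis by (simp add: avg_def)
  qed
  have T: "apply_bcontfun (T v) x = inverse (E x) *\<^sub>R step k A (W v) x" for v x
  proof -
    have "continuous_on UNIV (\<lambda>x. inverse (E x) *\<^sub>R step k A (W v) x)"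
      unfolding step_def
      by (intro continuous_intros cE continuous_on_avg continuous_fu cW) auto
    moreover have "norm (inverse (E x) *\<^sub>R step k A (W v) x) \<le> \<bar>A\<bar> + 2 * B / (4 * L)" for x
    proof -
      have "\<bar>x * avg 0 (\<lambda>x. f1 (W v x)) x\<bar> \<le> \<bar>x\<bar> * B" "\<bar>x * avg k (\<lambda>x. f2 (W v x)) x\<bar> \<le> \<bar>x\<bar> * B"
        unfolding abs_mult by (intro mult_left_mono avgB continuous_fu cW B; simp)+
      then have "norm (step k A (W v) x) \<le> \<bar>A\<bar> + 2 * (\<bar>x\<bar> * B)"
        unfolding step_def by (intro order_trans[OF norm_Pair_le]) (unfold real_norm_def, linarith)
      moreover have "4 * L * \<bar>x\<bar> \<le> E x" unfolding E_def
        using exp_ge_add_one_self[of "4 * L * \<bar>x\<bar>"] by linarith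
      then have "\<bar>x\<bar> * B \<le> E x / (4 * L) * B"
        using L \<open>B \<ge> 0\<close> by (intro mult_right_mono) (auto simp: field_simps)
      moreover have "\<bar>A\<bar> * 1 \<le> \<bar>A\<bar> * E x"
        by (rule mult_left_mono) (use L in \<open>auto simp: E_def\<close>)
      ultimately have "norm (step k A (W v) x) \<le> E x * (\<bar>A\<bar> + 2 * B / (4 * L))"
        by (simp add: algebra_simps)
      then show ?thesis using E0[of x] by (simp add: field_simps)
    qed
    ultimately have "(\<lambda>x. inverse (E x) *\<^sub>R step k A (W v) x) \<in> bcontfun"
      unfolding bcontfun_def by (auto intro!: boundedI)
    then show ?thesis unfolding T_def by (simp add: Bcontfun_inverse)
  qed
  have "dist (T v) (T w) \<le> 1 / 2 * dist v w" for v w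
  proof (rule dist_bound)
    fix x
    have "norm (step k A (W v) x - step k A (W w) x) \<le> \<bar>A - A\<bar> + dist v w / 2 * exp (4 * L * \<bar>x\<bar>)"
    proof (rule step_diff[of UNIV])
      fix t :: real assume t: "0 \<le> t" "t \<le> 1"
      have "norm (W v (t * x) - W w (t * x)) = E (t * x) * dist (apply_bcontfun v (t * x)) (apply_bcontfun w (t * x))"
        using E0[of "t * x"] by (simp add: W_def dist_norm scaleR_diff_right[symmetric])
      also have "\<dots> \<le> E (t * x) * dist v w"
        using E0[of "t * x"] by (intro mult_left_mono dist_bounded) auto
      finally show "norm (W v (t * x) - W w (t * x)) \<le> dist v w * exp (4 * L * \<bar>x\<bar> * t)"
        using t by (simp add: E_def abs_mult mult_ac)
    qed (use cW in auto)
    then have "norm (step k A (W v) x - step k A (W w) x) \<le> E x * (1 / 2 * dist v w)"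
      by (simp add: E_def mult_ac)
    moreover have "E x * dist (apply_bcontfun (T v) x) (apply_bcontfun (T w) x)
        = norm (step k A (W v) x - step k A (W w) x)"
      using E0[of x] by (simp add: T dist_norm scaleR_diff_right[symmetric])
    ultimately have "E x * dist (apply_bcontfun (T v) x) (apply_bcontfun (T w) x) \<le> E x * (1 / 2 * dist v w)"
      by simp
    then show "dist (apply_bcontfun (T v) x) (apply_bcontfun (T w) x) \<le> 1 / 2 * dist v w"
      by (rule mult_left_le_imp_le) (rule E0)
  qed
  then have "\<exists>!v. T v = v" by (intro banach_fix_type[of "1/2"]) auto
  then obtain v where v: "T v = v" by blast
  have "W v x = step k A (W v) x" for x
  proof -
    have "apply_bcontfun v x = inverse (E x) *\<^sub>R step k A (W v) x" using T[of v x] v by simp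
    then have "E x *\<^sub>R apply_bcontfun v x = step k A (W v) x" using E0[of x] by simp
    then show ?thesis unfolding W_def .
  qed
  then show ?thesis using that cW by blast
qed

end

section \<open>The profile equation\<close>

lemma C1_lipschitz:
  fixes f f' :: "real \<Rightarrow> real"
  assumes "\<And>x. x \<in> {a..b} \<Longrightarrow> (f has_real_derivative f' x) (at x)" "continuous_on {a..b} f'"
  obtains L where "L > 0" "\<And>x y. x \<in> {a..b} \<Longrightarrow> y \<in> {a..b} \<Longrightarrow> \<bar>f x - f y\<bar> \<le> L * \<bar>x - y\<bar>"
proof -
  have "bounded (f' ` {a..b})"
    using assms(2) compact_continuous_image compact_imp_bounded by blast
  then obtain L where L: "L > 0" "\<And>x. x \<in> {a..b} \<Longrightarrow> norm (f' x) \<le> L"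
    by (auto simp: bounded_pos)
  have "norm (f x - f y) \<le> L * norm (x - y)" if "x \<in> {a..b}" "y \<in> {a..b}" for x y
    by (rule field_differentiable_bound[of "{a..b}" f f'])
       (use assms(1) L that in \<open>auto intro: has_field_derivative_at_within\<close>)
  then show ?thesis using that[OF L(1)] by auto
qed

lemma continuous_pos_bound:
  fixes g :: "real \<Rightarrow> real"
  assumes "compact K" "continuous_on K g" "\<And>x. x \<in> K \<Longrightarrow> g x > 0"
  obtains e where "e > 0" "\<And>x. x \<in> K \<Longrightarrow> e \<le> g x"
proof (cases "K = {}")
  case True
  then show ?thesis using that[of 1] by auto
next
  case False
  then obtain z where "z \<in> K" "\<And>x. x \<in> K \<Longrightarrow> g z \<le> g x"
    using continuous_attains_inf[OF assms(1) _ assms(2)] by auto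
  then show ?thesis using that[of "g z"] assms(3) by auto
qed

lemma abs_components_le_norm:
  fixes u v :: "real \<times> real"
  shows "\<bar>fst u - fst v\<bar> \<le> norm (u - v)" "\<bar>snd u - snd v\<bar> \<le> norm (u - v)"
  using norm_fst_le[of "fst (u - v)" "snd (u - v)"] norm_snd_le[of "snd (u - v)" "fst (u - v)"] by (simp_all del: fst_diff snd_diff) (simp_all add: fst_diff snd_diff)

lemma one_minus_square_pos: "\<bar>S\<bar> < 1 \<Longrightarrow> 0 < 1 - (S::real)\<^sup>2"
  by (simp add: abs_square_less_1)

lemma DERIV_sqrt_one_minus_square:
  assumes "\<bar>S\<bar> < 1"
  shows "((\<lambda>S. sqrt (1 - S\<^sup>2)) has_real_derivative - S / sqrt (1 - S\<^sup>2)) (at S)"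
  using one_minus_square_pos[OF assms]
  by (auto intro!: derivative_eq_intros simp: divide_simps)

locale cmc =
  fixes k l :: nat and h :: real
  assumes k: "k \<ge> 1" and l: "l \<ge> 1" and h: "h > 0"
begin

text \<open>Here \<open>k = n - 1\<close>, \<open>l = m - 1\<close>, and \<open>S\<close> stands for \<open>sin \<sigma>\<close>.  For a graph \<open>y = p(x)\<close> the curvature
  equation becomes \<open>y' = F1 S\<close>, \<open>S' + k S / x = F2 y S\<close>.  The solution of the second equation that is
  regular at \<open>x = 0\<close> is \<open>S = x * avg k (F2 y S)\<close>, which makes sense on both sides of \<open>0\<close>.\<close>

definition F1 :: "real \<Rightarrow> real" where "F1 S = S / sqrt (1 - S\<^sup>2)"
definition F2 :: "real \<Rightarrow> real \<Rightarrow> real" where "F2 y S = real l * cot y * sqrt (1 - S\<^sup>2) - h"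
text \<open>These compact sets exhaust the open domain \<open>0 < y < pi\<close>,
  \<open>|S| < 1\<close> of the system as \<open>\<epsilon>\<close> tends to
  \<open>0\<close>.\<close>

definition box :: "real \<Rightarrow> (real \<times> real) set"
  where "box \<epsilon> = {u. \<epsilon> \<le> fst u \<and> fst u \<le> pi - \<epsilon> \<and> \<bar>snd u\<bar> \<le> 1 - \<epsilon>}"

text \<open>\<open>F1\<close> and \<open>F2\<close> are composed with the projections of
  \<open>y\<close> and \<open>S\<close> onto the sides of the box. The projections are
  \<open>1\<close>-Lipschitz, and \<open>F1\<close>, \<open>cot\<close> and the square root are
  bounded and Lipschitz over the box, so the truncated functions have both properties
  everywhere.\<close>

lemma truncated_system:
  assumes \<epsilon>: "0 < \<epsilon>" "\<epsilon> \<le> 1 / 2"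
  obtains f1 f2 L B where "lipschitz_pair f1 f2 L" "\<And>u. \<bar>f1 u\<bar> \<le> B" "\<And>u. \<bar>f2 u\<bar> \<le> B"
    "\<And>u. u \<in> box \<epsilon> \<Longrightarrow> f1 u = F1 (snd u)" "\<And>u. u \<in> box \<epsilon> \<Longrightarrow> f2 u = F2 (fst u) (snd u)"
proof -
  define a where "a = 1 - \<epsilon>"
  have a: "0 < a" "a < 1" using \<epsilon> by (auto simp: a_def)
  have pe: "\<epsilon> < pi - \<epsilon>" using \<epsilon> pi_gt3 by linarith
  have S1: "\<bar>S\<bar> < 1" "0 < 1 - S\<^sup>2" if "S \<in> {-a..a}" for S
    using that a one_minus_square_pos[of S] by auto
  have cs: "continuous_on {-a..a} (\<lambda>S. sqrt (1 - S\<^sup>2))" by (intro continuous_intros)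
  have sq0: "sqrt (1 - S\<^sup>2) \<noteq> 0" if "S \<in> {-a..a}" for S using S1(2)[OF that] by auto
  obtain L1 where L1: "L1 > 0" "\<And>x y. x \<in> {-a..a} \<Longrightarrow> y \<in> {-a..a} \<Longrightarrow> \<bar>F1 x - F1 y\<bar> \<le> L1 * \<bar>x - y\<bar>"
  proof (rule C1_lipschitz[of "-a" a F1])
    show "(F1 has_real_derivative (1 * sqrt (1 - S\<^sup>2) - S * (- S / sqrt (1 - S\<^sup>2))) / (sqrt (1 - S\<^sup>2) * sqrt (1 - S\<^sup>2))) (at S)"
      if "S \<in> {-a..a}" for S
      unfolding F1_def[abs_def]
      by (rule DERIV_divide[OF DERIV_ident DERIV_sqrt_one_minus_square[OF S1(1)[OF that]] sq0[OF that]])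
    show "continuous_on {-a..a} (\<lambda>S. (1 * sqrt (1 - S\<^sup>2) - S * (- S / sqrt (1 - S\<^sup>2))) / (sqrt (1 - S\<^sup>2) * sqrt (1 - S\<^sup>2)))"
      using sq0 by (intro continuous_intros cs) auto
  qed (rule that)
  obtain L2 where L2: "L2 > 0" "\<And>x y. x \<in> {-a..a} \<Longrightarrow> y \<in> {-a..a} \<Longrightarrow>
      \<bar>sqrt (1 - x\<^sup>2) - sqrt (1 - y\<^sup>2)\<bar> \<le> L2 * \<bar>x - y\<bar>"
  proof (rule C1_lipschitz[of "-a" a "\<lambda>S. sqrt (1 - S\<^sup>2)"])
    show "((\<lambda>S. sqrt (1 - S\<^sup>2)) has_real_derivative - S / sqrt (1 - S\<^sup>2)) (at S)" if "S \<in> {-a..a}" for S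
      by (rule DERIV_sqrt_one_minus_square[OF S1(1)[OF that]])
    show "continuous_on {-a..a} (\<lambda>S. - S / sqrt (1 - S\<^sup>2))"
      using sq0 by (intro continuous_intros cs) auto
  qed (rule that)
  have sin0: "sin y \<noteq> 0" if "y \<in> {\<epsilon>..pi - \<epsilon>}" for y
    using sin_gt_zero[of y] that \<epsilon> by auto
  have cc: "continuous_on {\<epsilon>..pi - \<epsilon>} cot"
    by (rule continuous_at_imp_continuous_on) (use sin0 DERIV_cot DERIV_isCont in blast)
  obtain L3 where L3: "L3 > 0" "\<And>x y. x \<in> {\<epsilon>..pi - \<epsilon>} \<Longrightarrow> y \<in> {\<epsilon>..pi - \<epsilon>} \<Longrightarrow> \<bar>cot x - cot y\<bar> \<le> L3 * \<bar>x - y\<bar>"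
  proof (rule C1_lipschitz[of \<epsilon> "pi - \<epsilon>" cot])
    show "(cot has_real_derivative - inverse ((sin x)\<^sup>2)) (at x)" if "x \<in> {\<epsilon>..pi - \<epsilon>}" for x
      by (rule DERIV_cot[OF sin0[OF that]])
    show "continuous_on {\<epsilon>..pi - \<epsilon>} (\<lambda>x. - inverse ((sin x)\<^sup>2))"
      using sin0 by (intro continuous_intros) auto
  qed (rule that)
  have "bounded (cot ` {\<epsilon>..pi - \<epsilon>})" "bounded (F1 ` {-a..a})"
    using cc compact_continuous_image[of "{\<epsilon>..pi - \<epsilon>}" cot] compact_continuous_image[of "{-a..a}" F1] compact_imp_bounded
      continuous_on_divide[OF continuous_on_id cs] sq0
    by (auto simp: F1_def[abs_def])
  then obtain M M1 where M: "M > 0" "\<And>y. y \<in> {\<epsilon>..pi - \<epsilon>} \<Longrightarrow> \<bar>cot y\<bar> \<le> M"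
      and M1: "M1 > 0" "\<And>y. y \<in> {-a..a} \<Longrightarrow> \<bar>F1 y\<bar> \<le> M1"
    by (auto simp: bounded_pos)
  define c1 where "c1 y = max \<epsilon> (min (pi - \<epsilon>) y)" for y
  define c2 where "c2 y = max (- a) (min a y)" for y
  have c1: "c1 y \<in> {\<epsilon>..pi - \<epsilon>}" and c2: "c2 y \<in> {-a..a}" for y
    using pe a by (auto simp: c1_def c2_def)
  have c1l: "\<bar>c1 x - c1 y\<bar> \<le> \<bar>x - y\<bar>" and c2l: "\<bar>c2 x - c2 y\<bar> \<le> \<bar>x - y\<bar>" for x y
    using pe a by (auto simp: c1_def c2_def)
  note n = abs_components_le_norm
  have s1: "\<bar>sqrt (1 - x\<^sup>2)\<bar> \<le> 1" if "x \<in> {-a..a}" for x using S1(2)[OF that] by auto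
  define f1 where "f1 u = F1 (c2 (snd u))" for u :: "real \<times> real"
  define f2 where "f2 u = F2 (c1 (fst u)) (c2 (snd u))" for u
  define L where "L = L1 + real l * (M * L2 + L3)"
  have lpos: "real l > 0" using l by simp
  show ?thesis
  proof (rule that[of f1 f2 L "M1 + (real l * M + h)"])
    show "lipschitz_pair f1 f2 L"
    proof
      show "L > 0" unfolding L_def using L1 L2 L3 M lpos by (intro add_pos_pos mult_pos_pos) auto
      fix u v :: "real \<times> real"
      let ?N = "norm (u - v)"
      have "\<bar>f1 u - f1 v\<bar> \<le> L1 * \<bar>c2 (snd u) - c2 (snd v)\<bar>" unfolding f1_def by (rule L1(2)[OF c2 c2])
      also have "\<dots> \<le> L1 * ?N" using L1(1) order_trans[OF c2l n(2)] by (intro mult_left_mono) auto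
      also have "\<dots> \<le> L * ?N"
        using L2(1) L3(1) M(1) by (intro mult_right_mono) (auto simp: L_def)
      finally show "\<bar>f1 u - f1 v\<bar> \<le> L * ?N" .
      define p q p' q' where "p = cot (c1 (fst u))" "q = sqrt (1 - (c2 (snd u))\<^sup>2)"
        "p' = cot (c1 (fst v))" "q' = sqrt (1 - (c2 (snd v))\<^sup>2)"
      have "\<bar>q - q'\<bar> \<le> L2 * ?N"
        using order_trans[OF L2(2)[OF c2 c2] mult_left_mono[OF order_trans[OF c2l n(2)]]] L2(1)
        by (auto simp: p_q_p'_q'_def)
      moreover have "\<bar>p - p'\<bar> \<le> L3 * ?N"
        using order_trans[OF L3(2)[OF c1 c1] mult_left_mono[OF order_trans[OF c1l n(1)]]] L3(1)
        by (auto simp: p_q_p'_q'_def)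
      moreover have "\<bar>p\<bar> \<le> M" "\<bar>q'\<bar> \<le> 1" unfolding p_q_p'_q'_def using M(2)[OF c1] s1[OF c2] by blast+
      ultimately have "\<bar>p * (q - q')\<bar> \<le> M * (L2 * ?N)" "\<bar>(p - p') * q'\<bar> \<le> (L3 * ?N) * 1"
        unfolding abs_mult using M(1) by (intro mult_mono; simp)+
      moreover have "p * q - p' * q' = p * (q - q') + (p - p') * q'" by (simp add: algebra_simps)
      ultimately have "\<bar>p * q - p' * q'\<bar> \<le> (M * L2 + L3) * ?N" by (simp add: algebra_simps)
      then have "real l * \<bar>p * q - p' * q'\<bar> \<le> real l * ((M * L2 + L3) * ?N)" by (intro mult_left_mono) auto
      moreover have "f2 u - f2 v = real l * (p * q - p' * q')"
        by (simp add: f2_def F2_def p_q_p'_q'_def algebra_simps)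
      ultimately have "\<bar>f2 u - f2 v\<bar> \<le> real l * ((M * L2 + L3) * ?N)" by (simp add: abs_mult)
      also have "\<dots> = (real l * (M * L2 + L3)) * ?N" by simp
      also have "\<dots> \<le> L * ?N" using L1(1) by (intro mult_right_mono) (auto simp: L_def)
      finally show "\<bar>f2 u - f2 v\<bar> \<le> L * ?N" .
    qed
    fix u :: "real \<times> real"
    have "0 \<le> real l * M + h" using lpos M(1) h by (simp add: add_nonneg_nonneg)
    then show "\<bar>f1 u\<bar> \<le> M1 + (real l * M + h)" unfolding f1_def using M1(2)[OF c2, of "snd u"] by linarith
    have "\<bar>cot (c1 (fst u)) * sqrt (1 - (c2 (snd u))\<^sup>2)\<bar> \<le> M * 1"
      unfolding abs_mult by (intro mult_mono M(2)[OF c1] s1[OF c2]) (use M in auto)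
    then have "real l * \<bar>cot (c1 (fst u)) * sqrt (1 - (c2 (snd u))\<^sup>2)\<bar> \<le> real l * M"
      by (intro mult_left_mono) auto
    then have "\<bar>real l * cot (c1 (fst u)) * sqrt (1 - (c2 (snd u))\<^sup>2)\<bar> \<le> real l * M"
      by (simp add: abs_mult mult.assoc)
    then show "\<bar>f2 u\<bar> \<le> M1 + (real l * M + h)" unfolding f2_def F2_def using M1(1) h by linarith
    assume u: "u \<in> box \<epsilon>"
    then have "c1 (fst u) = fst u" "c2 (snd u) = snd u" by (auto simp: box_def c1_def c2_def a_def)
    then show "f1 u = F1 (snd u)" "f2 u = F2 (fst u) (snd u)" by (auto simp: f1_def f2_def)
  qed
qed

text \<open>The integral equations contain the initial values \<open>y 0 = A\<close>,
  \<open>S 0 = 0\<close> and require no derivative at \<open>0\<close>. The interval is two-sided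
  although the profile itself lives over \<open>x \<ge> 0\<close>: thus \<open>0\<close> becomes an
  interior point, at which derivatives and parity make sense.\<close>

definition sol :: "real \<Rightarrow> real \<Rightarrow> (real \<Rightarrow> real) \<Rightarrow> (real \<Rightarrow> real) \<Rightarrow> bool"
  where "sol A X y S \<longleftrightarrow> X \<ge> 0 \<and> continuous_on {-X..X} y \<and> continuous_on {-X..X} S \<and>
    (\<forall>x. \<bar>x\<bar> \<le> X \<longrightarrow> 0 < y x \<and> y x < pi \<and> \<bar>S x\<bar> < 1 \<and>
       y x = A + x * avg 0 (\<lambda>x. F1 (S x)) x \<and> S x = x * avg k (\<lambda>x. F2 (y x) (S x)) x)"

lemma solD:
  assumes "sol A X y S"
  shows "X \<ge> 0" "continuous_on {-X..X} y" "continuous_on {-X..X} S"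
    "\<And>x. \<bar>x\<bar> \<le> X \<Longrightarrow> 0 < y x" "\<And>x. \<bar>x\<bar> \<le> X \<Longrightarrow> y x < pi" "\<And>x. \<bar>x\<bar> \<le> X \<Longrightarrow> \<bar>S x\<bar> < 1"
    "\<And>x. \<bar>x\<bar> \<le> X \<Longrightarrow> y x = A + x * avg 0 (\<lambda>x. F1 (S x)) x"
    "\<And>x. \<bar>x\<bar> \<le> X \<Longrightarrow> S x = x * avg k (\<lambda>x. F2 (y x) (S x)) x"
  using assms unfolding sol_def by blast+

lemma abs_mult_le: "\<bar>x\<bar> \<le> X \<Longrightarrow> 0 \<le> t \<Longrightarrow> t \<le> 1 \<Longrightarrow> \<bar>t * x\<bar> \<le> (X::real)"
  using mult_mono[of "\<bar>t\<bar>" 1 "\<bar>x\<bar>" X] by (simp add: abs_mult)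

lemma sol_subset:
  assumes "sol A X y S" "0 \<le> X'" "X' \<le> X" shows "sol A X' y S"
proof -
  have sub: "{-X'..X'} \<subseteq> {-X..X}" using assms(3) by auto
  have x: "\<bar>x\<bar> \<le> X" if "\<bar>x\<bar> \<le> X'" for x using that assms(3) by simp
  show ?thesis
    unfolding sol_def
    using assms(2) continuous_on_subset[OF solD(2)[OF assms(1)] sub]
      continuous_on_subset[OF solD(3)[OF assms(1)] sub] solD(4-8)[OF assms(1) x] by blast
qed

lemma sol_cong:
  assumes "sol A X y S" "\<And>x. \<bar>x\<bar> \<le> X \<Longrightarrow> y x = y' x" "\<And>x. \<bar>x\<bar> \<le> X \<Longrightarrow> S x = S' x"
  shows "sol A X y' S'"
  unfolding sol_def
proof (intro conjI allI impI)
  show "continuous_on {-X..X} y'" "continuous_on {-X..X} S'"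
    using solD(2,3)[OF assms(1)] assms(2,3)
    by (metis (no_types, lifting) abs_le_iff atLeastAtMost_iff continuous_on_cong minus_le_iff)+
  fix x assume x: "\<bar>x\<bar> \<le> X"
  note d = solD(4-8)[OF assms(1) x] assms(2,3)[OF x]
  show "0 < y' x" "y' x < pi" "\<bar>S' x\<bar> < 1" using d by auto
  have "avg 0 (\<lambda>x. F1 (S x)) x = avg 0 (\<lambda>x. F1 (S' x)) x"
    "avg k (\<lambda>x. F2 (y x) (S x)) x = avg k (\<lambda>x. F2 (y' x) (S' x)) x"
    using assms(2,3) abs_mult_le[OF x] by (auto intro!: avg_cong)
  then show "y' x = A + x * avg 0 (\<lambda>x. F1 (S' x)) x" "S' x = x * avg k (\<lambda>x. F2 (y' x) (S' x)) x"
    using d by auto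
qed (use solD[OF assms(1)] in auto)

lemma sol_box:
  assumes "sol A X y S"
  obtains \<epsilon> where "0 < \<epsilon>" "\<epsilon> \<le> 1 / 2" "\<And>x. \<bar>x\<bar> \<le> X \<Longrightarrow> (y x, S x) \<in> box \<epsilon>"
proof -
  note d = solD[OF assms]
  obtain e where e: "e > 0" "\<And>x. x \<in> {-X..X} \<Longrightarrow> e \<le> min (min (y x) (pi - y x)) (1 - \<bar>S x\<bar>)"
  proof (rule continuous_pos_bound[of "{-X..X}" "\<lambda>x. min (min (y x) (pi - y x)) (1 - \<bar>S x\<bar>)"])
    show "continuous_on {-X..X} (\<lambda>x. min (min (y x) (pi - y x)) (1 - \<bar>S x\<bar>))"
      using d(2,3) by (intro continuous_intros)
    show "0 < min (min (y x) (pi - y x)) (1 - \<bar>S x\<bar>)" if "x \<in> {-X..X}" for x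
      using d(4-6)[of x] that by (auto simp: abs_le_iff)
  qed auto
  have "(y x, S x) \<in> box (min e (1 / 2))" if "\<bar>x\<bar> \<le> X" for x
    using e(2)[of x] that unfolding box_def by (auto simp: abs_le_iff)
  then show ?thesis using that[of "min e (1/2)"] e(1) by auto
qed

text \<open>The averages at \<open>x\<close> see only the arguments \<open>t * x\<close> with
  \<open>0 \<le> t \<le> 1\<close>, where \<open>u\<close> lies in the box and the truncation has no
  effect. So truncated and true integral equations coincide; the next two lemmas use this in either
  direction.\<close>

lemma sol_step:
  assumes "lipschitz_pair f1 f2 L" "\<And>u. u \<in> box \<epsilon> \<Longrightarrow> f1 u = F1 (snd u)" "\<And>u. u \<in> box \<epsilon> \<Longrightarrow> f2 u = F2 (fst u) (snd u)"
    "\<And>x. \<bar>x\<bar> \<le> X \<Longrightarrow> u x \<in> box \<epsilon>" "\<bar>x\<bar> \<le> X"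
  shows "lipschitz_pair.step f1 f2 k A u x = (A + x * avg 0 (\<lambda>x. F1 (snd (u x))) x, x * avg k (\<lambda>x. F2 (fst (u x)) (snd (u x))) x)"
proof -
  have "avg 0 (\<lambda>x. f1 (u x)) x = avg 0 (\<lambda>x. F1 (snd (u x))) x"
    "avg k (\<lambda>x. f2 (u x)) x = avg k (\<lambda>x. F2 (fst (u x)) (snd (u x))) x"
    by (rule avg_cong, rule assms(2)[OF assms(4)[OF abs_mult_le[OF assms(5)]]], assumption+,
        rule avg_cong, rule assms(3)[OF assms(4)[OF abs_mult_le[OF assms(5)]]], assumption+)
  then show ?thesis unfolding lipschitz_pair.step_def[OF assms(1)] by simp
qed

lemma step_sol:
  assumes "sol A X y S" "lipschitz_pair f1 f2 L" "\<And>u. u \<in> box \<epsilon> \<Longrightarrow> f1 u = F1 (snd u)" "\<And>u. u \<in> box \<epsilon> \<Longrightarrow> f2 u = F2 (fst u) (snd u)"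
    "\<And>x. \<bar>x\<bar> \<le> X \<Longrightarrow> (y x, S x) \<in> box \<epsilon>" "\<bar>x\<bar> \<le> X"
  shows "(y x, S x) = lipschitz_pair.step f1 f2 k A (\<lambda>x. (y x, S x)) x"
  using sol_step[of f1 f2 L \<epsilon> X "\<lambda>x. (y x, S x)" x A, OF assms(2-6)] solD(7,8)[OF assms(1,6)] by simp

lemma sol_of_step:
  assumes "lipschitz_pair f1 f2 L" "\<And>u. u \<in> box \<epsilon> \<Longrightarrow> f1 u = F1 (snd u)" "\<And>u. u \<in> box \<epsilon> \<Longrightarrow> f2 u = F2 (fst u) (snd u)"
    "0 < \<epsilon>" "X \<ge> 0" "continuous_on {-X..X} u" "\<And>x. \<bar>x\<bar> \<le> X \<Longrightarrow> u x = lipschitz_pair.step f1 f2 k A u x"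
    "\<And>x. \<bar>x\<bar> \<le> X \<Longrightarrow> u x \<in> box \<epsilon>"
  shows "sol A X (\<lambda>x. fst (u x)) (\<lambda>x. snd (u x))"
  unfolding sol_def
proof (intro conjI allI impI)
  fix x assume x: "\<bar>x\<bar> \<le> X"
  show "0 < fst (u x)" "fst (u x) < pi" "\<bar>snd (u x)\<bar> < 1" using assms(4) assms(8)[OF x] by (auto simp: box_def)
  have "u x = (A + x * avg 0 (\<lambda>x. F1 (snd (u x))) x, x * avg k (\<lambda>x. F2 (fst (u x)) (snd (u x))) x)"
    using sol_step[OF assms(1-3,8) x] assms(7)[OF x] by simp
  then show "fst (u x) = A + x * avg 0 (\<lambda>x. F1 (snd (u x))) x"
    "snd (u x) = x * avg k (\<lambda>x. F2 (fst (u x)) (snd (u x))) x" by (metis fst_conv, metis snd_conv)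
qed (use assms in \<open>auto intro: continuous_intros\<close>)

lemma box_mono: "u \<in> box \<epsilon> \<Longrightarrow> \<delta> \<le> \<epsilon> \<Longrightarrow> u \<in> box \<delta>"
  by (auto simp: box_def)

text \<open>Two solutions on a compact interval share a box, so both are fixed points of one
  truncated Picard map, and \<open>stability\<close> with equal heights applies.\<close>

lemma sol_unique:
  assumes "sol A X y S" "sol A X y' S'" "\<bar>x\<bar> \<le> X"
  shows "y x = y' x" "S x = S' x"
proof -
  obtain e where e: "0 < e" "e \<le> 1/2" "\<And>x. \<bar>x\<bar> \<le> X \<Longrightarrow> (y x, S x) \<in> box e"
    by (rule sol_box[OF assms(1)], rule that)
  obtain e' where e': "0 < e'" "e' \<le> 1/2" "\<And>x. \<bar>x\<bar> \<le> X \<Longrightarrow> (y' x, S' x) \<in> box e'"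
    by (rule sol_box[OF assms(2)], rule that)
  define d where "d = min e e'"
  have d: "0 < d" "d \<le> 1/2" "d \<le> e" "d \<le> e'" using e(1,2) e'(1,2) by (auto simp: d_def)
  have b: "\<And>x. \<bar>x\<bar> \<le> X \<Longrightarrow> (y x, S x) \<in> box d" "\<And>x. \<bar>x\<bar> \<le> X \<Longrightarrow> (y' x, S' x) \<in> box d"
    using box_mono[OF e(3) d(3)] box_mono[OF e'(3) d(4)] by blast+
  obtain f1 f2 L B where f: "lipschitz_pair f1 f2 L" "\<And>u. \<bar>f1 u\<bar> \<le> B" "\<And>u. \<bar>f2 u\<bar> \<le> B"
    "\<And>u. u \<in> box d \<Longrightarrow> f1 u = F1 (snd u)" "\<And>u. u \<in> box d \<Longrightarrow> f2 u = F2 (fst u) (snd u)"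
    by (rule truncated_system[OF d(1,2)], rule that)
  have "norm ((y x, S x) - (y' x, S' x)) \<le> 2 * \<bar>A - A\<bar> * exp (4 * L * \<bar>x\<bar>)"
    by (rule lipschitz_pair.stability[OF f(1) solD(1)[OF assms(1)]
          continuous_on_Pair[OF solD(2,3)[OF assms(1)]] step_sol[OF assms(1) f(1,4,5) b(1)]
          continuous_on_Pair[OF solD(2,3)[OF assms(2)]] step_sol[OF assms(2) f(1,4,5) b(2)] assms(3)])
  then show "y x = y' x" "S x = S' x" by (auto simp: zero_prod_def)
qed

lemma box_near: "u \<in> box \<epsilon> \<Longrightarrow> dist v u \<le> \<epsilon> / 2 \<Longrightarrow> v \<in> box (\<epsilon> / 2)"
  using abs_components_le_norm[of v u] by (auto simp: box_def dist_norm abs_le_iff)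

text \<open>The given solution lies in \<open>box e\<close>, and the system is truncated only
  outside \<open>box (e / 2)\<close>. A truncated solution that stays within \<open>e / 2\<close> of
  the given one never feels the truncation, hence solves the true system.\<close>

lemma sol_near:
  assumes "sol A X y S" "\<eta> > 0"
  obtains \<delta> where "\<delta> > 0" "\<And>A'. \<bar>A' - A\<bar> < \<delta> \<Longrightarrow> \<exists>y' S'. sol A' X y' S' \<and>
      (\<forall>x. \<bar>x\<bar> \<le> X \<longrightarrow> \<bar>y' x - y x\<bar> < \<eta> \<and> \<bar>S' x - S x\<bar> < \<eta>)"
proof -
  note X = solD(1)[OF assms(1)]
  obtain e where e: "0 < e" "e \<le> 1/2" "\<And>x. \<bar>x\<bar> \<le> X \<Longrightarrow> (y x, S x) \<in> box e"
    by (rule sol_box[OF assms(1)], rule that)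
  have e2: "0 < e / 2" "e / 2 \<le> 1/2" using e by auto
  obtain f1 f2 L B where f: "lipschitz_pair f1 f2 L" "\<And>u. \<bar>f1 u\<bar> \<le> B" "\<And>u. \<bar>f2 u\<bar> \<le> B"
    "\<And>u. u \<in> box (e/2) \<Longrightarrow> f1 u = F1 (snd u)" "\<And>u. u \<in> box (e/2) \<Longrightarrow> f2 u = F2 (fst u) (snd u)"
    by (rule truncated_system[OF e2], rule that)
  interpret lipschitz_pair f1 f2 L by (rule f(1))
  have b: "(y x, S x) \<in> box (e / 2)" if "\<bar>x\<bar> \<le> X" for x
    using box_mono[OF e(3)[OF that]] e(1) by simp
  define \<mu> where "\<mu> = min (\<eta> / 2) (e / 2)"
  have \<mu>: "\<mu> > 0" using e(1) assms(2) by (auto simp: \<mu>_def)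
  \<comment> \<open>Chosen so that the stability estimate at the end of the interval yields
    \<open>\<mu>\<close>.\<close>
  define \<delta> where "\<delta> = \<mu> / (2 * exp (4 * L * X))"
  show ?thesis
  proof (rule that)
    show "\<delta> > 0" using \<mu> by (simp add: \<delta>_def)
    fix A' assume A': "\<bar>A' - A\<bar> < \<delta>"
    obtain u where u: "continuous_on UNIV u" "\<And>x. u x = step k A' u x"
      by (rule existence[OF f(2,3), of k A'], rule that)
    have near: "dist (u x) (y x, S x) \<le> \<mu>" if "\<bar>x\<bar> \<le> X" for x
    proof -
      have "norm (u x - (y x, S x)) \<le> 2 * \<bar>A' - A\<bar> * exp (4 * L * \<bar>x\<bar>)"
        by (rule stability[OF X continuous_on_subset[OF u(1) subset_UNIV] u(2)
              continuous_on_Pair[OF solD(2,3)[OF assms(1)]] step_sol[OF assms(1) f(1,4,5) b] that])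
      also have "\<dots> \<le> 2 * \<delta> * exp (4 * L * X)"
        using A' that L by (intro mult_mono) auto
      also have "\<dots> = \<mu>" by (simp add: \<delta>_def)
      finally show ?thesis by (simp add: dist_norm)
    qed
    have "u x \<in> box (e / 2)" if "\<bar>x\<bar> \<le> X" for x
      by (rule box_near[OF e(3)[OF that]]) (use near[OF that] in \<open>auto simp: \<mu>_def\<close>)
    then have bu: "u x \<in> box (e / 2)" if "\<bar>x\<bar> \<le> X" for x using that by blast
    have "sol A' X (\<lambda>x. fst (u x)) (\<lambda>x. snd (u x))"
      by (rule sol_of_step[OF f(1,4,5) e2(1) X continuous_on_subset[OF u(1) subset_UNIV] u(2) bu])
    moreover have "\<bar>fst (u x) - y x\<bar> < \<eta> \<and> \<bar>snd (u x) - S x\<bar> < \<eta>" if "\<bar>x\<bar> \<le> X" for x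
      using abs_components_le_norm[of "u x" "(y x, S x)"] near[OF that] assms(2)
      unfolding dist_norm \<mu>_def by auto
    ultimately show "\<exists>y' S'. sol A' X y' S' \<and>
      (\<forall>x. \<bar>x\<bar> \<le> X \<longrightarrow> \<bar>y' x - y x\<bar> < \<eta> \<and> \<bar>S' x - S x\<bar> < \<eta>)" by blast
  qed
qed

text \<open>The continuation principle: a solution that stays in a compact box extends past the end of
  its interval.\<close>

lemma sol_extend:
  assumes "0 \<le> R" "0 < \<epsilon>" "\<epsilon> \<le> 1/2" "(A, 0) \<in> box \<epsilon>"
    and "\<And>X. 0 \<le> X \<Longrightarrow> X < R \<Longrightarrow> \<exists>y S. sol A X y S \<and> (\<forall>x. \<bar>x\<bar> \<le> X \<longrightarrow> (y x, S x) \<in> box \<epsilon>)"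
  obtains X y S where "X > R" "sol A X y S"
proof -
  have e2: "0 < \<epsilon> / 2" "\<epsilon> / 2 \<le> 1/2" using assms by auto
  obtain f1 f2 L B where f: "lipschitz_pair f1 f2 L" "\<And>u. \<bar>f1 u\<bar> \<le> B" "\<And>u. \<bar>f2 u\<bar> \<le> B"
    "\<And>u. u \<in> box (\<epsilon>/2) \<Longrightarrow> f1 u = F1 (snd u)" "\<And>u. u \<in> box (\<epsilon>/2) \<Longrightarrow> f2 u = F2 (fst u) (snd u)"
    by (rule truncated_system[OF e2], rule that)
  interpret lipschitz_pair f1 f2 L by (rule f(1))
  \<comment> \<open>A global solution of the system truncated at \<open>\<epsilon> / 2\<close>. It
    agrees with every given solution, and the slack between \<open>\<epsilon>\<close> and
    \<open>\<epsilon> / 2\<close> lets it continue past \<open>R\<close> as a true solution.\<close>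
  obtain u where u: "continuous_on UNIV u" "\<And>x. u x = step k A u x"
    by (rule existence[OF f(2,3), of k A], rule that)
  have inner: "u x \<in> box \<epsilon>" if xR: "\<bar>x\<bar> < R" for x
  proof -
    obtain y S where s: "sol A \<bar>x\<bar> y S" "\<And>z. \<bar>z\<bar> \<le> \<bar>x\<bar> \<Longrightarrow> (y z, S z) \<in> box \<epsilon>"
      using assms(5)[OF abs_ge_zero xR] by blast
    have b: "(y z, S z) \<in> box (\<epsilon> / 2)" if "\<bar>z\<bar> \<le> \<bar>x\<bar>" for z
      using box_mono[OF s(2)[OF that]] assms(2) by simp
    have "norm (u x - (y x, S x)) \<le> 2 * \<bar>A - A\<bar> * exp (4 * L * \<bar>x\<bar>)"
      by (rule stability[OF abs_ge_zero continuous_on_subset[OF u(1) subset_UNIV] u(2)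
            continuous_on_Pair[OF solD(2,3)[OF s(1)]] step_sol[OF s(1) f(1,4,5) b] order_refl])
    then show ?thesis using s(2)[of x] by auto
  qed
  have u0: "u 0 = (A, 0)" using u(2)[of 0] by (simp add: step_def)
  have closed: "u x \<in> box \<epsilon>" if "\<bar>x\<bar> \<le> R" for x
  proof (cases "R = 0")
    case True
    then show ?thesis using that u0 assms(4) by auto
  next
    case False
    have "closed (box \<epsilon>)" unfolding box_def
      by (intro closed_Collect_conj closed_Collect_le continuous_intros)
    then have "closed (u -` box \<epsilon>)" using u(1) by (simp add: continuous_on_closed_vimage closed_vimage)
    moreover have "{-R<..<R} \<subseteq> u -` box \<epsilon>" using inner by auto
    ultimately have "closure {-R<..<R} \<subseteq> u -` box \<epsilon>" by (rule closure_minimal[rotated])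
    then have "{-R..R} \<subseteq> u -` box \<epsilon>" using False assms(1) by (simp add: closure_greaterThanLessThan)
    moreover have "x \<in> {-R..R}" using that by auto
    ultimately show ?thesis by blast
  qed
  have near: "\<exists>d>0. \<forall>x. dist x z < d \<longrightarrow> dist (u x) (u z) < \<epsilon> / 2" for z
    using u(1)[unfolded continuous_on_iff] e2(1) by blast
  obtain d1 where d1: "d1 > 0" "\<And>x. dist x R < d1 \<Longrightarrow> dist (u x) (u R) < \<epsilon> / 2" using near[of R] by blast
  obtain d2 where d2: "d2 > 0" "\<And>x. dist x (-R) < d2 \<Longrightarrow> dist (u x) (u (-R)) < \<epsilon> / 2" using near[of "-R"] by blast
  define X where "X = R + min d1 d2 / 2"
  have X: "X > R" "X - R < d1" "X - R < d2" using d1(1) d2(1) by (auto simp: X_def)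
  have "u x \<in> box (\<epsilon> / 2)" if "\<bar>x\<bar> \<le> X" for x
  proof -
    consider "\<bar>x\<bar> \<le> R" | "R < x" | "x < - R" by linarith
    then show ?thesis
    proof cases
      case 1
      then show ?thesis using box_mono[OF closed] assms(2) by simp
    next
      case 2
      have "dist x R < d1" using 2 that X by (simp add: dist_real_def)
      then show ?thesis using box_near[OF closed[of R]] d1(2) assms(1) by (simp add: less_imp_le)
    next
      case 3
      have "dist x (-R) < d2" using 3 that X by (simp add: dist_real_def)
      then show ?thesis using box_near[OF closed[of "-R"]] d2(2) assms(1) by (simp add: less_imp_le)
    qed
  qed
  then have b: "u x \<in> box (\<epsilon> / 2)" if "\<bar>x\<bar> \<le> X" for x using that by blast
  have "0 \<le> X" using X(1) assms(1) by simp
  have "sol A X (\<lambda>x. fst (u x)) (\<lambda>x. snd (u x))"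
    by (rule sol_of_step[OF f(1,4,5) e2(1) \<open>0 \<le> X\<close> continuous_on_subset[OF u(1) subset_UNIV] u(2) b])
  then show ?thesis by (rule that[OF X(1)])
qed

text \<open>\<open>F1\<close> is odd in \<open>S\<close> and \<open>F2\<close> is even in it, so the
  reflected pair solves the same equations; uniqueness does the rest.\<close>

lemma sol_even:
  assumes "sol A X y S" "\<bar>x\<bar> \<le> X" shows "y (- x) = y x" "S (- x) = - S x"
proof -
  have "sol A X (\<lambda>x. y (- x)) (\<lambda>x. - S (- x))"
    unfolding sol_def
  proof (intro conjI allI impI)
    show "continuous_on {-X..X} (\<lambda>x. y (- x))" "continuous_on {-X..X} (\<lambda>x. - S (- x))"
      by (auto intro!: continuous_intros continuous_on_compose2[OF solD(2)[OF assms(1)]] continuous_on_compose2[OF solD(3)[OF assms(1)]])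
    fix x assume x: "\<bar>x\<bar> \<le> X"
    then have x': "\<bar>- x\<bar> \<le> X" by simp
    note d = solD(4-8)[OF assms(1) x']
    show "0 < y (- x)" "y (- x) < pi" "\<bar>- S (- x)\<bar> < 1" using d by auto
    have "avg 0 (\<lambda>x. F1 (- S (- x))) x = - avg 0 (\<lambda>x. F1 (S x)) (- x)"
      unfolding avg_uminus by (simp add: avg_def F1_def)
    then show "y (- x) = A + x * avg 0 (\<lambda>x. F1 (- S (- x))) x" using d by simp
    have "avg k (\<lambda>x. F2 (y (- x)) (- S (- x))) x = avg k (\<lambda>x. F2 (y x) (S x)) (- x)"
      unfolding avg_uminus by (simp add: F2_def)
    then show "- S (- x) = x * avg k (\<lambda>x. F2 (y (- x)) (- S (- x))) x" using d by simp
  qed (use solD[OF assms(1)] in auto)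
  from sol_unique[OF this assms] show "y (- x) = y x" "S (- x) = - S x" by auto
qed

end

section \<open>Energy, maximal solutions and heights with entire graphs\<close>

lemma avg_le_const:
  fixes f :: "real \<Rightarrow> real"
  assumes "convex U" "0 \<in> U" "continuous_on U f" "x \<in> U" "\<And>t. 0 \<le> t \<Longrightarrow> t \<le> 1 \<Longrightarrow> f (t * x) \<le> c"
  shows "avg k f x \<le> c / (real k + 1)"
proof -
  have "avg k f x \<le> avg k (\<lambda>_. c) x"
    unfolding avg_def
  proof (rule integral_le)
    show "(\<lambda>t. t ^ k * f (t * x)) integrable_on {0..1}" by (rule avg_integrable[OF assms(1-4)])
    show "(\<lambda>t. t ^ k * c) integrable_on {0..1}" by (intro integrable_continuous_real continuous_intros)
    show "t ^ k * f (t * x) \<le> t ^ k * c" if "t \<in> {0..1}" for t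
      using that assms(5)[of t] by (intro mult_left_mono) auto
  qed
  also have "avg k (\<lambda>_. c) x = avg k (\<lambda>_. c) 0" by (simp add: avg_def)
  finally show ?thesis by (simp add: avg_zero)
qed

lemma cot_diff:
  assumes "sin x \<noteq> 0" "sin y \<noteq> 0" shows "cot y - cot x = sin (x - y) / (sin x * sin (y::real))"
  using assms by (simp add: cot_def sin_diff field_simps)

lemma cot_antimono:
  fixes x y :: real
  assumes "0 < y" "y \<le> x" "x < pi" shows "cot x \<le> cot y"
proof -
  have s: "sin x > 0" "sin y > 0" "sin (x - y) \<ge> 0" using assms by (auto intro: sin_gt_zero sin_ge_zero)
  then have "cot y - cot x \<ge> 0" using cot_diff[of x y] by simp
  then show ?thesis by simp
qed

text \<open>Connectedness of the half-line: at the infimum of the points where \<open>P\<close>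
  fails, the limit hypothesis yields \<open>P\<close>, and the local one extends it to the
  right.\<close>

lemma real_continuation:
  fixes P :: "real \<Rightarrow> bool"
  assumes "P a" and "\<And>z. z \<ge> a \<Longrightarrow> P z \<Longrightarrow> \<exists>e>0. \<forall>x. z \<le> x \<and> x < z + e \<longrightarrow> P x"
    and "\<And>z. z > a \<Longrightarrow> (\<And>x. a \<le> x \<Longrightarrow> x < z \<Longrightarrow> P x) \<Longrightarrow> P z" and "x \<ge> a"
  shows "P x"
proof (rule ccontr)
  assume "\<not> P x"
  define Z where "Z = {x. x \<ge> a \<and> \<not> P x}"
  have Z: "Z \<noteq> {}" "bdd_below Z" using \<open>\<not> P x\<close> assms(4) by (auto simp: Z_def bdd_below_def)
  define z where "z = Inf Z"
  have "z \<ge> a" unfolding z_def by (rule cInf_greatest[OF Z(1)]) (simp add: Z_def)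
  have less: "P y" if "a \<le> y" "y < z" for y
  proof (rule ccontr)
    assume "\<not> P y"
    then have "y \<in> Z" using that(1) by (simp add: Z_def)
    then have "z \<le> y" unfolding z_def by (rule cInf_lower[OF _ Z(2)])
    then show False using that(2) by simp
  qed
  have "P z"
  proof (cases "z = a")
    case True then show ?thesis using assms(1) by simp
  next
    case False
    then have "z > a" using \<open>z \<ge> a\<close> by simp
    then show ?thesis by (rule assms(3)) (rule less)
  qed
  then obtain e where e: "e > 0" "\<forall>x. z \<le> x \<and> x < z + e \<longrightarrow> P x" using assms(2)[OF \<open>z \<ge> a\<close>] by blast
  have "z + e \<le> z"
    unfolding z_def[symmetric]
    by (subst (2) z_def, rule cInf_greatest[OF Z(1)]) (use e less in \<open>force simp: Z_def not_less\<close>)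
  then show False using e(1) by simp
qed

context cmc
begin

text \<open>\<open>en y S\<close> is a first integral of the equation without the term \<open>k S / x\<close>; this term makes it
  nondecreasing along solutions.\<close>

definition Isin :: "real \<Rightarrow> real" where "Isin y = y * avg 0 (\<lambda>y. sin y ^ l) y"
definition en :: "real \<Rightarrow> real \<Rightarrow> real" where "en y S = sin y ^ l * sqrt (1 - S\<^sup>2) - h * Isin y"

lemma DERIV_Isin: "(Isin has_real_derivative sin y ^ l) (at y)"
proof -
  have "continuous_on UNIV (\<lambda>y::real. sin y ^ l)" by (intro continuous_intros)
  then show ?thesis
    unfolding Isin_def[abs_def] using DERIV_mult_avg[of UNIV "\<lambda>y. sin y ^ l" y 0] by simp
qed

lemma Isin_0 [simp]: "Isin 0 = 0" by (simp add: Isin_def)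

lemma Isin_nonneg: assumes "0 \<le> y" "y \<le> pi" shows "0 \<le> Isin y"
  using DERIV_nonneg_imp_nondecreasing[OF assms(1), of Isin] DERIV_Isin assms sin_ge_zero
  by (metis Isin_0 order_trans zero_le_power)

text \<open>The difference of the two sides vanishes at \<open>0\<close> and has derivative
  \<open>(l + 1) * sin y * Isin y \<ge> 0\<close>. This converts an energy bound, which involves the
  integral \<open>Isin\<close>, into one on \<open>cot y\<close>.\<close>

lemma cos_Isin_le: assumes "0 \<le> y" "y \<le> pi" shows "(real l + 1) * cos y * Isin y \<le> sin y ^ (l + 1)"
proof -
  define J where "J y = sin y ^ (l + 1) - (real l + 1) * cos y * Isin y" for y
  have "(J has_real_derivative (real l + 1) * sin y * Isin y) (at y)" for y
  proof -
    have "sin y * sin y ^ (l - Suc 0) = sin y ^ l" using l by (cases l) auto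
    then show ?thesis
      unfolding J_def[abs_def] by (auto intro!: derivative_eq_intros DERIV_Isin simp: algebra_simps)
  qed
  moreover have "0 \<le> (real l + 1) * sin x * Isin x" if "0 \<le> x" "x \<le> y" for x
    using that assms by (intro mult_nonneg_nonneg sin_ge_zero Isin_nonneg) auto
  ultimately have "J 0 \<le> J y" by (intro DERIV_nonneg_imp_nondecreasing[OF assms(1)]) blast
  then show ?thesis by (simp add: J_def)
qed

lemma Isin_le: assumes "0 \<le> y" "y \<le> pi / 2" shows "Isin y \<le> y * sin y ^ l"
proof -
  have "avg 0 (\<lambda>y. sin y ^ l) y \<le> sin y ^ l / (real 0 + 1)"
  proof (rule avg_le_const[of UNIV])
    fix t :: real assume t: "0 \<le> t" "t \<le> 1"
    then have "t * y \<le> y" using assms(1) by (simp add: mult_left_le_one_le)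
    moreover have ty: "0 \<le> t * y" using t assms by simp
    moreover have "- (pi / 2) \<le> t * y" using ty pi_gt_zero by linarith
    ultimately have "sin (t * y) \<le> sin y" "0 \<le> sin (t * y)"
      using assms pi_gt_zero by (auto intro!: sin_monotone_2pi_le sin_ge_zero)
    then show "sin (t * y) ^ l \<le> sin y ^ l" by (rule power_mono)
  qed (auto intro!: continuous_intros)
  then show ?thesis unfolding Isin_def using assms(1) by (intro mult_left_mono) auto
qed

lemma continuous_en: "continuous_on UNIV (\<lambda>p. en (fst p) (snd p))"
proof -
  have "continuous_on UNIV Isin" by (meson DERIV_Isin DERIV_isCont continuous_at_imp_continuous_on)
  then have "continuous_on UNIV (\<lambda>p::real\<times>real. Isin (fst p))"
    by (rule continuous_on_compose2) (auto intro!: continuous_intros)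
  then show ?thesis unfolding en_def by (intro continuous_intros)
qed

definition life :: "real \<Rightarrow> real \<Rightarrow> bool" where "life A X \<longleftrightarrow> (\<exists>y S. sol A X y S)"
text \<open>\<open>maxsol A x\<close>, and hence \<open>ys\<close>, \<open>Ss\<close> and \<open>Qs\<close>, is meaningful only if \<open>life A \<bar>x\<bar>\<close>.\<close>

definition maxsol :: "real \<Rightarrow> real \<Rightarrow> real \<times> real"
  where "maxsol A x = (let p = (SOME p. sol A \<bar>x\<bar> (fst p) (snd p)) in (fst p x, snd p x))"
definition ys :: "real \<Rightarrow> real \<Rightarrow> real" where "ys A x = fst (maxsol A x)"
definition Ss :: "real \<Rightarrow> real \<Rightarrow> real" where "Ss A x = snd (maxsol A x)"
definition Qs :: "real \<Rightarrow> real \<Rightarrow> real" where "Qs A = avg k (\<lambda>x. F2 (ys A x) (Ss A x))"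
definition En :: "real \<Rightarrow> real \<Rightarrow> real" where "En A x = en (ys A x) (Ss A x)"

text \<open>\<open>maxsol\<close> chooses a solution separately for each \<open>x\<close>;
  uniqueness makes these choices fit together into one function.\<close>

lemma sol_eq:
  assumes "sol A X y S" "\<bar>x\<bar> \<le> X" shows "ys A x = y x" "Ss A x = S x"
proof -
  have s: "sol A \<bar>x\<bar> y S" by (rule sol_subset[OF assms(1) abs_ge_zero assms(2)])
  then have "\<exists>p. sol A \<bar>x\<bar> (fst p) (snd p)" by (intro exI[of _ "(y, S)"]) simp
  from someI_ex[OF this] obtain p where p: "sol A \<bar>x\<bar> (fst p) (snd p)" "maxsol A x = (fst p x, snd p x)"
    by (simp add: maxsol_def Let_def)
  show "ys A x = y x" "Ss A x = S x"
    using sol_unique[OF s p(1) order_refl] p(2) by (simp_all add: ys_def Ss_def)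
qed

lemma life_sol: assumes "life A X" shows "sol A X (ys A) (Ss A)"
proof -
  obtain y S where s: "sol A X y S" using assms by (auto simp: life_def)
  show ?thesis by (rule sol_cong[OF s]) (use sol_eq[OF s] in auto)
qed

lemma life_ge_0: "life A X \<Longrightarrow> X \<ge> 0" by (auto simp: life_def sol_def)

lemma life_le: "life A X \<Longrightarrow> 0 \<le> X' \<Longrightarrow> X' \<le> X \<Longrightarrow> life A X'"
  by (auto simp: life_def intro: sol_subset)

lemma life_0: assumes "0 < A" "A < pi" shows "life A 0"
  unfolding life_def by (rule exI[of _ "\<lambda>_. A"], rule exI[of _ "\<lambda>_. 0"]) (use assms in \<open>simp add: sol_def\<close>)

lemma at_0: assumes "life A 0" shows "ys A 0 = A" "Ss A 0 = 0"
  using solD(7,8)[OF life_sol[OF assms], of 0] by auto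

lemma ranges:
  assumes "life A \<bar>x\<bar>" shows "0 < ys A x" "ys A x < pi" "\<bar>Ss A x\<bar> < 1" "0 < sin (ys A x)"
    "0 < sqrt (1 - (Ss A x)\<^sup>2)" "sqrt (1 - (Ss A x)\<^sup>2) \<le> 1" "sqrt (1 - (Ss A x)\<^sup>2) ^ 2 = 1 - (Ss A x)\<^sup>2"
proof -
  note d = solD(4-6)[OF life_sol[OF assms] order_refl]
  show "0 < ys A x" "ys A x < pi" "\<bar>Ss A x\<bar> < 1" using d by auto
  then show "0 < sin (ys A x)" by (intro sin_gt_zero)
  have "1 - (Ss A x)\<^sup>2 > 0" using d(3) by (rule one_minus_square_pos)
  then show "0 < sqrt (1 - (Ss A x)\<^sup>2)" "sqrt (1 - (Ss A x)\<^sup>2) \<le> 1" "sqrt (1 - (Ss A x)\<^sup>2) ^ 2 = 1 - (Ss A x)\<^sup>2"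
    by auto
qed

lemma parity: assumes "life A \<bar>x\<bar>" shows "ys A (- x) = ys A x" "Ss A (- x) = - Ss A x"
  using sol_even[OF life_sol[OF assms] order_refl] by auto

lemma Ss_eq: assumes "life A \<bar>x\<bar>" shows "Ss A x = x * Qs A x"
  using solD(8)[OF life_sol[OF assms] order_refl] by (simp add: Qs_def)

lemma Qs_even: assumes "life A \<bar>x\<bar>" shows "Qs A (- x) = Qs A x"
proof (cases "x = 0")
  case False
  have "life A \<bar>- x\<bar>" using assms by simp
  then have "- x * Qs A (- x) = - (x * Qs A x)" using parity(2)[OF assms] Ss_eq[OF assms] Ss_eq[of A "- x"] by simp
  then show ?thesis using False by simp
qed simp

lemma continuous_F2:
  assumes "life A X" shows "continuous_on {-X..X} (\<lambda>x. F2 (ys A x) (Ss A x))"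
proof -
  have s: "sin (ys A x) \<noteq> 0" if "x \<in> {-X..X}" for x
  proof -
    have "\<bar>x\<bar> \<le> X" using that by auto
    then show ?thesis using ranges(4)[OF life_le[OF assms], of x] by auto
  qed
  have c: "continuous_on {-X..X} (\<lambda>x. cos (ys A x) / sin (ys A x))"
    using s solD(2)[OF life_sol[OF assms]] by (intro continuous_intros) auto
  then show ?thesis
    unfolding F2_def cot_def using solD(3)[OF life_sol[OF assms]]
    by (intro continuous_on_diff continuous_on_mult c continuous_on_const continuous_on_real_sqrt continuous_on_power)
qed

lemma continuous_F1:
  assumes "life A X" shows "continuous_on {-X..X} (\<lambda>x. F1 (Ss A x))"
proof -
  have "sqrt (1 - (Ss A x)\<^sup>2) \<noteq> 0" if "x \<in> {-X..X}" for x
  proof -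
    have "\<bar>x\<bar> \<le> X" using that by auto
    then show ?thesis using ranges(5)[OF life_le[OF assms], of x] by auto
  qed
  then show ?thesis
    unfolding F1_def using solD(3)[OF life_sol[OF assms]] by (intro continuous_intros) auto
qed

text \<open>\<open>DERIV_mult_avg\<close> turns the integral equations back into differential ones.
  The singular term appears as \<open>k * Qs A x\<close>, which is \<open>k S / x\<close> off the
  axis and still meaningful at \<open>x = 0\<close>.\<close>

lemma DERIV_ys_Ss:
  assumes "life A X" "\<bar>x\<bar> < X"
  shows "(ys A has_real_derivative F1 (Ss A x)) (at x)"
    "(Ss A has_real_derivative F2 (ys A x) (Ss A x) - real k * Qs A x) (at x)"
proof -
  let ?U = "{-X<..<X}"
  have x: "x \<in> ?U" using assms(2) by auto
  have U: "convex ?U" "0 \<in> ?U" "open ?U" using assms(2) by (auto simp: convex_real_interval)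
  have sub: "?U \<subseteq> {-X..X}" by auto
  have ev: "\<forall>\<^sub>F z in nhds x. z \<in> ?U" by (rule eventually_nhds_in_open[OF U(3) x])
  have lz: "life A \<bar>z\<bar>" if "z \<in> ?U" for z by (rule life_le[OF assms(1)]) (use that in auto)
  have "((\<lambda>x. A + x * avg 0 (\<lambda>x. F1 (Ss A x)) x) has_real_derivative
     0 + (F1 (Ss A x) - real 0 * avg 0 (\<lambda>x. F1 (Ss A x)) x)) (at x)"
    by (rule DERIV_add[OF DERIV_const DERIV_mult_avg[OF U continuous_on_subset[OF continuous_F1[OF assms(1)] sub] x]])
  then have d1: "((\<lambda>x. A + x * avg 0 (\<lambda>x. F1 (Ss A x)) x) has_real_derivative F1 (Ss A x)) (at x)" by simp
  have e1: "\<forall>\<^sub>F z in nhds x. A + z * avg 0 (\<lambda>x. F1 (Ss A x)) z = ys A z"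
    using ev by (rule eventually_mono) (use solD(7)[OF life_sol[OF lz] order_refl] in auto)
  show "(ys A has_real_derivative F1 (Ss A x)) (at x)"
    by (rule DERIV_cong_ev[OF refl e1 refl, THEN iffD1, OF d1])
  have d2: "((\<lambda>x. x * Qs A x) has_real_derivative F2 (ys A x) (Ss A x) - real k * Qs A x) (at x)"
    unfolding Qs_def by (rule DERIV_mult_avg[OF U continuous_on_subset[OF continuous_F2[OF assms(1)] sub] x])
  have e2: "\<forall>\<^sub>F z in nhds x. z * Qs A z = Ss A z"
    using ev by (rule eventually_mono) (use Ss_eq[OF lz] in auto)
  show "(Ss A has_real_derivative F2 (ys A x) (Ss A x) - real k * Qs A x) (at x)"
    by (rule DERIV_cong_ev[OF refl e2 refl, THEN iffD1, OF d2])
qed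

text \<open>\<open>C = sqrt (1 - S\<^sup>2)\<close> is \<open>cos \<sigma>\<close>. Its derivative
  is \<open>- F1 S * S'\<close>, so it falls exactly as fast as \<open>S\<close> turns towards
  \<open>- 1\<close>; the barrier arguments near a vertical end rest on this.\<close>

lemma DERIV_C:
  assumes "life A X" "\<bar>x\<bar> < X"
  shows "((\<lambda>x. sqrt (1 - (Ss A x)\<^sup>2)) has_real_derivative
    - F1 (Ss A x) * (F2 (ys A x) (Ss A x) - real k * Qs A x)) (at x)"
proof -
  have "life A \<bar>x\<bar>" by (rule life_le[OF assms(1)]) (use assms(2) in auto)
  from DERIV_chain2[OF DERIV_sqrt_one_minus_square[OF ranges(3)[OF this]] DERIV_ys_Ss(2)[OF assms]]
  show ?thesis by (simp add: F1_def)
qed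

lemma DERIV_En:
  assumes "life A X" "\<bar>x\<bar> < X"
  shows "(En A has_real_derivative real k * sin (ys A x) ^ l * F1 (Ss A x) * Qs A x) (at x)"
proof -
  have lx: "life A \<bar>x\<bar>" by (rule life_le[OF assms(1)]) (use assms(2) in auto)
  note r = ranges[OF lx]
  let ?y = "ys A x" and ?S = "Ss A x" and ?C = "sqrt (1 - (Ss A x)\<^sup>2)"
  have "(En A has_real_derivative
      real l * sin ?y ^ (l - 1) * (cos ?y * F1 ?S) * ?C + (- F1 ?S * (F2 ?y ?S - real k * Qs A x)) * sin ?y ^ l
      - h * (sin ?y ^ l * F1 ?S)) (at x)"
    unfolding En_def[abs_def] en_def
    by (rule derivative_eq_intros DERIV_C[OF assms] DERIV_chain2[OF DERIV_Isin] DERIV_ys_Ss[OF assms] refl)+ simp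
  moreover have "real l * sin ?y ^ (l - 1) * (cos ?y * F1 ?S) * ?C + (- F1 ?S * (F2 ?y ?S - real k * Qs A x)) * sin ?y ^ l
      - h * (sin ?y ^ l * F1 ?S) = real k * sin ?y ^ l * F1 ?S * Qs A x"
  proof -
    have "sin ?y ^ l = sin ?y * sin ?y ^ (l - 1)" using l by (cases l) auto
    moreover have "F2 ?y ?S * sin ?y = real l * cos ?y * ?C - h * sin ?y"
      using r(4) by (simp add: F2_def cot_def field_simps)
    then have "(F2 ?y ?S * sin ?y) * (F1 ?S * sin ?y ^ (l - 1)) = (real l * cos ?y * ?C - h * sin ?y) * (F1 ?S * sin ?y ^ (l - 1))"
      by simp
    ultimately show ?thesis by (simp add: algebra_simps)
  qed
  ultimately show ?thesis by simp
qed

text \<open>Inserting \<open>S = x * Q\<close> into the derivative of the energy leaves a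
  nonnegative factor times \<open>x * Q\<^sup>2 / C\<close>.\<close>

lemma En_mono:
  assumes "life A b" "0 \<le> a" "a \<le> b" shows "En A a \<le> En A b"
proof (cases "a = b")
  case False
  show ?thesis
  proof (rule DERIV_nonneg_imp_increasing_open[of a b "En A"])
    show "a \<le> b" by fact
    fix x assume x: "a < x" "x < b"
    have lx: "life A \<bar>x\<bar>" by (rule life_le[OF assms(1)]) (use x assms in auto)
    have "F1 (Ss A x) * Qs A x = x * (Qs A x)\<^sup>2 / sqrt (1 - (Ss A x)\<^sup>2)"
      unfolding F1_def by (subst (1) Ss_eq[OF lx]) (simp add: power2_eq_square)
    also have "\<dots> \<ge> 0" using x assms ranges(5)[OF lx] by (intro divide_nonneg_pos mult_nonneg_nonneg) auto
    finally have p: "0 \<le> F1 (Ss A x) * Qs A x" .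
    have "0 \<le> real k * sin (ys A x) ^ l" using ranges(4)[OF lx] by simp
    from mult_nonneg_nonneg[OF this p] have "0 \<le> real k * sin (ys A x) ^ l * F1 (Ss A x) * Qs A x" by (simp add: mult.assoc)
    then show "\<exists>D. (En A has_real_derivative D) (at x) \<and> 0 \<le> D"
      using DERIV_En[OF assms(1), of x] x assms(2) by auto
  next
    have "continuous_on {a..b} (\<lambda>x. (ys A x, Ss A x))"
      by (rule continuous_on_subset[OF continuous_on_Pair[OF solD(2,3)[OF life_sol[OF assms(1)]]]]) (use assms in auto)
    from continuous_on_compose2[OF continuous_en this]
    show "continuous_on {a..b} (En A)" by (simp add: En_def[abs_def])
  qed
qed simp

text \<open>For \<open>cos y \<le> 0\<close> even \<open>F2 \<le> - h\<close> holds. Otherwise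
  nonpositive energy says \<open>sin y ^ l * C \<le> h * Isin y\<close>; multiplied by
  \<open>(l + 1) * cos y\<close> and combined with \<open>cos_Isin_le\<close> it gives
  \<open>cot y * C \<le> h / (l + 1)\<close>. Taken \<open>l\<close> times, this leaves
  \<open>h / (l + 1)\<close> of the term \<open>h\<close> uncompensated.\<close>

lemma F2_le_of_En:
  assumes "life A \<bar>x\<bar>" "En A x \<le> 0" shows "F2 (ys A x) (Ss A x) \<le> - (h / (real l + 1))"
proof -
  note r = ranges[OF assms(1)]
  let ?y = "ys A x" and ?C = "sqrt (1 - (Ss A x)\<^sup>2)"
  have hl: "h / (real l + 1) \<le> h" using h by (simp add: divide_le_eq algebra_simps)
  show ?thesis
  proof (cases "cos ?y \<le> 0")
    case True
    then have "cot ?y \<le> 0" unfolding cot_def using r(4) by (simp add: divide_nonpos_pos)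
    then have "real l * cot ?y \<le> 0" by (intro mult_nonneg_nonpos) auto
    then have "real l * cot ?y * ?C \<le> 0" using mult_nonpos_nonneg[of "real l * cot ?y" ?C] r(5) by simp
    then show ?thesis using hl by (simp add: F2_def)
  next
    case False
    have "sin ?y ^ l * ?C \<le> h * Isin ?y" using assms(2) by (simp add: En_def en_def)
    then have "cos ?y * (sin ?y ^ l * ?C) \<le> cos ?y * (h * Isin ?y)" by (rule mult_left_mono) (use False in auto)
    then have "(real l + 1) * (cos ?y * (sin ?y ^ l * ?C)) \<le> (real l + 1) * (cos ?y * (h * Isin ?y))"
      by (rule mult_left_mono) auto
    also have "\<dots> = h * ((real l + 1) * cos ?y * Isin ?y)" by simp
    also have "\<dots> \<le> h * sin ?y ^ (l + 1)" using h r by (intro mult_left_mono cos_Isin_le) auto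
    finally have "sin ?y ^ l * ((real l + 1) * (cos ?y * ?C)) \<le> sin ?y ^ l * (h * sin ?y)" by (simp add: mult_ac)
    then have "(real l + 1) * (cos ?y * ?C) \<le> h * sin ?y"
      using r(4) by (simp add: mult_le_cancel_left_pos del: mult_le_cancel_left)
    then have "cot ?y * ?C \<le> h / (real l + 1)"
      unfolding cot_def using r(4) by (simp add: field_simps)
    then have "real l * (cot ?y * ?C) \<le> real l * (h / (real l + 1))" by (intro mult_left_mono) auto
    also have "\<dots> = h - h / (real l + 1)" by (simp add: field_simps)
    finally show ?thesis by (simp add: F2_def mult.assoc)
  qed
qed

text \<open>Monotonicity carries nonpositive energy back from \<open>X\<close> to all of
  \<open>[0, X]\<close>, so the bound on \<open>F2\<close> holds on the whole segment over which
  \<open>Qs\<close> averages; the weight \<open>t ^ k\<close> contributes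
  \<open>1 / (k + 1)\<close>.\<close>

lemma Ss_le_of_En:
  assumes "life A X" "En A X \<le> 0" shows "Ss A X \<le> - (h / ((real l + 1) * (real k + 1))) * X"
proof -
  have X: "X \<ge> 0" by (rule life_ge_0[OF assms(1)])
  have "Qs A X \<le> - (h / (real l + 1)) / (real k + 1)"
    unfolding Qs_def
  proof (rule avg_le_const[of "{-X..X}"])
    fix t :: real assume t: "0 \<le> t" "t \<le> 1"
    then have tx: "0 \<le> t * X" "t * X \<le> X" using X by (auto simp: mult_left_le_one_le)
    have "life A \<bar>t * X\<bar>" by (rule life_le[OF assms(1)]) (use tx in auto)
    then show "F2 (ys A (t * X)) (Ss A (t * X)) \<le> - (h / (real l + 1))"
      by (rule F2_le_of_En) (use En_mono[OF assms(1) tx] assms(2) in simp)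
  qed (use continuous_F2[OF assms(1)] X in \<open>auto simp: convex_real_interval\<close>)
  then have "X * Qs A X \<le> X * (- (h / (real l + 1)) / (real k + 1))" using X by (intro mult_left_mono)
  moreover have "Ss A X = X * Qs A X" using Ss_eq[of A X] assms(1) X by simp
  ultimately show ?thesis by (simp add: field_simps)
qed

text \<open>Positive energy is a certificate of infinite life: it survives small changes of
  \<open>A\<close> and, once attained, persists along the profile.\<close>

definition good :: "real \<Rightarrow> bool" where "good A \<longleftrightarrow> (\<exists>X. life A X \<and> En A X > 0)"

lemma good_open:
  assumes "good A" obtains \<delta> where "\<delta> > 0" "\<And>A'. \<bar>A' - A\<bar> < \<delta> \<Longrightarrow> good A'"
proof -
  obtain X where X: "life A X" "En A X > 0" using assms by (auto simp: good_def)
  have X0: "X \<ge> 0" by (rule life_ge_0[OF X(1)])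
  have "open {p. 0 < en (fst p) (snd p)}"
    by (rule open_Collect_less[OF continuous_on_const continuous_en])
  moreover have "(ys A X, Ss A X) \<in> {p. 0 < en (fst p) (snd p)}" using X(2) by (simp add: En_def)
  ultimately obtain e where e: "e > 0" "\<And>p. dist p (ys A X, Ss A X) < e \<Longrightarrow> en (fst p) (snd p) > 0"
    unfolding open_dist by (metis (mono_tags, lifting) mem_Collect_eq)
  have e2: "e / 2 > 0" using e(1) by simp
  obtain \<delta> where \<delta>: "\<delta> > 0" "\<And>A'. \<bar>A' - A\<bar> < \<delta> \<Longrightarrow> \<exists>y' S'. sol A' X y' S' \<and>
      (\<forall>x. \<bar>x\<bar> \<le> X \<longrightarrow> \<bar>y' x - ys A x\<bar> < e / 2 \<and> \<bar>S' x - Ss A x\<bar> < e / 2)"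
    by (rule sol_near[OF life_sol[OF X(1)] e2], rule that)
  show ?thesis
  proof (rule that[OF \<delta>(1)])
    fix A' assume "\<bar>A' - A\<bar> < \<delta>"
    then obtain y' S' where s: "sol A' X y' S'" "\<bar>y' X - ys A X\<bar> < e / 2" "\<bar>S' X - Ss A X\<bar> < e / 2"
      using \<delta>(2) X0 by force
    have "dist (y' X, S' X) (ys A X, Ss A X) \<le> \<bar>y' X - ys A X\<bar> + \<bar>S' X - Ss A X\<bar>"
      using norm_Pair_le[of "y' X - ys A X" "S' X - Ss A X"] by (simp add: dist_norm)
    then have "en (y' X) (S' X) > 0" using e(2)[of "(y' X, S' X)"] s by simp
    then have "En A' X > 0" using sol_eq[OF s(1), of X] X0 by (simp add: En_def)
    then show "good A'" using s(1) by (auto simp: good_def life_def)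
  qed
qed

text \<open>Both factors of \<open>sin y ^ l * C\<close> are at most \<open>1\<close>, so each is at
  least \<open>e\<close>; then \<open>sin y \<le> y\<close> and \<open>sin y \<le> pi - y\<close>
  convert this into distance from the poles.\<close>

lemma En_bounds:
  assumes "life A \<bar>x\<bar>" "e \<le> En A x" "e > 0"
  shows "e \<le> ys A x" "ys A x \<le> pi - e" "e \<le> sqrt (1 - (Ss A x)\<^sup>2)" "e \<le> 1"
proof -
  note r = ranges[OF assms(1)]
  let ?y = "ys A x" and ?C = "sqrt (1 - (Ss A x)\<^sup>2)"
  have "0 \<le> h * Isin ?y" using h r by (intro mult_nonneg_nonneg Isin_nonneg) auto
  then have e: "e \<le> sin ?y ^ l * ?C" using assms(2) by (simp add: En_def en_def)
  have s1: "sin ?y ^ l \<le> 1" using r(4) by (intro power_le_one) auto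
  have "sin ?y ^ l * ?C \<le> 1 * ?C" using s1 r(5) by (intro mult_right_mono) auto
  then show c: "e \<le> ?C" using e by simp
  show "e \<le> 1" using c r(6) by (rule order_trans)
  have "sin ?y ^ l * ?C \<le> sin ?y ^ l * 1" using r(4,6) by (intro mult_left_mono) auto
  also have "\<dots> \<le> sin ?y" using power_decreasing[of 1 l "sin ?y"] l r(4) by simp
  finally have "e \<le> sin ?y" using e by simp
  moreover have "sin ?y \<le> ?y" using r by (intro sin_x_le_x) auto
  moreover have "sin (pi - ?y) \<le> pi - ?y" using r by (intro sin_x_le_x) auto
  ultimately show "e \<le> ?y" "?y \<le> pi - e" by auto
qed

text \<open>Positive energy bounds both \<open>sin y\<close> and \<open>sqrt (1 - S\<^sup>2)\<close> away from \<open>0\<close>.\<close>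

lemma good_life: assumes "good A" "X \<ge> 0" shows "life A X"
proof -
  obtain X0 where X0: "life A X0" "En A X0 > 0" using assms by (auto simp: good_def)
  define e where "e = En A X0"
  have X0p: "X0 \<ge> 0" by (rule life_ge_0[OF X0(1)])
  show ?thesis
  proof (rule ccontr)
    assume "\<not> life A X"
    then have le: "Z \<le> X" if "life A Z" for Z using life_le[OF that assms(2)] by force
    define R where "R = Sup {Z. life A Z}"
    have bdd: "bdd_above {Z. life A Z}" using le by (auto simp: bdd_above_def)
    have R: "Z \<le> R" if "life A Z" for Z unfolding R_def by (rule cSup_upper) (use that bdd in auto)
    have lR: "life A Z" if ZR: "0 \<le> Z" "Z < R" for Z
    proof -
      have "\<exists>Z'\<in>{Z. life A Z}. Z < Z'"
        using ZR(2) less_cSup_iff[OF _ bdd, of Z] X0(1) unfolding R_def by blast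
      then obtain Z' where "life A Z'" "Z < Z'" by blast
      then show ?thesis using life_le ZR(1) by force
    qed
    obtain d where d: "0 < d" "d \<le> 1 / 2" "\<And>x. \<bar>x\<bar> \<le> X0 \<Longrightarrow> (ys A x, Ss A x) \<in> box d"
      by (rule sol_box[OF life_sol[OF X0(1)]], rule that)
    \<comment> \<open>\<open>sqrt (1 - S\<^sup>2) \<ge> e\<close> amounts to
      \<open>|S| \<le> 1 - c\<close>.\<close>
    define c where "c = 1 - sqrt (1 - e\<^sup>2)"
    have e: "0 < e" "e \<le> 1" using X0 En_bounds(4)[of A X0 e] X0p by (auto simp: e_def)
    have "0 < e\<^sup>2" "e\<^sup>2 \<le> 1" using e by (auto simp: power_le_one)
    then have c: "0 < c" by (simp add: c_def)
    define d' where "d' = min d (min e c)"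
    have d': "0 < d'" "d' \<le> 1/2" "d' \<le> d" "d' \<le> e" "d' \<le> c" using d e c by (auto simp: d'_def)
    \<comment> \<open>One box for the whole life: up to \<open>X0\<close> by compactness, beyond it
      by the energy.\<close>
    have box: "(ys A x, Ss A x) \<in> box d'" if "life A \<bar>x\<bar>" for x
    proof (cases "\<bar>x\<bar> \<le> X0")
      case True then show ?thesis using box_mono[OF d(3) d'(3)] by blast
    next
      case False
      then have "e \<le> En A \<bar>x\<bar>" unfolding e_def using X0p by (intro En_mono[OF that]) auto
      also have "En A \<bar>x\<bar> = En A x" using parity[OF that] by (auto simp: En_def en_def abs_if)
      finally have E: "e \<le> En A x" .
      note b = En_bounds[OF that E e(1)] and r = ranges[OF that]
      have "e\<^sup>2 \<le> 1 - (Ss A x)\<^sup>2" using power_mono[OF b(3), of 2] e r(7) by simp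
      then have "\<bar>Ss A x\<bar> \<le> sqrt (1 - e\<^sup>2)" by (intro real_le_rsqrt) simp
      then show ?thesis using b d' unfolding box_def c_def by auto
    qed
    have "R \<ge> 0" using R[OF X0(1)] X0p by simp
    have b0: "(A, 0) \<in> box d'" using box[of 0] at_0 life_le[OF X0(1) order_refl X0p] by simp
    have ex: "\<exists>y S. sol A Z y S \<and> (\<forall>x. \<bar>x\<bar> \<le> Z \<longrightarrow> (y x, S x) \<in> box d')" if "0 \<le> Z" "Z < R" for Z
    proof (intro exI conjI allI impI)
      show "sol A Z (ys A) (Ss A)" by (rule life_sol[OF lR[OF that]])
      show "(ys A x, Ss A x) \<in> box d'" if "\<bar>x\<bar> \<le> Z" for x
        by (rule box, rule life_le[OF lR[OF \<open>0 \<le> Z\<close> \<open>Z < R\<close>]]) (use that in auto)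
    qed
    show False
    proof (rule sol_extend[OF \<open>R \<ge> 0\<close> d'(1,2) b0 ex])
      show False if "Z > R" "sol A Z y S" for Z y S
        using that R[of Z] by (auto simp: life_def)
    qed
  qed
qed

end

section \<open>The threshold height and the end of the critical profile\<close>

lemma antimono_tendsto_left:
  fixes f :: "real \<Rightarrow> real"
  assumes "a < R" and anti: "\<And>x y. a \<le> x \<Longrightarrow> x \<le> y \<Longrightarrow> y < R \<Longrightarrow> f y \<le> f x"
    and B: "\<And>x. a \<le> x \<Longrightarrow> x < R \<Longrightarrow> B \<le> f x"
  obtains L where "(f \<longlongrightarrow> L) (at_left R)" "\<And>x. a \<le> x \<Longrightarrow> x < R \<Longrightarrow> L \<le> f x" "B \<le> L"
proof -
  define L where "L = Inf (f ` {a..<R})"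
  have ne: "f ` {a..<R} \<noteq> {}" using assms(1) by auto
  have bdd: "bdd_below (f ` {a..<R})" unfolding bdd_below_def using B by (intro exI[of _ B]) auto
  have le: "L \<le> f x" if "a \<le> x" "x < R" for x
    unfolding L_def by (rule cInf_lower[OF _ bdd]) (use that in auto)
  have "B \<le> L" unfolding L_def by (rule cInf_greatest[OF ne]) (use B in auto)
  have "(f \<longlongrightarrow> L) (at_left R)"
  proof (rule order_tendstoI)
    fix c assume "c < L"
    show "\<forall>\<^sub>F x in at_left R. c < f x"
      unfolding eventually_at_left_field
      using assms(1) le \<open>c < L\<close> by (meson less_le_trans less_imp_le)
  next
    fix c assume "L < c"
    then obtain z where z: "z \<in> f ` {a..<R}" "z < c"
      using cInf_less_iff[OF ne bdd, of c] unfolding L_def by blast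
    then obtain x0 where x0: "a \<le> x0" "x0 < R" "f x0 < c" by auto
    show "\<forall>\<^sub>F x in at_left R. f x < c"
      unfolding eventually_at_left_field
      using x0 anti by (meson le_less_trans less_imp_le)
  qed
  then show ?thesis using that le \<open>B \<le> L\<close> by blast
qed

lemma ev_left: fixes a R :: real shows "a < R \<Longrightarrow> \<forall>\<^sub>F x in at_left R. a < x \<and> x < R"
  unfolding eventually_at_left_field by auto

context cmc
begin

lemma F1_sign: "\<bar>S\<bar> < 1 \<Longrightarrow> S < 0 \<Longrightarrow> F1 S < 0" "\<bar>S\<bar> < 1 \<Longrightarrow> S \<le> 0 \<Longrightarrow> F1 S \<le> 0"
  unfolding F1_def using one_minus_square_pos[of S]
  by (auto intro!: divide_neg_pos divide_nonpos_pos)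


lemma DERIV_en_0: "((\<lambda>A. en A 0) has_real_derivative real l * (sin A ^ (l - 1) * cos A) - h * sin A ^ l) (at A)"
  unfolding en_def by (auto intro!: derivative_eq_intros DERIV_Isin)

lemma continuous_en_0: "continuous_on U (\<lambda>A. en A 0)"
  by (rule continuous_at_imp_continuous_on) (intro ballI DERIV_isCont[OF DERIV_en_0])

text \<open>The derivative of \<open>en A 0\<close> in \<open>A\<close> is
  \<open>sin A ^ (l - 1) * (l * cos A - h * sin A)\<close>, which is positive as long as
  \<open>cot A > h / l\<close>, that is, below \<open>xh\<close>.\<close>

lemma en_0_pos:
  assumes "0 < xh" "xh < pi" "cot xh = h / real l" "0 < A" "A \<le> xh" shows "0 < en A 0"
proof -
  have sx: "sin xh > 0" using assms by (intro sin_gt_zero)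
  have lp: "real l > 0" using l by simp
  have hx: "h * sin xh = real l * cos xh"
    using assms(3) sx lp by (simp add: cot_def field_simps)
  have "en 0 0 < en A 0"
  proof (rule DERIV_pos_imp_increasing_open[OF assms(4)])
    fix z assume z: "0 < z" "z < A"
    have sz: "sin z > 0" using z assms by (intro sin_gt_zero) auto
    have "sin xh * (real l * cos z - h * sin z) = real l * (cos z * sin xh) - sin z * (h * sin xh)"
      by (simp add: algebra_simps)
    also have "\<dots> = real l * sin (xh - z)" unfolding hx by (simp add: sin_diff algebra_simps)
    also have "\<dots> > 0" using lp z assms by (intro mult_pos_pos sin_gt_zero) auto
    finally have "real l * cos z - h * sin z > 0" using sx by (simp add: zero_less_mult_iff)
    then have "0 < sin z ^ (l - 1) * (real l * cos z - h * sin z)" using sz by simp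
    also have "\<dots> = real l * (sin z ^ (l - 1) * cos z) - h * (sin z * sin z ^ (l - 1))" by (simp add: algebra_simps)
    also have "sin z * sin z ^ (l - 1) = sin z ^ l" using l by (cases l) auto
    finally show "\<exists>D. ((\<lambda>A. en A 0) has_real_derivative D) (at z) \<and> 0 < D"
      using DERIV_en_0 by blast
  next
    show "continuous_on {0..A} (\<lambda>A. en A 0)" by (rule continuous_en_0)
  qed
  moreover have "en 0 0 = 0" using l by (simp add: en_def)
  ultimately show ?thesis by simp
qed

lemma good_start: assumes "0 < A" "A < pi" "0 < en A 0" shows "good A"
  unfolding good_def
  by (rule exI[of _ 0]) (use life_0[OF assms(1,2)] at_0[OF life_0[OF assms(1,2)]] assms(3) in \<open>simp add: En_def\<close>)

lemma threshold:
  assumes "0 < xh" "xh < pi" "cot xh = h / real l"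
  obtains b where "xh < b" "b \<le> pi" "\<And>A. 0 < A \<Longrightarrow> A < b \<Longrightarrow> good A" "b < pi \<Longrightarrow> \<not> good b"
proof -
  define BB where "BB = {B. B \<le> pi \<and> (\<forall>A. 0 < A \<and> A < B \<longrightarrow> good A)}"
  have bdd: "bdd_above BB" by (auto simp: BB_def bdd_above_def)
  have "open {A. 0 < en A 0}" by (rule open_Collect_less[OF continuous_on_const continuous_en_0])
  moreover have "xh \<in> {A. 0 < en A 0}" using en_0_pos[OF assms assms(1)] by simp
  ultimately obtain e where e: "e > 0" "\<And>A. dist A xh < e \<Longrightarrow> 0 < en A 0"
    unfolding open_dist by (metis (mono_tags, lifting) mem_Collect_eq)
  \<comment> \<open>Openness of the condition \<open>0 < en A 0\<close> at \<open>xh\<close> itself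
    is what makes the inequality \<open>xh < b\<close> strict.\<close>
  define B0 where "B0 = min (xh + e) pi"
  have "good A" if "0 < A" "A < B0" for A
  proof (rule good_start[OF that(1)])
    show "A < pi" using that by (simp add: B0_def)
    show "0 < en A 0"
    proof (cases "A \<le> xh")
      case True then show ?thesis using en_0_pos[OF assms that(1)] by simp
    next
      case False then show ?thesis using e(2)[of A] that by (simp add: B0_def dist_real_def)
    qed
  qed
  then have B0: "B0 \<in> BB" by (auto simp: BB_def B0_def)
  then have ne: "BB \<noteq> {}" by auto
  define b where "b = Sup BB"
  have "B0 \<le> b" unfolding b_def by (rule cSup_upper[OF B0 bdd])
  then have xb: "xh < b" using e(1) assms(2) by (auto simp: B0_def)
  have bpi: "b \<le> pi" unfolding b_def by (rule cSup_least[OF ne]) (simp add: BB_def)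
  have gd: "good A" if "0 < A" "A < b" for A
  proof -
    have "\<exists>B\<in>BB. A < B" using less_cSup_iff[OF ne bdd, of A] that(2) unfolding b_def by blast
    then show ?thesis using that(1) by (auto simp: BB_def)
  qed
  have "\<not> good b" if "b < pi"
  proof
    assume gb: "good b"
    obtain \<delta> where \<delta>: "\<delta> > 0" "\<And>A'. \<bar>A' - b\<bar> < \<delta> \<Longrightarrow> good A'"
      by (rule good_open[OF gb], rule that)
    define B where "B = min (b + \<delta> / 2) pi"
    have "good A" if "0 < A" "A < B" for A
    proof (cases "A < b")
      case False
      then have "\<bar>A - b\<bar> < \<delta>" using that(2) \<delta>(1) by (simp add: B_def)
      then show ?thesis by (rule \<delta>(2))
    qed (use gd that in auto)
    then have "B \<in> BB" by (auto simp: BB_def B_def)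
    then have "B \<le> b" unfolding b_def by (rule cSup_upper[OF _ bdd])
    then show False using \<delta>(1) that by (auto simp: B_def)
  qed
  then show ?thesis using that xb bpi gd by blast
qed

definition critical :: "real \<Rightarrow> real \<Rightarrow> bool"
  where "critical A R \<longleftrightarrow> 0 < A \<and> A < pi \<and> \<not> good A \<and> 0 < R \<and> (\<forall>X. 0 \<le> X \<longrightarrow> X < R \<longrightarrow> life A X) \<and> \<not> life A R"

text \<open>Without positive energy \<open>S\<close> lies below \<open>- (h / N) * X\<close>, while
  \<open>|S| < 1\<close>; so the life ends at \<open>N / h\<close> at the latest. Applied at both
  ends, \<open>sol_extend\<close> shows that the supremum of the lifetimes is positive and not
  attained.\<close>

lemma critical_exists:
  assumes "0 < A" "A < pi" "\<not> good A" obtains R where "critical A R"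
proof -
  define N where "N = (real l + 1) * (real k + 1)"
  have N: "N > 0" by (simp add: N_def)
  have bound: "X \<le> N / h" if "life A X" for X
  proof -
    have "En A X \<le> 0" using assms(3) that by (auto simp: good_def not_less)
    then have "Ss A X \<le> - (h / N) * X" using Ss_le_of_En[OF that] by (simp add: N_def)
    moreover have "\<bar>Ss A X\<bar> < 1" using ranges(3)[of A X] that life_ge_0[OF that] by simp
    ultimately have "h / N * X \<le> 1" by linarith
    then show ?thesis using h N by (simp add: field_simps)
  qed
  define R where "R = Sup {X. life A X}"
  have bdd: "bdd_above {X. life A X}" using bound by (auto simp: bdd_above_def)
  have up: "X \<le> R" if "life A X" for X unfolding R_def by (rule cSup_upper) (use that bdd in auto)
  have l0: "life A 0" by (rule life_0[OF assms(1,2)])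
  have "R > 0"
  proof -
    define \<epsilon> where "\<epsilon> = min (1/2) (min A (pi - A))"
    have "0 < \<epsilon>" "(A, 0) \<in> box \<epsilon>" using assms by (auto simp: \<epsilon>_def box_def)
    moreover have "\<epsilon> \<le> 1/2" unfolding \<epsilon>_def by (rule min.cobounded1)
    ultimately have \<epsilon>: "0 < \<epsilon>" "\<epsilon> \<le> 1/2" "(A, 0) \<in> box \<epsilon>" by auto
    show ?thesis
    proof (rule sol_extend[OF order_refl \<epsilon>])
      fix X y S assume "X > 0" "sol A X y S"
      moreover from this have "life A X" by (auto simp: life_def)
      ultimately show "R > 0" using up[of X] by simp
    qed auto
  qed
  moreover have lR: "life A X" if "0 \<le> X" "X < R" for X
  proof -
    have "\<exists>Z'\<in>{Z. life A Z}. X < Z'"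
      using that(2) less_cSup_iff[OF _ bdd, of X] l0 unfolding R_def by blast
    then show ?thesis using life_le that(1) by force
  qed
  moreover have "\<not> life A R"
  proof
    assume lf: "life A R"
    obtain \<epsilon> where \<epsilon>: "0 < \<epsilon>" "\<epsilon> \<le> 1/2" "\<And>x. \<bar>x\<bar> \<le> R \<Longrightarrow> (ys A x, Ss A x) \<in> box \<epsilon>"
      by (rule sol_box[OF life_sol[OF lf]], rule that)
    have b0: "(A, 0) \<in> box \<epsilon>" using \<epsilon>(3)[of 0] at_0[OF l0] \<open>R > 0\<close> by simp
    show False
    proof (rule sol_extend[OF less_imp_le[OF \<open>R > 0\<close>] \<epsilon>(1,2) b0])
      fix X assume X: "0 \<le> X" "X < R"
      show "\<exists>y S. sol A X y S \<and> (\<forall>x. \<bar>x\<bar> \<le> X \<longrightarrow> (y x, S x) \<in> box \<epsilon>)"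
        using life_sol[OF lR[OF X]] \<epsilon>(3) X by (intro exI[of _ "ys A"] exI[of _ "Ss A"]) auto
    next
      show False if "X > R" "sol A X y S" for X y S
        using up[of X] that by (auto simp: life_def)
    qed
  qed
  ultimately have "critical A R" using assms by (auto simp: critical_def)
  then show ?thesis by (rule that)
qed

context
  fixes A R :: real
  assumes crit: "critical A R"
begin

lemma crit_basic: "0 < A" "A < pi" "0 < R" "\<And>x. \<bar>x\<bar> < R \<Longrightarrow> life A \<bar>x\<bar>" "\<not> life A R"
  using crit by (auto simp: critical_def)

lemma crit_life: "0 \<le> X \<Longrightarrow> X < R \<Longrightarrow> life A X"
  using crit by (auto simp: critical_def)

lemma crit_En: assumes "0 \<le> x" "x < R" shows "En A x \<le> 0"
  using crit crit_life[OF assms] by (auto simp: critical_def good_def not_less)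

lemma crit_DERIV:
  assumes "\<bar>x\<bar> < R"
  shows "(ys A has_real_derivative F1 (Ss A x)) (at x)"
    "(Ss A has_real_derivative F2 (ys A x) (Ss A x) - real k * Qs A x) (at x)"
    "((\<lambda>x. sqrt (1 - (Ss A x)\<^sup>2)) has_real_derivative - F1 (Ss A x) * (F2 (ys A x) (Ss A x) - real k * Qs A x)) (at x)"
proof -
  have m: "\<bar>x\<bar> < (\<bar>x\<bar> + R) / 2" "(\<bar>x\<bar> + R) / 2 < R" "0 \<le> (\<bar>x\<bar> + R) / 2" using assms by auto
  note lm = crit_life[OF m(3,2)]
  show "(ys A has_real_derivative F1 (Ss A x)) (at x)"
    "(Ss A has_real_derivative F2 (ys A x) (Ss A x) - real k * Qs A x) (at x)"
    "((\<lambda>x. sqrt (1 - (Ss A x)\<^sup>2)) has_real_derivative - F1 (Ss A x) * (F2 (ys A x) (Ss A x) - real k * Qs A x)) (at x)"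
    by (rule DERIV_ys_Ss[OF lm m(1)] DERIV_C[OF lm m(1)])+
qed

lemma crit_Ss_le: assumes "0 \<le> x" "x < R" shows "Ss A x \<le> 0" "0 < x \<Longrightarrow> Ss A x < 0"
proof -
  let ?c = "h / ((real l + 1) * (real k + 1))"
  have c: "?c > 0" using h by simp
  have le: "Ss A x \<le> - (?c * x)"
    using Ss_le_of_En[OF crit_life[OF assms] crit_En[OF assms]] by (simp only: mult_minus_left)
  moreover have "0 \<le> ?c * x" by (rule mult_nonneg_nonneg[OF less_imp_le[OF c] assms(1)])
  ultimately show "Ss A x \<le> 0" by linarith
  assume "0 < x"
  with c have "?c * x > 0" by (rule mult_pos_pos)
  then show "Ss A x < 0" using le by linarith
qed

lemma crit_ys_anti: assumes "0 \<le> x" "x \<le> z" "z < R" shows "ys A z \<le> ys A x"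
proof (rule DERIV_nonpos_imp_nonincreasing[OF assms(2)])
  fix t assume "x \<le> t" "t \<le> z"
  then have t: "0 \<le> t" "t < R" "\<bar>t\<bar> < R" using assms by auto
  have "F1 (Ss A t) \<le> 0" by (rule F1_sign(2)[OF ranges(3)[OF crit_basic(4)[OF t(3)]] crit_Ss_le(1)[OF t(1,2)]])
  then show "\<exists>D. (ys A has_real_derivative D) (at t) \<and> D \<le> 0"
    using crit_DERIV(1)[OF t(3)] by blast
qed

text \<open>In the half near the pole, nonpositive energy bounds \<open>cos \<sigma>\<close> by the
  height. So a profile that tends to \<open>y = 0\<close> becomes vertical there, and
  \<open>cos \<sigma>\<close> vanishes at the pole to first order in \<open>y\<close> at
  least.\<close>

lemma crit_C_le: assumes "0 \<le> x" "x < R" "ys A x \<le> pi / 2" shows "sqrt (1 - (Ss A x)\<^sup>2) \<le> h * ys A x"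
proof -
  have lx: "life A \<bar>x\<bar>" using crit_life[OF assms(1,2)] assms(1) by simp
  note r = ranges[OF lx]
  have "sin (ys A x) ^ l * sqrt (1 - (Ss A x)\<^sup>2) \<le> h * Isin (ys A x)"
    using crit_En[OF assms(1,2)] by (simp add: En_def en_def)
  also have "\<dots> \<le> h * (ys A x * sin (ys A x) ^ l)"
    using h r Isin_le[of "ys A x"] assms(3) by (intro mult_left_mono) auto
  finally have "sin (ys A x) ^ l * sqrt (1 - (Ss A x)\<^sup>2) \<le> sin (ys A x) ^ l * (h * ys A x)"
    by (simp add: mult_ac)
  then show ?thesis using r(4) by (rule mult_left_le_imp_le[OF _ zero_less_power])
qed

definition y1 where "y1 = (THE L. (ys A \<longlongrightarrow> L) (at_left R))"

lemma crit_y1: "(ys A \<longlongrightarrow> y1) (at_left R)" "\<And>x. 0 \<le> x \<Longrightarrow> x < R \<Longrightarrow> y1 \<le> ys A x" "0 \<le> y1"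
proof -
  obtain L where L: "(ys A \<longlongrightarrow> L) (at_left R)" "\<And>x. 0 \<le> x \<Longrightarrow> x < R \<Longrightarrow> L \<le> ys A x" "0 \<le> L"
  proof (rule antimono_tendsto_left[OF crit_basic(3), of "ys A" 0])
    show "ys A y \<le> ys A x" if "0 \<le> x" "x \<le> y" "y < R" for x y by (rule crit_ys_anti[OF that])
    show "0 \<le> ys A x" if "0 \<le> x" "x < R" for x
      using ranges(1)[OF crit_basic(4), of x] that by simp
  qed (rule that)
  have "y1 = L" unfolding y1_def
    by (rule the_equality[where P="\<lambda>L. (ys A \<longlongrightarrow> L) (at_left R)"], rule L(1), rule tendsto_unique[OF _ _ L(1)]) auto
  then show "(ys A \<longlongrightarrow> y1) (at_left R)" "\<And>x. 0 \<le> x \<Longrightarrow> x < R \<Longrightarrow> y1 \<le> ys A x" "0 \<le> y1"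
    using L by auto
qed

text \<open>The sign of \<open>S'\<close> is not evident, as \<open>F2\<close> and
  \<open>- k S / x\<close> compete. But \<open>x ^ k * S\<close> has derivative
  \<open>x ^ k * F2 \<le> 0\<close>, so it is monotone, and it is bounded.\<close>

lemma crit_S1_exists: obtains S1 where "(Ss A \<longlongrightarrow> S1) (at_left R)"
proof -
  define P where "P x = x ^ k * Ss A x" for x
  have dP: "(P has_real_derivative x ^ k * F2 (ys A x) (Ss A x)) (at x)" if "\<bar>x\<bar> < R" for x
  proof -
    have "(P has_real_derivative real k * x ^ (k - 1) * Ss A x + (F2 (ys A x) (Ss A x) - real k * Qs A x) * x ^ k) (at x)"
      unfolding P_def[abs_def] using crit_DERIV(2)[OF that] by (auto intro!: derivative_eq_intros)
    moreover have "x ^ (k - 1) * Ss A x = Qs A x * x ^ k"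
      using Ss_eq[OF crit_basic(4)[OF that]] k by (cases k) auto
    ultimately show ?thesis by (simp add: algebra_simps)
  qed
  obtain L where L: "(P \<longlongrightarrow> L) (at_left R)"
  proof (rule antimono_tendsto_left[OF crit_basic(3), of P "- (R ^ k)"])
    fix x y assume xy: "0 \<le> x" "x \<le> y" "y < R"
    show "P y \<le> P x"
    proof (rule DERIV_nonpos_imp_nonincreasing[OF xy(2)])
      fix t assume "x \<le> t" "t \<le> y"
      then have t: "0 \<le> t" "t < R" "\<bar>t\<bar> < R" using xy by auto
      have "F2 (ys A t) (Ss A t) \<le> - (h / (real l + 1))"
        by (rule F2_le_of_En[OF crit_basic(4)[OF t(3)] crit_En[OF t(1,2)]])
      also have "\<dots> \<le> 0" using h by simp
      finally have "t ^ k * F2 (ys A t) (Ss A t) \<le> 0" using t(1) by (intro mult_nonneg_nonpos) auto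
      then show "\<exists>D. (P has_real_derivative D) (at t) \<and> D \<le> 0" using dP[OF t(3)] by blast
    qed
  next
    fix x assume x: "0 \<le> x" "x < R"
    have "\<bar>x ^ k * Ss A x\<bar> \<le> R ^ k * 1"
      unfolding abs_mult using x ranges(3)[OF crit_basic(4), of x]
      by (intro mult_mono) (auto simp: power_mono)
    then show "- (R ^ k) \<le> P x" by (simp add: P_def)
  qed (rule that)
  have "((\<lambda>x. P x / x ^ k) \<longlongrightarrow> L / R ^ k) (at_left R)"
    using crit_basic(3) by (intro tendsto_intros L) auto
  moreover have "\<forall>\<^sub>F x in at_left R. P x / x ^ k = Ss A x"
    using ev_left[OF crit_basic(3)] by (rule eventually_mono) (auto simp: P_def)
  ultimately have "(Ss A \<longlongrightarrow> L / R ^ k) (at_left R)" by (rule Lim_transform_eventually)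
  then show ?thesis by (rule that)
qed

text \<open>If \<open>y1 = 0\<close>, the bound of \<open>cos \<sigma>\<close> by
  \<open>h * y\<close> forces a vertical end. If \<open>y1 > 0\<close>, any other limit of
  \<open>S\<close> would keep the profile in one box up to \<open>R\<close>, and it would continue
  past \<open>R\<close>.\<close>

lemma crit_Ss_tendsto: "(Ss A \<longlongrightarrow> - 1) (at_left R)"
proof -
  obtain S1 where S1: "(Ss A \<longlongrightarrow> S1) (at_left R)" by (rule crit_S1_exists)
  have nb: "at_left R \<noteq> bot" by simp
  have S1le: "S1 \<le> 0"
  proof (rule tendsto_upperbound[OF S1 _ nb])
    show "\<forall>\<^sub>F x in at_left R. Ss A x \<le> 0"
      using ev_left[OF crit_basic(3)] by (rule eventually_mono) (use crit_Ss_le(1) in auto)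
  qed
  have S1ge: "-1 \<le> S1"
  proof (rule tendsto_lowerbound[OF S1 _ nb])
    show "\<forall>\<^sub>F x in at_left R. -1 \<le> Ss A x"
      using ev_left[OF crit_basic(3)]
    proof (rule eventually_mono)
      fix x assume "0 < x \<and> x < R"
      then show "-1 \<le> Ss A x" using ranges(3)[OF crit_basic(4), of x] by simp
    qed
  qed
  have "S1 = -1"
  proof (cases "y1 = 0")
    case True
    have "((\<lambda>x. sqrt (1 - (Ss A x)\<^sup>2)) \<longlongrightarrow> sqrt (1 - S1\<^sup>2)) (at_left R)"
      by (intro tendsto_intros S1)
    moreover have "((\<lambda>x. h * ys A x) \<longlongrightarrow> h * y1) (at_left R)" by (intro tendsto_intros crit_y1(1))
    moreover have "\<forall>\<^sub>F x in at_left R. sqrt (1 - (Ss A x)\<^sup>2) \<le> h * ys A x"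
    proof -
      have "\<forall>\<^sub>F x in at_left R. ys A x < pi / 2"
        using order_tendstoD(2)[OF crit_y1(1), of "pi / 2"] True pi_gt_zero by simp
      then show ?thesis using ev_left[OF crit_basic(3)]
        by eventually_elim (use crit_C_le in auto)
    qed
    ultimately have "sqrt (1 - S1\<^sup>2) \<le> h * y1" using tendsto_le[OF nb] by blast
    then have "1 - S1\<^sup>2 \<le> 0" using True by simp
    then have "\<not> \<bar>S1\<bar> < 1" using one_minus_square_pos[of S1] by auto
    then show ?thesis using S1le S1ge by auto
  next
    case False
    then have y1: "y1 > 0" using crit_y1(3) by simp
    show ?thesis
    proof (rule ccontr)
      assume "S1 \<noteq> -1"
      then have S1': "-1 < S1" using S1ge by simp
      \<comment> \<open>The midpoint of \<open>- 1\<close> and \<open>S1\<close>: a lower bound for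
        \<open>S\<close> close to \<open>R\<close> that still exceeds \<open>- 1\<close>.\<close>
      define s where "s = (S1 - 1) / 2"
      have s: "-1 < s" "s < S1" using S1' S1le by (auto simp: s_def)
      obtain r0 where r0: "r0 < R" "\<And>x. r0 < x \<Longrightarrow> x < R \<Longrightarrow> s < Ss A x"
        using order_tendstoD(1)[OF S1 s(2)] unfolding eventually_at_left_field by blast
      define r1 where "r1 = max 0 r0"
      have r1: "0 \<le> r1" "r1 < R" "r0 \<le> r1" using r0(1) crit_basic(3) by (auto simp: r1_def)
      obtain d where d: "0 < d" "d \<le> 1/2" "\<And>x. \<bar>x\<bar> \<le> r1 \<Longrightarrow> (ys A x, Ss A x) \<in> box d"
        by (rule sol_box[OF life_sol[OF crit_life[OF r1(1,2)]]], rule that)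
      define \<epsilon> where "\<epsilon> = min d (min (min y1 (pi - A)) (1 + s))"
      have "0 < \<epsilon>" "\<epsilon> \<le> d" "\<epsilon> \<le> y1" "\<epsilon> \<le> pi - A" "\<epsilon> \<le> 1 + s"
        using d(1) y1 crit_basic(2) s by (auto simp: \<epsilon>_def)
      with d(2) have \<epsilon>: "0 < \<epsilon>" "\<epsilon> \<le> 1/2" "\<epsilon> \<le> d" "\<epsilon> \<le> y1" "\<epsilon> \<le> pi - A" "\<epsilon> \<le> 1 + s"
        by linarith+
      have bx: "(ys A x, Ss A x) \<in> box \<epsilon>" if x: "0 \<le> x" "x < R" for x
      proof (cases "x \<le> r1")
        case True then show ?thesis using box_mono[OF d(3) \<epsilon>(3)] x by simp
      next
        case False
        have "y1 \<le> ys A x" "ys A x \<le> A" "Ss A x \<le> 0" "s < Ss A x"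
          using crit_y1(2)[OF x] crit_ys_anti[OF order_refl x] at_0(1)[OF crit_life[OF order_refl crit_basic(3)]]
            crit_Ss_le(1)[OF x] r0(2)[of x] False r1 x by auto
        then show ?thesis using \<epsilon> by (auto simp: box_def)
      qed
      have bx': "(ys A x, Ss A x) \<in> box \<epsilon>" if "\<bar>x\<bar> < R" for x
        using bx[of "\<bar>x\<bar>"] that parity[OF crit_basic(4)[OF that]] by (auto simp: box_def abs_if split: if_splits)
      have b0: "(A, 0) \<in> box \<epsilon>" using bx[of 0] crit_basic(3) at_0[OF crit_life[OF order_refl crit_basic(3)]] by simp
      show False
      proof (rule sol_extend[OF less_imp_le[OF crit_basic(3)] \<epsilon>(1,2) b0])
        fix X assume X: "0 \<le> X" "X < R"
        show "\<exists>y S. sol A X y S \<and> (\<forall>x. \<bar>x\<bar> \<le> X \<longrightarrow> (y x, S x) \<in> box \<epsilon>)"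
          using life_sol[OF crit_life[OF X]] bx' X by (intro exI[of _ "ys A"] exI[of _ "Ss A"]) auto
      next
        show False if "X > R" "sol A X y S" for X y S
          using that life_le[of A X R] crit_basic(3,5) by (auto simp: life_def)
      qed
    qed
  qed
  then show ?thesis using S1 by simp
qed

lemma crit_C_tendsto: "((\<lambda>x. sqrt (1 - (Ss A x)\<^sup>2)) \<longlongrightarrow> 0) (at_left R)"
proof -
  have "((\<lambda>x. sqrt (1 - (Ss A x)\<^sup>2)) \<longlongrightarrow> sqrt (1 - (-1)\<^sup>2)) (at_left R)"
    by (intro tendsto_intros crit_Ss_tendsto)
  then show ?thesis by simp
qed

text \<open>If \<open>h \<le> k / R\<close>, then \<open>C\<close> satisfies a linear differential inequality in terms of \<open>y\<close> and
  could not vanish at \<open>R\<close>: the vertical line \<open>x = k / h\<close> is itself a solution curve.\<close>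

lemma crit_h: "real k / R < h"
proof (rule ccontr)
  assume "\<not> real k / R < h"
  then have hk: "h \<le> real k / R" by simp
  note Rp = crit_basic(3)
  \<comment> \<open>\<open>K\<close> is such that \<open>- S' \<le> K * C\<close> on
    \<open>[R / 2, R)\<close>: the first summand takes care of \<open>cot y\<close>, the second of
    \<open>h + k S / x\<close>, where \<open>x \<ge> R / 2\<close> causes the factor
    \<open>2\<close>. Hence \<open>C * exp (- K * y)\<close> does not decrease, although
    \<open>C\<close> tends to \<open>0\<close>.\<close>
  define K where "K = real l * \<bar>cot A\<bar> + 2 * real k / R"
  define C where "C x = sqrt (1 - (Ss A x)\<^sup>2)" for x
  define f where "f x = C x * exp (- K * ys A x)" for x
  have mono: "f (R / 2) \<le> f x" if x: "R / 2 \<le> x" "x < R" for x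
  proof (rule DERIV_nonneg_imp_nondecreasing[OF x(1)])
    fix t assume t: "R / 2 \<le> t" "t \<le> x"
    then have t': "0 < t" "t < R" "\<bar>t\<bar> < R" using x Rp by auto
    note lt = crit_basic(4)[OF t'(3)]
    note r = ranges[OF lt]
    have d: "(f has_real_derivative (- F1 (Ss A t) * (F2 (ys A t) (Ss A t) - real k * Qs A t)) * exp (- K * ys A t)
        + exp (- K * ys A t) * (- K * F1 (Ss A t)) * C t) (at t)"
      unfolding f_def[abs_def] C_def
      by (rule DERIV_mult[OF crit_DERIV(3)[OF t'(3)] DERIV_fun_exp[OF DERIV_cmult[OF crit_DERIV(1)[OF t'(3)]]]])
    have Q: "real k * Qs A t = real k * Ss A t / t" using Ss_eq[OF lt] t'(1) by simp
    have F1n: "F1 (Ss A t) < 0" using F1_sign(1)[OF r(3)] crit_Ss_le(2)[of t] t' by simp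
    have "- (F2 (ys A t) (Ss A t) - real k * Qs A t) \<le> K * C t"
    proof -
      have "cot A \<le> cot (ys A t)"
        using r crit_ys_anti[of 0 t] at_0(1)[OF crit_life[OF order_refl Rp]] t' crit_basic by (intro cot_antimono) auto
      then have "- cot (ys A t) \<le> \<bar>cot A\<bar>" by linarith
      then have "real l * (- cot (ys A t)) * C t \<le> real l * \<bar>cot A\<bar> * C t"
        using r(5) by (intro mult_right_mono mult_left_mono) (auto simp: C_def)
      moreover have "h + real k * Ss A t / t \<le> 2 * real k / R * C t"
      proof -
        have "h \<le> real k / t" using hk t' k Rp by (intro order_trans[OF hk]) (auto simp: frac_le)
        then have "h + real k * Ss A t / t \<le> real k / t * (1 + Ss A t)"
          by (simp add: algebra_simps)
        also have "\<dots> \<le> (real k / (R / 2)) * C t"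
        proof (intro mult_mono)
          have "Ss A t \<le> 0" using crit_Ss_le(1)[of t] t' by simp
          have "(1 + Ss A t)\<^sup>2 \<le> (1 + Ss A t) * (1 - Ss A t)"
            unfolding power2_eq_square using r(3) \<open>Ss A t \<le> 0\<close> by (intro mult_left_mono) auto
          also have "\<dots> = 1 - (Ss A t)\<^sup>2" by (simp add: power2_eq_square algebra_simps)
          finally show "1 + Ss A t \<le> C t" unfolding C_def by (rule real_le_rsqrt)
          show "real k / t \<le> real k / (R / 2)" using t Rp by (intro divide_left_mono) auto
        qed (use r(3) Rp in auto)
        finally show ?thesis by (simp add: mult_ac)
      qed
      ultimately show ?thesis by (simp add: F2_def Q K_def C_def algebra_simps)
    qed
    then have "F1 (Ss A t) * (K * C t) \<le> F1 (Ss A t) * (- (F2 (ys A t) (Ss A t) - real k * Qs A t))"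
      using F1n by (intro mult_left_mono_neg) auto
    then have "0 \<le> - F1 (Ss A t) * (F2 (ys A t) (Ss A t) - real k * Qs A t) - K * F1 (Ss A t) * C t"
      by (simp add: algebra_simps)
    then have "0 \<le> (- F1 (Ss A t) * (F2 (ys A t) (Ss A t) - real k * Qs A t) - K * F1 (Ss A t) * C t) * exp (- K * ys A t)"
      by (rule mult_nonneg_nonneg) simp
    then show "\<exists>D. (f has_real_derivative D) (at t) \<and> 0 \<le> D"
      using d by (intro exI conjI) (auto simp: algebra_simps)
  qed
  have "(f \<longlongrightarrow> 0 * exp (- K * y1)) (at_left R)"
    unfolding f_def C_def by (intro tendsto_intros crit_C_tendsto crit_y1(1))
  moreover have "\<forall>\<^sub>F x in at_left R. f (R / 2) \<le> f x"
  proof -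
    have "R / 2 < R" using Rp by simp
    from ev_left[OF this] show ?thesis by (rule eventually_mono) (use mono in auto)
  qed
  ultimately have "f (R / 2) \<le> 0 * exp (- K * y1)"
    by (intro tendsto_lowerbound[of f _ "at_left R"]) auto
  moreover have "f (R / 2) > 0"
    unfolding f_def C_def using ranges(5)[OF crit_basic(4), of "R / 2"] Rp by simp
  ultimately show False by simp
qed

text \<open>Suppose \<open>y1 > 0\<close>.  A good profile starting close to \<open>A\<close> follows the critical one until it is almost
  vertical, with \<open>y\<close> still far from \<open>0\<close>.  There \<open>S' \<le> - d < 0\<close>, so \<open>S\<close> would have to pass below \<open>- 1\<close>.\<close>

lemma crit_y1_zero:
  assumes near: "\<And>\<delta>. \<delta> > 0 \<Longrightarrow> \<exists>A'. \<bar>A' - A\<bar> < \<delta> \<and> good A'" shows "y1 = 0"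
proof (rule ccontr)
  assume "y1 \<noteq> 0"
  then have y1: "y1 > 0" using crit_y1(3) by simp
  note Rp = crit_basic(3)
  \<comment> \<open>A third of the gap: one third is spent on the \<open>cot\<close> term, one on
    replacing \<open>k / x\<close> by \<open>k / R\<close>, and the last remains as the rate in
    \<open>S' \<le> - d\<close>.\<close>
  define d where "d = (h - real k / R) / 3"
  have d: "d > 0" using crit_h by (simp add: d_def)
  define M where "M = \<bar>cot (y1 / 2)\<bar>"
  \<comment> \<open>The first bound makes the \<open>cot\<close> term at most \<open>d\<close>; the
    second keeps the further loss of height, \<open>c / d\<close>, below
    \<open>y1 / 4\<close>.\<close>
  define c where "c = min (d / (real l * M + 1)) (d * y1 / 8)"
  have lM: "real l * M \<ge> 0" by (simp add: M_def)
  have c: "c > 0" using d y1 lM by (simp add: c_def)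
  have c1: "real l * M * c \<le> d"
  proof -
    have "real l * M * c \<le> real l * M * (d / (real l * M + 1))"
      using lM by (intro mult_left_mono) (auto simp: c_def)
    also have "\<dots> \<le> d" using lM d by (simp add: field_simps)
    finally show ?thesis .
  qed
  have "c \<le> d * y1 / 8" unfolding c_def by (rule min.cobounded2)
  then have c2: "c / d < y1 / 4" using d y1 by (simp add: field_simps) (smt (verit) mult_pos_pos)
  have "((\<lambda>x. real k / x) \<longlongrightarrow> real k / R) (at_left R)" using Rp by (intro tendsto_intros) auto
  then have "\<forall>\<^sub>F x in at_left R. real k / x < real k / R + d"
    by (rule order_tendstoD(2)) (use d in simp)
  moreover have "\<forall>\<^sub>F x in at_left R. sqrt (1 - (Ss A x)\<^sup>2) < c / 2"
    by (rule order_tendstoD(2)[OF crit_C_tendsto]) (use c in simp)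
  moreover have "\<forall>\<^sub>F x in at_left R. Ss A x < - (1 / 2)"
    by (rule order_tendstoD(2)[OF crit_Ss_tendsto]) simp
  ultimately have "\<forall>\<^sub>F x in at_left R. real k / x < real k / R + d \<and> sqrt (1 - (Ss A x)\<^sup>2) < c / 2 \<and>
      Ss A x < - (1 / 2) \<and> 0 < x \<and> x < R"
    using ev_left[OF Rp] by eventually_elim blast
  then obtain x0 where x0: "real k / x0 < real k / R + d" "sqrt (1 - (Ss A x0)\<^sup>2) < c / 2"
      "Ss A x0 < - (1 / 2)" "0 < x0" "x0 < R"
    using eventually_happens'[of "at_left R"] by auto
  have lx0: "life A x0" using crit_life x0 by simp
  \<comment> \<open>\<open>y1 / 4\<close> keeps the good profile above height
    \<open>3 * y1 / 4\<close>, \<open>1 / 2\<close> keeps its \<open>S\<close> negative, and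
    \<open>c\<^sup>2 / 4\<close> keeps its \<open>C\<close> below \<open>c\<close>, all at
    \<open>x0\<close>.\<close>
  define \<eta> where "\<eta> = min (y1 / 4) (min (1 / 2) (c\<^sup>2 / 4))"
  have \<eta>: "\<eta> > 0" "\<eta> \<le> y1 / 4" "\<eta> \<le> 1 / 2" "\<eta> \<le> c\<^sup>2 / 4"
    unfolding \<eta>_def using y1 c by (auto intro: min.coboundedI1 min.coboundedI2)
  obtain \<delta> where \<delta>: "\<delta> > 0" "\<And>A'. \<bar>A' - A\<bar> < \<delta> \<Longrightarrow> \<exists>y' S'. sol A' x0 y' S' \<and>
      (\<forall>x. \<bar>x\<bar> \<le> x0 \<longrightarrow> \<bar>y' x - ys A x\<bar> < \<eta> \<and> \<bar>S' x - Ss A x\<bar> < \<eta>)"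
    by (rule sol_near[OF life_sol[OF lx0] \<eta>(1)], rule that)
  obtain A' where A': "\<bar>A' - A\<bar> < \<delta>" "good A'" using near[OF \<delta>(1)] by blast
  obtain y' S' where s: "sol A' x0 y' S'" "\<And>x. \<bar>x\<bar> \<le> x0 \<Longrightarrow> \<bar>y' x - ys A x\<bar> < \<eta> \<and> \<bar>S' x - Ss A x\<bar> < \<eta>"
    using \<delta>(2)[OF A'(1)] by blast
  have close: "\<bar>ys A' x0 - ys A x0\<bar> < \<eta>" "\<bar>Ss A' x0 - Ss A x0\<bar> < \<eta>"
    using s(2)[of x0] sol_eq[OF s(1), of x0] x0(4) by auto
  define Y S C where "Y = ys A'" and "S = Ss A'" and "C x = sqrt (1 - (S x)\<^sup>2)" for x
  note L = good_life[OF A'(2)]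
  have r: "0 < Y x" "Y x < pi" "\<bar>S x\<bar> < 1" "0 < C x" if "x \<ge> 0" for x
    using ranges[of A' x] L[OF abs_ge_zero] by (auto simp: Y_def S_def C_def)
  have D: "(Y has_real_derivative F1 (S x)) (at x)"
    "(S has_real_derivative F2 (Y x) (S x) - real k * S x / x) (at x)"
    "(C has_real_derivative - F1 (S x) * (F2 (Y x) (S x) - real k * S x / x)) (at x)" if "x > 0" for x
  proof -
    have x1: "\<bar>x\<bar> < x + 1" "0 \<le> x + 1" using that by auto
    have "real k * Qs A' x = real k * S x / x"
      using Ss_eq[OF L[OF abs_ge_zero], of x] that by (simp add: S_def)
    then show "(Y has_real_derivative F1 (S x)) (at x)"
      "(S has_real_derivative F2 (Y x) (S x) - real k * S x / x) (at x)"
      "(C has_real_derivative - F1 (S x) * (F2 (Y x) (S x) - real k * S x / x)) (at x)"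
      using DERIV_ys_Ss[OF L[OF x1(2)] x1(1)] DERIV_C[OF L[OF x1(2)] x1(1)]
      unfolding Y_def S_def C_def[abs_def] by simp_all
  qed
  have iC: "isCont Y x" "isCont S x" "isCont C x" if "x > 0" for x
    by (rule DERIV_isCont[OF D(1)[OF that]] DERIV_isCont[OF D(2)[OF that]] DERIV_isCont[OF D(3)[OF that]])+
  have cont: "continuous_on {x0..z} Y" "continuous_on {x0..z} S" "continuous_on {x0..z} C" for z
    using iC x0(4) by (auto intro!: continuous_at_imp_continuous_on)
  define P where "P x \<longleftrightarrow> y1 / 2 < Y x \<and> C x < c \<and> S x < 0" for x
  have Sd: "F2 (Y t) (S t) - real k * S t / t \<le> - d" if t: "x0 \<le> t" "P t" for t
  proof -
    have t0: "t > 0" using t x0 by simp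
    have "cot (Y t) \<le> M"
      using cot_antimono[of "y1/2" "Y t"] t(2) r(2)[of t] t0 y1 by (auto simp: M_def P_def)
    then have "cot (Y t) * C t \<le> M * C t" using r(4)[of t] t0 by (intro mult_right_mono) auto
    also have "\<dots> \<le> M * c" using t(2) by (intro mult_left_mono) (auto simp: M_def P_def)
    finally have "real l * (cot (Y t) * C t) \<le> real l * (M * c)" by (rule mult_left_mono) simp
    then have "F2 (Y t) (S t) \<le> d - h" using c1 by (simp add: F2_def C_def mult.assoc)
    moreover have "- (real k * S t / t) \<le> real k / x0"
    proof -
      have "real k * (- S t) / t \<le> real k * 1 / t"
        using r(3)[of t] t0 by (intro divide_right_mono mult_left_mono) auto
      also have "\<dots> \<le> real k / x0" using t(1) x0(4) by (simp add: frac_le)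
      finally show ?thesis by simp
    qed
    moreover have "h = 3 * d + real k / R" by (simp add: d_def diff_divide_distrib)
    ultimately show ?thesis using x0(1) by linarith
  qed
  have Px: "P x" if "x \<ge> x0" for x
  proof (rule real_continuation[OF _ _ _ that])
    have "Y x0 > 3 * y1 / 4" using close(1) \<eta>(2) crit_y1(2)[of x0] x0 by (simp add: Y_def)
    moreover have "S x0 < 0" using close(2) \<eta>(3) x0(3) by (simp add: S_def)
    moreover have Cx0: "C x0 < c"
    proof -
      have lt: "life A \<bar>x0\<bar>" using lx0 x0(4) by simp
      have "(Ss A x0)\<^sup>2 - (S x0)\<^sup>2 = (Ss A x0 - S x0) * (Ss A x0 + S x0)"
        by (simp add: power2_eq_square algebra_simps)
      also have "\<dots> \<le> \<bar>Ss A x0 - S x0\<bar> * \<bar>Ss A x0 + S x0\<bar>" by (metis abs_ge_self abs_mult)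
      also have "\<dots> \<le> \<eta> * 2"
        using close(2) r(3)[of x0] ranges(3)[OF lt] x0(4) \<eta>(1) by (intro mult_mono) (auto simp: S_def)
      finally have "1 - (S x0)\<^sup>2 \<le> (1 - (Ss A x0)\<^sup>2) + c\<^sup>2 / 2" using \<eta>(4) by linarith
      moreover have "1 - (Ss A x0)\<^sup>2 < (c / 2)\<^sup>2"
      proof -
        have "(sqrt (1 - (Ss A x0)\<^sup>2))\<^sup>2 < (c / 2)\<^sup>2"
          using x0(2) ranges(5)[OF lt] by (intro power_strict_mono) auto
        then show ?thesis using ranges(7)[OF lt] by simp
      qed
      moreover have "(c / 2)\<^sup>2 = c\<^sup>2 / 4" by (simp add: power_divide)
      ultimately have "1 - (S x0)\<^sup>2 < c\<^sup>2" using zero_less_power[OF c, of 2] by linarith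
      then show ?thesis unfolding C_def using c by (intro real_less_lsqrt) auto
    qed
    ultimately show P0: "P x0" using y1 by (simp add: P_def)
    show "\<exists>e>0. \<forall>x. z \<le> x \<and> x < z + e \<longrightarrow> P x" if z: "x0 \<le> z" "P z" for z
    proof -
      have zp: "z > 0" using z x0 by simp
      have "(Y \<longlongrightarrow> Y z) (at z)" "(C \<longlongrightarrow> C z) (at z)" "(S \<longlongrightarrow> S z) (at z)"
        using iC[OF zp] unfolding isCont_def by blast+
      then have "\<forall>\<^sub>F x in at z. y1 / 2 < Y x" "\<forall>\<^sub>F x in at z. C x < c" "\<forall>\<^sub>F x in at z. S x < 0"
        using z(2) order_tendstoD unfolding P_def by blast+
      then have "\<forall>\<^sub>F x in at z. P x" unfolding P_def by eventually_elim blast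
      then obtain e where "e > 0" "\<And>x. x \<noteq> z \<Longrightarrow> dist x z < e \<Longrightarrow> P x"
        unfolding eventually_at by blast
      then show ?thesis using z(2) by (intro exI[of _ e]) (metis add_diff_cancel_left' dist_real_def abs_of_nonneg diff_ge_0_iff_ge diff_less_eq add.commute)
    qed
    show "P z" if z: "x0 < z" "\<And>x. x0 \<le> x \<Longrightarrow> x < z \<Longrightarrow> P x" for z
    proof -
      have F1n: "F1 (S t) < 0" if "x0 < t" "t < z" for t
        using F1_sign(1)[OF r(3)] z(2)[of t] that x0(4) by (simp add: P_def)
      have "S z \<le> S x0"
      proof (rule DERIV_nonpos_imp_decreasing_open[of x0 z S])
        fix t assume t: "x0 < t" "t < z"
        then show "\<exists>D. (S has_real_derivative D) (at t) \<and> D \<le> 0"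
          using D(2)[of t] Sd[of t] z(2)[of t] x0(4) d by (intro exI conjI) auto
      qed (use z cont in auto)
      moreover have "C z \<le> C x0"
      proof (rule DERIV_nonpos_imp_decreasing_open[of x0 z C])
        fix t assume t: "x0 < t" "t < z"
        have "F2 (Y t) (S t) - real k * S t / t \<le> 0" using Sd[of t] z(2)[of t] t d by simp
        then have "- F1 (S t) * (F2 (Y t) (S t) - real k * S t / t) \<le> 0"
          using F1n[OF t] by (intro mult_nonneg_nonpos) auto
        then show "\<exists>D. (C has_real_derivative D) (at t) \<and> D \<le> 0"
          using D(3)[of t] t x0(4) by (intro exI conjI) auto
      qed (use z cont in auto)
      \<comment> \<open>The loss of height is paid for by the decrease of \<open>C\<close>: the
        ratio of \<open>Y'\<close> to \<open>C'\<close> is \<open>- 1 / S'\<close>, which is at most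
        \<open>1 / d\<close>.\<close>
      moreover have "Y x0 - C x0 / d \<le> Y z - C z / d"
      proof (rule DERIV_nonneg_imp_increasing_open[of x0 z "\<lambda>x. Y x - C x / d"])
        fix t assume t: "x0 < t" "t < z"
        let ?S' = "F2 (Y t) (S t) - real k * S t / t"
        have "?S' / d \<le> - 1" using Sd[of t] z(2)[of t] t d by (simp add: field_simps)
        then have "0 \<le> F1 (S t) * (1 + ?S' / d)" using F1n[OF t] by (intro mult_nonpos_nonpos) auto
        moreover have "F1 (S t) * (1 + s / d) = F1 (S t) - (- F1 (S t) * s) / d" for s
          by (simp add: algebra_simps)
        ultimately have "0 \<le> F1 (S t) - (- F1 (S t) * ?S') / d" by simp
        moreover have "((\<lambda>x. Y x - C x / d) has_real_derivative F1 (S t) - (- F1 (S t) * ?S') / d) (at t)"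
          using t x0(4) by (intro DERIV_diff DERIV_cdivide D) auto
        ultimately show "\<exists>D. ((\<lambda>x. Y x - C x / d) has_real_derivative D) (at t) \<and> 0 \<le> D" by blast
      qed (use z cont d in \<open>auto intro!: continuous_intros\<close>)
      moreover have "C x0 / d < y1 / 4" using c2 Cx0 d by (smt (verit) divide_strict_right_mono)
      moreover have "C z / d > 0" using r(4)[of z] z(1) x0(4) d by simp
      ultimately show "P z"
        using \<open>Y x0 > 3 * y1 / 4\<close> \<open>S x0 < 0\<close> Cx0 unfolding P_def by linarith
    qed
  qed
  \<comment> \<open>Over a length \<open>2 / d\<close> the value of \<open>S\<close> drops by at
    least \<open>2\<close>, which does not fit into \<open>(-1, 1)\<close>.\<close>
  define X where "X = x0 + 2 / d"
  have "S X + d * X \<le> S x0 + d * x0"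
  proof (rule DERIV_nonpos_imp_nonincreasing[of x0 X "\<lambda>x. S x + d * x"])
    fix t assume t: "x0 \<le> t" "t \<le> X"
    show "\<exists>D. ((\<lambda>x. S x + d * x) has_real_derivative D) (at t) \<and> D \<le> 0"
    proof (intro exI conjI)
      show "((\<lambda>x. S x + d * x) has_real_derivative (F2 (Y t) (S t) - real k * S t / t) + d * 1) (at t)"
        using t x0(4) by (intro DERIV_add D DERIV_cmult DERIV_ident) auto
      show "F2 (Y t) (S t) - real k * S t / t + d * 1 \<le> 0" using Sd[OF t(1) Px[OF t(1)]] by simp
    qed
  qed (use d in \<open>simp add: X_def\<close>)
  moreover have "d * X = d * x0 + 2" using d by (simp add: X_def field_simps)
  ultimately have "S X \<le> S x0 - 2" by simp
  moreover have "\<bar>S X\<bar> < 1" "\<bar>S x0\<bar> < 1" using r(3)[of X] r(3)[of x0] x0(4) d by (auto simp: X_def)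
  ultimately show False by linarith
qed

end

end

section \<open>Tangent spaces and mean curvature of invariant hypersurfaces\<close>

text \<open>\<open>tangent_space\<close> asks for curves inside \<open>M\<close> defined on the
  whole real line; a local curve is continued by the constant \<open>p\<close>, which does not
  affect the derivative at \<open>0\<close>.\<close>

lemma tangent_spaceI:
  fixes \<gamma> :: "real \<Rightarrow> 'a::real_normed_vector"
  assumes "\<gamma> 0 = p" "e > 0" "\<And>t. \<bar>t\<bar> < e \<Longrightarrow> \<gamma> t \<in> M" "(\<gamma> has_vector_derivative v) (at 0)"
  shows "v \<in> tangent_space M p"
proof -
  define \<gamma>' where "\<gamma>' t = (if \<bar>t\<bar> < e then \<gamma> t else p)" for t
  have "(\<gamma>' has_vector_derivative v) (at 0)"
    by (rule has_vector_derivative_transform_within_open[OF assms(4), of "{-e<..<e}"])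
       (use assms(2) in \<open>auto simp: \<gamma>'_def\<close>)
  moreover have "p \<in> M" using assms(1,2) assms(3)[of 0] by simp
  then have "\<gamma>' t \<in> M" for t using assms(3) by (simp add: \<gamma>'_def)
  moreover have "\<gamma>' 0 = p" using assms(1,2) by (simp add: \<gamma>'_def)
  ultimately show ?thesis unfolding tangent_space_def by blast
qed

text \<open>A straight line projected radially to the unit sphere. For \<open>b\<close> orthogonal
  to a unit vector \<open>q\<close> it stays in the sphere and has velocity \<open>b\<close> at
  \<open>0\<close>, also if \<open>b = 0\<close>.\<close>

definition unit_arc :: "'a::real_inner \<Rightarrow> 'a \<Rightarrow> real \<Rightarrow> 'a"
  where "unit_arc q b t = inverse (sqrt (1 + t\<^sup>2 * (b \<bullet> b))) *\<^sub>R (q + t *\<^sub>R b)"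

lemma unit_arc_0 [simp]: "unit_arc q b 0 = q"
  by (simp add: unit_arc_def)

lemma norm_unit_arc:
  assumes "norm q = 1" "b \<bullet> q = 0" shows "norm (unit_arc q b t) = 1"
proof -
  have pos: "1 + t\<^sup>2 * (b \<bullet> b) > 0" by (simp add: add_pos_nonneg)
  have "q \<bullet> q = 1" using assms(1) by (simp add: norm_eq_1)
  then have "(q + t *\<^sub>R b) \<bullet> (q + t *\<^sub>R b) = 1 + t\<^sup>2 * (b \<bullet> b)"
    using assms(2) by (simp add: inner_left_distrib inner_right_distrib inner_commute[of q b] power2_eq_square)
  then have "norm (q + t *\<^sub>R b) = sqrt (1 + t\<^sup>2 * (b \<bullet> b))"
    by (simp add: norm_eq_sqrt_inner)
  then show ?thesis using pos by (simp add: unit_arc_def)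
qed

lemma has_vector_derivative_unit_arc: "(unit_arc q b has_vector_derivative b) (at 0)"
proof -
  have "((\<lambda>t. inverse (sqrt (1 + t\<^sup>2 * (b \<bullet> b)))) has_real_derivative 0) (at 0)"
    by (auto intro!: derivative_eq_intros)
  moreover have "((\<lambda>t. q + t *\<^sub>R b) has_vector_derivative b) (at 0)"
    by (auto intro!: derivative_eq_intros)
  ultimately have "((\<lambda>t. inverse (sqrt (1 + t\<^sup>2 * (b \<bullet> b))) *\<^sub>R (q + t *\<^sub>R b)) has_vector_derivative
      inverse (sqrt (1 + 0\<^sup>2 * (b \<bullet> b))) *\<^sub>R b + 0 *\<^sub>R (q + 0 *\<^sub>R b)) (at 0)"
    by (rule has_vector_derivative_scaleR)
  then show ?thesis unfolding unit_arc_def[abs_def] by simp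
qed

lemma has_vector_derivative_unit_orthogonal:
  fixes \<gamma> :: "real \<Rightarrow> 'a::real_inner"
  assumes "(\<gamma> has_vector_derivative b) (at 0)" "\<And>t. norm (\<gamma> t) = 1"
  shows "b \<bullet> \<gamma> 0 = 0"
proof -
  have "((\<lambda>t. \<gamma> t \<bullet> \<gamma> t) has_derivative (\<lambda>t. \<gamma> 0 \<bullet> (t *\<^sub>R b) + (t *\<^sub>R b) \<bullet> \<gamma> 0)) (at 0)"
    using assms(1) unfolding has_vector_derivative_def by (rule has_derivative_inner) (use assms(1) in \<open>simp add: has_vector_derivative_def\<close>)
  moreover have "(\<lambda>t. \<gamma> t \<bullet> \<gamma> t) = (\<lambda>_. 1)" using assms(2) by (simp add: norm_eq_1)
  ultimately have "((\<lambda>_::real. 1::real) has_derivative (\<lambda>t. \<gamma> 0 \<bullet> (t *\<^sub>R b) + (t *\<^sub>R b) \<bullet> \<gamma> 0)) (at 0)" by simp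
  from has_derivative_unique[OF this has_derivative_const]
  have "\<gamma> 0 \<bullet> (1 *\<^sub>R b) + (1 *\<^sub>R b) \<bullet> \<gamma> 0 = 0" by metis
  then show ?thesis by (simp add: inner_commute)
qed

lemma tangent_space_RnSm:
  assumes "norm q = 1"
  shows "tangent_space RnSm (v, q) = {z :: ('n::finite, 'm::finite) ambient. snd z \<bullet> q = 0}"
proof (intro equalityI subsetI)
  fix z :: "('n, 'm) ambient" assume "z \<in> tangent_space RnSm (v, q)"
  then obtain \<gamma> where \<gamma>: "\<gamma> 0 = (v, q)" "\<And>t. \<gamma> t \<in> RnSm" "(\<gamma> has_vector_derivative z) (at 0)"
    by (auto simp: tangent_space_def)
  have "((\<lambda>t. snd (\<gamma> t)) has_vector_derivative snd z) (at 0)"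
    using bounded_linear.has_vector_derivative[OF bounded_linear_snd \<gamma>(3)] .
  moreover have "norm (snd (\<gamma> t)) = 1" for t using \<gamma>(2)[of t] by (auto simp: RnSm_def)
  ultimately have "snd z \<bullet> snd (\<gamma> 0) = 0" by (rule has_vector_derivative_unit_orthogonal)
  then show "z \<in> {z. snd z \<bullet> q = 0}" using \<gamma>(1) by simp
next
  fix z :: "('n, 'm) ambient" assume z: "z \<in> {z. snd z \<bullet> q = 0}"
  show "z \<in> tangent_space RnSm (v, q)"
  proof (rule tangent_spaceI[of "\<lambda>t. (v + t *\<^sub>R fst z, unit_arc q (snd z) t)" _ 1])
    show "((\<lambda>t. (v + t *\<^sub>R fst z, unit_arc q (snd z) t)) has_vector_derivative z) (at 0)"
    proof -
      have "((\<lambda>t. (v + t *\<^sub>R fst z, unit_arc q (snd z) t)) has_vector_derivative (fst z, snd z)) (at 0)"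
        by (intro has_vector_derivative_Pair has_vector_derivative_unit_arc) (auto intro!: derivative_eq_intros)
      then show ?thesis by simp
    qed
  qed (use assms z norm_unit_arc in \<open>auto simp: RnSm_def\<close>)
qed

lemma norm_sphere_point:
  fixes \<theta> :: "'a::real_normed_vector"
  assumes "norm \<theta> = 1" shows "norm (- cos y, sin y *\<^sub>R \<theta>) = 1"
  using assms by (simp add: norm_Pair)

lemma inner_unit [simp]: "norm \<omega> = 1 \<Longrightarrow> \<omega> \<bullet> \<omega> = 1" for \<omega> :: "'a::real_inner"
  by (simp add: norm_eq_1)

text \<open>The linear algebra at one point of an invariant hypersurface, with \<open>y\<close> the
  polar angle, \<open>S = sin \<sigma>\<close> and \<open>C = cos \<sigma>\<close>: \<open>T\<close>
  is the unit tangent of the profile and \<open>N\<close> the lifted normal. No chart is involved,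
  so that graph points and pole points can share it.\<close>

locale surface_point =
  fixes M :: "('n::finite, 'm::finite) ambient set" and \<nu> :: "('n, 'm) ambient \<Rightarrow> ('n, 'm) ambient"
    and v :: "real^'n" and \<omega> :: "real^'n" and \<theta> :: "real^'m" and y S C :: real
  assumes \<omega>: "norm \<omega> = 1" and \<theta>: "norm \<theta> = 1" and SC: "S\<^sup>2 + C\<^sup>2 = 1"
begin

definition q :: "real \<times> (real^'m)" where "q = (- cos y, sin y *\<^sub>R \<theta>)"
definition T :: "('n, 'm) ambient" where "T = (C *\<^sub>R \<omega>, S * sin y, (S * cos y) *\<^sub>R \<theta>)"
definition N :: "('n, 'm) ambient" where "N = (S *\<^sub>R \<omega>, - C * sin y, - (C * cos y) *\<^sub>R \<theta>)"

lemma norm_q: "norm q = 1" unfolding q_def by (rule norm_sphere_point[OF \<theta>])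

lemma cos_sin_sq: "cos y * cos y + sin y * sin y = 1"
  using sin_cos_squared_add2[of y] by (simp add: power2_eq_square)

lemma mult_mult_cos_sin_sq: "a * (b * (cos y * cos y)) + a * (b * (sin y * sin y)) = a * (b::real)"
  by (simp only: distrib_left[symmetric] cos_sin_sq mult_1_right)

lemma mult_cos_sin_sq: "a * (cos y * cos y) + a * (sin y * sin y) = (a::real)"
  by (simp only: distrib_left[symmetric] cos_sin_sq mult_1_right)

lemma SC_mult: "S * S + C * C = 1" using SC by (simp add: power2_eq_square)

lemma norm_N: "norm N = 1"
proof -
  have "N \<bullet> N = 1"
    using \<omega> \<theta> SC_mult mult_mult_cos_sin_sq[of C C] by (simp add: N_def algebra_simps)
  then show ?thesis by (simp add: norm_eq_1)
qed

lemma N_tangent: "N \<in> tangent_space RnSm (v, q)"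
  unfolding tangent_space_RnSm[OF norm_q] using \<theta> by (simp add: N_def q_def)

text \<open>The principal directions are \<open>T\<close>, the \<open>n - 1\<close> directions
  orthogonal to \<open>\<omega>\<close> in the first factor and the \<open>m - 1\<close> directions
  orthogonal to \<open>\<theta>\<close> in the last one, with one curvature for each family. The
  component \<open>c *\<^sub>R q\<close> is normal to the ambient product and drops out.\<close>

lemma mean_curvature:
  assumes TM: "tangent_space M (v, q) = {z. snd z \<bullet> q = 0 \<and> z \<bullet> N = 0}"
    and D: "(\<nu> has_derivative D) (at (v, q) within M)"
    and DT: "D T = \<alpha> *\<^sub>R T + (0, c *\<^sub>R q)"
    and De: "\<And>e. e \<bullet> \<omega> = 0 \<Longrightarrow> D (e, 0, 0) = \<beta> *\<^sub>R (e, 0, 0)"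
    and Df: "\<And>f. f \<bullet> \<theta> = 0 \<Longrightarrow> D (0, 0, f) = - \<gamma> *\<^sub>R (0, 0, f)"
  shows "has_mean_curvature_at RnSm M \<nu> (v, q)
    (- \<alpha> - (real CARD('n) - 1) * \<beta> + (real CARD('m) - 1) * \<gamma>)"
proof -
  have nz: "\<omega> \<noteq> 0" "\<theta> \<noteq> 0" using \<omega> \<theta> by auto
  have sub1: "subspace {e. \<omega> \<bullet> e = 0}" and sub2: "subspace {f. \<theta> \<bullet> f = 0}"
    by (rule subspace_hyperplane)+
  obtain B1 where B1: "B1 \<subseteq> {e. \<omega> \<bullet> e = 0}" "pairwise orthogonal B1" "\<And>e. e \<in> B1 \<Longrightarrow> norm e = 1"
      "independent B1" "card B1 = dim {e. \<omega> \<bullet> e = 0}" "span B1 = {e. \<omega> \<bullet> e = 0}"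
    by (rule orthonormal_basis_subspace[OF sub1], rule that)
  obtain B2 where B2: "B2 \<subseteq> {f. \<theta> \<bullet> f = 0}" "pairwise orthogonal B2" "\<And>f. f \<in> B2 \<Longrightarrow> norm f = 1"
      "independent B2" "card B2 = dim {f. \<theta> \<bullet> f = 0}" "span B2 = {f. \<theta> \<bullet> f = 0}"
    by (rule orthonormal_basis_subspace[OF sub2], rule that)
  have card: "real (card B1) = real CARD('n) - 1" "real (card B2) = real CARD('m) - 1"
    unfolding B1(5) B2(5) dim_hyperplane[OF nz(1)] dim_hyperplane[OF nz(2)]
    by (simp_all add: of_nat_diff)
  have fin: "finite B1" "finite B2" using B1(4) B2(4) by (auto dest: independent_imp_finite)
  define i1 :: "real^'n \<Rightarrow> ('n, 'm) ambient" where "i1 e = (e, 0, 0)" for e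
  define i2 :: "real^'m \<Rightarrow> ('n, 'm) ambient" where "i2 f = (0, 0, f)" for f
  have i1: "linear i1" and i2: "linear i2"
    unfolding i1_def i2_def by (auto intro!: linearI)
  have inj: "inj_on i1 B1" "inj_on i2 B2" by (auto simp: inj_on_def i1_def i2_def)
  have e\<omega>: "e \<bullet> \<omega> = 0" "\<omega> \<bullet> e = 0" if "e \<in> B1" for e using B1(1) that by (auto simp: inner_commute)
  have f\<theta>: "f \<bullet> \<theta> = 0" "\<theta> \<bullet> f = 0" if "f \<in> B2" for f using B2(1) that by (auto simp: inner_commute)
  have TT: "norm T = 1"
  proof -
    have "T \<bullet> T = 1"
      using \<omega> \<theta> SC_mult mult_mult_cos_sin_sq[of S S] by (simp add: T_def algebra_simps)
    then show ?thesis by (simp add: norm_eq_1)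
  qed
  have Ti1: "T \<bullet> i1 e = 0" if "e \<in> B1" for e using e\<omega>[OF that] by (simp add: T_def i1_def)
  have Ti2: "T \<bullet> i2 f = 0" if "f \<in> B2" for f using f\<theta>[OF that] by (simp add: T_def i2_def)
  have i12: "i1 e \<bullet> i2 f = 0" for e f by (simp add: i1_def i2_def)
  have nT: "T \<notin> i1 ` B1" "T \<notin> i2 ` B2"
    using Ti1 Ti2 TT by (auto simp: norm_eq_1)
  have ni: "i1 ` B1 \<inter> i2 ` B2 = {}"
    using B1(3) by (force simp: i1_def i2_def)
  define B where "B = insert T (i1 ` B1 \<union> i2 ` B2)"
  define \<kappa> where "\<kappa> z = (if z = T then - \<alpha> else if z \<in> i1 ` B1 then - \<beta> else \<gamma>)" for z
  have po: "pairwise orthogonal B"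
    unfolding B_def pairwise_insert pairwise_def
    using B1(2) B2(2) Ti1 Ti2 i12
    by (auto simp: orthogonal_def inner_commute pairwise_def i1_def i2_def) blast+
  have nB: "norm z = 1" if "z \<in> B" for z
    using that TT B1(3) B2(3) by (auto simp: B_def i1_def i2_def norm_Pair)
  let ?W = "{z :: ('n, 'm) ambient. snd z \<bullet> q = 0 \<and> z \<bullet> N = 0}"
  have sW: "subspace ?W"
    by (auto simp: subspace_def inner_left_distrib)
  have "span B = ?W"
  proof
    have "T \<in> ?W"
      using \<omega> \<theta> mult_mult_cos_sin_sq[of C S] by (simp add: T_def q_def N_def algebra_simps)
    moreover have "i1 ` B1 \<subseteq> ?W" using e\<omega> by (auto simp: i1_def N_def q_def)
    moreover have "i2 ` B2 \<subseteq> ?W" using f\<theta> by (auto simp: i2_def N_def q_def)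
    ultimately show "span B \<subseteq> ?W" unfolding B_def by (intro span_minimal sW) auto
    show "?W \<subseteq> span B"
    proof
      fix z assume "z \<in> ?W"
      obtain a t b where z: "z = (a, t, b)" by (cases z)
      define a' where "a' = a - (a \<bullet> \<omega>) *\<^sub>R \<omega>"
      define b' where "b' = b - (b \<bullet> \<theta>) *\<^sub>R \<theta>"
      \<comment> \<open>\<open>\<rho>\<close> is the component of \<open>z\<close> in the direction
        of increasing \<open>y\<close>, and \<open>\<mu>\<close> the one along \<open>T\<close>. The
        two orthogonality conditions leave only a multiple of \<open>T\<close> and parts orthogonal
        to \<open>\<omega>\<close> and \<open>\<theta>\<close>.\<close>
      define \<rho> where "\<rho> = t * sin y + (b \<bullet> \<theta>) * cos y"
      define \<mu> where "\<mu> = C * (a \<bullet> \<omega>) + S * \<rho>"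
      have 1: "(b \<bullet> \<theta>) * sin y = t * cos y" using \<open>z \<in> ?W\<close> by (simp add: z q_def mult.commute)
      have 2: "S * (a \<bullet> \<omega>) = C * \<rho>"
        using \<open>z \<in> ?W\<close> by (simp add: z N_def \<rho>_def algebra_simps)
      have t: "t = \<rho> * sin y"
      proof -
        have "\<rho> * sin y = t * (sin y * sin y) + ((b \<bullet> \<theta>) * sin y) * cos y" by (simp add: \<rho>_def algebra_simps)
        also have "\<dots> = t" unfolding 1 using mult_cos_sin_sq[of t] by (simp add: algebra_simps)
        finally show ?thesis by simp
      qed
      have b: "b \<bullet> \<theta> = \<rho> * cos y"
      proof -
        have "\<rho> * cos y = (t * cos y) * sin y + (b \<bullet> \<theta>) * (cos y * cos y)" by (simp add: \<rho>_def algebra_simps)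
        also have "\<dots> = b \<bullet> \<theta>" unfolding 1[symmetric] using mult_cos_sin_sq[of "b \<bullet> \<theta>"] by (simp add: algebra_simps)
        finally show ?thesis by simp
      qed
      have a: "a \<bullet> \<omega> = \<mu> * C"
      proof -
        have "\<mu> * C = (C * C) * (a \<bullet> \<omega>) + S * (C * \<rho>)" by (simp add: \<mu>_def algebra_simps)
        also have "\<dots> = (S * S + C * C) * (a \<bullet> \<omega>)" unfolding 2[symmetric] by (simp add: algebra_simps)
        finally show ?thesis using SC_mult by simp
      qed
      have l: "\<rho> = \<mu> * S"
      proof -
        have "\<mu> * S = C * (S * (a \<bullet> \<omega>)) + (S * S) * \<rho>" by (simp add: \<mu>_def algebra_simps)
        also have "\<dots> = (S * S + C * C) * \<rho>" unfolding 2 by (simp add: algebra_simps)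
        finally show ?thesis using SC_mult by simp
      qed
      have "a' \<in> span B1" unfolding B1(6) using \<omega> by (simp add: a'_def inner_diff_right inner_commute)
      then have "i1 a' \<in> span (i1 ` B1)" using linear_span_image[OF i1] by blast
      then have s1: "i1 a' \<in> span B" by (rule set_mp[OF span_mono, rotated]) (auto simp: B_def)
      have "b' \<in> span B2" unfolding B2(6) using \<theta> by (simp add: b'_def inner_diff_right inner_commute)
      then have "i2 b' \<in> span (i2 ` B2)" using linear_span_image[OF i2] by blast
      then have s2: "i2 b' \<in> span B" by (rule set_mp[OF span_mono, rotated]) (auto simp: B_def)
      have "\<mu> *\<^sub>R T \<in> span B" by (intro span_scale span_base) (simp add: B_def)
      from span_add[OF span_add[OF this s1] s2] have "\<mu> *\<^sub>R T + i1 a' + i2 b' \<in> span B" .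
      moreover have "\<mu> *\<^sub>R T + i1 a' + i2 b' = z"
      proof -
        have "(\<mu> * C) *\<^sub>R \<omega> + a' = a" unfolding a'_def a by simp
        moreover have "\<mu> * (S * sin y) = t" unfolding t l by simp
        moreover have "(\<mu> * (S * cos y)) *\<^sub>R \<theta> + b' = b" unfolding b'_def b l by (simp add: mult_ac)
        ultimately show ?thesis by (simp add: z T_def i1_def i2_def)
      qed
      ultimately show "z \<in> span B" by simp
    qed
  qed
  then have spB: "span B = tangent_space M (v, q)" using TM by simp
  have \<kappa>1: "\<kappa> (i1 e) = - \<beta>" if "e \<in> B1" for e
  proof -
    have "i1 e \<in> i1 ` B1" using that by blast
    then show ?thesis using nT(1) unfolding \<kappa>_def by metis
  qed
  have \<kappa>2: "\<kappa> (i2 f) = \<gamma>" if "f \<in> B2" for f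
  proof -
    have "i2 f \<in> i2 ` B2" using that by blast
    then have "i2 f \<noteq> T" "i2 f \<notin> i1 ` B1" using nT(2) ni by (metis, blast)
    then show ?thesis unfolding \<kappa>_def by simp
  qed
  have \<kappa>T: "\<kappa> T = - \<alpha>" by (simp add: \<kappa>_def)
  have princ: "(D z + \<kappa> z *\<^sub>R z) \<bullet> w = 0" if z: "z \<in> B" and w: "w \<in> tangent_space RnSm (v, q)" for z w
  proof -
    have wq: "snd w \<bullet> q = 0" using w unfolding tangent_space_RnSm[OF norm_q] by simp
    consider "z = T" | e where "e \<in> B1" "z = i1 e" | f where "f \<in> B2" "z = i2 f" using z by (auto simp: B_def)
    then show ?thesis
    proof cases
      case 1
      have "D z + \<kappa> z *\<^sub>R z = (0, c *\<^sub>R q)" using 1 DT \<kappa>T by simp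
      then show ?thesis using wq by (cases w) (simp add: inner_commute)
    next
      case 2
      then show ?thesis using De[OF e\<omega>(1)] \<kappa>1 by (cases w rule: prod_cases3) (simp add: i1_def)
    next
      case 3
      then show ?thesis using Df[OF f\<theta>(1)] \<kappa>2 by (cases w rule: prod_cases3) (simp add: i2_def)
    qed
  qed
  have "(\<Sum>z\<in>B. \<kappa> z) = \<kappa> T + ((\<Sum>z\<in>i1 ` B1. \<kappa> z) + (\<Sum>z\<in>i2 ` B2. \<kappa> z))"
    unfolding B_def using fin nT ni by (simp add: sum.union_disjoint)
  also have "(\<Sum>z\<in>i1 ` B1. \<kappa> z) = (\<Sum>e\<in>B1. - \<beta>)" using inj \<kappa>1 by (simp add: sum.reindex)
  also have "(\<Sum>z\<in>i2 ` B2. \<kappa> z) = (\<Sum>e\<in>B2. \<gamma>)" using inj \<kappa>2 by (simp add: sum.reindex)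
  finally have "- \<alpha> - (real CARD('n) - 1) * \<beta> + (real CARD('m) - 1) * \<gamma> = (\<Sum>z\<in>B. \<kappa> z)"
    using \<kappa>T card by simp
  then show ?thesis
    unfolding has_mean_curvature_at_def using D po nB spB princ by blast
qed

end

section \<open>Curvature of a graph over the axis and its neighbourhood\<close>

lemma open_fst_ball: "open {p :: 'a::real_normed_vector \<times> 'b::real_normed_vector. norm (fst p) < R}"
  by (intro open_Collect_less continuous_intros)

lemma has_derivative_unit:
  fixes \<theta> :: "'a::euclidean_space"
  assumes "norm \<theta> = 1" "s > 0"
  shows "((\<lambda>w. inverse (norm w) *\<^sub>R w) has_derivative (\<lambda>b. inverse s *\<^sub>R (b - (b \<bullet> \<theta>) *\<^sub>R \<theta>))) (at (s *\<^sub>R \<theta>))"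
proof -
  have n: "norm (s *\<^sub>R \<theta>) = s" and nz: "s *\<^sub>R \<theta> \<noteq> 0" and sg: "sgn (s *\<^sub>R \<theta>) = \<theta>"
    using assms by (auto simp: sgn_div_norm)
  have dn: "(norm has_derivative (\<lambda>b. b \<bullet> \<theta>)) (at (s *\<^sub>R \<theta>))"
    using has_derivative_norm[OF nz] sg by simp
  have "norm (s *\<^sub>R \<theta>) \<noteq> 0" using nz by simp
  from Deriv.has_derivative_inverse[OF this dn]
  have "((\<lambda>w. inverse (norm w)) has_derivative (\<lambda>b. - (inverse s * (b \<bullet> \<theta>) * inverse s))) (at (s *\<^sub>R \<theta>))"
    unfolding n .
  from has_derivative_scaleR[OF this has_derivative_ident]
  have d: "((\<lambda>w. inverse (norm w) *\<^sub>R w) has_derivative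
     (\<lambda>b. inverse (norm (s *\<^sub>R \<theta>)) *\<^sub>R b + (- (inverse s * (b \<bullet> \<theta>) * inverse s)) *\<^sub>R (s *\<^sub>R \<theta>))) (at (s *\<^sub>R \<theta>))" .
  have "inverse (norm (s *\<^sub>R \<theta>)) *\<^sub>R b + (- (inverse s * (b \<bullet> \<theta>) * inverse s)) *\<^sub>R (s *\<^sub>R \<theta>)
      = inverse s *\<^sub>R (b - (b \<bullet> \<theta>) *\<^sub>R \<theta>)" for b
    unfolding n using assms(2) by (simp add: algebra_simps)
  then show ?thesis using d by simp
qed

text \<open>All points over \<open>[0, R)\<close>, the axis included. \<open>Q\<close> stands for
  \<open>sin \<sigma> / x\<close>; the equations are required on both sides of \<open>0\<close>, so
  that functions of \<open>norm (fst p)\<close> built from even data are smooth at the axis.\<close>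

locale profile_chart =
  fixes M :: "('n::finite, 'm::finite) ambient set" and R h :: real and y Q :: "real \<Rightarrow> real"
  assumes R: "R > 0"
    and smooth_y: "smooth_on {-R<..<R} y" and smooth_Q: "smooth_on {-R<..<R} Q"
    and even_y: "\<And>x. \<bar>x\<bar> < R \<Longrightarrow> y (- x) = y x" and even_Q: "\<And>x. \<bar>x\<bar> < R \<Longrightarrow> Q (- x) = Q x"
    and y_range: "\<And>x. \<bar>x\<bar> < R \<Longrightarrow> 0 < y x" "\<And>x. \<bar>x\<bar> < R \<Longrightarrow> y x < pi"
    and S_less: "\<And>x. \<bar>x\<bar> < R \<Longrightarrow> \<bar>x * Q x\<bar> < 1"
    and DERIV_y: "\<And>x. \<bar>x\<bar> < R \<Longrightarrow> (y has_real_derivative x * Q x / sqrt (1 - (x * Q x)\<^sup>2)) (at x)"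
    and DERIV_S: "\<And>x. \<bar>x\<bar> < R \<Longrightarrow> ((\<lambda>x. x * Q x) has_real_derivative
      (real CARD('m) - 1) * cot (y x) * sqrt (1 - (x * Q x)\<^sup>2) - h - (real CARD('n) - 1) * Q x) (at x)"
    and M_subset: "M \<subseteq> RnSm"
    and M_graph: "\<And>p. norm (fst p) < R \<Longrightarrow> p \<in> M \<longleftrightarrow> p \<in> RnSm \<and> fst (snd p) = - cos (y (norm (fst p)))"
begin

definition S where "S x = x * Q x"
definition C where "C x = sqrt (1 - (S x)\<^sup>2)"
definition g1 where "g1 x = - C x * sin (y x)"
definition g2 where "g2 x = - C x * cos (y x)"
text \<open>The lifted normal has first component \<open>sin \<sigma>\<close> times
  \<open>\<omega> = v / norm v\<close>; writing it as \<open>Q\<close> times \<open>v\<close>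
  removes the singularity at \<open>v = 0\<close>. Only the last component divides by a norm, and on
  the hypersurface that norm is \<open>sin y > 0\<close>.\<close>

definition nu :: "('n, 'm) ambient \<Rightarrow> ('n, 'm) ambient"
  where "nu p = (Q (norm (fst p)) *\<^sub>R fst p, g1 (norm (fst p)),
    g2 (norm (fst p)) *\<^sub>R (inverse (norm (snd (snd p))) *\<^sub>R snd (snd p)))"
definition U :: "('n, 'm) ambient set" where "U = {p. norm (fst p) < R \<and> snd (snd p) \<noteq> 0}"

lemma open_U: "open U"
proof -
  have "open {p :: ('n, 'm) ambient. snd (snd p) \<noteq> 0}"
    by (intro open_Collect_neq continuous_intros)
  then show ?thesis unfolding U_def using open_fst_ball open_Collect_conj by blast
qed

lemma C_pos: "\<bar>x\<bar> < R \<Longrightarrow> 0 < C x" and S2_C2: "\<bar>x\<bar> < R \<Longrightarrow> (S x)\<^sup>2 + (C x)\<^sup>2 = 1"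
  using one_minus_square_pos[OF S_less] by (simp_all add: C_def S_def less_imp_le)

lemma sin_pos: "\<bar>x\<bar> < R \<Longrightarrow> 0 < sin (y x)"
  using y_range by (intro sin_gt_zero)

lemma smooth_S: "Ck_on k {-R<..<R} S"
  unfolding S_def[abs_def] using smooth_Q by (intro Ck_on_mult Ck_on_ident) auto

lemma smooth_C: "Ck_on k {-R<..<R} C"
  unfolding C_def[abs_def]
proof (rule Ck_on_sqrt)
  show "Ck_on k {-R<..<R} (\<lambda>x. 1 - (S x)\<^sup>2)" by (intro Ck_on_diff Ck_on_const Ck_on_power smooth_S) auto
  show "0 < 1 - (S x)\<^sup>2" if "x \<in> {-R<..<R}" for x
    using S_less[of x] one_minus_square_pos that by (auto simp: S_def abs_less_iff)
qed simp

lemma even_C: "\<bar>x\<bar> < R \<Longrightarrow> C (- x) = C x"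
  by (simp add: C_def S_def even_Q)

lemma smooth_g: "smooth_on {-R<..<R} g1" "smooth_on {-R<..<R} g2"
  unfolding g1_def[abs_def] g2_def[abs_def] using smooth_C smooth_y
  by (auto intro!: Ck_on_mult Ck_on_minus Ck_on_sin Ck_on_cos)

lemma even_g: "\<bar>x\<bar> < R \<Longrightarrow> g1 (- x) = g1 x" "\<bar>x\<bar> < R \<Longrightarrow> g2 (- x) = g2 x"
  by (simp_all add: g1_def g2_def even_C even_y)

lemma smooth_radial_fst:
  fixes q :: "real \<Rightarrow> real"
  assumes "smooth_on {-R<..<R} q" "\<And>x. \<bar>x\<bar> < R \<Longrightarrow> q (- x) = q x"
  shows "Ck_on k {p :: ('n, 'm) ambient. norm (fst p) < R} (\<lambda>p. q (norm (fst p)))"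
  by (rule Ck_on_compose[OF open_fst_ball open_ball _ Ck_on_fst Ck_on_radial[OF R assms(2,1)]])
     (auto intro: Ck_on_ident open_fst_ball)

lemma smooth_nu: "Ck_on k U nu"
proof -
  have sub: "U \<subseteq> {p. norm (fst p) < R}" by (auto simp: U_def)
  note rad = Ck_on_subset[OF smooth_radial_fst sub]
  have w: "Ck_on k U (\<lambda>p. snd (snd p))" and v: "Ck_on k U fst"
    by (intro Ck_on_snd Ck_on_fst Ck_on_ident open_U)+
  show ?thesis
    unfolding nu_def[abs_def]
    by (intro Ck_on_Pair Ck_on_scaleR Ck_on_inverse Ck_on_norm open_U v w
        rad[OF smooth_Q even_Q] rad[OF smooth_g(1) even_g(1)] rad[OF smooth_g(2) even_g(2)])
       (auto simp: U_def)
qed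

lemma M_point:
  assumes "p \<in> M" "norm (fst p) < R"
  obtains \<omega> \<theta> where "norm \<omega> = 1" "norm \<theta> = 1"
    "p = (norm (fst p) *\<^sub>R \<omega>, - cos (y (norm (fst p))), sin (y (norm (fst p))) *\<^sub>R \<theta>)"
proof -
  obtain v t w where p: "p = (v, t, w)" by (cases p)
  let ?y = "y (norm v)"
  have t: "t = - cos ?y" and n: "norm (t, w) = 1"
    using assms M_graph[OF assms(2)] by (auto simp: p RnSm_def)
  have "(norm w)\<^sup>2 = 1 - (cos ?y)\<^sup>2" using n by (simp add: norm_Pair t)
  then have "norm w = sin ?y"
    using sin_pos[of "norm v"] assms(2) by (simp add: p sin_squared_eq[symmetric])
  then have nw: "norm w = sin ?y" "w \<noteq> 0" using sin_pos[of "norm v"] assms(2) by (auto simp: p)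
  have "w = norm w *\<^sub>R sgn w" using nw(2) by (simp add: sgn_div_norm)
  then have w: "w = sin ?y *\<^sub>R sgn w" "norm (sgn w) = 1" using nw(2) by (simp_all only: nw(1) norm_sgn) simp
  show ?thesis
  proof (cases "v = 0")
    case True
    \<comment> \<open>On the axis every unit vector may serve as \<open>\<omega>\<close>.\<close>
    then show ?thesis using that[of "axis (SOME i. True) 1" "sgn w"] w t by (simp add: p)
  next
    case False
    then show ?thesis using that[of "sgn v" "sgn w"] w t by (simp add: p sgn_div_norm norm_sgn)
  qed
qed

lemma M_subset_U: assumes "p \<in> M" "norm (fst p) < R" shows "p \<in> U"
proof -
  obtain \<omega> :: "real^'n" and \<theta> :: "real^'m" where "norm \<theta> = 1" and p: "p = (norm (fst p) *\<^sub>R \<omega>, - cos (y (norm (fst p))), sin (y (norm (fst p))) *\<^sub>R \<theta>)"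
    by (rule M_point[OF assms], rule that)
  have "snd (snd p) = sin (y (norm (fst p))) *\<^sub>R \<theta>" by (subst p) simp
  then show ?thesis
    using \<open>norm \<theta> = 1\<close> sin_pos[of "norm (fst p)"] assms(2) by (auto simp: U_def)
qed

context
  fixes x :: real and \<omega> :: "real^'n" and \<theta> :: "real^'m" and p :: "('n, 'm) ambient"
  assumes x: "0 \<le> x" "x < R" and \<omega>: "norm \<omega> = 1" and \<theta>: "norm \<theta> = 1"
    and p: "p = (x *\<^sub>R \<omega>, - cos (y x), sin (y x) *\<^sub>R \<theta>)"
begin

lemma abs_x_less: "\<bar>x\<bar> < R" using x by simp

interpretation sp: surface_point M nu "x *\<^sub>R \<omega>" \<omega> \<theta> "y x" "S x" "C x"
  by standard (use \<omega> \<theta> S2_C2[OF abs_x_less] in auto)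

lemma p_eq: "p = (x *\<^sub>R \<omega>, sp.q)"
  by (simp add: p sp.q_def)

lemma norm_v: "norm (x *\<^sub>R \<omega>) = x" using x \<omega> by simp

lemma nu_p: "nu p = sp.N"
proof -
  have "sin (y x) > 0" using sin_pos[OF abs_x_less] .
  then show ?thesis
    unfolding sp.N_def using x \<omega> \<theta> by (simp add: nu_def p g1_def g2_def S_def mult.commute)
qed

lemma p_in_M: "p \<in> M"
proof -
  have "p \<in> RnSm" using norm_sphere_point[OF \<theta>] by (simp add: p RnSm_def)
  then show ?thesis using M_graph[of p] \<omega> x by (simp add: p)
qed

text \<open>One inclusion differentiates the graph equation along a curve in \<open>M\<close>. For
  the other a curve with the given velocity is written down: \<open>v\<close> moves linearly, the
  angle follows as \<open>y (norm v)\<close>, and \<open>\<theta>\<close> moves along a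
  \<open>unit_arc\<close>.\<close>

lemma tangent_M: "tangent_space M p = {z. snd z \<bullet> sp.q = 0 \<and> z \<bullet> sp.N = 0}"
proof (intro equalityI subsetI)
  have sy: "sin (y x) > 0" by (rule sin_pos[OF abs_x_less])
  have Cp: "C x > 0" by (rule C_pos[OF abs_x_less])
  have dy: "(y has_real_derivative S x / C x) (at x)" using DERIV_y[OF abs_x_less] by (simp add: S_def C_def)
  have dy0: "S x / C x = 0" if "x = 0" using that by (simp add: S_def)
  have dP: "((\<lambda>v. y (norm v)) has_derivative (\<lambda>a. S x / C x * (\<omega> \<bullet> a))) (at (x *\<^sub>R \<omega>))"
    by (rule has_derivative_radial[OF dy refl \<omega> x(1) dy0])
  {
    fix z assume z: "z \<in> tangent_space M p"
    then obtain \<gamma> where \<gamma>: "\<gamma> 0 = p" "\<And>t. \<gamma> t \<in> M" "(\<gamma> has_vector_derivative z) (at 0)"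
      by (auto simp: tangent_space_def)
    have zN: "z \<in> tangent_space RnSm p"
      using \<gamma> M_subset unfolding tangent_space_def by blast
    then have q0: "snd z \<bullet> sp.q = 0" unfolding p_eq tangent_space_RnSm[OF sp.norm_q] by simp
    obtain a \<tau> b where zz: "z = (a, \<tau>, b)" by (cases z)
    have da: "((\<lambda>t. fst (\<gamma> t)) has_vector_derivative a) (at 0)"
      using bounded_linear.has_vector_derivative[OF bounded_linear_fst \<gamma>(3)] by (simp add: zz)
    have dt: "((\<lambda>t. fst (snd (\<gamma> t))) has_vector_derivative \<tau>) (at 0)"
      using bounded_linear.has_vector_derivative[OF bounded_linear_fst bounded_linear.has_vector_derivative[OF bounded_linear_snd \<gamma>(3)]] by (simp add: zz)
    have f0: "fst (\<gamma> 0) = x *\<^sub>R \<omega>" using \<gamma>(1) p by simp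
    have dY': "((\<lambda>t. y (norm (fst (\<gamma> t)))) has_derivative (\<lambda>t. S x / C x * (\<omega> \<bullet> (t *\<^sub>R a)))) (at 0)"
      by (rule has_derivative_compose[OF da[unfolded has_vector_derivative_def] dP[folded f0]])
    have dY: "((\<lambda>t. y (norm (fst (\<gamma> t)))) has_real_derivative S x / C x * (\<omega> \<bullet> a)) (at 0)"
      unfolding has_field_derivative_def by (rule has_derivative_eq_rhs[OF dY']) (simp add: fun_eq_iff)
    have y0: "y (norm (fst (\<gamma> 0))) = y x" using f0 norm_v by simp
    have dcos: "((\<lambda>t. - cos (y (norm (fst (\<gamma> t))))) has_real_derivative sin (y x) * (S x / C x * (\<omega> \<bullet> a))) (at 0)"
      using dY y0 by (auto intro!: derivative_eq_intros)
    have ev: "\<forall>\<^sub>F t in nhds 0. - cos (y (norm (fst (\<gamma> t)))) = fst (snd (\<gamma> t))"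
    proof -
      have "isCont (\<lambda>t. fst (\<gamma> t)) 0" using da has_vector_derivative_continuous by blast
      then have "((\<lambda>t. fst (\<gamma> t)) \<longlongrightarrow> x *\<^sub>R \<omega>) (at 0)" using f0 by (simp add: isCont_def)
      then have "((\<lambda>t. norm (fst (\<gamma> t))) \<longlongrightarrow> x) (at 0)" using tendsto_norm norm_v by metis
      then have "\<forall>\<^sub>F t in at 0. norm (fst (\<gamma> t)) < R" by (rule order_tendstoD(2)) (rule x(2))
      moreover have "norm (fst (\<gamma> 0)) < R" using f0 norm_v x(2) by simp
      ultimately have "\<forall>\<^sub>F t in nhds 0. norm (fst (\<gamma> t)) < R" by (simp add: eventually_nhds_conv_at)
      then show ?thesis
      proof (rule eventually_mono)
        fix t assume "norm (fst (\<gamma> t)) < R"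
        from M_graph[OF this] \<gamma>(2)[of t] show "- cos (y (norm (fst (\<gamma> t)))) = fst (snd (\<gamma> t))" by simp
      qed
    qed
    have \<tau>: "\<tau> = sin (y x) * (S x / C x * (\<omega> \<bullet> a))"
      by (rule DERIV_unique[OF dt[folded has_real_derivative_iff_has_vector_derivative]
            DERIV_cong_ev[OF refl ev refl, THEN iffD1, OF dcos]])
    define \<mu> where "\<mu> = S x / C x * (\<omega> \<bullet> a)"
    have \<mu>: "S x * (\<omega> \<bullet> a) = C x * \<mu>" using Cp by (simp add: \<mu>_def)
    have "sin (y x) * (b \<bullet> \<theta>) = sin (y x) * (cos (y x) * \<mu>)"
      using q0 \<tau> by (simp add: zz sp.q_def \<mu>_def algebra_simps)
    then have b: "b \<bullet> \<theta> = cos (y x) * \<mu>" using sy by simp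
    have "z \<bullet> sp.N = 0"
      using b \<tau>[folded \<mu>_def] \<mu> sp.mult_mult_cos_sin_sq[of "C x" \<mu>]
      by (simp add: zz sp.N_def inner_commute[of _ \<omega>] inner_commute[of _ \<theta>] algebra_simps)
    with q0 show "z \<in> {z. snd z \<bullet> sp.q = 0 \<and> z \<bullet> sp.N = 0}" by simp
  next
    fix z :: "('n, 'm) ambient" assume z: "z \<in> {z. snd z \<bullet> sp.q = 0 \<and> z \<bullet> sp.N = 0}"
    obtain a \<tau> b where zz: "z = (a, \<tau>, b)" by (cases z)
    define \<mu> where "\<mu> = S x / C x * (\<omega> \<bullet> a)"
    have 1: "sin (y x) * (b \<bullet> \<theta>) = cos (y x) * \<tau>" using z by (simp add: zz sp.q_def)
    have 2: "S x * (\<omega> \<bullet> a) = C x * (sin (y x) * \<tau> + cos (y x) * (b \<bullet> \<theta>))"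
      using z by (simp add: zz sp.N_def inner_commute algebra_simps)
    then have \<mu>: "\<mu> = sin (y x) * \<tau> + cos (y x) * (b \<bullet> \<theta>)" using Cp by (simp add: \<mu>_def)
    have "sin (y x) * \<mu> = sin (y x) * sin (y x) * \<tau> + cos (y x) * (sin (y x) * (b \<bullet> \<theta>))"
      unfolding \<mu> by (simp add: algebra_simps)
    also have "\<dots> = \<tau>" unfolding 1 using sp.mult_cos_sin_sq[of \<tau>] by (simp add: algebra_simps)
    finally have t: "\<tau> = sin (y x) * \<mu>" by simp
    have "cos (y x) * \<mu> = (cos (y x) * \<tau>) * sin (y x) + cos (y x) * cos (y x) * (b \<bullet> \<theta>)"
      unfolding \<mu> by (simp add: algebra_simps)
    also have "\<dots> = b \<bullet> \<theta>"
      unfolding 1[symmetric] using sp.mult_cos_sin_sq[of "b \<bullet> \<theta>"] by (simp add: algebra_simps)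
    finally have b: "b \<bullet> \<theta> = cos (y x) * \<mu>" by simp
    \<comment> \<open>The part of \<open>b\<close> orthogonal to \<open>\<theta>\<close>, divided by
      \<open>sin y\<close> because the arc enters the curve with that factor.\<close>
    define f where "f = inverse (sin (y x)) *\<^sub>R (b - (b \<bullet> \<theta>) *\<^sub>R \<theta>)"
    have f\<theta>: "f \<bullet> \<theta> = 0" using \<theta> by (simp add: f_def inner_diff_left)
    have bf: "b = (cos (y x) * \<mu>) *\<^sub>R \<theta> + sin (y x) *\<^sub>R f" using sy b by (simp add: f_def)
    define Y where "Y t = y (norm (x *\<^sub>R \<omega> + t *\<^sub>R a))" for t
    have "((\<lambda>t. x *\<^sub>R \<omega> + t *\<^sub>R a) has_vector_derivative a) (at 0)" by (auto intro!: derivative_eq_intros)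
    then have dl: "((\<lambda>t. x *\<^sub>R \<omega> + t *\<^sub>R a) has_derivative (\<lambda>t. t *\<^sub>R a)) (at 0)"
      by (simp add: has_vector_derivative_def)
    have dP0: "((\<lambda>v. y (norm v)) has_derivative (\<lambda>a. S x / C x * (\<omega> \<bullet> a))) (at (x *\<^sub>R \<omega> + 0 *\<^sub>R a))"
      using dP by simp
    have dY': "(Y has_derivative (\<lambda>t. S x / C x * (\<omega> \<bullet> (t *\<^sub>R a)))) (at 0)"
      unfolding Y_def[abs_def] by (rule has_derivative_compose[OF dl dP0])
    have dY: "(Y has_real_derivative \<mu>) (at 0)"
      unfolding has_field_derivative_def \<mu>_def by (rule has_derivative_eq_rhs[OF dY']) (simp add: fun_eq_iff)
    have Y0: "Y 0 = y x" using norm_v by (simp add: Y_def)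
    define \<gamma> where "\<gamma> t = (x *\<^sub>R \<omega> + t *\<^sub>R a, - cos (Y t), sin (Y t) *\<^sub>R unit_arc \<theta> f t)" for t
    have d1: "((\<lambda>t. - cos (Y t)) has_vector_derivative sin (y x) * \<mu>) (at 0)"
      unfolding has_real_derivative_iff_has_vector_derivative[symmetric]
      using dY Y0 by (auto intro!: derivative_eq_intros)
    have "((\<lambda>t. sin (Y t)) has_real_derivative cos (y x) * \<mu>) (at 0)"
      using dY Y0 by (auto intro!: derivative_eq_intros)
    from has_vector_derivative_scaleR[OF this has_vector_derivative_unit_arc[of \<theta> f]]
    have d2: "((\<lambda>t. sin (Y t) *\<^sub>R unit_arc \<theta> f t) has_vector_derivative b) (at 0)"
      using Y0 bf by (simp add: add.commute)
    have d0: "((\<lambda>t. x *\<^sub>R \<omega> + t *\<^sub>R a) has_vector_derivative a) (at 0)" by (auto intro!: derivative_eq_intros)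
    have d\<gamma>: "(\<gamma> has_vector_derivative z) (at 0)"
      unfolding \<gamma>_def[abs_def] zz t
      by (intro has_vector_derivative_Pair d0 d1 d2)
    have "open {t. norm (x *\<^sub>R \<omega> + t *\<^sub>R a) < R}" by (intro open_Collect_less continuous_intros)
    moreover have "0 \<in> {t. norm (x *\<^sub>R \<omega> + t *\<^sub>R a) < R}" using \<omega> x by simp
    ultimately obtain e where e: "e > 0" "\<And>t. dist t 0 < e \<Longrightarrow> norm (x *\<^sub>R \<omega> + t *\<^sub>R a) < R"
      unfolding open_dist by (metis (mono_tags, lifting) mem_Collect_eq)
    show "z \<in> tangent_space M p"
    proof (rule tangent_spaceI[OF _ e(1) _ d\<gamma>])
      show "\<gamma> 0 = p" using Y0 by (simp add: \<gamma>_def p)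
      fix t :: real assume "\<bar>t\<bar> < e"
      then have lt: "norm (fst (\<gamma> t)) < R" using e(2) by (simp add: \<gamma>_def)
      have "norm (unit_arc \<theta> f t) = 1" by (rule norm_unit_arc[OF \<theta> f\<theta>])
      then have "\<gamma> t \<in> RnSm" using norm_sphere_point by (auto simp: \<gamma>_def RnSm_def)
      then show "\<gamma> t \<in> M" using M_graph[OF lt] by (simp add: \<gamma>_def Y_def)
    qed
  }
qed

lemma normal_at:
  shows "norm (nu p) = 1" "nu p \<in> tangent_space RnSm p" "\<And>z. z \<in> tangent_space M p \<Longrightarrow> nu p \<bullet> z = 0"
proof -
  show "norm (nu p) = 1" by (simp only: nu_p sp.norm_N)
  show "nu p \<in> tangent_space RnSm p" unfolding nu_p unfolding p_eq by (rule sp.N_tangent)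
  show "nu p \<bullet> z = 0" if "z \<in> tangent_space M p" for z
    using that unfolding tangent_M nu_p by (simp add: inner_commute)
qed

text \<open>The principal curvatures are \<open>- S'\<close> along the profile, \<open>- Q\<close>
  orthogonal to \<open>\<omega>\<close> and \<open>cot y * C\<close> orthogonal to
  \<open>\<theta>\<close>; the equation for \<open>S'\<close> says that their sum with
  multiplicities is \<open>h\<close>. The derivative is taken within \<open>M\<close>, so the field
  \<open>\<nu>\<close> has to agree with \<open>nu\<close> on \<open>M\<close> only, which admits
  fields glued from two charts.\<close>

lemma curvature_at:
  assumes ext: "\<And>p. p \<in> M \<Longrightarrow> norm (fst p) < R \<Longrightarrow> \<nu> p = nu p"
  shows "has_mean_curvature_at RnSm M \<nu> p h"
proof -
  have sy: "sin (y x) > 0" by (rule sin_pos[OF abs_x_less])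
  have Cp: "C x > 0" by (rule C_pos[OF abs_x_less])
  have I: "open {-R<..<R}" "x \<in> {-R<..<R}" using x by auto
  have dQ: "(Q has_real_derivative deriv Q x) (at x)" by (rule smooth_on_real_deriv(1)[OF I(1) smooth_Q I(2)])
  have dQ0: "deriv Q x = 0" if "x = 0"
    using DERIV_even_zero[of R Q "deriv Q x", OF R even_Q] dQ that by simp
  define s where "s = (real CARD('m) - 1) * cot (y x) * C x - h - (real CARD('n) - 1) * Q x"
  have dS: "(S has_real_derivative s) (at x)" using DERIV_S[OF abs_x_less] by (simp add: S_def[abs_def] C_def s_def)
  \<comment> \<open>The derivative of \<open>S\<close> in a second form: \<open>nu\<close> is
    written with \<open>Q\<close>, so its derivative produces \<open>Q + x * Q'\<close>, which has
    to be recognized as \<open>s\<close>.\<close>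
  have "(S has_real_derivative x * deriv Q x + 1 * Q x) (at x)"
    unfolding S_def[abs_def] by (rule DERIV_mult[OF DERIV_ident dQ, THEN DERIV_cong]) simp
  from DERIV_unique[OF dS this] have s: "s = Q x + x * deriv Q x" by simp
  have dC: "(C has_real_derivative - S x / C x * s) (at x)"
    unfolding C_def[abs_def] using DERIV_chain2[OF DERIV_sqrt_one_minus_square dS] S_less[OF abs_x_less]
    by (simp add: S_def[symmetric] C_def[symmetric])
  have dy: "(y has_real_derivative S x / C x) (at x)" using DERIV_y[OF abs_x_less] by (simp add: S_def C_def)
  define a1 where "a1 = - (- S x / C x * s * sin (y x) + C x * (cos (y x) * (S x / C x)))"
  define a2 where "a2 = - (- S x / C x * s * cos (y x) - C x * (sin (y x) * (S x / C x)))"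
  have dg1: "(g1 has_real_derivative a1) (at x)" and dg2: "(g2 has_real_derivative a2) (at x)"
    unfolding g1_def[abs_def] g2_def[abs_def] a1_def a2_def
    by (auto intro!: derivative_eq_intros dC dy simp: algebra_simps)
  have z: "a1 = 0" "a2 = 0" if "x = 0" using that by (simp_all add: a1_def a2_def S_def)
  let ?v = "x *\<^sub>R \<omega>"
  have fp: "fst p = ?v" "snd (snd p) = sin (y x) *\<^sub>R \<theta>" by (simp_all add: p)
  have rad: "((\<lambda>p::('n, 'm) ambient. q (norm (fst p))) has_derivative (\<lambda>z. D * (\<omega> \<bullet> fst z))) (at p)"
    if "(q has_real_derivative D) (at x)" "x = 0 \<Longrightarrow> D = 0" for q D
    by (rule has_derivative_compose[OF has_derivative_fst[OF has_derivative_ident]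
          has_derivative_radial[OF that(1) refl \<omega> x(1) that(2), folded fp(1)]])
  have du: "((\<lambda>p::('n, 'm) ambient. inverse (norm (snd (snd p))) *\<^sub>R snd (snd p)) has_derivative
      (\<lambda>z. inverse (sin (y x)) *\<^sub>R (snd (snd z) - (snd (snd z) \<bullet> \<theta>) *\<^sub>R \<theta>))) (at p)"
    by (rule has_derivative_compose[OF has_derivative_snd[OF has_derivative_snd[OF has_derivative_ident]]
          has_derivative_unit[OF \<theta> sy, folded fp(2)]])
  define D where "D z = ((Q x *\<^sub>R fst z + (deriv Q x * (\<omega> \<bullet> fst z)) *\<^sub>R fst p),
     a1 * (\<omega> \<bullet> fst z),
     g2 x *\<^sub>R (inverse (sin (y x)) *\<^sub>R (snd (snd z) - (snd (snd z) \<bullet> \<theta>) *\<^sub>R \<theta>)) + (a2 * (\<omega> \<bullet> fst z)) *\<^sub>R \<theta>)" for z :: "('n, 'm) ambient"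
  have "(nu has_derivative D) (at p)"
  proof -
    have n: "norm (fst p) = x" using fp norm_v by simp
    have "inverse (norm (snd (snd p))) *\<^sub>R snd (snd p) = \<theta>" using fp sy \<theta> by simp
    then have "(nu has_derivative (\<lambda>z. (Q (norm (fst p)) *\<^sub>R fst z + (deriv Q x * (\<omega> \<bullet> fst z)) *\<^sub>R fst p,
        a1 * (\<omega> \<bullet> fst z),
        g2 (norm (fst p)) *\<^sub>R (inverse (sin (y x)) *\<^sub>R (snd (snd z) - (snd (snd z) \<bullet> \<theta>) *\<^sub>R \<theta>)) +
          (a2 * (\<omega> \<bullet> fst z)) *\<^sub>R (inverse (norm (snd (snd p))) *\<^sub>R snd (snd p))))) (at p)"
      unfolding nu_def[abs_def]
      by (intro has_derivative_Pair has_derivative_scaleR rad[OF dQ dQ0] rad[OF dg1 z(1)] rad[OF dg2 z(2)] du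
          has_derivative_fst[OF has_derivative_ident])
    then show ?thesis unfolding D_def[abs_def] n \<open>inverse (norm (snd (snd p))) *\<^sub>R snd (snd p) = \<theta>\<close> .
  qed
  then have Dw: "(nu has_derivative D) (at p within M)" by (rule has_derivative_at_withinI)
  have "p \<in> {p. norm (fst p) < R}" using fp(1) norm_v x(2) by simp
  with open_fst_ball obtain e where e: "e > 0" "ball p e \<subseteq> {p. norm (fst p) < R}"
    unfolding open_contains_ball by blast
  have D\<nu>: "(\<nu> has_derivative D) (at p within M)"
    by (rule has_derivative_transform_within[OF Dw e(1) p_in_M]) (use ext e(2) in \<open>auto simp: dist_commute subset_eq\<close>)
  have "has_mean_curvature_at RnSm M \<nu> (x *\<^sub>R \<omega>, sp.q)
    (- s - (real CARD('n) - 1) * Q x + (real CARD('m) - 1) * (cot (y x) * C x))"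
  proof (rule surface_point.mean_curvature)
    show "surface_point \<omega> \<theta> (S x) (C x)" by unfold_locales
    show "tangent_space M (x *\<^sub>R \<omega>, sp.q) = {z. snd z \<bullet> sp.q = 0 \<and> z \<bullet> sp.N = 0}" using tangent_M p_eq by simp
    show "(\<nu> has_derivative D) (at (x *\<^sub>R \<omega>, sp.q) within M)" using D\<nu> p_eq by simp
    show "D sp.T = s *\<^sub>R sp.T + (0, (C x * S x) *\<^sub>R sp.q)"
    proof -
      have "Q x *\<^sub>R (C x *\<^sub>R \<omega>) + (deriv Q x * C x) *\<^sub>R (x *\<^sub>R \<omega>) = s *\<^sub>R (C x *\<^sub>R \<omega>)"
        unfolding s by (simp add: algebra_simps)
      moreover have "a1 * C x = s * (S x * sin (y x)) + (C x * S x) * (- cos (y x))"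
        unfolding a1_def using Cp by (simp add: field_simps)
      moreover have "a2 * C x = s * (S x * cos (y x)) + (C x * S x) * sin (y x)"
        unfolding a2_def using Cp by (simp add: field_simps)
      then have "(a2 * C x) *\<^sub>R \<theta> = (s * (S x * cos (y x))) *\<^sub>R \<theta> + (C x * S x * sin (y x)) *\<^sub>R \<theta>"
        by (simp only: scaleR_add_left)
      ultimately show ?thesis
        using \<theta> by (simp add: D_def sp.T_def sp.q_def fp inner_unit[OF \<omega>] mult_ac)
    qed
    show "D (e, 0, 0) = Q x *\<^sub>R (e, 0, 0)" if "e \<bullet> \<omega> = 0" for e
      using that by (simp add: D_def inner_commute)
    show "D (0, 0, f) = - (cot (y x) * C x) *\<^sub>R (0, 0, f)" if "f \<bullet> \<theta> = 0" for f
      using that sy by (simp add: D_def g2_def cot_def divide_inverse mult_ac)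
  qed
  moreover have "- s - (real CARD('n) - 1) * Q x + (real CARD('m) - 1) * (cot (y x) * C x) = h"
    by (simp add: s_def)
  ultimately show ?thesis using p_eq by simp
qed

end

end

section \<open>Entire graphs\<close>

lemma OnOm_invariantI:
  fixes M :: "('n::finite, 'm::finite) ambient set"
  assumes "\<And>v t w v' w'. (v, t, w) \<in> M \<Longrightarrow> norm v' = norm v \<Longrightarrow> norm w' = norm w \<Longrightarrow> (v', t, w') \<in> M"
  shows "OnOm_invariant M"
  unfolding OnOm_invariant_def
proof (intro allI impI equalityI subsetI)
  fix P :: "real^'n \<Rightarrow> real^'n" and Q :: "real^'m \<Rightarrow> real^'m" and p
  assume PQ: "orthogonal_transformation P \<and> orthogonal_transformation Q"
  then have n: "norm (P v) = norm v" "norm (Q w) = norm w" for v w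
    by (auto simp: orthogonal_transformation_norm)
  {
    assume "p \<in> (\<lambda>(v, t, w). (P v, t, Q w)) ` M"
    then obtain v t w where "(v, t, w) \<in> M" "p = (P v, t, Q w)" by auto
    then show "p \<in> M" using assms n by blast
  next
    assume p: "p \<in> M"
    obtain v t w where vtw: "p = (v, t, w)" by (cases p)
    obtain v' w' where v': "P v' = v" "Q w' = w"
      using PQ orthogonal_transformation_surj unfolding surj_def by metis
    then have "(v', t, w') \<in> M" using assms[of v t w v' w'] p n(1)[of v'] n(2)[of w'] vtw by simp
    then show "p \<in> (\<lambda>(v, t, w). (P v, t, Q w)) ` M"
      using v' vtw by (intro image_eqI[of _ _ "(v', t, w')"]) auto
  }
qed

lemma RnSm_iff: "(v, t, w) \<in> RnSm \<longleftrightarrow> t\<^sup>2 + (norm w)\<^sup>2 = 1"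
  by (simp add: RnSm_def norm_Pair)

lemma smooth_mapI:
  assumes "open U" "S \<subseteq> U" "\<And>k. Ck_on k U f" shows "smooth_map S f"
  unfolding smooth_map_def using assms by blast

lemma smooth_map_continuous:
  assumes "smooth_map S f" shows "continuous_on S f"
  unfolding continuous_on_eq_continuous_within
proof
  fix x assume x: "x \<in> S"
  then obtain U g where U: "open U" "x \<in> U" "\<forall>k. Ck_on k U g" "\<forall>y\<in>S \<inter> U. g y = f y"
    using assms unfolding smooth_map_def by blast
  have "continuous_on U g" using U(3) Ck_on_0I by blast
  then have "continuous (at x within S) g"
    using U(1,2) continuous_on_eq_continuous_at continuous_at_imp_continuous_at_within by blast
  moreover obtain e where "e > 0" "ball x e \<subseteq> U" using U(1,2) openE by blast
  ultimately show "continuous (at x within S) f"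
    by (rule_tac continuous_transform_within[of x S g e f]) (use x U(4) in \<open>auto simp: dist_commute subset_eq\<close>)
qed

lemma diffeomorphismI:
  assumes "\<And>x. x \<in> S \<Longrightarrow> f x \<in> T \<and> g (f x) = x" "\<And>x. x \<in> T \<Longrightarrow> g x \<in> S \<and> f (g x) = x"
    and "smooth_map S f" "smooth_map T g"
  shows "diffeomorphism S T f g"
proof -
  have i: "f ` S = T" "g ` T = S" using assms(1,2) by (force simp: image_iff)+
  have "homeomorphism S T f g"
    unfolding homeomorphism_def
    by (intro conjI ballI i smooth_map_continuous assms(3,4)) (simp_all add: assms(1,2))
  then show ?thesis unfolding diffeomorphism_def using assms(3,4) by simp
qed

context cmc
begin

text \<open>Bootstrapping: the derivatives are expressions in \<open>ys\<close>, \<open>Ss\<close>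
  and \<open>Qs\<close>, and \<open>Qs\<close> is an average of such an expression. As
  \<open>Ck_on_avg\<close> loses no derivative, even across \<open>0\<close>, each round gains
  one.\<close>

lemma profile_smooth:
  assumes "R > 0" "\<And>X. 0 \<le> X \<Longrightarrow> X < R \<Longrightarrow> life A X"
  shows "smooth_on {-R<..<R} (ys A)" "smooth_on {-R<..<R} (Ss A)" "smooth_on {-R<..<R} (Qs A)"
proof -
  let ?I = "{-R<..<R}"
  have I: "convex ?I" "0 \<in> ?I" "open ?I" using assms(1) by (auto simp: convex_real_interval)
  have lx: "life A \<bar>x\<bar>" if "x \<in> ?I" for x by (rule assms(2)) (use that in auto)
  have D: "(ys A has_real_derivative F1 (Ss A x)) (at x)"
    "(Ss A has_real_derivative F2 (ys A x) (Ss A x) - real k * Qs A x) (at x)" if "x \<in> ?I" for x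
  proof -
    have m: "\<bar>x\<bar> < (\<bar>x\<bar> + R) / 2" "(\<bar>x\<bar> + R) / 2 < R" "0 \<le> (\<bar>x\<bar> + R) / 2" using that assms(1) by auto
    show "(ys A has_real_derivative F1 (Ss A x)) (at x)"
      "(Ss A has_real_derivative F2 (ys A x) (Ss A x) - real k * Qs A x) (at x)"
      by (rule DERIV_ys_Ss[OF assms(2)[OF m(3,2)] m(1)])+
  qed
  have sin0: "sin (ys A x) \<noteq> 0" and sq0: "1 - (Ss A x)\<^sup>2 > 0" if "x \<in> ?I" for x
    using ranges(4)[OF lx[OF that]] one_minus_square_pos[OF ranges(3)[OF lx[OF that]]] by auto
  have C: "Ck_on j ?I (\<lambda>x. sqrt (1 - (Ss A x)\<^sup>2))" if "Ck_on j ?I (Ss A)" for j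
    by (rule Ck_on_sqrt[OF I(3) Ck_on_diff[OF I(3) Ck_on_const Ck_on_power[OF I(3) that]] sq0])
  have sqn: "sqrt (1 - (Ss A x)\<^sup>2) \<noteq> 0" if "x \<in> ?I" for x using sq0[OF that] by auto
  have F1: "Ck_on j ?I (\<lambda>x. F1 (Ss A x))" if "Ck_on j ?I (Ss A)" for j
    unfolding F1_def by (rule Ck_on_divide[OF I(3) that C[OF that] sqn])
  have F2: "Ck_on j ?I (\<lambda>x. F2 (ys A x) (Ss A x))" if "Ck_on j ?I (ys A)" "Ck_on j ?I (Ss A)" for j
    unfolding F2_def cot_def
    by (intro Ck_on_diff Ck_on_mult Ck_on_const C that I Ck_on_divide Ck_on_cos Ck_on_sin sin0)
  have Q: "Ck_on j ?I (Qs A)" if "Ck_on j ?I (ys A)" "Ck_on j ?I (Ss A)" for j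
    unfolding Qs_def by (rule Ck_on_avg[OF I F2[OF that]])
  have yS: "Ck_on j ?I (ys A) \<and> Ck_on j ?I (Ss A)" for j
  proof (induction j)
    case 0
    have "isCont (ys A) x" "isCont (Ss A) x" if "x \<in> ?I" for x
      by (rule DERIV_isCont[OF D(1)[OF that]] DERIV_isCont[OF D(2)[OF that]])+
    then show ?case by (simp add: continuous_at_imp_continuous_on)
  next
    case (Suc j)
    then have c: "Ck_on j ?I (ys A)" "Ck_on j ?I (Ss A)" by auto
    show ?case
      by (intro conjI Ck_on_real_SucI[OF I(3) D(1)] Ck_on_real_SucI[OF I(3) D(2)] F1 Ck_on_diff
          F2 Ck_on_mult Ck_on_const Q c I)
  qed
  then show "smooth_on ?I (ys A)" "smooth_on ?I (Ss A)" "smooth_on ?I (Qs A)" using Q by blast+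
qed

lemma profile_chart_maxsol:
  fixes M :: "('n::finite, 'm::finite) ambient set"
  assumes "CARD('n) = k + 1" "CARD('m) = l + 1" and R: "R > 0"
    and lR: "\<And>X. 0 \<le> X \<Longrightarrow> X < R \<Longrightarrow> life A X" and "M \<subseteq> RnSm"
    and "\<And>p. norm (fst p) < R \<Longrightarrow> p \<in> M \<longleftrightarrow> p \<in> RnSm \<and> fst (snd p) = - cos (ys A (norm (fst p)))"
  shows "profile_chart M R h (ys A) (Qs A)"
proof
  have lx: "life A \<bar>x\<bar>" if "\<bar>x\<bar> < R" for x using lR that by auto
  show "smooth_on {-R<..<R} (ys A)" "smooth_on {-R<..<R} (Qs A)" using profile_smooth[OF R lR] by auto
  fix x :: real assume x: "\<bar>x\<bar> < R"
  note l0 = lx[OF x] and r = ranges[OF lx[OF x]]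
  show "ys A (- x) = ys A x" by (rule parity(1)[OF l0])
  show "Qs A (- x) = Qs A x" by (rule Qs_even[OF l0])
  show "0 < ys A x" "ys A x < pi" using r by auto
  show "\<bar>x * Qs A x\<bar> < 1" using r(3) Ss_eq[OF l0] by simp
  have m: "\<bar>x\<bar> < (\<bar>x\<bar> + R) / 2" "(\<bar>x\<bar> + R) / 2 < R" "0 \<le> (\<bar>x\<bar> + R) / 2" using x by auto
  note D = DERIV_ys_Ss[OF lR[OF m(3,2)] m(1)]
  show "(ys A has_real_derivative x * Qs A x / sqrt (1 - (x * Qs A x)\<^sup>2)) (at x)"
    using D(1) Ss_eq[OF l0] by (simp add: F1_def)
  have ev: "\<forall>\<^sub>F z in nhds x. Ss A z = z * Qs A z"
  proof -
    have "\<forall>\<^sub>F z in nhds x. z \<in> {-R<..<R}" by (rule eventually_nhds_in_open) (use x in auto)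
    then show ?thesis by (rule eventually_mono) (use Ss_eq lx in auto)
  qed
  have eq: "F2 (ys A x) (Ss A x) - real k * Qs A x =
      (real CARD('m) - 1) * cot (ys A x) * sqrt (1 - (x * Qs A x)\<^sup>2) - h - (real CARD('n) - 1) * Qs A x"
    using assms(1,2) Ss_eq[OF l0] by (simp add: F2_def)
  show "((\<lambda>x. x * Qs A x) has_real_derivative
      (real CARD('m) - 1) * cot (ys A x) * sqrt (1 - (x * Qs A x)\<^sup>2) - h - (real CARD('n) - 1) * Qs A x) (at x)"
    by (rule DERIV_cong_ev[OF refl ev eq, THEN iffD1, OF D(2)])
qed (use assms in auto)

text \<open>The arc length \<open>L\<close> is the integral of \<open>1 / C\<close> from
  \<open>0\<close>. As \<open>C \<le> 1\<close>, it grows at least like \<open>x\<close>; so an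
  entire graph has infinite length, and \<open>L\<close> is a bijection of the line.\<close>

lemma arclength_inverse:
  assumes "\<And>X. 0 \<le> X \<Longrightarrow> life A X"
  obtains L X :: "real \<Rightarrow> real" where "X 0 = 0" "\<And>x. X (L x) = x" "\<And>s. L (X s) = s"
    "\<And>x. x \<ge> 0 \<Longrightarrow> L x \<ge> 0" "\<And>s. s \<ge> 0 \<Longrightarrow> X s \<ge> 0"
    "\<And>s. (X has_real_derivative sqrt (1 - (Ss A (X s))\<^sup>2)) (at s)"
proof -
  define c where "c x = inverse (sqrt (1 - (Ss A x)\<^sup>2))" for x
  note r = ranges[OF assms[OF abs_ge_zero]]
  have cpos: "c x > 0" for x using r(5)[of x] by (simp add: c_def)
  have c1: "c x \<ge> 1" for x using r(5,6)[of x] unfolding c_def by (intro one_le_inverse) auto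
  have "continuous_on UNIV (Ss A)"
  proof (rule continuous_at_imp_continuous_on, rule ballI)
    fix x :: real
    have "\<bar>x\<bar> < \<bar>x\<bar> + 1" "0 \<le> \<bar>x\<bar> + 1" by auto
    then show "isCont (Ss A) x" using DERIV_ys_Ss(2)[OF assms] DERIV_isCont by blast
  qed
  then have cc: "continuous_on UNIV c"
    unfolding c_def using r(5) by (intro continuous_intros ballI) (auto simp: less_imp_neq[symmetric])
  define L where "L x = x * avg 0 c x" for x
  have dL: "(L has_real_derivative c x) (at x)" for x
    unfolding L_def[abs_def] using DERIV_mult_avg[of UNIV c x 0] cc by simp
  have L0: "L 0 = 0" by (simp add: L_def)
  have mono: "L x < L y" if "x < y" for x y
    by (rule DERIV_pos_imp_increasing[OF that]) (use dL cpos in blast)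
  have inj: "inj L" by (rule linorder_injI) (use mono in \<open>force simp: less_le\<close>)
  have iL: "isCont L x" for x by (rule DERIV_isCont[OF dL])
  have grow: "y - x \<le> L y - L x" if "x \<le> y" for x y
  proof -
    have "L x - x \<le> L y - y"
    proof (rule DERIV_nonneg_imp_nondecreasing[OF that, of "\<lambda>x. L x - x"])
      fix t
      show "\<exists>D. ((\<lambda>x. L x - x) has_real_derivative D) (at t) \<and> 0 \<le> D"
        using DERIV_diff[OF dL[of t] DERIV_ident] c1[of t] by (intro exI conjI) auto
    qed
    then show ?thesis by simp
  qed
  have surj: "\<exists>x. L x = s" for s
  proof -
    have "L (- \<bar>s\<bar>) \<le> s" "s \<le> L \<bar>s\<bar>" using grow[of "- \<bar>s\<bar>" 0] grow[of 0 "\<bar>s\<bar>"] L0 by auto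
    then obtain x where "- \<bar>s\<bar> \<le> x" "x \<le> \<bar>s\<bar>" "L x = s"
      using IVT[of L "- \<bar>s\<bar>" s "\<bar>s\<bar>"] iL by auto
    then show ?thesis by blast
  qed
  define X where "X = inv L"
  have XL: "X (L x) = x" for x unfolding X_def by (rule inv_f_f[OF inj])
  have LX: "L (X s) = s" for s unfolding X_def using surj by (metis f_inv_into_f rangeI)
  have X0: "X 0 = 0" using XL[of 0] L0 by simp
  have Lge: "L x \<ge> 0" if "x \<ge> 0" for x using grow[OF that] L0 that by simp
  have Xge: "X s \<ge> 0" if "s \<ge> 0" for s
  proof (rule ccontr)
    assume "\<not> X s \<ge> 0"
    then have "L (X s) < L 0" by (intro mono) simp
    then show False using LX L0 that by simp
  qed
  have "(X has_real_derivative sqrt (1 - (Ss A (X s))\<^sup>2)) (at s)" for s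
  proof -
    have "isCont X (L (X s))"
      by (rule isCont_inverse_function2[of "X s - 1" _ "X s + 1"]) (use XL iL in auto)
    then have "isCont X s" by (simp add: LX)
    then have "(X has_real_derivative inverse (c (X s))) (at s)"
      by (intro DERIV_inverse_function[where f=L and a="s - 1" and b="s + 1"] dL) (use cpos LX in \<open>auto simp: less_imp_neq[symmetric]\<close>)
    then show ?thesis by (simp add: c_def)
  qed
  then show ?thesis using that[OF X0 XL LX Lge Xge] by blast
qed

text \<open>The diffeomorphism normalizes the last component to length \<open>1\<close>; its inverse
  puts back the factor \<open>sin y\<close>. Smoothness and curvature are local, so near each point
  the chart of radius \<open>norm v + 1\<close> is used, which the infinite life of the profile
  permits.\<close>

lemma entire_graph:
  fixes M :: "('n::finite, 'm::finite) ambient set"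
  assumes dims: "CARD('n) = k + 1" "CARD('m) = l + 1" and lX: "\<And>X. 0 \<le> X \<Longrightarrow> life A X"
    and M: "M = {p \<in> RnSm. fst (snd p) = - cos (ys A (norm (fst p)))}"
  shows "M \<subseteq> RnSm" "OnOm_invariant M"
    "diffeomorphic M (UNIV \<times> sphere 0 1 :: ((real^'n) \<times> (real^'m)) set)"
    "\<exists>\<phi> \<sigma> \<nu>. generating_curve \<phi> \<sigma> \<and> \<phi> 0 = (0, A) \<and> \<sigma> 0 = 0 \<and> M = generated_hypersurface \<phi> \<and>
       lifts_curve_normal \<phi> \<sigma> \<nu> \<and> constant_mean_curvature RnSm M \<nu> h"
proof -
  note r = ranges[OF lX[OF abs_ge_zero]]
  show sub: "M \<subseteq> RnSm" by (auto simp: M)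
  show "OnOm_invariant M"
  proof (rule OnOm_invariantI)
    fix v v' :: "real^'n" and w w' :: "real^'m" and t :: real
    assume "(v, t, w) \<in> M" "norm v' = norm v" "norm w' = norm w"
    then show "(v', t, w') \<in> M" by (auto simp: M RnSm_iff)
  qed
  have chart: "profile_chart M R h (ys A) (Qs A)" if "R > 0" for R
    by (rule profile_chart_maxsol[OF dims that lX sub]) (auto simp: M)
  define f where "f p = (fst p, inverse (norm (snd (snd p))) *\<^sub>R snd (snd p))" for p :: "('n, 'm) ambient"
  define g where "g z = (fst z, - cos (ys A (norm (fst z))), sin (ys A (norm (fst z))) *\<^sub>R snd z)" for z :: "(real^'n) \<times> (real^'m)"
  have Mp: "norm w = sin (ys A (norm v))" "w \<noteq> 0" "t = - cos (ys A (norm v))" if "(v, t, w) \<in> M" for v t w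
  proof -
    show t: "t = - cos (ys A (norm v))" using that by (simp add: M)
    have "(norm w)\<^sup>2 = (sin (ys A (norm v)))\<^sup>2"
      using that t by (simp add: M RnSm_iff sin_squared_eq)
    then show n: "norm w = sin (ys A (norm v))" using r(4)[of "norm v"] by simp
    then show "w \<noteq> 0" using r(4)[of "norm v"] by auto
  qed
  have "diffeomorphism M (UNIV \<times> sphere 0 1) f g"
  proof (rule diffeomorphismI)
    fix p assume p: "p \<in> M"
    obtain v t w where vtw: "p = (v, t, w)" by (cases p)
    note q = Mp[OF p[unfolded vtw]]
    have "sin (ys A (norm v)) *\<^sub>R inverse (norm w) *\<^sub>R w = w" using q(2) by (simp add: q(1)[symmetric])
    then show "f p \<in> UNIV \<times> sphere 0 1 \<and> g (f p) = p"
      using q(2,3) by (simp add: vtw f_def g_def)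
  next
    fix z :: "(real^'n) \<times> (real^'m)" assume "z \<in> UNIV \<times> sphere 0 1"
    then have n: "norm (snd z) = 1" by auto
    show "g z \<in> M \<and> f (g z) = z"
      using n r(4)[of "norm (fst z)"] by (simp add: f_def g_def M RnSm_iff)
  next
    show "smooth_map M f"
    proof (rule smooth_mapI)
      show op: "open {p :: ('n, 'm) ambient. snd (snd p) \<noteq> 0}"
        by (intro open_Collect_neq continuous_intros)
      show "M \<subseteq> {p. snd (snd p) \<noteq> 0}" using Mp(2) by auto
      show "Ck_on k {p. snd (snd p) \<noteq> 0} f" for k
        unfolding f_def[abs_def]
        by (intro Ck_on_Pair Ck_on_scaleR Ck_on_inverse Ck_on_norm Ck_on_fst Ck_on_snd Ck_on_ident op) auto
    qed
    show "smooth_map (UNIV \<times> sphere 0 1) g"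
      unfolding smooth_map_def
    proof
      fix z :: "(real^'n) \<times> (real^'m)" assume "z \<in> UNIV \<times> sphere 0 1"
      define R where "R = norm (fst z) + 1"
      have R: "R > 0" by (simp add: R_def add_nonneg_pos)
      interpret profile_chart M R h "ys A" "Qs A" by (rule chart[OF R])
      let ?U = "{z :: (real^'n) \<times> (real^'m). norm (fst z) < R}"
      have op: "open ?U" by (rule open_fst_ball)
      have y: "Ck_on k ?U (\<lambda>z. ys A (norm (fst z)))" for k
        by (rule Ck_on_compose[OF op open_ball _ Ck_on_fst[OF op Ck_on_ident[OF op]] Ck_on_radial[OF R even_y smooth_y]])
           auto
      have "Ck_on k ?U g" for k
        unfolding g_def[abs_def]
        by (intro Ck_on_Pair Ck_on_scaleR Ck_on_minus Ck_on_cos Ck_on_sin y Ck_on_fst Ck_on_snd Ck_on_ident op)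
      then show "\<exists>U ga. open U \<and> z \<in> U \<and> (\<forall>k. Ck_on k U ga) \<and> (\<forall>y\<in>UNIV \<times> sphere 0 1 \<inter> U. ga y = g y)"
        using op by (intro exI[of _ ?U] exI[of _ g]) (auto simp: R_def)
    qed
  qed
  then show "diffeomorphic M (UNIV \<times> sphere 0 1 :: ((real^'n) \<times> (real^'m)) set)"
    unfolding diffeomorphic_def by blast
  obtain L X :: "real \<Rightarrow> real" where X: "X 0 = 0" "\<And>x. X (L x) = x" "\<And>s. L (X s) = s"
    "\<And>x. x \<ge> 0 \<Longrightarrow> L x \<ge> 0" "\<And>s. s \<ge> 0 \<Longrightarrow> X s \<ge> 0"
    "\<And>s. (X has_real_derivative sqrt (1 - (Ss A (X s))\<^sup>2)) (at s)"
    by (rule arclength_inverse[OF lX], assumption, rule that)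
  define \<phi> where "\<phi> s = (X s, ys A (X s))" for s
  define \<sigma> where "\<sigma> s = arcsin (Ss A (X s))" for s
  define \<nu> where "\<nu> = (profile_chart.nu (ys A) (Qs A) :: ('n, 'm) ambient \<Rightarrow> ('n, 'm) ambient)"
  have sc: "sin (\<sigma> s) = Ss A (X s)" "cos (\<sigma> s) = sqrt (1 - (Ss A (X s))\<^sup>2)" for s
    using r(3)[of "X s"] by (simp_all add: \<sigma>_def cos_arcsin)
  have l0: "life A 0" by (rule lX) simp
  have "generating_curve \<phi> \<sigma>"
    unfolding generating_curve_def
  proof (intro conjI allI impI)
    have "inj X" using X(3) by (metis injI)
    then show "inj_on \<phi> {0..}" by (auto simp: \<phi>_def inj_on_def inj_def)
    have iX: "isCont X s" for s by (rule DERIV_isCont[OF X(6)])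
    have iS: "isCont (Ss A) x" for x
    proof -
      have "\<bar>x\<bar> < \<bar>x\<bar> + 1" "0 \<le> \<bar>x\<bar> + 1" by auto
      then show ?thesis using DERIV_ys_Ss(2)[OF lX] DERIV_isCont by blast
    qed
    have "continuous_on {0..} (\<lambda>s. Ss A (X s))"
      by (intro continuous_at_imp_continuous_on ballI isCont_o2[OF iX iS])
    moreover have "- 1 \<le> Ss A (X s) \<and> Ss A (X s) \<le> 1" for s using r(3)[of "X s"] by auto
    ultimately show "continuous_on {0..} \<sigma>"
      unfolding \<sigma>_def by (intro continuous_on_arcsin) auto
    fix s :: real assume s: "s \<ge> 0"
    show "\<phi> s \<in> {0..} \<times> {0..pi}" using X(5)[OF s] r(1,2)[of "X s"] by (simp add: \<phi>_def less_imp_le)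
    have dy: "(ys A has_real_derivative F1 (Ss A (X s))) (at (X s))"
    proof -
      have "\<bar>X s\<bar> < \<bar>X s\<bar> + 1" "0 \<le> \<bar>X s\<bar> + 1" by auto
      then show ?thesis using DERIV_ys_Ss(1)[OF lX] by blast
    qed
    have "((\<lambda>s. ys A (X s)) has_real_derivative sin (\<sigma> s)) (at s)"
      using DERIV_chain2[OF dy X(6)] r(5)[of "X s"] by (simp add: sc F1_def)
    moreover have "(X has_real_derivative cos (\<sigma> s)) (at s)" using X(6) by (simp add: sc)
    ultimately have "(\<phi> has_vector_derivative (cos (\<sigma> s), sin (\<sigma> s))) (at s)"
      unfolding \<phi>_def[abs_def] has_real_derivative_iff_has_vector_derivative
      by (intro has_vector_derivative_Pair)
    then show "(\<phi> has_vector_derivative (cos (\<sigma> s), sin (\<sigma> s))) (at s within {0..})"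
      by (rule has_vector_derivative_at_within)
  qed
  moreover have "\<phi> 0 = (0, A)" "\<sigma> 0 = 0" using X(1) at_0[OF l0] by (simp_all add: \<phi>_def \<sigma>_def)
  moreover have "M = generated_hypersurface \<phi>"
  proof (rule set_eqI)
    fix p :: "('n, 'm) ambient"
    obtain v t w where p: "p = (v, t, w)" by (cases p)
    have "orbit_coords p = (norm v, arccos (- t))" by (simp add: orbit_coords_def south_pole_def p)
    moreover have "(norm v, arccos (- t)) \<in> \<phi> ` {0..} \<longleftrightarrow> arccos (- t) = ys A (norm v)"
    proof
      assume "(norm v, arccos (- t)) \<in> \<phi> ` {0..}"
      then show "arccos (- t) = ys A (norm v)" by (auto simp: \<phi>_def)
    next
      assume a: "arccos (- t) = ys A (norm v)"
      have "\<phi> (L (norm v)) = (norm v, arccos (- t))" using X(2) a by (simp add: \<phi>_def)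
      moreover have "L (norm v) \<in> {0..}" using X(4) by simp
      ultimately show "(norm v, arccos (- t)) \<in> \<phi> ` {0..}" by (metis image_eqI)
    qed
    moreover have "arccos (- t) = ys A (norm v) \<longleftrightarrow> t = - cos (ys A (norm v))" if "p \<in> RnSm"
    proof
      have "t\<^sup>2 + (norm w)\<^sup>2 = 1" using that by (simp add: p RnSm_iff)
      then have "t\<^sup>2 \<le> 1" using zero_le_power2[of "norm w"] by linarith
      then have t: "\<bar>t\<bar> \<le> 1" by (simp add: abs_square_le_1)
      assume "arccos (- t) = ys A (norm v)"
      then have "cos (ys A (norm v)) = cos (arccos (- t))" by simp
      also have "\<dots> = - t" using t by (intro cos_arccos) auto
      finally show "t = - cos (ys A (norm v))" by simp
    next
      assume "t = - cos (ys A (norm v))"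
      then show "arccos (- t) = ys A (norm v)" using r(1,2)[of "norm v"] by (simp add: arccos_cos)
    qed
    ultimately show "p \<in> M \<longleftrightarrow> p \<in> generated_hypersurface \<phi>"
      by (auto simp: M generated_hypersurface_def p)
  qed
  moreover have "lifts_curve_normal \<phi> \<sigma> \<nu>"
    unfolding lifts_curve_normal_def Let_def
  proof (intro allI impI)
    fix s :: real and \<omega> :: "real^'n" and \<theta> :: "real^'m"
    assume s: "s \<ge> 0" and n: "norm \<omega> = 1 \<and> norm \<theta> = 1"
    define x where "x = X s"
    have x: "x \<ge> 0" using X(5)[OF s] by (simp add: x_def)
    define R where "R = x + 1"
    have R: "R > 0" using x by (simp add: R_def)
    interpret profile_chart M R h "ys A" "Qs A" by (rule chart[OF R])
    have S: "x * Qs A x = Ss A x" using Ss_eq[OF lX[OF abs_ge_zero]] by simp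
    show "\<nu> (fst (\<phi> s) *\<^sub>R \<omega>, - cos (snd (\<phi> s)), sin (snd (\<phi> s)) *\<^sub>R \<theta>) =
      (sin (\<sigma> s) *\<^sub>R \<omega>, - cos (\<sigma> s) *\<^sub>R (sin (snd (\<phi> s)), cos (snd (\<phi> s)) *\<^sub>R \<theta>))"
      using n x r(4)[of x] S
      by (simp add: \<nu>_def \<phi>_def sc nu_def g1_def g2_def C_def S_def flip: x_def) (simp add: mult.commute)
  qed
  moreover have "constant_mean_curvature RnSm M \<nu> h"
    unfolding constant_mean_curvature_def unit_normal_field_def
  proof (intro conjI ballI)
    show "smooth_map M \<nu>"
      unfolding smooth_map_def
    proof
      fix p assume p: "p \<in> M"
      define R where "R = norm (fst p) + 1"
      have Rp: "R > 0" "norm (fst p) < R" by (auto simp: R_def add_nonneg_pos)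
      interpret profile_chart M R h "ys A" "Qs A" by (rule chart[OF Rp(1)])
      have "\<forall>k. Ck_on k U \<nu>" unfolding \<nu>_def using smooth_nu by blast
      then show "\<exists>U g. open U \<and> p \<in> U \<and> (\<forall>k. Ck_on k U g) \<and> (\<forall>y\<in>M \<inter> U. g y = \<nu> y)"
        using open_U M_subset_U[OF p Rp(2)] by blast
    qed
    fix p assume p: "p \<in> M"
    define R where "R = norm (fst p) + 1"
    have Rp: "R > 0" "norm (fst p) < R" by (auto simp: R_def add_nonneg_pos)
    interpret profile_chart M R h "ys A" "Qs A" by (rule chart[OF Rp(1)])
    obtain \<omega> :: "real^'n" and \<theta> :: "real^'m" where pp: "norm \<omega> = 1" "norm \<theta> = 1"
      "p = (norm (fst p) *\<^sub>R \<omega>, - cos (ys A (norm (fst p))), sin (ys A (norm (fst p))) *\<^sub>R \<theta>)"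
      by (rule M_point[OF p Rp(2)], rule that)
    note n = normal_at[OF norm_ge_zero Rp(2) pp]
    show "norm (\<nu> p) = 1" "\<nu> p \<in> tangent_space RnSm p" using n(1,2) by (simp_all add: \<nu>_def)
    show "\<nu> p \<bullet> z = 0" if "z \<in> tangent_space M p" for z using n(3)[OF that] by (simp add: \<nu>_def)
    show "has_mean_curvature_at RnSm M \<nu> p h"
      by (rule curvature_at[OF norm_ge_zero Rp(2) pp]) (simp add: \<nu>_def)
  qed
  ultimately show "\<exists>\<phi> \<sigma> \<nu>. generating_curve \<phi> \<sigma> \<and> \<phi> 0 = (0, A) \<and> \<sigma> 0 = 0 \<and> M = generated_hypersurface \<phi> \<and>
       lifts_curve_normal \<phi> \<sigma> \<nu> \<and> constant_mean_curvature RnSm M \<nu> h" by blast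
qed

end

section \<open>The critical profile near the pole\<close>

context cmc
begin

context
  fixes A R :: real
  assumes crit: "critical A R" and y10: "y1 A R = 0"
begin

lemma ys_tendsto_0: "(ys A \<longlongrightarrow> 0) (at_left R)"
  using crit_y1(1)[OF crit] y10 by simp

lemma crit_lx: "\<bar>x\<bar> < R \<Longrightarrow> life A \<bar>x\<bar>"
  by (rule crit_basic(4)[OF crit])

text \<open>In terms of \<open>r = sin y\<close> the function \<open>C = cos \<sigma>\<close> again satisfies an equation with a regular
  singularity, \<open>C' + l C / r = \<Theta>(r)\<close>, whence \<open>C = r * B r\<close> with \<open>B\<close> smooth and even.\<close>

lemma crit_pole:
  obtains r2 :: real and X B :: "real \<Rightarrow> real" where "0 < r2" "r2 < 1"
    "smooth_on {-r2<..<r2} X" "smooth_on {-r2<..<r2} B"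
    "\<And>r. X (- r) = X r" "\<And>r. B (- r) = B r" "X 0 = R" "B 0 = (h - real k / R) / (real l + 1)"
    "\<And>r. \<bar>r\<bar> < r2 \<Longrightarrow> \<bar>r * B r\<bar> < 1" "\<And>r. \<bar>r\<bar> < r2 \<Longrightarrow> 0 < X r" "\<And>r. \<bar>r\<bar> < r2 \<Longrightarrow> 0 < B r"
    "\<And>r. \<bar>r\<bar> < r2 \<Longrightarrow> (X has_real_derivative - (r * B r) / (sqrt (1 - (r * B r)\<^sup>2) * sqrt (1 - r\<^sup>2))) (at r)"
    "\<And>r. 0 < r \<Longrightarrow> r < r2 \<Longrightarrow> X r < R"
    "\<And>r. 0 < r \<Longrightarrow> r < r2 \<Longrightarrow> sin (ys A (X r)) = r"
    "\<And>r. 0 < r \<Longrightarrow> r < r2 \<Longrightarrow> cos (ys A (X r)) = sqrt (1 - r\<^sup>2)"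
    "\<And>r. 0 < r \<Longrightarrow> r < r2 \<Longrightarrow> sqrt (1 - (Ss A (X r))\<^sup>2) = r * B r"
    "\<And>x. 0 \<le> x \<Longrightarrow> x < R \<Longrightarrow> 0 < cos (ys A x) \<Longrightarrow> sin (ys A x) < r2 \<Longrightarrow> X (sin (ys A x)) = x"
proof -
  note Rp = crit_basic(3)[OF crit]
  have "\<forall>\<^sub>F x in at_left R. ys A x < pi / 2"
    by (rule order_tendstoD(2)[OF ys_tendsto_0]) (use pi_gt_zero in simp)
  then obtain x2' where x2': "x2' < R" "\<And>x. x2' < x \<Longrightarrow> x < R \<Longrightarrow> ys A x < pi / 2"
    unfolding eventually_at_left_field by blast
  \<comment> \<open>Beyond \<open>x2\<close> the height is below \<open>pi / 2\<close> and
    decreasing, so \<open>sin y\<close> decreases strictly and can replace \<open>x\<close> as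
    parameter.\<close>
  define x2 where "x2 = (max 0 x2' + R) / 2"
  have x2: "0 < x2" "x2 < R" "x2' < x2" using x2'(1) Rp by (auto simp: x2_def max_def)
  have yr: "0 < ys A x" "ys A x < pi / 2" if "x2 \<le> x" "x < R" for x
    using ranges(1)[OF crit_lx, of x] x2'(2)[of x] that x2 by auto
  define \<rho> where "\<rho> x = sin (ys A x)" for x
  have d\<rho>: "(\<rho> has_real_derivative cos (ys A x) * F1 (Ss A x)) (at x)" if "x2 \<le> x" "x < R" for x
  proof -
    have "\<bar>x\<bar> < R" using that x2 by simp
    from DERIV_chain2[OF DERIV_sin crit_DERIV(1)[OF crit this]] show ?thesis
      unfolding \<rho>_def[abs_def] .
  qed
  have cosp: "cos (ys A x) > 0" if "x2 \<le> x" "x < R" for x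
    using yr[OF that] by (intro cos_gt_zero_pi) auto
  have Sneg: "Ss A x < 0" and S1: "\<bar>Ss A x\<bar> < 1" if "x2 \<le> x" "x < R" for x
    using crit_Ss_le(2)[OF crit, of x] ranges(3)[OF crit_lx, of x] that x2 by auto
  have d\<rho>neg: "cos (ys A x) * F1 (Ss A x) < 0" if "x2 \<le> x" "x < R" for x
    using cosp[OF that] F1_sign(1)[OF S1[OF that] Sneg[OF that]] by (rule mult_pos_neg)
  have anti: "\<rho> y < \<rho> x" if "x2 \<le> x" "x < y" "y < R" for x y
    by (rule DERIV_neg_imp_decreasing[OF that(2)])
       (use d\<rho> d\<rho>neg that in \<open>metis order_trans le_less_trans\<close>)
  define r2 where "r2 = \<rho> x2"
  have r2: "0 < r2" "r2 < 1"
  proof -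
    show "0 < r2" unfolding r2_def \<rho>_def using yr[of x2] x2 pi_gt_zero by (intro sin_gt_zero) auto
    have "sin (ys A x2) < sin (pi / 2)" using yr[of x2] x2 pi_gt_zero by (intro sin_monotone_2pi) auto
    then show "r2 < 1" by (simp add: r2_def \<rho>_def)
  qed
  have "(\<rho> \<longlongrightarrow> sin 0) (at_left R)" unfolding \<rho>_def by (intro tendsto_intros ys_tendsto_0)
  then have \<rho>0: "(\<rho> \<longlongrightarrow> 0) (at_left R)" by simp
  have ex: "\<exists>x. x2 < x \<and> x < R \<and> \<rho> x = r" if r: "0 < r" "r < r2" for r
  proof -
    have "\<forall>\<^sub>F x in at_left R. \<rho> x < r \<and> x2 < x \<and> x < R"
      using order_tendstoD(2)[OF \<rho>0 r(1)] ev_left[OF x2(2)] by eventually_elim auto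
    then obtain x3 where x3: "\<rho> x3 < r" "x2 < x3" "x3 < R"
      using eventually_happens'[of "at_left R"] by auto
    have "\<forall>x. x2 \<le> x \<and> x \<le> x3 \<longrightarrow> isCont \<rho> x"
    proof (intro allI impI)
      fix x assume "x2 \<le> x \<and> x \<le> x3"
      then show "isCont \<rho> x" using DERIV_isCont[OF d\<rho>[of x]] x3(3) by auto
    qed
    then obtain x where "x2 \<le> x" "x \<le> x3" "\<rho> x = r"
      using IVT2[of \<rho> x3 r x2] x3 r(2) by (auto simp: r2_def)
    moreover have "x \<noteq> x2" using \<open>\<rho> x = r\<close> r(2) r2_def by auto
    ultimately show ?thesis using x3(3) by (intro exI[of _ x]) auto
  qed
  \<comment> \<open>The inverse of \<open>\<rho>\<close>, extended evenly in \<open>r\<close> and by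
    the end value \<open>R\<close> at \<open>r = 0\<close>.\<close>
  define X where "X r = (if r = 0 then R else SOME x. x2 < x \<and> x < R \<and> \<rho> x = \<bar>r\<bar>)" for r
  have X: "x2 < X r" "X r < R" "\<rho> (X r) = r" if "0 < r" "r < r2" for r
    using someI_ex[OF ex[OF that]] that by (auto simp: X_def)
  have Xeven: "X (- r) = X r" for r by (simp add: X_def)
  have X\<rho>: "X (\<rho> x) = x" if "x2 < x" "x < R" for x
  proof -
    have "0 < \<rho> x" unfolding \<rho>_def using yr[of x] that pi_gt_zero by (intro sin_gt_zero) auto
    moreover have "\<rho> x < r2" unfolding r2_def by (rule anti) (use that in auto)
    ultimately have Xx: "x2 < X (\<rho> x)" "X (\<rho> x) < R" "\<rho> (X (\<rho> x)) = \<rho> x" using X by blast+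
    show ?thesis
    proof (rule ccontr)
      assume "X (\<rho> x) \<noteq> x"
      then have "X (\<rho> x) < x \<or> x < X (\<rho> x)" by auto
      then show False using anti[of "X (\<rho> x)" x] anti[of x "X (\<rho> x)"] Xx that by auto
    qed
  qed
  \<comment> \<open>\<open>cos \<sigma>\<close> as a function of \<open>r\<close>, extended as an
    odd function, since it is to become \<open>r\<close> times an even one.\<close>
  define Ct where "Ct r = (if r = 0 then 0 else sgn r * sqrt (1 - (Ss A (X r))\<^sup>2))" for r
  have Ct_odd: "Ct (- r) = - Ct r" for r by (simp add: Ct_def Xeven sgn_minus)
  have Ctp: "0 < Ct r" "Ct r < 1" "Ct r = sqrt (1 - (Ss A (X r))\<^sup>2)" "Ss A (X r) = - sqrt (1 - (Ct r)\<^sup>2)"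
    if r: "0 < r" "r < r2" for r
  proof -
    have x: "x2 \<le> X r" "X r < R" "\<bar>X r\<bar> < R" using X(1,2)[OF r] x2(1) by auto
    show c: "Ct r = sqrt (1 - (Ss A (X r))\<^sup>2)" using r by (simp add: Ct_def)
    show "0 < Ct r" using ranges(5)[OF crit_lx[OF x(3)]] c by simp
    have "(Ss A (X r))\<^sup>2 > 0" using Sneg[OF x(1,2)] by simp
    then show "Ct r < 1" unfolding c by simp
    have "1 - (Ct r)\<^sup>2 = (Ss A (X r))\<^sup>2" unfolding c using ranges(7)[OF crit_lx[OF x(3)]] by simp
    then show "Ss A (X r) = - sqrt (1 - (Ct r)\<^sup>2)" using Sneg[OF x(1,2)] by simp
  qed
  let ?I = "{-r2<..<r2}"
  have I: "convex ?I" "0 \<in> ?I" "open ?I" using r2(1) by (auto simp: convex_real_interval)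
  have Ct1: "\<bar>Ct r\<bar> < 1" if "r \<in> ?I" for r
  proof (cases r "0::real" rule: linorder_cases)
    case less
    then have "\<bar>Ct (- r)\<bar> < 1" using Ctp(1,2)[of "- r"] that by auto
    then show ?thesis by (simp add: Ct_odd)
  next
    case equal then show ?thesis by (simp add: Ct_def)
  next
    case greater
    then show ?thesis using Ctp(1,2)[of r] that by auto
  qed
  have Xpos: "X r > 0" if "r \<in> ?I" for r
  proof (cases r "0::real" rule: linorder_cases)
    case less
    then have "0 < X (- r)" using X(1)[of "- r"] x2 that by auto
    then show ?thesis by (simp add: Xeven)
  next
    case equal then show ?thesis using Rp by (simp add: X_def)
  next
    case greater
    then show ?thesis using X(1)[of r] x2 that by auto
  qed
  have cosX: "cos (ys A (X r)) = sqrt (1 - r\<^sup>2)" if r: "0 < r" "r < r2" for r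
  proof -
    have "cos (ys A (X r)) > 0" using cosp[of "X r"] X[OF r] by simp
    moreover have "(cos (ys A (X r)))\<^sup>2 = 1 - r\<^sup>2" using X(3)[OF r] by (simp add: \<rho>_def cos_squared_eq)
    ultimately show ?thesis by (metis less_imp_le real_sqrt_unique)
  qed
  \<comment> \<open>\<open>G\<close> is the derivative of \<open>X\<close>, and
    \<open>\<Theta>\<close> is what remains of the derivative of \<open>Ct\<close> when the singular
    term \<open>- l * Ct / r\<close> is split off.\<close>
  define G where "G r = - Ct r / (sqrt (1 - (Ct r)\<^sup>2) * sqrt (1 - r\<^sup>2))" for r
  define \<Theta> where "\<Theta> r = (h - real k * sqrt (1 - (Ct r)\<^sup>2) / X r) / sqrt (1 - r\<^sup>2)" for r
  have F1eq: "F1 (Ss A (X r)) = - sqrt (1 - (Ct r)\<^sup>2) / Ct r" if r: "0 < r" "r < r2" for r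
    unfolding F1_def Ctp(3)[OF r, symmetric] by (simp only: Ctp(4)[OF r])
  have q0: "sqrt (1 - (Ct r)\<^sup>2) > 0" if r: "0 < r" "r < r2" for r
    using one_minus_square_pos[of "Ct r"] Ctp(1,2)[OF r] by simp
  have dX: "(X has_real_derivative G r) (at r)" if r: "0 < r" "r < r2" for r
  proof -
    note x = X[OF r]
    define a where "a = (x2 + X r) / 2"
    define b where "b = (X r + R) / 2"
    have ab: "x2 < a" "a < X r" "X r < b" "b < R" using x by (auto simp: a_def b_def)
    have "isCont X (\<rho> (X r))"
    proof (rule isCont_inverse_function2[OF ab(2,3)])
      fix z assume z: "a \<le> z" "z \<le> b"
      show "X (\<rho> z) = z" by (rule X\<rho>) (use z ab in auto)
      show "isCont \<rho> z" by (rule DERIV_isCont[OF d\<rho>]) (use z ab in auto)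
    qed
    then have iX: "isCont X r" by (simp add: x(3))
    have ne: "cos (ys A (X r)) * F1 (Ss A (X r)) \<noteq> 0" using d\<rho>neg[of "X r"] x by auto
    have "(X has_real_derivative inverse (cos (ys A (X r)) * F1 (Ss A (X r)))) (at r)"
      by (rule DERIV_inverse_function[OF d\<rho> ne r _ iX]) (use x X(3) in auto)
    moreover have "inverse (cos (ys A (X r)) * F1 (Ss A (X r))) = G r"
      unfolding F1eq[OF r] cosX[OF r] G_def by (simp add: divide_inverse mult_ac)
    ultimately show ?thesis by simp
  qed
  have dCt: "(Ct has_real_derivative \<Theta> r - real l * Ct r / r) (at r)" if r: "0 < r" "r < r2" for r
  proof -
    note x = X[OF r] and c = Ctp[OF r]
    have xR: "\<bar>X r\<bar> < R" using x x2 by simp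
    have Cp: "sqrt (1 - (Ss A (X r))\<^sup>2) > 0" using c(1,3) by simp
    have qp: "0 < sqrt (1 - r\<^sup>2)" using cosX[OF r] cosp[of "X r"] x by simp
    have Q: "real k * Qs A (X r) = real k * Ss A (X r) / X r"
      using Ss_eq[OF crit_lx[OF xR]] x x2 by simp
    have "((\<lambda>r. sqrt (1 - (Ss A (X r))\<^sup>2)) has_real_derivative
        - F1 (Ss A (X r)) * (F2 (ys A (X r)) (Ss A (X r)) - real k * Qs A (X r)) * G r) (at r)"
      by (rule DERIV_chain2[OF crit_DERIV(3)[OF crit xR] dX[OF r]])
    moreover have "- F1 (Ss A (X r)) * (F2 (ys A (X r)) (Ss A (X r)) - real k * Qs A (X r)) * G r
        = \<Theta> r - real l * Ct r / r"
    proof -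
      have g: "F1 (Ss A (X r)) * G r = inverse (sqrt (1 - r\<^sup>2))"
        unfolding F1eq[OF r] G_def using c(1) q0[OF r] qp by (simp add: field_simps)
      have f2: "F2 (ys A (X r)) (Ss A (X r)) = real l * (sqrt (1 - r\<^sup>2) / r) * Ct r - h"
        unfolding F2_def cot_def cosX[OF r] x(3)[unfolded \<rho>_def] c(3) ..
      have Q': "real k * Qs A (X r) = - (real k * sqrt (1 - (Ct r)\<^sup>2) / X r)"
        unfolding Q by (subst c(4)) simp
      have "- F1 (Ss A (X r)) * (F2 (ys A (X r)) (Ss A (X r)) - real k * Qs A (X r)) * G r
          = - (F1 (Ss A (X r)) * G r) * (F2 (ys A (X r)) (Ss A (X r)) - real k * Qs A (X r))"
        by (simp only: mult_ac minus_mult_left)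
      also have "\<dots> = - inverse (sqrt (1 - r\<^sup>2)) * (real l * (sqrt (1 - r\<^sup>2) / r) * Ct r - h + real k * sqrt (1 - (Ct r)\<^sup>2) / X r)"
        unfolding g f2 Q' by simp
      also have "\<dots> = \<Theta> r - real l * Ct r / r"
        unfolding \<Theta>_def using qp r x x2 by (simp add: field_simps)
      finally show ?thesis .
    qed
    moreover have "\<forall>\<^sub>F s in nhds r. sqrt (1 - (Ss A (X s))\<^sup>2) = Ct s"
    proof -
      have "\<forall>\<^sub>F s in nhds r. s \<in> {0<..<r2}" by (rule eventually_nhds_in_open) (use r in auto)
      then show ?thesis by (rule eventually_mono) (use Ctp(3) in auto)
    qed
    ultimately show ?thesis using DERIV_cong_ev[OF refl _ refl] by metis
  qed
  have contX0: "isCont X 0"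
    unfolding isCont_def
  proof (rule LIM_I)
    fix e :: real assume e: "e > 0"
    define x3 where "x3 = max ((x2 + R) / 2) (R - e / 2)"
    have x3: "x2 < x3" "x3 < R" "R - e < x3" using x2 e by (auto simp: x3_def max_def)
    have pos: "\<rho> x3 > 0" unfolding \<rho>_def using yr[of x3] x3 pi_gt_zero by (intro sin_gt_zero) auto
    have key: "\<bar>X r - R\<bar> < e" if r: "0 < r" "r < \<rho> x3" for r
    proof -
      have "\<rho> x3 < r2" unfolding r2_def by (rule anti) (use x3 in auto)
      then have rr: "0 < r" "r < r2" using r by auto
      have "X r > x3"
      proof (rule ccontr)
        assume "\<not> X r > x3"
        then have "\<rho> x3 \<le> \<rho> (X r)" using anti[of "X r" x3] X(1)[OF rr] x3 by (cases "X r = x3") auto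
        then show False using X(3)[OF rr] r(2) by simp
      qed
      then show ?thesis using X(2)[OF rr] x3(3) by simp
    qed
    show "\<exists>s>0. \<forall>r::real. r \<noteq> 0 \<and> norm (r - 0) < s \<longrightarrow> norm (X r - X 0) < e"
    proof (intro exI conjI allI impI)
      fix r :: real assume r: "r \<noteq> 0 \<and> norm (r - 0) < \<rho> x3"
      then have "\<bar>X (\<bar>r\<bar>) - R\<bar> < e" by (intro key) auto
      moreover have "X (\<bar>r\<bar>) = X r" by (simp add: abs_if Xeven)
      ultimately show "norm (X r - X 0) < e" by (simp add: X_def)
    qed (rule pos)
  qed
  have Ct0: "Ct 0 = 0" by (simp add: Ct_def)
  \<comment> \<open>Here the energy enters: \<open>crit_C_le\<close> bounds
    \<open>cos \<sigma>\<close> by \<open>h * y\<close>, and \<open>y = arcsin r\<close>.\<close>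
  have contCt0: "isCont Ct 0"
    unfolding isCont_def Ct0
  proof (rule Lim_null_comparison)
    have "\<forall>\<^sub>F r in at 0. r \<in> ?I - {0}"
      using eventually_at_in_open[OF I(3), of 0] I(2) by simp
    then show "\<forall>\<^sub>F r in at 0. norm (Ct r) \<le> h * arcsin (\<bar>r\<bar>)"
    proof (rule eventually_mono)
      fix r assume "r \<in> ?I - {0}"
      then have r: "0 < \<bar>r\<bar>" "\<bar>r\<bar> < r2" by auto
      have "\<bar>Ct r\<bar> = Ct (\<bar>r\<bar>)"
      proof (cases "r > 0")
        case True then show ?thesis using Ctp(1)[OF r] by simp
      next
        case False
        then have "\<bar>r\<bar> = - r" by simp
        then show ?thesis using Ctp(1)[OF r] Ct_odd[of r] by simp
      qed
      also have "\<dots> \<le> h * ys A (X (\<bar>r\<bar>))"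
        unfolding Ctp(3)[OF r] using X[OF r] x2 yr[of "X (\<bar>r\<bar>)"] by (intro crit_C_le[OF crit]) auto
      also have "ys A (X (\<bar>r\<bar>)) = arcsin (\<bar>r\<bar>)"
        using X[OF r] yr[of "X (\<bar>r\<bar>)"] arcsin_sin[of "ys A (X (\<bar>r\<bar>))"] by (simp add: \<rho>_def)
      finally show "norm (Ct r) \<le> h * arcsin (\<bar>r\<bar>)" by simp
    qed
    have "((\<lambda>r. h * arcsin (\<bar>r\<bar>)) \<longlongrightarrow> h * arcsin (\<bar>0\<bar>)) (at 0)"
      by (intro tendsto_intros isCont_tendsto_compose[of _ arcsin] isCont_arcsin) auto
    then show "((\<lambda>r. h * arcsin (\<bar>r\<bar>)) \<longlongrightarrow> 0) (at 0)" by simp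
  qed
  have isC: "isCont X r" "isCont Ct r" if rI: "r \<in> ?I" for r
  proof -
    have pos: "isCont X s" "isCont Ct s" if "0 < s" "s < r2" for s
      by (rule DERIV_isCont[OF dX[OF that]] DERIV_isCont[OF dCt[OF that]])+
    have "isCont X r \<and> isCont Ct r"
    proof (cases r "0::real" rule: linorder_cases)
      case less
      then have m: "isCont X (- r)" "isCont Ct (- r)" using pos[of "- r"] rI by auto
      have u: "isCont uminus r" by (intro continuous_intros)
      have "isCont (\<lambda>s. X (- s)) r" "isCont (\<lambda>s. - Ct (- s)) r"
        using isCont_o2[OF u m(1)] isCont_minus[OF isCont_o2[OF u m(2)]] by auto
      then show ?thesis by (simp add: Xeven Ct_odd)
    next
      case equal then show ?thesis using contX0 contCt0 by simp
    next
      case greater then show ?thesis using pos rI by auto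
    qed
    then show "isCont X r" "isCont Ct r" by auto
  qed
  have cX: "continuous_on ?I X" and cCt: "continuous_on ?I Ct"
    using isC by (auto intro!: continuous_at_imp_continuous_on)
  have q1: "1 - (Ct r)\<^sup>2 > 0" and q2: "1 - r\<^sup>2 > 0" if "r \<in> ?I" for r
    using one_minus_square_pos[OF Ct1[OF that]] one_minus_square_pos[of r] that r2 by auto
  have q1': "sqrt (1 - (Ct r)\<^sup>2) \<noteq> 0" and q2': "sqrt (1 - r\<^sup>2) \<noteq> 0" and X0: "X r \<noteq> 0" if "r \<in> ?I" for r
    using q1[OF that] q2[OF that] Xpos[OF that] by auto
  have cG: "continuous_on ?I G" and c\<Theta>: "continuous_on ?I \<Theta>"
    unfolding G_def[abs_def] \<Theta>_def[abs_def] using cX cCt q1' q2' X0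
    by (auto intro!: continuous_intros)
  have Godd: "G (- r) = - G r" and \<Theta>even: "\<Theta> (- r) = \<Theta> r" for r
    by (simp_all add: G_def \<Theta>_def Ct_odd Xeven)
  have avgGodd: "avg 0 G (- r) = - avg 0 G r" for r
    unfolding avg_uminus Godd by (simp add: avg_def)
  define B where "B = avg l \<Theta>"
  have Beven: "B (- r) = B r" for r unfolding B_def avg_uminus \<Theta>even ..
  have Xeq0: "X r = R + r * avg 0 G r" if r: "0 < r" "r < r2" for r
  proof -
    have sub: "{0..r} \<subseteq> ?I" using r by auto
    have "X r - r * avg 0 G r = X 0 - 0 * avg 0 G 0"
    proof (rule DERIV_isconst_end[OF r(1), of "\<lambda>s. X s - s * avg 0 G s"])
      show "continuous_on {0..r} (\<lambda>s. X s - s * avg 0 G s)"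
        by (intro continuous_intros continuous_on_subset[OF cX sub]
            continuous_on_subset[OF continuous_on_avg[OF I(1,2) cG] sub])
      fix s assume s: "0 < s" "s < r"
      have "s \<in> ?I" using s r by auto
      have "((\<lambda>s. X s - s * avg 0 G s) has_real_derivative G s - (G s - real 0 * avg 0 G s)) (at s)"
        by (rule DERIV_diff[OF dX DERIV_mult_avg[OF I cG \<open>s \<in> ?I\<close>]]) (use s r in auto)
      then show "((\<lambda>s. X s - s * avg 0 G s) has_real_derivative 0) (at s)" by simp
    qed
    then show ?thesis by (simp add: X_def)
  qed
  have Cteq0: "Ct r = r * B r" if r: "0 < r" "r < r2" for r
  proof -
    have sub: "{0..r} \<subseteq> ?I" using r by auto
    \<comment> \<open>\<open>Ct\<close> and \<open>r * avg l \<Theta> r\<close> solve the same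
      singular equation, so they differ by a multiple of \<open>r ^ (- l)\<close>: the product with
      \<open>r ^ l\<close> is constant. Continuity of both at \<open>0\<close> and
      \<open>l \<ge> 1\<close> make this constant \<open>0\<close>.\<close>
    have "r ^ l * (Ct r - r * avg l \<Theta> r) = 0 ^ l * (Ct 0 - 0 * avg l \<Theta> 0)"
    proof (rule DERIV_isconst_end[OF r(1), of "\<lambda>s. s ^ l * (Ct s - s * avg l \<Theta> s)"])
      show "continuous_on {0..r} (\<lambda>s. s ^ l * (Ct s - s * avg l \<Theta> s))"
        by (intro continuous_intros continuous_on_subset[OF cCt sub]
            continuous_on_subset[OF continuous_on_avg[OF I(1,2) c\<Theta>] sub])
      fix s assume s: "0 < s" "s < r"
      have "s \<in> ?I" using s r by auto
      have "((\<lambda>s. Ct s - s * avg l \<Theta> s) has_real_derivative (\<Theta> s - real l * Ct s / s) - (\<Theta> s - real l * avg l \<Theta> s)) (at s)"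
        by (rule DERIV_diff[OF dCt DERIV_mult_avg[OF I c\<Theta> \<open>s \<in> ?I\<close>]]) (use s r in auto)
      from DERIV_mult[OF DERIV_pow[of l s] this]
      have "((\<lambda>s. s ^ l * (Ct s - s * avg l \<Theta> s)) has_real_derivative
          real l * s ^ (l - Suc 0) * (Ct s - s * avg l \<Theta> s) +
          ((\<Theta> s - real l * Ct s / s) - (\<Theta> s - real l * avg l \<Theta> s)) * s ^ l) (at s)" by simp
      moreover have "real l * s ^ (l - Suc 0) * (Ct s - s * avg l \<Theta> s) +
          ((\<Theta> s - real l * Ct s / s) - (\<Theta> s - real l * avg l \<Theta> s)) * s ^ l = 0"
        using l s(1) by (cases l) (auto simp: field_simps)
      ultimately show "((\<lambda>s. s ^ l * (Ct s - s * avg l \<Theta> s)) has_real_derivative 0) (at s)" by simp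
    qed
    then show ?thesis using r(1) l by (simp add: B_def Ct0)
  qed
  have Xeq: "X r = R + r * avg 0 G r" and Cteq: "Ct r = r * B r" if "r \<in> ?I" for r
  proof -
    have "X r = R + r * avg 0 G r \<and> Ct r = r * B r"
    proof (cases r "0::real" rule: linorder_cases)
      case less
      then show ?thesis
        using Xeq0[of "- r"] Cteq0[of "- r"] that by (simp add: Xeven Ct_odd Beven avgGodd)
    next
      case equal then show ?thesis by (simp add: X_def Ct0)
    next
      case greater then show ?thesis using Xeq0 Cteq0 that by auto
    qed
    then show "X r = R + r * avg 0 G r" "Ct r = r * B r" by auto
  qed
  have ev: "\<forall>\<^sub>F s in nhds r. s \<in> ?I" if "r \<in> ?I" for r by (rule eventually_nhds_in_open[OF I(3) that])
  have DX: "(X has_real_derivative G r) (at r)" if "r \<in> ?I" for r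
  proof -
    have e: "\<forall>\<^sub>F s in nhds r. X s = R + s * avg 0 G s" using ev[OF that] by (rule eventually_mono) (rule Xeq)
    have "((\<lambda>s. R + s * avg 0 G s) has_real_derivative 0 + (G r - real 0 * avg 0 G r)) (at r)"
      by (rule DERIV_add[OF DERIV_const DERIV_mult_avg[OF I cG that]])
    then have d: "((\<lambda>s. R + s * avg 0 G s) has_real_derivative G r) (at r)" by simp
    show ?thesis by (rule DERIV_cong_ev[OF refl e refl, THEN iffD2, OF d])
  qed
  have DC: "(Ct has_real_derivative \<Theta> r - real l * B r) (at r)" if "r \<in> ?I" for r
  proof -
    have e: "\<forall>\<^sub>F s in nhds r. Ct s = s * B s" using ev[OF that] by (rule eventually_mono) (rule Cteq)
    have d: "((\<lambda>s. s * B s) has_real_derivative \<Theta> r - real l * B r) (at r)"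
      unfolding B_def by (rule DERIV_mult_avg[OF I c\<Theta> that])
    show ?thesis by (rule DERIV_cong_ev[OF refl e refl, THEN iffD2, OF d])
  qed
  have sq: "Ck_on j ?I (\<lambda>r. sqrt (1 - (Ct r)\<^sup>2))" if "Ck_on j ?I Ct" for j
    by (rule Ck_on_sqrt[OF I(3) Ck_on_diff[OF I(3) Ck_on_const Ck_on_power[OF I(3) that]] q1])
  have sq2: "Ck_on j ?I (\<lambda>r. sqrt (1 - r\<^sup>2))" for j
    by (rule Ck_on_sqrt[OF I(3) Ck_on_diff[OF I(3) Ck_on_const Ck_on_power[OF I(3) Ck_on_ident[OF I(3)]]] q2])
  have kG: "Ck_on j ?I G" if "Ck_on j ?I Ct" for j
    unfolding G_def[abs_def]
    by (intro Ck_on_divide Ck_on_minus Ck_on_mult sq sq2 that I) (use q1' q2' in auto)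
  have k\<Theta>: "Ck_on j ?I \<Theta>" if "Ck_on j ?I Ct" "Ck_on j ?I X" for j
    unfolding \<Theta>_def[abs_def]
    by (intro Ck_on_divide Ck_on_diff Ck_on_mult Ck_on_const sq sq2 that I X0 q2')
  have kB: "Ck_on j ?I B" if "Ck_on j ?I Ct" "Ck_on j ?I X" for j
    unfolding B_def by (rule Ck_on_avg[OF I k\<Theta>[OF that]])
  have kk: "Ck_on j ?I X \<and> Ck_on j ?I Ct" for j
  proof (induction j)
    case 0 then show ?case using cX cCt by simp
  next
    case (Suc j)
    then have c: "Ck_on j ?I X" "Ck_on j ?I Ct" by auto
    show ?case
      by (intro conjI Ck_on_real_SucI[OF I(3) DX] Ck_on_real_SucI[OF I(3) DC] kG k\<Theta> kB Ck_on_diff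
          Ck_on_mult Ck_on_const c I)
  qed
  have B0: "B 0 = (h - real k / R) / (real l + 1)"
    unfolding B_def avg_zero by (simp add: \<Theta>_def Ct0 X_def)
  \<comment> \<open>For \<open>r \<noteq> 0\<close> this is \<open>cos \<sigma> > 0\<close>; at
    \<open>r = 0\<close> it is the inequality \<open>k / R < h\<close>.\<close>
  have Bpos: "B r > 0" if "r \<in> ?I" for r
  proof -
    have p: "B s > 0" if "0 < s" "s < r2" for s
      using Ctp(1)[OF that] Cteq0[OF that] that(1) by (simp add: zero_less_mult_iff)
    show ?thesis
    proof (cases r "0::real" rule: linorder_cases)
      case less then show ?thesis using p[of "- r"] that by (simp add: Beven)
    next
      case equal
      have "0 < h - real k / R" using crit_h[OF crit] by simp
      then show ?thesis unfolding equal B0 by (intro divide_pos_pos) auto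
    next
      case greater then show ?thesis using p that by auto
    qed
  qed
  show ?thesis
  proof (rule that[of r2 X B])
    show "smooth_on ?I X" "smooth_on ?I B" using kk kB by blast+
    fix r :: real assume "\<bar>r\<bar> < r2"
    then have rI: "r \<in> ?I" by auto
    show "\<bar>r * B r\<bar> < 1" using Ct1[OF rI] Cteq[OF rI] by simp
    show "0 < X r" "0 < B r" by (rule Xpos[OF rI], rule Bpos[OF rI])
    show "(X has_real_derivative - (r * B r) / (sqrt (1 - (r * B r)\<^sup>2) * sqrt (1 - r\<^sup>2))) (at r)"
      using DX[OF rI] Cteq[OF rI] by (simp add: G_def)
  next
    fix r :: real assume r: "0 < r" "r < r2"
    show "X r < R" by (rule X(2)[OF r])
    show "sin (ys A (X r)) = r" using X(3)[OF r] by (simp add: \<rho>_def)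
    show "cos (ys A (X r)) = sqrt (1 - r\<^sup>2)" by (rule cosX[OF r])
    show "sqrt (1 - (Ss A (X r))\<^sup>2) = r * B r" using Ctp(3)[OF r] Cteq0[OF r] by simp
  next
    fix x assume x: "0 \<le> x" "x < R" "0 < cos (ys A x)" "sin (ys A x) < r2"
    \<comment> \<open>Up to \<open>x2\<close> the height is at least that at \<open>x2\<close>, so
      \<open>cos y > 0\<close> would imply \<open>sin y \<ge> r2\<close>.\<close>
    have "x2 < x"
    proof (rule ccontr)
      assume "\<not> x2 < x"
      then have le: "ys A x2 \<le> ys A x" using x x2 by (intro crit_ys_anti[OF crit]) auto
      have xr: "0 < ys A x" "ys A x < pi" using ranges(1,2)[OF crit_lx, of x] x by auto
      have "ys A x \<le> pi / 2"
      proof (rule ccontr)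
        assume "\<not> ys A x \<le> pi / 2"
        then have "cos (ys A x) < 0" using xr by (intro cos_lt_zero_pi) auto
        then show False using x(3) by simp
      qed
      then have "sin (ys A x2) \<le> sin (ys A x)"
        using le yr[of x2] x2 pi_gt_zero by (intro sin_monotone_2pi_le) auto
      then show False using x(4) by (simp add: r2_def \<rho>_def)
    qed
    then show "X (sin (ys A x)) = x" using X\<rho>[of x] x(2) by (simp add: \<rho>_def)
  qed (use r2 Xeven Beven B0 in \<open>auto simp: X_def\<close>)
qed

end

end

section \<open>Hypersurfaces near the pole\<close>

lemma open_snd_ball: "open {p :: 'a::real_normed_vector \<times> 'b::real_normed_vector \<times> 'c::real_normed_vector. norm (snd (snd p)) < r}"
  by (intro open_Collect_less continuous_intros)

text \<open>A neighbourhood of the points over \<open>(R, 0)\<close>, where \<open>v\<close> no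
  longer parametrizes \<open>M\<close> but \<open>w\<close> does. Curvature is examined here only at
  \<open>w = 0\<close>, the other points being left to \<open>profile_chart\<close>; so of the
  equation for \<open>B\<close> just the value at \<open>0\<close> occurs.\<close>

locale pole_chart =
  fixes M :: "('n::finite, 'm::finite) ambient set" and R h r2 :: real and X B :: "real \<Rightarrow> real"
  assumes R: "R > 0" and r2: "0 < r2" "r2 < 1"
    and smooth_X: "smooth_on {-r2<..<r2} X" and smooth_B: "smooth_on {-r2<..<r2} B"
    and even_X: "\<And>r. X (- r) = X r" and even_B: "\<And>r. B (- r) = B r"
    and X_0: "X 0 = R" and X_pos: "\<And>r. \<bar>r\<bar> < r2 \<Longrightarrow> 0 < X r"
    and B_0: "B 0 = (h - (real CARD('n) - 1) / R) / real CARD('m)"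
    and rB: "\<And>r. \<bar>r\<bar> < r2 \<Longrightarrow> \<bar>r * B r\<bar> < 1"
    and M_subset: "M \<subseteq> RnSm"
    and M_graph: "\<And>p. fst (snd p) < 0 \<Longrightarrow> norm (snd (snd p)) < r2 \<Longrightarrow>
      p \<in> M \<longleftrightarrow> p \<in> RnSm \<and> norm (fst p) = X (norm (snd (snd p)))"
begin

definition S where "S r = - sqrt (1 - (r * B r)\<^sup>2)"
definition q2 where "q2 r = - (B r * r\<^sup>2)"
definition q3 where "q3 r = - (B r * sqrt (1 - r\<^sup>2))"
text \<open>The lifted normal once more, with \<open>sin y = r = norm w\<close> and
  \<open>cos \<sigma> = r * B r\<close>: the factor \<open>r\<close> cancels against
  \<open>\<theta> = w / r\<close>, and the last component becomes the smooth multiple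
  \<open>q3\<close> of \<open>w\<close>.\<close>

definition nu :: "('n, 'm) ambient \<Rightarrow> ('n, 'm) ambient"
  where "nu p = (S (norm (snd (snd p))) *\<^sub>R (inverse (norm (fst p)) *\<^sub>R fst p),
    q2 (norm (snd (snd p))), q3 (norm (snd (snd p))) *\<^sub>R snd (snd p))"
definition U :: "('n, 'm) ambient set" where "U = {p. fst p \<noteq> 0 \<and> norm (snd (snd p)) < r2}"

lemma open_U: "open U"
proof -
  have "open {p :: ('n, 'm) ambient. fst p \<noteq> 0}"
    by (intro open_Collect_neq continuous_intros)
  then show ?thesis unfolding U_def using open_snd_ball open_Collect_conj by blast
qed

lemma interval: "open {-r2<..<r2}" "0 \<in> {-r2<..<r2}" using r2 by auto

lemma smooth_S: "smooth_on {-r2<..<r2} S"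
proof
  fix k
  have "Ck_on k {-r2<..<r2} (\<lambda>r. sqrt (1 - (r * B r)\<^sup>2))"
  proof (rule Ck_on_sqrt[OF interval(1)])
    show "Ck_on k {-r2<..<r2} (\<lambda>r. 1 - (r * B r)\<^sup>2)"
      using smooth_B by (intro Ck_on_diff Ck_on_const Ck_on_power Ck_on_mult Ck_on_ident interval) auto
    show "0 < 1 - (r * B r)\<^sup>2" if "r \<in> {-r2<..<r2}" for r
      using rB[of r] one_minus_square_pos that by auto
  qed
  then show "Ck_on k {-r2<..<r2} S" unfolding S_def[abs_def] by (rule Ck_on_minus[OF interval(1)])
qed

lemma smooth_q: "smooth_on {-r2<..<r2} q2" "smooth_on {-r2<..<r2} q3"
proof -
  have sq: "Ck_on k {-r2<..<r2} (\<lambda>r. sqrt (1 - r\<^sup>2))" for k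
  proof (rule Ck_on_sqrt[OF interval(1)])
    show "Ck_on k {-r2<..<r2} (\<lambda>r. 1 - r\<^sup>2)" by (intro Ck_on_diff Ck_on_const Ck_on_power Ck_on_ident interval)
    show "0 < 1 - r\<^sup>2" if "r \<in> {-r2<..<r2}" for r
      using one_minus_square_pos[of r] that r2 by auto
  qed
  show "smooth_on {-r2<..<r2} q2" "smooth_on {-r2<..<r2} q3"
    unfolding q2_def[abs_def] q3_def[abs_def] using smooth_B sq
    by (auto intro!: Ck_on_minus Ck_on_mult Ck_on_power Ck_on_ident)
qed

lemma even: "S (- r) = S r" "q2 (- r) = q2 r" "q3 (- r) = q3 r"
  by (simp_all add: S_def q2_def q3_def even_B)

lemma smooth_radial_snd:
  fixes q :: "real \<Rightarrow> real"
  assumes "smooth_on {-r2<..<r2} q" "\<And>r. q (- r) = q r"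
  shows "Ck_on k {p :: ('n, 'm) ambient. norm (snd (snd p)) < r2} (\<lambda>p. q (norm (snd (snd p))))"
  by (rule Ck_on_compose[OF open_snd_ball open_ball _ Ck_on_snd[OF _ Ck_on_snd] Ck_on_radial[OF r2(1) assms(2,1)]])
     (auto intro: Ck_on_ident open_snd_ball)

lemma smooth_nu: "Ck_on k U nu"
proof -
  have sub: "U \<subseteq> {p. norm (snd (snd p)) < r2}" by (auto simp: U_def)
  note rad = Ck_on_subset[OF smooth_radial_snd sub]
  have w: "Ck_on k U (\<lambda>p. snd (snd p))" and v: "Ck_on k U fst"
    by (intro Ck_on_snd Ck_on_fst Ck_on_ident open_U)+
  show ?thesis
    unfolding nu_def[abs_def]
    by (intro Ck_on_Pair Ck_on_scaleR Ck_on_inverse Ck_on_norm open_U v w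
        rad[OF smooth_S even(1)] rad[OF smooth_q(1) even(2)] rad[OF smooth_q(2) even(3)])
       (auto simp: U_def)
qed

context
  fixes \<omega> :: "real^'n" and p :: "('n, 'm) ambient"
  assumes \<omega>: "norm \<omega> = 1" and p: "p = (R *\<^sub>R \<omega>, - 1, 0)"
begin

text \<open>At \<open>w = 0\<close> no direction is distinguished; any unit vector instantiates
  \<open>surface_point\<close>, and \<open>T\<close> becomes \<open>(0, 0, - \<theta>)\<close>, one
  of \<open>m\<close> equivalent directions.\<close>

definition \<theta> :: "real^'m" where "\<theta> = axis (SOME i. True) 1"

lemma \<theta>: "norm \<theta> = 1" by (simp add: \<theta>_def)

interpretation sp: surface_point M nu "R *\<^sub>R \<omega>" \<omega> \<theta> 0 "- 1" 0
  by standard (use \<omega> \<theta> in auto)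

lemma q_eq: "sp.q = (- 1, 0)" by (simp add: sp.q_def)

lemma p_eq: "p = (R *\<^sub>R \<omega>, sp.q)" by (simp add: p q_eq)

lemma N_eq: "sp.N = (- \<omega>, 0, 0)" by (simp add: sp.N_def)

lemma nu_p: "nu p = sp.N"
  using R \<omega> by (simp add: nu_def p N_eq S_def q2_def)

lemma p_in_M: "p \<in> M"
  using M_graph[of p] X_0 \<omega> R r2 by (simp add: p RnSm_def norm_Pair)

lemma radial_snd_derivative:
  fixes q :: "real \<Rightarrow> real"
  assumes "smooth_on {-r2<..<r2} q" "\<And>r. q (- r) = q r"
  shows "((\<lambda>w::real^'m. q (norm w)) has_derivative (\<lambda>b. 0)) (at 0)"
proof -
  have d: "(q has_real_derivative deriv q 0) (at 0)" by (rule smooth_on_real_deriv(1)[OF interval(1) assms(1) interval(2)])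
  have "deriv q 0 = 0" by (rule DERIV_even_zero[OF r2(1) _ d]) (rule assms(2))
  then have d0: "(q has_real_derivative 0) (at 0)" using d by simp
  have "((\<lambda>w::real^'m. q (norm w)) has_derivative (\<lambda>b. 0 * (\<theta> \<bullet> b))) (at 0)"
    by (rule has_derivative_radial[OF d0 _ \<theta>]) auto
  then show ?thesis by simp
qed

lemma near_p:
  fixes \<gamma> :: "real \<Rightarrow> ('n, 'm) ambient"
  assumes "isCont \<gamma> 0" "\<gamma> 0 = p"
  shows "\<forall>\<^sub>F t in nhds 0. fst (snd (\<gamma> t)) < 0 \<and> norm (snd (snd (\<gamma> t))) < r2"
proof -
  have "open {p :: ('n, 'm) ambient. fst (snd p) < 0 \<and> norm (snd (snd p)) < r2}" (is "open ?V")
    by (intro open_Collect_conj open_Collect_less continuous_intros)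
  moreover have "p \<in> ?V" using r2 by (simp add: p)
  moreover have "(\<gamma> \<longlongrightarrow> p) (at 0)" using assms by (simp add: isCont_def)
  ultimately have "\<forall>\<^sub>F t in at 0. \<gamma> t \<in> ?V" using topological_tendstoD by blast
  moreover have "\<gamma> 0 \<in> ?V" using assms(2) \<open>p \<in> ?V\<close> by simp
  ultimately have "\<forall>\<^sub>F t in nhds 0. \<gamma> t \<in> ?V" by (simp add: eventually_nhds_conv_at)
  then show ?thesis by simp
qed

text \<open>\<open>X\<close> is smooth and even, so \<open>X (norm w)\<close> is stationary at
  \<open>w = 0\<close>: to first order \<open>norm v\<close> stays equal to \<open>R\<close> while
  \<open>w\<close> moves freely.\<close>

lemma tangent_M: "tangent_space M p = {z. snd z \<bullet> sp.q = 0 \<and> z \<bullet> sp.N = 0}"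
proof (intro equalityI subsetI)
  fix z assume z: "z \<in> tangent_space M p"
  then obtain \<gamma> where \<gamma>: "\<gamma> 0 = p" "\<And>t. \<gamma> t \<in> M" "(\<gamma> has_vector_derivative z) (at 0)"
    by (auto simp: tangent_space_def)
  have zN: "z \<in> tangent_space RnSm p"
    using \<gamma> M_subset unfolding tangent_space_def by blast
  then have q0: "snd z \<bullet> sp.q = 0" unfolding p_eq tangent_space_RnSm[OF sp.norm_q] by simp
  obtain a \<tau> b where zz: "z = (a, \<tau>, b)" by (cases z)
  have dv: "((\<lambda>t. fst (\<gamma> t)) has_derivative (\<lambda>t. t *\<^sub>R a)) (at 0)"
    using bounded_linear.has_vector_derivative[OF bounded_linear_fst \<gamma>(3)] by (simp add: zz has_vector_derivative_def)
  have dw: "((\<lambda>t. snd (snd (\<gamma> t))) has_derivative (\<lambda>t. t *\<^sub>R b)) (at 0)"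
    using bounded_linear.has_vector_derivative[OF bounded_linear_snd bounded_linear.has_vector_derivative[OF bounded_linear_snd \<gamma>(3)]]
    by (simp add: zz has_vector_derivative_def)
  have g0: "fst (\<gamma> 0) = R *\<^sub>R \<omega>" "snd (snd (\<gamma> 0)) = 0" using \<gamma>(1) by (simp_all add: p)
  have nz: "R *\<^sub>R \<omega> \<noteq> 0" and sg: "sgn (R *\<^sub>R \<omega>) = \<omega>" using R \<omega> by (auto simp: sgn_div_norm)
  have "(norm has_derivative (\<lambda>a. a \<bullet> \<omega>)) (at (R *\<^sub>R \<omega>))"
    using has_derivative_norm[OF nz] sg by simp
  from has_derivative_compose[OF dv this[folded g0(1)]]
  have d1: "((\<lambda>t. norm (fst (\<gamma> t))) has_derivative (\<lambda>t. (t *\<^sub>R a) \<bullet> \<omega>)) (at 0)" .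
  from has_derivative_compose[OF dw radial_snd_derivative[OF smooth_X even_X, folded g0(2)]]
  have d2: "((\<lambda>t. X (norm (snd (snd (\<gamma> t))))) has_derivative (\<lambda>t. 0)) (at 0)" .
  have "isCont \<gamma> 0" using \<gamma>(3) has_vector_derivative_continuous by blast
  from near_p[OF this \<gamma>(1)]
  have "\<forall>\<^sub>F t in nhds 0. X (norm (snd (snd (\<gamma> t)))) = norm (fst (\<gamma> t))"
  proof (rule eventually_mono)
    fix t assume V: "fst (snd (\<gamma> t)) < 0 \<and> norm (snd (snd (\<gamma> t))) < r2"
    from M_graph[of "\<gamma> t"] V \<gamma>(2)[of t] show "X (norm (snd (snd (\<gamma> t)))) = norm (fst (\<gamma> t))" by simp
  qed
  then obtain V where V: "open V" "0 \<in> V" "\<And>t. t \<in> V \<Longrightarrow> X (norm (snd (snd (\<gamma> t)))) = norm (fst (\<gamma> t))"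
    unfolding eventually_nhds by blast
  have "((\<lambda>t. norm (fst (\<gamma> t))) has_derivative (\<lambda>t. 0)) (at 0)"
    by (rule has_derivative_transform_within_open[OF d2 V])
  from has_derivative_unique[OF d1 this] have "(1 *\<^sub>R a) \<bullet> \<omega> = 0" by metis
  then have "z \<bullet> sp.N = 0" by (simp add: zz N_eq)
  then show "z \<in> {z. snd z \<bullet> sp.q = 0 \<and> z \<bullet> sp.N = 0}" using q0 by simp
next
  fix z :: "('n, 'm) ambient" assume z: "z \<in> {z. snd z \<bullet> sp.q = 0 \<and> z \<bullet> sp.N = 0}"
  obtain a \<tau> b where zz: "z = (a, \<tau>, b)" by (cases z)
  have \<tau>: "\<tau> = 0" and a: "a \<bullet> \<omega> = 0" using z by (simp_all add: zz q_eq N_eq)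
  define a' where "a' = inverse R *\<^sub>R a"
  have a': "a' \<bullet> \<omega> = 0" using a by (simp add: a'_def)
  define \<gamma> where "\<gamma> t = (X (norm (t *\<^sub>R b)) *\<^sub>R unit_arc \<omega> a' t, - sqrt (1 - t\<^sup>2 * (b \<bullet> b)), t *\<^sub>R b)" for t
  have db: "((\<lambda>t::real. t *\<^sub>R b) has_derivative (\<lambda>t. t *\<^sub>R b)) (at 0)" by (auto intro!: derivative_eq_intros)
  have t0: "(0::real) *\<^sub>R b = 0" by simp
  have "((\<lambda>t. X (norm (t *\<^sub>R b))) has_derivative (\<lambda>t. 0)) (at 0)"
    by (rule has_derivative_compose[OF db radial_snd_derivative[OF smooth_X even_X, folded t0]])
  then have dX: "((\<lambda>t. X (norm (t *\<^sub>R b))) has_real_derivative 0) (at 0)"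
    by (simp add: has_field_derivative_def lambda_zero)
  have d1: "((\<lambda>t. X (norm (t *\<^sub>R b)) *\<^sub>R unit_arc \<omega> a' t) has_vector_derivative a) (at 0)"
    using has_vector_derivative_scaleR[OF dX has_vector_derivative_unit_arc[of \<omega> a']] R X_0 by (simp add: a'_def)
  have d2: "((\<lambda>t. - sqrt (1 - t\<^sup>2 * (b \<bullet> b))) has_vector_derivative 0) (at 0)"
    unfolding has_real_derivative_iff_has_vector_derivative[symmetric]
    by (auto intro!: derivative_eq_intros)
  have d3: "((\<lambda>t. t *\<^sub>R b) has_vector_derivative b) (at 0)" by (auto intro!: derivative_eq_intros)
  have d\<gamma>: "(\<gamma> has_vector_derivative z) (at 0)"
    unfolding \<gamma>_def[abs_def] zz \<tau> by (intro has_vector_derivative_Pair d1 d2 d3)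
  have g0: "\<gamma> 0 = p" using X_0 by (simp add: \<gamma>_def p)
  have "isCont \<gamma> 0" using d\<gamma> has_vector_derivative_continuous by blast
  from near_p[OF this g0] obtain e where e: "e > 0"
    "\<And>t. dist t 0 < e \<Longrightarrow> fst (snd (\<gamma> t)) < 0 \<and> norm (snd (snd (\<gamma> t))) < r2"
    unfolding eventually_nhds_metric by blast
  show "z \<in> tangent_space M p"
  proof (rule tangent_spaceI[OF g0 e(1) _ d\<gamma>])
    fix t :: real assume "\<bar>t\<bar> < e"
    then have V: "fst (snd (\<gamma> t)) < 0" "norm (snd (snd (\<gamma> t))) < r2" using e(2)[of t] by auto
    have n: "norm (t *\<^sub>R b) < r2" using V(2) by (simp add: \<gamma>_def)
    then have "(norm (t *\<^sub>R b))\<^sup>2 < 1" using r2(2) by (simp add: abs_square_less_1)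
    moreover have nn: "(norm (t *\<^sub>R b))\<^sup>2 = t\<^sup>2 * (b \<bullet> b)"
      by (simp add: power_mult_distrib power2_norm_eq_inner)
    ultimately have "(sqrt (1 - t\<^sup>2 * (b \<bullet> b)))\<^sup>2 + (norm (t *\<^sub>R b))\<^sup>2 = 1" by simp
    then have "\<gamma> t \<in> RnSm" by (simp add: \<gamma>_def RnSm_iff)
    moreover have "norm (fst (\<gamma> t)) = X (norm (snd (snd (\<gamma> t))))"
      using norm_unit_arc[OF \<omega> a', of t] X_pos[of "norm (t *\<^sub>R b)"] n by (simp add: \<gamma>_def)
    ultimately show "\<gamma> t \<in> M" using M_graph[OF V] by simp
  qed
qed

lemma normal_at:
  shows "norm (nu p) = 1" "nu p \<in> tangent_space RnSm p" "\<And>z. z \<in> tangent_space M p \<Longrightarrow> nu p \<bullet> z = 0"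
proof -
  show "norm (nu p) = 1" by (simp only: nu_p sp.norm_N)
  show "nu p \<in> tangent_space RnSm p" unfolding nu_p unfolding p_eq by (rule sp.N_tangent)
  show "nu p \<bullet> z = 0" if "z \<in> tangent_space M p" for z
    using that unfolding tangent_M nu_p by (simp add: inner_commute)
qed

text \<open>All \<open>m\<close> directions of the last factor have curvature \<open>B 0\<close>,
  and the other \<open>n - 1\<close> have curvature \<open>1 / R\<close>, that of a sphere of radius
  \<open>R\<close>. The value of \<open>B 0\<close> is exactly the one with
  \<open>m * B 0 + (n - 1) / R = h\<close>.\<close>

lemma curvature_at:
  assumes ext: "\<And>p. p \<in> M \<Longrightarrow> fst (snd p) < 0 \<Longrightarrow> norm (snd (snd p)) < r2 \<Longrightarrow> \<nu> p = nu p"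
  shows "has_mean_curvature_at RnSm M \<nu> p h"
proof -
  have fp: "fst p = R *\<^sub>R \<omega>" "snd (snd p) = 0" by (simp_all add: p)
  have rad: "((\<lambda>p::('n, 'm) ambient. q (norm (snd (snd p)))) has_derivative (\<lambda>z. 0)) (at p)"
    if "smooth_on {-r2<..<r2} q" "\<And>r. q (- r) = q r" for q :: "real \<Rightarrow> real"
    by (rule has_derivative_compose[OF has_derivative_snd[OF has_derivative_snd[OF has_derivative_ident]]
          radial_snd_derivative[OF that, folded fp(2)]])
  have du: "((\<lambda>p::('n, 'm) ambient. inverse (norm (fst p)) *\<^sub>R fst p) has_derivative
      (\<lambda>z. inverse R *\<^sub>R (fst z - (fst z \<bullet> \<omega>) *\<^sub>R \<omega>))) (at p)"
    by (rule has_derivative_compose[OF has_derivative_fst[OF has_derivative_ident] has_derivative_unit[OF \<omega> R, folded fp(1)]])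
  define D where "D z = (- (inverse R *\<^sub>R (fst z - (fst z \<bullet> \<omega>) *\<^sub>R \<omega>)), 0::real, - B 0 *\<^sub>R snd (snd z))"
    for z :: "('n, 'm) ambient"
  have "(nu has_derivative (\<lambda>z. (S (norm (snd (snd p))) *\<^sub>R (inverse R *\<^sub>R (fst z - (fst z \<bullet> \<omega>) *\<^sub>R \<omega>))
        + 0 *\<^sub>R (inverse (norm (fst p)) *\<^sub>R fst p), 0,
      q3 (norm (snd (snd p))) *\<^sub>R snd (snd z) + 0 *\<^sub>R snd (snd p)))) (at p)"
    unfolding nu_def[abs_def]
    by (intro has_derivative_Pair has_derivative_scaleR rad[OF smooth_S even(1)] rad[OF smooth_q(1) even(2)]
        rad[OF smooth_q(2) even(3)] du has_derivative_snd[OF has_derivative_snd[OF has_derivative_ident]])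
  then have "(nu has_derivative D) (at p)"
    unfolding D_def[abs_def] fp by (simp add: S_def q3_def)
  then have Dw: "(nu has_derivative D) (at p within M)" by (rule has_derivative_at_withinI)
  have "open {p :: ('n, 'm) ambient. fst (snd p) < 0 \<and> norm (snd (snd p)) < r2}"
    by (intro open_Collect_conj open_Collect_less continuous_intros)
  moreover have "p \<in> {p. fst (snd p) < 0 \<and> norm (snd (snd p)) < r2}" using r2 by (simp add: p)
  ultimately obtain e where e: "e > 0" "ball p e \<subseteq> {p. fst (snd p) < 0 \<and> norm (snd (snd p)) < r2}"
    unfolding open_contains_ball by blast
  have D\<nu>: "(\<nu> has_derivative D) (at p within M)"
  proof (rule has_derivative_transform_within[OF Dw e(1) p_in_M])
    fix p' assume "p' \<in> M" "dist p' p < e"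
    then show "nu p' = \<nu> p'" using ext[of p'] e(2) by (auto simp: dist_commute subset_eq)
  qed
  have "has_mean_curvature_at RnSm M \<nu> (R *\<^sub>R \<omega>, sp.q)
    (- (- B 0) - (real CARD('n) - 1) * (- inverse R) + (real CARD('m) - 1) * B 0)"
  proof (rule surface_point.mean_curvature)
    show "surface_point \<omega> \<theta> (- 1) 0" by unfold_locales
    show "tangent_space M (R *\<^sub>R \<omega>, sp.q) = {z. snd z \<bullet> sp.q = 0 \<and> z \<bullet> sp.N = 0}" using tangent_M p_eq by simp
    show "(\<nu> has_derivative D) (at (R *\<^sub>R \<omega>, sp.q) within M)" using D\<nu> p_eq by simp
    show "D sp.T = (- B 0) *\<^sub>R sp.T + (0, 0 *\<^sub>R sp.q)"
      by (simp add: D_def sp.T_def q_eq)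
    show "D (e, 0, 0) = (- inverse R) *\<^sub>R (e, 0, 0)" if "e \<bullet> \<omega> = 0" for e
      using that by (simp add: D_def)
    show "D (0, 0, f) = - B 0 *\<^sub>R (0, 0, f)" if "f \<bullet> \<theta> = 0" for f
      by (simp add: D_def)
  qed
  moreover have "- (- B 0) - (real CARD('n) - 1) * (- inverse R) + (real CARD('m) - 1) * B 0 = h"
  proof -
    have "real CARD('m) * B 0 = h - (real CARD('n) - 1) / R" unfolding B_0 by simp
    then show ?thesis by (simp add: algebra_simps divide_inverse)
  qed
  ultimately show ?thesis using p_eq by simp
qed

end

end

section \<open>Closing a graph at the pole\<close>

text \<open>The topological half of the sphere statement: the shape of the profile enters, the
  curvature equation does not. The derivative \<open>- (r * W r)\<close> with \<open>W > 0\<close>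
  makes \<open>r = 0\<close> a nondegenerate maximum of \<open>X\<close>, as a smooth closing
  requires.\<close>

locale capped_graph =
  fixes R r2 :: real and y X W :: "real \<Rightarrow> real"
  assumes R: "R > 0" and r2: "0 < r2" "r2 < 1"
    and smooth_y: "smooth_on {-R<..<R} y" and even_y: "\<And>x. \<bar>x\<bar> < R \<Longrightarrow> y (- x) = y x"
    and y_range: "\<And>x. \<bar>x\<bar> < R \<Longrightarrow> 0 < y x" "\<And>x. \<bar>x\<bar> < R \<Longrightarrow> y x < pi"
    and smooth_X: "smooth_on {-r2<..<r2} X" and smooth_W: "smooth_on {-r2<..<r2} W"
    and even_X: "\<And>r. X (- r) = X r" and X_0: "X 0 = R"
    and X_pos: "\<And>r. \<bar>r\<bar> < r2 \<Longrightarrow> 0 < X r" and W_pos: "\<And>r. \<bar>r\<bar> < r2 \<Longrightarrow> 0 < W r"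
    and DERIV_X: "\<And>r. \<bar>r\<bar> < r2 \<Longrightarrow> (X has_real_derivative - (r * W r)) (at r)"
    and X_less: "\<And>r. 0 < r \<Longrightarrow> r < r2 \<Longrightarrow> X r < R"
    and sin_y_X: "\<And>r. 0 < r \<Longrightarrow> r < r2 \<Longrightarrow> sin (y (X r)) = r"
    and cos_y_X: "\<And>r. 0 < r \<Longrightarrow> r < r2 \<Longrightarrow> cos (y (X r)) = sqrt (1 - r\<^sup>2)"
    and X_sin_y: "\<And>x. 0 \<le> x \<Longrightarrow> x < R \<Longrightarrow> 0 < cos (y x) \<Longrightarrow> sin (y x) < r2 \<Longrightarrow> X (sin (y x)) = x"
begin

lemma sin_pos: "\<bar>x\<bar> < R \<Longrightarrow> 0 < sin (y x)"
  using y_range by (intro sin_gt_zero)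

text \<open>The inverse \<open>G\<close> of the embedding \<open>F\<close> below has the second component \<open>H (norm w) *\<^sub>R w\<close> near the pole;
  in contrast to the formulas for \<open>F\<close> and \<open>G\<close>, this shows smoothness at \<open>w = 0\<close>.\<close>

lemma pole_scale:
  obtains H where "smooth_on {-r2<..<r2} H" "\<And>r. \<bar>r\<bar> < r2 \<Longrightarrow> 0 < H r" "\<And>r. \<bar>r\<bar> < r2 \<Longrightarrow> H (- r) = H r"
    "\<And>r. \<bar>r\<bar> < r2 \<Longrightarrow> 1 - (X r / R)\<^sup>2 = (r * H r)\<^sup>2"
    "\<And>r. \<bar>r\<bar> < r2 \<Longrightarrow> ((\<lambda>r. r * H r) has_real_derivative deriv (\<lambda>r. r * H r) r) (at r)"
    "\<And>r. \<bar>r\<bar> < r2 \<Longrightarrow> 0 < deriv (\<lambda>r. r * H r) r"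
proof -
  let ?I = "{-r2<..<r2}"
  have I: "convex ?I" "0 \<in> ?I" "open ?I" using r2 by (auto simp: convex_real_interval)
  \<comment> \<open>Chosen so that \<open>1 - (X r / R)\<^sup>2\<close> has the derivative
    \<open>r * p r\<close>.\<close>
  define p where "p r = 2 * X r * W r / R\<^sup>2" for r
  define f where "f r = 1 - (X r / R)\<^sup>2" for r
  have p: "smooth_on ?I p"
    unfolding p_def[abs_def] using smooth_X smooth_W R
    by (intro allI Ck_on_divide Ck_on_mult Ck_on_const I) auto
  have ppos: "0 < p r" if "\<bar>r\<bar> < r2" for r using X_pos[OF that] W_pos[OF that] R by (simp add: p_def)
  have df: "(f has_real_derivative r * p r) (at r)" if "\<bar>r\<bar> < r2" for r
    unfolding f_def[abs_def]
    using DERIV_diff[OF DERIV_const DERIV_power[OF DERIV_cdivide[OF DERIV_X[OF that], of R], of 2], of 1]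
    by (simp add: p_def power2_eq_square mult_ac)
  have f0: "f 0 = 0" using R by (simp add: f_def X_0)
  have cp: "continuous_on ?I p" using p Ck_on_0I by blast
  \<comment> \<open>The weight \<open>1\<close> makes this \<open>f r / r\<^sup>2\<close>, with the
    value \<open>p 0 / 2 > 0\<close> at \<open>0\<close>; hence its root \<open>H\<close> is
    smooth.\<close>
  define J where "J = avg 1 p"
  have fJ: "f r = r\<^sup>2 * J r" if r: "\<bar>r\<bar> < r2" for r
  proof -
    have c: "continuous_on ?I (\<lambda>r. r * p r)" by (intro continuous_intros cp)
    have "f r = f 0 + r * avg 0 (\<lambda>r. r * p r) r"
      by (rule mult_avg_deriv[OF I _ c]) (use df r in auto)
    also have "avg 0 (\<lambda>r. r * p r) r = r * J r"
    proof -
      have "(\<lambda>t. t ^ 0 * (t * r * p (t * r))) = (\<lambda>t. r * (t ^ 1 * p (t * r)))" by (auto simp: mult_ac)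
      then show ?thesis unfolding J_def avg_def by simp
    qed
    finally show ?thesis by (simp add: f0 power2_eq_square)
  qed
  have feven: "f (- r) = f r" for r by (simp add: f_def even_X)
  have fpos: "0 < f r" if "\<bar>r\<bar> < r2" "r \<noteq> 0" for r
  proof -
    have "X r < R" using X_less[of r] X_less[of "- r"] even_X[of r] that by (cases "r > 0") auto
    then have "X r / R < 1" "0 \<le> X r / R" using X_pos[OF that(1)] R by (auto simp: field_simps)
    then have "(X r / R)\<^sup>2 < 1" by (simp add: power_less_one_iff abs_square_less_1)
    then show ?thesis by (simp add: f_def)
  qed
  have J0: "J 0 = p 0 / 2" unfolding J_def avg_zero by simp
  have Jpos: "0 < J r" if "\<bar>r\<bar> < r2" for r
  proof (cases "r = 0")
    case True then show ?thesis using J0 ppos[OF that] by simp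
  next
    case False
    then show ?thesis using fJ[OF that] fpos[OF that False] by (simp add: zero_less_mult_iff)
  qed
  have Jeven: "J (- r) = J r" if "\<bar>r\<bar> < r2" for r
    using fJ[OF that] fJ[of "- r"] feven[of r] that by (cases "r = 0") auto
  have Js: "smooth_on ?I J" unfolding J_def using Ck_on_avg[OF I] p by blast
  define H where "H r = sqrt (J r)" for r
  have H: "smooth_on ?I H" unfolding H_def[abs_def]
    by (intro allI Ck_on_sqrt I) (use Js Jpos in auto)
  have Hpos: "0 < H r" if "\<bar>r\<bar> < r2" for r using Jpos[OF that] by (simp add: H_def)
  have K2: "f r = (r * H r)\<^sup>2" if "\<bar>r\<bar> < r2" for r
    using fJ[OF that] Jpos[OF that] by (simp add: H_def power_mult_distrib)
  have Ks: "smooth_on ?I (\<lambda>r. r * H r)" by (intro allI Ck_on_mult Ck_on_ident I) (use H in blast)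
  have dK: "((\<lambda>r. r * H r) has_real_derivative deriv (\<lambda>r. r * H r) r) (at r)" if "\<bar>r\<bar> < r2" for r
    by (rule smooth_on_real_deriv(1)[OF I(3) Ks]) (use that in auto)
  have "0 < deriv (\<lambda>r. r * H r) r" if r: "\<bar>r\<bar> < r2" for r
  proof (cases "r = 0")
    case True
    have dH: "(H has_real_derivative deriv H 0) (at 0)" by (rule smooth_on_real_deriv(1)[OF I(3) H I(2)])
    have "((\<lambda>r. r * H r) has_real_derivative H 0) (at 0)"
      using DERIV_mult[OF DERIV_ident dH] by simp
    then have "deriv (\<lambda>r. r * H r) 0 = H 0" by (rule DERIV_imp_deriv)
    then show ?thesis using True Hpos[OF r] by simp
  next
    case False
    \<comment> \<open>Differentiating \<open>f = (r * H r)\<^sup>2\<close> and cancelling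
      \<open>r\<close> gives \<open>p = 2 * H * (r * H)'\<close>, where \<open>p\<close> and
      \<open>H\<close> are positive.\<close>
    have ev: "\<forall>\<^sub>F z in nhds r. f z = (z * H z)\<^sup>2"
    proof -
      have "\<forall>\<^sub>F z in nhds r. z \<in> ?I" by (rule eventually_nhds_in_open) (use r in auto)
      then show ?thesis by (rule eventually_mono) (use K2 in auto)
    qed
    have "((\<lambda>z. (z * H z)\<^sup>2) has_real_derivative r * p r) (at r)"
      by (rule DERIV_cong_ev[OF refl ev refl, THEN iffD1, OF df[OF r]])
    moreover have "((\<lambda>z. (z * H z)\<^sup>2) has_real_derivative 2 * (r * H r) * deriv (\<lambda>r. r * H r) r) (at r)"
      using DERIV_power[OF dK[OF r], of 2] by (simp add: mult_ac)
    ultimately have "r * p r = 2 * (r * H r) * deriv (\<lambda>r. r * H r) r" by (rule DERIV_unique)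
    then have "p r = 2 * H r * deriv (\<lambda>r. r * H r) r" using False by simp
    then show ?thesis using ppos[OF r] Hpos[OF r] by (metis mult_pos_pos zero_less_mult_pos zero_less_numeral)
  qed
  moreover have "H (- r) = H r" if "\<bar>r\<bar> < r2" for r using Jeven[OF that] by (simp add: H_def)
  ultimately show ?thesis using that[OF H Hpos _ _ dK] K2 unfolding f_def by blast
qed

text \<open>The second alternative adds the points over the end \<open>(R, 0)\<close> of the
  profile; it is stated separately because the locale does not fix \<open>y\<close> at
  \<open>R\<close>.\<close>

definition \<Sigma> :: "('n::finite, 'm::finite) ambient set"
  where "\<Sigma> = {p \<in> RnSm. norm (fst p) < R \<and> fst (snd p) = - cos (y (norm (fst p))) \<or>
    norm (fst p) = R \<and> fst (snd p) = - 1}"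

lemma \<Sigma>_subset: "\<Sigma> \<subseteq> RnSm" by (auto simp: \<Sigma>_def)

lemma \<Sigma>_graph: "norm (fst p) < R \<Longrightarrow> p \<in> \<Sigma> \<longleftrightarrow> p \<in> RnSm \<and> fst (snd p) = - cos (y (norm (fst p)))"
  by (auto simp: \<Sigma>_def)

lemma \<Sigma>_invariant: "OnOm_invariant \<Sigma>"
  by (rule OnOm_invariantI) (auto simp: \<Sigma>_def RnSm_iff)

lemma \<Sigma>_norm_snd:
  assumes "(v, t, w) \<in> \<Sigma>" "norm v < R" shows "norm w = sin (y (norm v))" "w \<noteq> 0" "t = - cos (y (norm v))"
proof -
  note s = sin_pos[of "norm v"]
  show t: "t = - cos (y (norm v))" using assms by (auto simp: \<Sigma>_def)
  have "(norm w)\<^sup>2 = (sin (y (norm v)))\<^sup>2"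
    using assms t by (simp add: \<Sigma>_def RnSm_iff sin_squared_eq)
  then show n: "norm w = sin (y (norm v))" using s assms by simp
  then show "w \<noteq> 0" using s assms by auto
qed

lemma \<Sigma>_pole:
  assumes "(v, t, w) \<in> \<Sigma>" "\<not> norm v < R" shows "norm v = R" "w = 0" "t = - 1"
  using assms by (auto simp: \<Sigma>_def RnSm_iff)

lemma \<Sigma>_pole_graph:
  fixes p :: "('n::finite, 'm::finite) ambient"
  assumes "fst (snd p) < 0" "norm (snd (snd p)) < r2"
  shows "p \<in> \<Sigma> \<longleftrightarrow> p \<in> RnSm \<and> norm (fst p) = X (norm (snd (snd p)))"
proof -
  obtain v t w where p: "p = (v, t, w)" by (cases p)
  have t: "t < 0" and w: "norm w < r2" using assms by (simp_all add: p)
  show ?thesis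
  proof
    assume P: "p \<in> \<Sigma>"
    have "norm v = X (norm w)"
    proof (cases "norm v < R")
      case True
      note s = \<Sigma>_norm_snd[OF P[unfolded p] True]
      show ?thesis using X_sin_y[of "norm v"] True s t w by simp
    next
      case False
      then show ?thesis using \<Sigma>_pole[OF P[unfolded p]] X_0 by simp
    qed
    then show "p \<in> RnSm \<and> norm (fst p) = X (norm (snd (snd p)))" using P \<Sigma>_subset by (auto simp: p)
  next
    assume a: "p \<in> RnSm \<and> norm (fst p) = X (norm (snd (snd p)))"
    then have n: "t\<^sup>2 + (norm w)\<^sup>2 = 1" and v: "norm v = X (norm w)" by (simp_all add: p RnSm_iff)
    have "t\<^sup>2 = 1 - (norm w)\<^sup>2" using n by simp
    then have tt: "t = - sqrt (1 - (norm w)\<^sup>2)" using t by (metis abs_of_neg minus_minus real_sqrt_abs)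
    show "p \<in> \<Sigma>"
    proof (cases "w = 0")
      case True
      then show ?thesis using a v tt X_0 by (simp add: \<Sigma>_def p)
    next
      case False
      then have "0 < norm w" by simp
      then show ?thesis
        using a v tt X_less[OF _ w] cos_y_X[OF _ w] by (simp add: \<Sigma>_def p)
    qed
  qed
qed

text \<open>Scaling by \<open>R\<close> matches the open ball in the first factor with the graph,
  and the subsphere \<open>w = 0\<close> with the added points. On that subsphere \<open>y\<close>
  would be evaluated at \<open>R\<close>, hence the explicit value \<open>- 1\<close>; the last
  component vanishes there in any case.\<close>

definition F :: "(real^'n) \<times> (real^'m) \<Rightarrow> ('n::finite, 'm::finite) ambient"
  where "F z = (R *\<^sub>R fst z, if snd z = 0 then - 1 else - cos (y (norm (R *\<^sub>R fst z))),
    (sin (y (norm (R *\<^sub>R fst z))) * inverse (norm (snd z))) *\<^sub>R snd z)"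

text \<open>On the unit sphere \<open>norm w\<close> is determined by \<open>u\<close> as
  \<open>sqrt (1 - u \<bullet> u)\<close>, so only the direction of the last component is taken from
  \<open>p\<close>.\<close>

definition G :: "('n::finite, 'm::finite) ambient \<Rightarrow> (real^'n) \<times> (real^'m)"
  where "G p = (inverse R *\<^sub>R fst p,
    (sqrt (1 - (inverse R *\<^sub>R fst p) \<bullet> (inverse R *\<^sub>R fst p)) * inverse (norm (snd (snd p)))) *\<^sub>R snd (snd p))"

lemma sphere_cases:
  fixes u :: "'a::real_normed_vector" and w :: "'b::real_normed_vector"
  assumes "(u, w) \<in> sphere 0 1"
  shows "(norm u)\<^sup>2 + (norm w)\<^sup>2 = 1" "w = 0 \<Longrightarrow> norm u = 1" "w \<noteq> 0 \<Longrightarrow> norm (R *\<^sub>R u) < R"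
proof -
  show n: "(norm u)\<^sup>2 + (norm w)\<^sup>2 = 1" using assms by (simp add: norm_Pair)
  show "w = 0 \<Longrightarrow> norm u = 1" using n by (simp add: power2_eq_1_iff norm_minus_cancel) (smt (verit) norm_ge_zero)
  assume "w \<noteq> 0"
  then have "(norm w)\<^sup>2 > 0" by simp
  then have "(norm u)\<^sup>2 < 1" using n by linarith
  then have "norm u < 1" by (simp add: abs_square_less_1)
  then show "norm (R *\<^sub>R u) < R" using R by simp
qed

lemma F_G: assumes "p \<in> \<Sigma>" shows "G p \<in> sphere 0 1 \<and> F (G p) = (p :: ('n::finite, 'm::finite) ambient)"
proof -
  obtain v t w where p: "p = (v, t, w)" by (cases p)
  have Rv: "R *\<^sub>R inverse R *\<^sub>R v = v" using R by simp
  show ?thesis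
  proof (cases "norm v < R")
    case True
    note s = \<Sigma>_norm_snd[OF assms[unfolded p] True]
    define c where "c = sqrt (1 - (inverse R *\<^sub>R v) \<bullet> (inverse R *\<^sub>R v))"
    have "norm (inverse R *\<^sub>R v) < 1" using True R by (simp add: field_simps)
    then have "(norm (inverse R *\<^sub>R v))\<^sup>2 < 1" by (simp add: abs_square_less_1)
    then have c0: "1 - (inverse R *\<^sub>R v) \<bullet> (inverse R *\<^sub>R v) > 0" by (simp only: dot_square_norm)
    have c: "c > 0" "c\<^sup>2 = 1 - (norm (inverse R *\<^sub>R v))\<^sup>2"
      using c0 unfolding c_def by (simp_all only: real_sqrt_gt_0_iff real_sqrt_pow2 less_imp_le dot_square_norm)
    have G: "G p = (inverse R *\<^sub>R v, (c * inverse (norm w)) *\<^sub>R w)" by (simp add: G_def p c_def)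
    have nw: "norm ((c * inverse (norm w)) *\<^sub>R w) = c" using s(2) c by simp
    have "(c * inverse (norm w)) *\<^sub>R w \<noteq> 0" using nw c(1) by auto
    moreover have "(sin (y (norm v)) * inverse c) *\<^sub>R (c * inverse (norm w)) *\<^sub>R w = w"
    proof -
      have "sin (y (norm v)) * inverse c * (c * inverse (norm w)) = 1"
        unfolding s(1)[symmetric] using s(2) c(1) by (simp add: field_simps)
      then show ?thesis by simp
    qed
    ultimately have "F (G p) = p" unfolding G F_def fst_conv snd_conv Rv nw by (simp add: p s)
    moreover have "G p \<in> sphere 0 1" unfolding G using c(2) nw by (simp add: norm_Pair)
    ultimately show ?thesis by simp
  next
    case False
    note s = \<Sigma>_pole[OF assms[unfolded p] False]
    have "norm (inverse R *\<^sub>R v) = 1" using s R by simp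
    then show ?thesis using R s by (simp add: G_def F_def p norm_Pair)
  qed
qed

lemma G_F: assumes "z \<in> sphere 0 1" shows "F z \<in> (\<Sigma> :: ('n::finite, 'm::finite) ambient set) \<and> G (F z) = z"
proof -
  obtain u :: "real^'n" and w :: "real^'m" where z: "z = (u, w)" by (cases z)
  note n = sphere_cases[OF assms[unfolded z]]
  have Ru: "inverse R *\<^sub>R R *\<^sub>R u = u" using R by simp
  show ?thesis
  proof (cases "w = 0")
    case True
    then show ?thesis using n R by (simp add: F_def G_def z \<Sigma>_def RnSm_iff)
  next
    case False
    define s where "s = sin (y (norm (R *\<^sub>R u)))"
    have s: "s > 0" unfolding s_def by (rule sin_pos) (use n(3)[OF False] in simp)
    have F: "F z = (R *\<^sub>R u, - cos (y (norm (R *\<^sub>R u))), (s * inverse (norm w)) *\<^sub>R w)"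
      using False by (simp add: F_def z s_def)
    have nw: "norm ((s * inverse (norm w)) *\<^sub>R w) = s" using False s by simp
    have Fz: "F z \<in> \<Sigma>" unfolding F \<Sigma>_def mem_Collect_eq RnSm_iff fst_conv snd_conv nw
      using n(3)[OF False] by (simp add: s_def)
    have "sqrt (1 - u \<bullet> u) = norm w"
      using n(1) by (simp add: dot_square_norm algebra_simps real_sqrt_unique)
    moreover have inv: "norm w * inverse s * (s * inverse (norm w)) = 1" using s False by (simp add: field_simps)
    ultimately have "G (F z) = z" unfolding F G_def fst_conv snd_conv nw Ru using inv by (simp add: z)
    with Fz show ?thesis by simp
  qed
qed

text \<open>Only \<open>w = 0\<close> is critical. With \<open>s = norm w\<close> on the unit sphere
  and \<open>r\<close> the corresponding norm on the hypersurface,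
  \<open>s\<^sup>2 = 1 - (X r / R)\<^sup>2\<close>; hence \<open>s = r * H r\<close> and conversely
  \<open>r = \<xi> s = s * E s\<close>. As \<open>H\<close> and \<open>E\<close> are smooth and
  even, each of the two maps multiplies \<open>w\<close> by a smooth function.\<close>

lemma diffeomorphism_sphere:
  "diffeomorphism (sphere 0 1) (\<Sigma> :: ('n::finite, 'm::finite) ambient set) F G"
proof (rule diffeomorphismI)
  obtain H where H: "smooth_on {-r2<..<r2} H" "\<And>r. \<bar>r\<bar> < r2 \<Longrightarrow> 0 < H r" "\<And>r. \<bar>r\<bar> < r2 \<Longrightarrow> H (- r) = H r"
    "\<And>r. \<bar>r\<bar> < r2 \<Longrightarrow> 1 - (X r / R)\<^sup>2 = (r * H r)\<^sup>2"
    "\<And>r. \<bar>r\<bar> < r2 \<Longrightarrow> ((\<lambda>r. r * H r) has_real_derivative deriv (\<lambda>r. r * H r) r) (at r)"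
    "\<And>r. \<bar>r\<bar> < r2 \<Longrightarrow> 0 < deriv (\<lambda>r. r * H r) r"
    by (rule pole_scale, rule that)
  have Ks: "smooth_on {-r2<..<r2} (\<lambda>r. r * H r)" by (intro allI Ck_on_mult Ck_on_ident) (use H(1) in auto)
  have Kodd: "- r * H (- r) = - (r * H r)" if "\<bar>r\<bar> < r2" for r using H(3)[OF that] by simp
  obtain d c \<xi> where \<xi>: "0 < c" "c < r2" "0 < d" "smooth_on {-d<..<d} \<xi>"
    "\<And>s. \<bar>s\<bar> < d \<Longrightarrow> \<bar>\<xi> s\<bar> < c" "\<And>s. \<bar>s\<bar> < d \<Longrightarrow> \<xi> s * H (\<xi> s) = s" "\<And>s. \<bar>s\<bar> < d \<Longrightarrow> \<xi> (- s) = - \<xi> s"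
    by (rule smooth_odd_inverse[OF r2(1) Ks Kodd H(5,6)], assumption, assumption, assumption, rule that)
  let ?J = "{-d<..<d}"
  have J: "convex ?J" "0 \<in> ?J" "open ?J" using \<xi>(3) by (auto simp: convex_real_interval)
  have \<xi>0: "\<xi> 0 = 0" using \<xi>(7)[of 0] \<xi>(3) by simp
  obtain E where E: "smooth_on ?J E" "\<And>s. s \<in> ?J \<Longrightarrow> \<xi> s = s * E s"
    by (rule smooth_on_divide_ident[OF J \<xi>(4) \<xi>0], rule that)
  have Eeven: "E (- s) = E s" if "\<bar>s\<bar> < d" for s
  proof -
    have "s \<in> ?J" "- s \<in> ?J" using that by auto
    from E(2)[OF this(1)] E(2)[OF this(2)] \<xi>(7)[OF that] show ?thesis by (cases "s = 0") auto
  qed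
  \<comment> \<open>This is \<open>- cos y\<close> at the point where
    \<open>sin y = \<xi> s\<close>.\<close>
  define q where "q s = - sqrt (1 - (s * E s)\<^sup>2)" for s
  have qs: "smooth_on ?J q"
    unfolding q_def[abs_def]
  proof (intro allI Ck_on_minus Ck_on_sqrt Ck_on_diff Ck_on_const Ck_on_power Ck_on_mult Ck_on_ident J)
    show "Ck_on k ?J E" for k using E(1) by blast
    fix s assume s: "s \<in> ?J"
    then have "\<bar>s\<bar> < d" by auto
    then have "\<bar>s * E s\<bar> < 1" using \<xi>(5)[of s] \<xi>(2) r2(2) E(2)[OF s] by simp
    then show "0 < 1 - (s * E s)\<^sup>2" by (rule one_minus_square_pos)
  qed
  have qeven: "q (- s) = q s" if "\<bar>s\<bar> < d" for s using Eeven[OF that] by (simp add: q_def)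
  have \<xi>pos: "0 < \<xi> s" if "0 < s" "s < d" for s
  proof -
    have "\<bar>\<xi> s\<bar> < r2" using \<xi>(5)[of s] \<xi>(2) that by simp
    then have "0 < H (\<xi> s)" by (rule H(2))
    moreover have "0 < \<xi> s * H (\<xi> s)" using \<xi>(6)[of s] that by simp
    ultimately show ?thesis by (simp add: zero_less_mult_iff)
  qed
  show "smooth_map (sphere 0 1) (F :: _ \<Rightarrow> ('n, 'm) ambient)"
    unfolding smooth_map_def
  proof
    fix z :: "(real^'n) \<times> (real^'m)" assume z: "z \<in> sphere 0 1"
    show "\<exists>U g. open U \<and> z \<in> U \<and> (\<forall>k. Ck_on k U g) \<and> (\<forall>z\<in>sphere 0 1 \<inter> U. g z = (F z :: ('n, 'm) ambient))"
    proof (cases "snd z = 0")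
      case True
      let ?U = "{z :: (real^'n) \<times> (real^'m). norm (snd z) < d}"
      define g where "g z = (R *\<^sub>R fst z, q (norm (snd z)), E (norm (snd z)) *\<^sub>R snd z)" for z :: "(real^'n) \<times> (real^'m)"
      have op: "open ?U" by (intro open_Collect_less continuous_intros)
      have rad: "Ck_on k ?U (\<lambda>z. f (norm (snd z)))" if "smooth_on ?J f" "\<And>s. \<bar>s\<bar> < d \<Longrightarrow> f (- s) = f s" for f :: "real \<Rightarrow> real" and k
        by (rule Ck_on_compose[OF op open_ball _ Ck_on_snd[OF op Ck_on_ident[OF op]] Ck_on_radial[OF \<xi>(3) that(2,1)]])
           auto
      have sm: "Ck_on k ?U g" for k
        unfolding g_def[abs_def]
        by (intro Ck_on_Pair Ck_on_scaleR Ck_on_const rad[OF qs qeven] rad[OF E(1) Eeven] Ck_on_fst Ck_on_snd Ck_on_ident op)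
      have "g z = F z" if zz: "z \<in> sphere 0 1" "z \<in> ?U" for z
      proof -
        obtain u w where uw: "z = (u, w)" by (cases z)
        note n = sphere_cases[OF zz(1)[unfolded uw]]
        show ?thesis
        proof (cases "w = 0")
          case True
          then show ?thesis by (simp add: g_def F_def uw q_def)
        next
          case False
          define s where "s = norm w"
          have s: "0 < s" "s < d" using False zz(2) by (simp_all add: s_def uw)
          have \<xi>r: "0 < \<xi> s" "\<xi> s < r2" using \<xi>pos[OF s] \<xi>(2) \<xi>(5)[of s] s by auto
          have "1 - (X (\<xi> s) / R)\<^sup>2 = s\<^sup>2" using H(4)[of "\<xi> s"] \<xi>(6)[of s] \<xi>r s by simp
          then have "(X (\<xi> s) / R)\<^sup>2 = (norm u)\<^sup>2" using n(1) by (simp add: s_def)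
          then have "X (\<xi> s) / R = norm u" using X_pos[of "\<xi> s"] \<xi>r R by simp
          then have X: "norm (R *\<^sub>R u) = X (\<xi> s)" using R by (simp add: field_simps)
          have \<xi>E: "\<xi> s = s * E s" using E(2)[of s] s by simp
          have "q s = - cos (y (X (\<xi> s)))" using cos_y_X[OF \<xi>r] by (simp add: q_def \<xi>E)
          moreover have "sin (y (X (\<xi> s))) * inverse s = E s" using sin_y_X[OF \<xi>r] s by (simp add: \<xi>E)
          ultimately show ?thesis using False X by (simp add: g_def F_def uw flip: s_def)
        qed
      qed
      then show ?thesis using op sm True \<xi>(3) by (intro exI[of _ ?U] exI[of _ g]) auto
    next
      case False
      let ?U = "{z :: (real^'n) \<times> (real^'m). norm (R *\<^sub>R fst z) < R \<and> snd z \<noteq> 0}"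
      define g where "g z = (R *\<^sub>R fst z, - cos (y (norm (R *\<^sub>R fst z))),
        (sin (y (norm (R *\<^sub>R fst z))) * inverse (norm (snd z))) *\<^sub>R snd z)" for z :: "(real^'n) \<times> (real^'m)"
      have op: "open ?U" by (intro open_Collect_conj open_Collect_less open_Collect_neq continuous_intros)
      have v: "Ck_on k ?U (\<lambda>z. R *\<^sub>R fst z)" for k
        by (intro Ck_on_scaleR Ck_on_const Ck_on_fst Ck_on_ident op)
      have yy: "Ck_on k ?U (\<lambda>z. y (norm (R *\<^sub>R fst z)))" for k
        by (rule Ck_on_compose[OF op open_ball _ v Ck_on_radial[OF R even_y smooth_y]]) auto
      have sm: "Ck_on k ?U g" for k
        unfolding g_def[abs_def]
        by (intro Ck_on_Pair Ck_on_scaleR Ck_on_mult Ck_on_inverse Ck_on_norm Ck_on_const Ck_on_minus Ck_on_sin Ck_on_cos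
            yy Ck_on_fst Ck_on_snd Ck_on_ident op) auto
      have "z \<in> ?U" using sphere_cases(3)[of "fst z" "snd z"] z False by simp
      then show ?thesis using op sm by (intro exI[of _ ?U] exI[of _ g]) (auto simp: g_def F_def)
    qed
  qed
  show "smooth_map (\<Sigma> :: ('n, 'm) ambient set) G"
    unfolding smooth_map_def
  proof
    fix p :: "('n, 'm) ambient" assume p: "p \<in> \<Sigma>"
    then have p': "(fst p, fst (snd p), snd (snd p)) \<in> \<Sigma>" by simp
    show "\<exists>U g. open U \<and> p \<in> U \<and> (\<forall>k. Ck_on k U g) \<and> (\<forall>p\<in>\<Sigma> \<inter> U. g p = G p)"
    proof (cases "norm (fst p) < R")
      case True
      let ?U = "{p :: ('n, 'm) ambient. norm (fst p) < R \<and> snd (snd p) \<noteq> 0}"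
      have op: "open ?U" by (intro open_Collect_conj open_Collect_less open_Collect_neq continuous_intros)
      have v: "Ck_on k ?U (\<lambda>p. inverse R *\<^sub>R fst p)" for k
        by (intro Ck_on_scaleR Ck_on_const Ck_on_fst Ck_on_ident op)
      have pos: "0 < 1 - (inverse R *\<^sub>R fst p) \<bullet> (inverse R *\<^sub>R fst p)" if "p \<in> ?U" for p
      proof -
        have "norm (inverse R *\<^sub>R fst p) < 1" using that R by (simp add: field_simps)
        then have "(norm (inverse R *\<^sub>R fst p))\<^sup>2 < 1" by (simp add: abs_square_less_1)
        then show ?thesis by (simp only: dot_square_norm)
      qed
      have "Ck_on k ?U G" for k
        unfolding G_def[abs_def]
        by (intro Ck_on_Pair Ck_on_scaleR[OF _ Ck_on_mult] Ck_on_inverse Ck_on_norm Ck_on_sqrt Ck_on_diff Ck_on_const Ck_on_inner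
            v Ck_on_snd Ck_on_ident op pos) auto
      moreover have "p \<in> ?U" using \<Sigma>_norm_snd(2)[OF p' True] True by simp
      ultimately show ?thesis using op by (intro exI[of _ ?U] exI[of _ G]) auto
    next
      case False
      let ?U = "{p :: ('n, 'm) ambient. fst (snd p) < 0 \<and> norm (snd (snd p)) < r2}"
      define g where "g p = (inverse R *\<^sub>R fst p, H (norm (snd (snd p))) *\<^sub>R snd (snd p))" for p :: "('n, 'm) ambient"
      have op: "open ?U" by (intro open_Collect_conj open_Collect_less continuous_intros)
      have w: "Ck_on k ?U (\<lambda>p. snd (snd p))" for k by (intro Ck_on_snd Ck_on_ident op)
      have rad: "Ck_on k ?U (\<lambda>p. H (norm (snd (snd p))))" for k
        by (rule Ck_on_compose[OF op open_ball _ w Ck_on_radial[OF r2(1) H(3,1)]]) auto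
      have sm: "Ck_on k ?U g" for k
        unfolding g_def[abs_def]
        by (intro Ck_on_Pair Ck_on_scaleR Ck_on_const rad Ck_on_fst Ck_on_snd Ck_on_ident op)
      have "g p = G p" if P: "p \<in> \<Sigma>" "p \<in> ?U" for p
      proof (cases "snd (snd p) = 0")
        case False
        define r where "r = norm (snd (snd p))"
        have r: "0 < r" "r < r2" using False P(2) by (auto simp: r_def)
        have "norm (fst p) = X r" using \<Sigma>_pole_graph[of p] P by (simp add: r_def)
        then have "norm (inverse R *\<^sub>R fst p) = X r / R" using R by (simp add: divide_inverse mult.commute)
        then have "1 - (inverse R *\<^sub>R fst p) \<bullet> (inverse R *\<^sub>R fst p) = (r * H r)\<^sup>2"
          using H(4)[of r] r by (simp add: dot_square_norm)
        moreover have "sqrt ((r * H r)\<^sup>2) = r * H r" using H(2)[of r] r by simp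
        moreover have "r * H r * inverse r = H r" using r by simp
        ultimately show ?thesis unfolding g_def G_def by (simp only: r_def[symmetric])
      qed (simp add: g_def G_def)
      moreover have "p \<in> ?U" using \<Sigma>_pole(2,3)[OF p' False] r2 by simp
      ultimately show ?thesis using op sm by (intro exI[of _ ?U] exI[of _ g]) auto
    qed
  qed
qed (use F_G G_F in blast)+

lemma sphere_embedding:
  "smooth_embedding (sphere 0 1) RnSm (F :: _ \<Rightarrow> ('n::finite, 'm::finite) ambient)"
  "F ` sphere 0 1 = (\<Sigma> :: ('n::finite, 'm::finite) ambient set)"
proof -
  show i: "F ` sphere 0 1 = (\<Sigma> :: ('n::finite, 'm::finite) ambient set)"
    using F_G G_F by (force simp: image_iff)
  show "smooth_embedding (sphere 0 1) RnSm (F :: _ \<Rightarrow> ('n, 'm) ambient)"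
    using \<Sigma>_subset diffeomorphism_sphere unfolding smooth_embedding_def i by blast
qed

end

section \<open>The sphere generated by the critical profile\<close>

context cmc
begin

text \<open>\<open>capped_graph\<close> supplies the embedding, \<open>profile_chart\<close> the
  curvature away from the pole and \<open>pole_chart\<close> the curvature at it. What links them is
  the agreement of the two normal fields on the overlap.\<close>

lemma critical_sphere:
  assumes dims: "CARD('n::finite) = k + 1" "CARD('m::finite) = l + 1"
    and crit: "critical A R" and y10: "y1 A R = 0"
  shows "\<exists>F :: (real^'n) \<times> (real^'m) \<Rightarrow> ('n, 'm) ambient.
    smooth_embedding (sphere 0 1) RnSm F \<and> OnOm_invariant (F ` sphere 0 1) \<and>
    (\<exists>\<nu>. constant_mean_curvature RnSm (F ` sphere 0 1) \<nu> h)"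
proof -
  obtain r2 :: real and X B :: "real \<Rightarrow> real" where r2: "0 < r2" "r2 < 1"
    and sX: "smooth_on {-r2<..<r2} X" and sB: "smooth_on {-r2<..<r2} B"
    and eX: "\<And>r. X (- r) = X r" and eB: "\<And>r. B (- r) = B r" and X0: "X 0 = R"
    and B0: "B 0 = (h - real k / R) / (real l + 1)"
    and rB: "\<And>r. \<bar>r\<bar> < r2 \<Longrightarrow> \<bar>r * B r\<bar> < 1" and Xpos: "\<And>r. \<bar>r\<bar> < r2 \<Longrightarrow> 0 < X r"
    and Bpos: "\<And>r. \<bar>r\<bar> < r2 \<Longrightarrow> 0 < B r"
    and dX: "\<And>r. \<bar>r\<bar> < r2 \<Longrightarrow> (X has_real_derivative - (r * B r) / (sqrt (1 - (r * B r)\<^sup>2) * sqrt (1 - r\<^sup>2))) (at r)"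
    and Xless: "\<And>r. 0 < r \<Longrightarrow> r < r2 \<Longrightarrow> X r < R"
    and sinX: "\<And>r. 0 < r \<Longrightarrow> r < r2 \<Longrightarrow> sin (ys A (X r)) = r"
    and cosX: "\<And>r. 0 < r \<Longrightarrow> r < r2 \<Longrightarrow> cos (ys A (X r)) = sqrt (1 - r\<^sup>2)"
    and CX: "\<And>r. 0 < r \<Longrightarrow> r < r2 \<Longrightarrow> sqrt (1 - (Ss A (X r))\<^sup>2) = r * B r"
    and Xsin: "\<And>x. 0 \<le> x \<Longrightarrow> x < R \<Longrightarrow> 0 < cos (ys A x) \<Longrightarrow> sin (ys A x) < r2 \<Longrightarrow> X (sin (ys A x)) = x"
    by (rule crit_pole[OF crit y10], rule that)
  note Rp = crit_basic(3)[OF crit] and lx = crit_basic(4)[OF crit] and lR = crit_life[OF crit]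
  note r = ranges[OF lx]
  let ?I = "{-r2<..<r2}"
  have op: "open ?I" by simp
  have dpos: "0 < 1 - (r * B r)\<^sup>2" "0 < 1 - r\<^sup>2" if "\<bar>r\<bar> < r2" for r
    using one_minus_square_pos[OF rB[OF that]] one_minus_square_pos[of r] that r2 by auto
  define W where "W r = B r / (sqrt (1 - (r * B r)\<^sup>2) * sqrt (1 - r\<^sup>2))" for r
  have sW: "smooth_on ?I W"
    unfolding W_def[abs_def]
  proof (intro allI Ck_on_divide Ck_on_mult Ck_on_sqrt Ck_on_diff Ck_on_const Ck_on_power Ck_on_ident op)
    fix r assume "r \<in> ?I"
    then have "\<bar>r\<bar> < r2" by auto
    from dpos[OF this] show "0 < 1 - (r * B r)\<^sup>2" "0 < 1 - r\<^sup>2"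
      "sqrt (1 - (r * B r)\<^sup>2) * sqrt (1 - r\<^sup>2) \<noteq> 0" by simp_all
  qed (use sB in blast)+
  interpret cg: capped_graph R r2 "ys A" X W
  proof
    show "smooth_on {-R<..<R} (ys A)" by (rule profile_smooth(1)[OF Rp lR])
    show "ys A (- x) = ys A x" if "\<bar>x\<bar> < R" for x by (rule parity(1)[OF lx[OF that]])
    show "0 < ys A x" "ys A x < pi" if "\<bar>x\<bar> < R" for x using r(1,2)[OF that] by auto
    show "0 < W r" if "\<bar>r\<bar> < r2" for r using dpos[OF that] Bpos[OF that] by (simp add: W_def)
    show "(X has_real_derivative - (r * W r)) (at r)" if "\<bar>r\<bar> < r2" for r
      using dX[OF that] by (simp add: W_def)
  qed (fact Rp r2 sX sW eX X0 Xpos Xless sinX cosX Xsin)+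
  define M :: "('n, 'm) ambient set" where "M = cg.\<Sigma>"
  have sub: "M \<subseteq> RnSm" unfolding M_def by (rule cg.\<Sigma>_subset)
  interpret ch: profile_chart M R h "ys A" "Qs A"
    by (rule profile_chart_maxsol[OF dims Rp lR sub]) (auto simp: M_def cg.\<Sigma>_graph)
  interpret po: pole_chart M R h r2 X B
  proof
    show "B 0 = (h - (real CARD('n) - 1) / R) / real CARD('m)" using B0 dims by (simp add: add.commute)
    show "p \<in> M \<longleftrightarrow> p \<in> RnSm \<and> norm (fst p) = X (norm (snd (snd p)))"
      if "fst (snd p) < 0" "norm (snd (snd p)) < r2" for p
      unfolding M_def by (rule cg.\<Sigma>_pole_graph[OF that])
  qed (fact Rp r2 sX sB eX eB X0 Xpos rB sub)+
  define \<nu> where "\<nu> p = (if norm (fst p) < R then ch.nu p else po.nu p)" for p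
  have ch_eq: "\<nu> p = ch.nu p" if "norm (fst p) < R" for p using that by (simp add: \<nu>_def)
  \<comment> \<open>On the overlap both formulas express the lifted normal, once with
    \<open>x\<close> and once with \<open>s = sin y\<close> as parameter. The condition
    \<open>fst (snd p) < 0\<close> means \<open>cos y > 0\<close>, which makes the change of
    parameter \<open>X s = x\<close> valid.\<close>
  have po_eq: "\<nu> p = po.nu p" if p: "p \<in> M" "fst (snd p) < 0" "norm (snd (snd p)) < r2" for p
  proof (cases "norm (fst p) < R")
    case True
    obtain v t w where vtw: "p = (v, t, w)" by (cases p)
    have vR: "norm v < R" using True by (simp add: vtw)
    define x s where "x = norm v" and "s = norm w"
    note q = cg.\<Sigma>_norm_snd[OF p(1)[unfolded M_def vtw] vR, folded x_def s_def]
    have s: "0 < s" "s < r2" using q(2) p(3) by (simp_all add: s_def vtw)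
    have "0 < cos (ys A x)" using p(2) q(3) by (simp add: vtw)
    then have "X (sin (ys A x)) = x"
      by (intro Xsin) (use vR s q(1) in \<open>simp_all add: x_def\<close>)
    then have x: "X s = x" by (simp add: q(1))
    have x0: "0 < x" using Xpos[of s] s x by simp
    have xR: "x < R" using vR by (simp add: x_def)
    have Sx: "x * Qs A x = Ss A x" using Ss_eq[OF lx, of x] x0 xR by simp
    have Cx: "sqrt (1 - (Ss A x)\<^sup>2) = s * B s" using CX[OF s] x by simp
    have "0 \<le> 1 - (Ss A x)\<^sup>2" using one_minus_square_pos[OF r(3), of x] x0 xR by simp
    then have "(s * B s)\<^sup>2 = 1 - (Ss A x)\<^sup>2" unfolding Cx[symmetric] by (rule real_sqrt_pow2)
    \<comment> \<open>The negative root, as \<open>S \<le> 0\<close> along a critical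
      profile.\<close>
    then have "- sqrt (1 - (s * B s)\<^sup>2) = Ss A x"
      using crit_Ss_le(1)[OF crit, of x] x0 xR by simp
    then have S: "po.S s = x * Qs A x" unfolding po.S_def Sx .
    have C: "ch.C x = s * B s" unfolding ch.C_def ch.S_def Sx Cx ..
    have "Qs A x *\<^sub>R v = po.S s *\<^sub>R (inverse x *\<^sub>R v)" using x0 by (simp add: S)
    moreover have "ch.g1 x = po.q2 s"
      unfolding ch.g1_def po.q2_def C by (simp add: q(1)[symmetric] power2_eq_square)
    moreover have "ch.g2 x *\<^sub>R (inverse s *\<^sub>R w) = po.q3 s *\<^sub>R w"
    proof -
      have "cos (ys A x) = sqrt (1 - s\<^sup>2)" using cosX[OF s] x by simp
      then have "ch.g2 x * inverse s = po.q3 s" using s by (simp add: ch.g2_def po.q3_def C)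
      then show ?thesis by simp
    qed
    ultimately show ?thesis
      unfolding ch_eq[OF True] ch.nu_def po.nu_def by (simp add: vtw flip: x_def s_def)
  qed (simp add: \<nu>_def)
  have "constant_mean_curvature RnSm M \<nu> h"
    unfolding constant_mean_curvature_def unit_normal_field_def
  proof (intro conjI ballI)
    have pole: "fst (snd p) = - 1" "snd (snd p) = 0" "norm (fst p) = R" if p: "p \<in> M" "\<not> norm (fst p) < R" for p
    proof -
      have "(fst p, fst (snd p), snd (snd p)) \<in> cg.\<Sigma>" using p(1) by (simp add: M_def)
      from cg.\<Sigma>_pole[OF this p(2)] show "fst (snd p) = - 1" "snd (snd p) = 0" "norm (fst p) = R" by simp_all
    qed
    show "smooth_map M \<nu>"
      unfolding smooth_map_def
    proof
      fix p assume p: "p \<in> M"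
      show "\<exists>V g. open V \<and> p \<in> V \<and> (\<forall>j. Ck_on j V g) \<and> (\<forall>y\<in>M \<inter> V. g y = \<nu> y)"
      proof (cases "norm (fst p) < R")
        case True
        have "\<nu> y = ch.nu y" if "y \<in> ch.U" for y
          by (rule ch_eq) (use that in \<open>simp add: ch.U_def\<close>)
        then show ?thesis
          using ch.open_U ch.M_subset_U[OF p True] ch.smooth_nu by (intro exI[of _ ch.U] exI[of _ ch.nu]) auto
      next
        case False
        let ?V = "po.U \<inter> {p. fst (snd p) < 0}"
        have "open {p :: ('n, 'm) ambient. fst (snd p) < 0}" by (intro open_Collect_less continuous_intros)
        then have "open ?V" using po.open_U by blast
        moreover have "p \<in> ?V" using pole[OF p False] Rp r2 by (auto simp: po.U_def)
        moreover have "Ck_on j ?V po.nu" for j by (rule Ck_on_subset[OF po.smooth_nu]) simp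
        moreover have "po.nu y = \<nu> y" if "y \<in> M" "y \<in> ?V" for y
          by (rule po_eq[symmetric]) (use that in \<open>simp_all add: po.U_def\<close>)
        ultimately show ?thesis by (intro exI[of _ ?V] exI[of _ po.nu]) auto
      qed
    qed
    fix p assume p: "p \<in> M"
    have "norm (\<nu> p) = 1 \<and> \<nu> p \<in> tangent_space RnSm p \<and> (\<forall>z\<in>tangent_space M p. \<nu> p \<bullet> z = 0) \<and>
      has_mean_curvature_at RnSm M \<nu> p h"
    proof (cases "norm (fst p) < R")
      case True
      obtain \<omega> :: "real^'n" and \<theta> :: "real^'m" where pp: "norm \<omega> = 1" "norm \<theta> = 1"
        "p = (norm (fst p) *\<^sub>R \<omega>, - cos (ys A (norm (fst p))), sin (ys A (norm (fst p))) *\<^sub>R \<theta>)"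
        by (rule ch.M_point[OF p True], rule that)
      note n = ch.normal_at[OF norm_ge_zero True pp]
      have "has_mean_curvature_at RnSm M \<nu> p h"
        by (rule ch.curvature_at[OF norm_ge_zero True pp]) (rule ch_eq)
      then show ?thesis using n ch_eq[OF True] by simp
    next
      case False
      note q = pole[OF p False]
      define \<omega> where "\<omega> = inverse R *\<^sub>R fst p"
      have \<omega>: "norm \<omega> = 1" using q(3) Rp by (simp add: \<omega>_def)
      have pp: "p = (R *\<^sub>R \<omega>, - 1, 0)" using q(1,2) Rp by (simp add: \<omega>_def prod_eq_iff)
      note n = po.normal_at[OF \<omega> pp]
      have "has_mean_curvature_at RnSm M \<nu> p h"
        by (rule po.curvature_at[OF \<omega> pp]) (rule po_eq)
      moreover have "\<nu> p = po.nu p" using False by (simp add: \<nu>_def)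
      ultimately show ?thesis using n by simp
    qed
    then show "norm (\<nu> p) = 1" "\<nu> p \<in> tangent_space RnSm p" "has_mean_curvature_at RnSm M \<nu> p h"
      "\<And>z. z \<in> tangent_space M p \<Longrightarrow> \<nu> p \<bullet> z = 0" by auto
  qed
  then have "\<exists>\<nu>. constant_mean_curvature RnSm (cg.F ` sphere 0 1 :: ('n, 'm) ambient set) \<nu> h"
    unfolding M_def cg.sphere_embedding(2) by blast
  moreover have "OnOm_invariant (cg.F ` sphere 0 1 :: ('n, 'm) ambient set)"
    unfolding cg.sphere_embedding(2) by (rule cg.\<Sigma>_invariant)
  ultimately show ?thesis
    by (intro exI[of _ cg.F] conjI cg.sphere_embedding(1))
qed

end

theorem theorem1p2:
  fixes h x\<^sub>h :: real
  assumes "CARD('n::finite) \<ge> 2" and "CARD('m::finite) \<ge> 2"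
    and "h > 0"
    and "0 < x\<^sub>h" and "x\<^sub>h < pi" and "cot x\<^sub>h = h / (real CARD('m) - 1)"
  shows "\<exists>b. x\<^sub>h < b \<and> b \<le> pi \<and>
    (\<exists>M :: real \<Rightarrow> ('n, 'm) ambient set. \<forall>A. 0 < A \<and> A < b \<longrightarrow>
       M A \<subseteq> RnSm \<and>
       OnOm_invariant (M A) \<and>
       diffeomorphic (M A) (UNIV \<times> sphere 0 1 :: ((real^'n) \<times> (real^'m)) set) \<and>
       (\<exists>\<phi> \<sigma> \<nu>. generating_curve \<phi> \<sigma> \<and> \<phi> 0 = (0, A) \<and> \<sigma> 0 = 0 \<and>
          M A = generated_hypersurface \<phi> \<and>
          lifts_curve_normal \<phi> \<sigma> \<nu> \<and>
          constant_mean_curvature RnSm (M A) \<nu> h)) \<and>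
    (b \<noteq> pi \<longrightarrow>
       (\<exists>F :: (real^'n) \<times> (real^'m) \<Rightarrow> ('n, 'm) ambient.
          smooth_embedding (sphere 0 1) RnSm F \<and>
          OnOm_invariant (F ` sphere 0 1) \<and>
          (\<exists>\<nu>. constant_mean_curvature RnSm (F ` sphere 0 1) \<nu> h)))"
proof -
  \<comment> \<open>The dimensions of the orbit spheres, both at least \<open>1\<close>.\<close>
  define k l where "k = CARD('n) - 1" and "l = CARD('m) - 1"
  have dims: "CARD('n) = k + 1" "CARD('m) = l + 1" using assms(1,2) by (auto simp: k_def l_def)
  interpret cmc k l h by standard (use assms(1-3) dims in auto)
  have xh: "cot x\<^sub>h = h / real l" using assms(6) dims(2) by simp
  obtain b where b: "x\<^sub>h < b" "b \<le> pi" "\<And>A. 0 < A \<Longrightarrow> A < b \<Longrightarrow> good A"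
    "b < pi \<Longrightarrow> \<not> good b"
    by (rule threshold[OF assms(4,5) xh], rule that)
  define M :: "real \<Rightarrow> ('n, 'm) ambient set"
    where "M A = {p \<in> RnSm. fst (snd p) = - cos (ys A (norm (fst p)))}" for A
  have "M A \<subseteq> RnSm \<and> OnOm_invariant (M A) \<and>
      diffeomorphic (M A) (UNIV \<times> sphere 0 1 :: ((real^'n) \<times> (real^'m)) set) \<and>
      (\<exists>\<phi> \<sigma> \<nu>. generating_curve \<phi> \<sigma> \<and> \<phi> 0 = (0, A) \<and> \<sigma> 0 = 0 \<and> M A = generated_hypersurface \<phi> \<and>
        lifts_curve_normal \<phi> \<sigma> \<nu> \<and> constant_mean_curvature RnSm (M A) \<nu> h)" if A: "0 < A \<and> A < b" for A
  proof -
    have lA: "life A X" if "0 \<le> X" for X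
      by (rule good_life) (use A b(2) b(3)[of A] that in auto)
    note e = entire_graph[OF dims lA M_def]
    show ?thesis by (intro conjI e)
  qed
  moreover have "\<exists>F :: (real^'n) \<times> (real^'m) \<Rightarrow> ('n, 'm) ambient.
      smooth_embedding (sphere 0 1) RnSm F \<and> OnOm_invariant (F ` sphere 0 1) \<and>
      (\<exists>\<nu>. constant_mean_curvature RnSm (F ` sphere 0 1) \<nu> h)" if "b \<noteq> pi"
  proof -
    have bpi: "0 < b" "b < pi" using that b(1,2) assms(4) by auto
    obtain R where R: "critical b R" by (rule critical_exists[OF bpi b(4)[OF bpi(2)]], rule that)
    have "y1 b R = 0"
    proof (rule crit_y1_zero[OF R])
      fix \<delta> :: real assume "\<delta> > 0"
      \<comment> \<open>A height below \<open>b\<close> and within \<open>\<delta>\<close> of it;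
        \<open>b / 2\<close> keeps it positive.\<close>
      then have "\<bar>max (b / 2) (b - \<delta> / 2) - b\<bar> < \<delta> \<and> good (max (b / 2) (b - \<delta> / 2))"
        using bpi by (intro conjI b(3)) auto
      then show "\<exists>A'. \<bar>A' - b\<bar> < \<delta> \<and> good A'" ..
    qed
    from critical_sphere[OF dims R this] show ?thesis .
  qed
  ultimately show ?thesis using b(1,2) by (intro exI[of _ b] conjI exI[of _ M]) blast+
qed

end
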